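(* Let $T:X\to X$ be a homeomorphism of a compact metric space and $\mu$ a $T$-invariant (Borel probability) measure on $X$. If $\theta_T$ is the automorphism of $C(X)$ induced by $T$, $\theta_T(f)=f\circ T$, and $\sigma$ denotes the state on $C(X)$ defined by $\mu$, then $$h_\mu(T)=hm_\sigma(\theta_T),$$ where $h_\mu(T)$ is the Kolmogorov--Sinai entropy of $T$ and $hm_\sigma(\theta_T)$ is the local state approximation entropy.
   Context: **Local state approximation entropy.** Let $\mathcal{A}$ be a unital exact $C^*$-algebra, $\theta:\mathcal{A}\to\mathcal{A}$ unital completely positive (u.c.p.), $\sigma$ a $\theta$-invariant state. Let $\iota:\mathcal{A}\to\mathcal{D}$ be a unital complete order embedding into an injective $C^*$-algebra $\mathcal{D}$. For finite $\Omega\subset\mathcal{A}$ and $\delta>0$, $\mathrm{CPA}(\iota,\Omega,\delta)$ is the set of triples $(\phi,\psi,\mathcal{B})$ with $\mathcal{B}$ a finite-dimensional $C^*$-algebra and $\phi:\mathcal{A}\to\mathcal{B}$, $\psi:\mathcal{B}\to\mathcal{D}$ u.c.p. with $\|\psi(\phi(x))-\iota(x)\|<\delta$ for all $x\in\Omega$. Let $\mathfrak{E}(\sigma,\iota)$ be the set of states on $\mathcal{D}$ extending $\sigma\circ\iota^{-1}$ on $\iota(\mathcal{A})$. For a state $\omega$ on $\mathcal{D}$, $cpe(\iota,\omega,\Omega,\delta)=\inf\{S(\omega\circ\psi):(\phi,\psi,\mathcal{B})\in\mathrm{CPA}(\iota,\Omega,\delta)\}$, where $S(\varphi)=-\mathrm{Tr}(\rho\log\rho)$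 is the von Neumann entropy of a state $\varphi$ on $\mathcal{B}$ with density $\rho$ with respect to the trace taking value $1$ on minimal projections. With $\Omega^{(n)}=\Omega\cup\theta(\Omega)\cup\dots\cup\theta^{n-1}(\Omega)$, $$hm_\sigma(\theta)=\sup_{\omega\in\mathfrak{E}(\sigma,\iota)}\ \sup_{\Omega}\ \sup_{\delta>0}\ \limsup_n\frac1n\,cpe(\iota,\omega,\Omega^{(n)},\delta),$$ $\Omega$ ranging over finite subsets of $\mathcal{A}$; this does not depend on $\iota$ and $\mathcal{D}$. *)

theory Defs
  imports
    "HOL-Probability.Probability"
    "HOL-Algebra.Ring"
    "HOL-Computational_Algebra.Polynomial"
begin

section \<open>Unital C*-algebras\<close>

text \<open>C*-algebras are treated with explicit carriers, as in HOL-Algebra, because the definitions below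
  quantify over C*-algebras. Maps between them only matter on the carrier.\<close>

record 'a cstar = "'a ring" +
  scale :: "complex \<Rightarrow> 'a \<Rightarrow> 'a" (infixr \<open>\<odot>\<index>\<close> 75)
  adj :: "'a \<Rightarrow> 'a"
  nrm :: "'a \<Rightarrow> real"

text \<open>The zero algebra is admitted; it carries no state.\<close>

locale cstar_algebra = ring A for A :: "'a cstar" (structure) +
  assumes scale_closed: "x \<in> carrier A \<Longrightarrow> c \<odot> x \<in> carrier A"
    and scale_add_left: "x \<in> carrier A \<Longrightarrow> (c + d) \<odot> x = c \<odot> x \<oplus> d \<odot> x"
    and scale_add_right:
      "x \<in> carrier A \<Longrightarrow> y \<in> carrier A \<Longrightarrow> c \<odot> (x \<oplus> y) = c \<odot> x \<oplus> c \<odot> y"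
    and scale_scale: "x \<in> carrier A \<Longrightarrow> c \<odot> (d \<odot> x) = (c * d) \<odot> x"
    and scale_one: "x \<in> carrier A \<Longrightarrow> 1 \<odot> x = x"
    and scale_mult_left:
      "x \<in> carrier A \<Longrightarrow> y \<in> carrier A \<Longrightarrow> (c \<odot> x) \<otimes> y = c \<odot> (x \<otimes> y)"
    and scale_mult_right:
      "x \<in> carrier A \<Longrightarrow> y \<in> carrier A \<Longrightarrow> x \<otimes> (c \<odot> y) = c \<odot> (x \<otimes> y)"
    and adj_closed: "x \<in> carrier A \<Longrightarrow> adj A x \<in> carrier A"
    and adj_adj: "x \<in> carrier A \<Longrightarrow> adj A (adj A x) = x"
    and adj_add:
      "x \<in> carrier A \<Longrightarrow> y \<in> carrier A \<Longrightarrow> adj A (x \<oplus> y) = adj A x \<oplus> adj A y"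
    and adj_scale: "x \<in> carrier A \<Longrightarrow> adj A (c \<odot> x) = cnj c \<odot> adj A x"
    and adj_mult:
      "x \<in> carrier A \<Longrightarrow> y \<in> carrier A \<Longrightarrow> adj A (x \<otimes> y) = adj A y \<otimes> adj A x"
    and nrm_nonneg: "x \<in> carrier A \<Longrightarrow> 0 \<le> nrm A x"
    and nrm_eq_0: "x \<in> carrier A \<Longrightarrow> nrm A x = 0 \<longleftrightarrow> x = \<zero>"
    and nrm_triangle:
      "x \<in> carrier A \<Longrightarrow> y \<in> carrier A \<Longrightarrow> nrm A (x \<oplus> y) \<le> nrm A x + nrm A y"
    and nrm_scale: "x \<in> carrier A \<Longrightarrow> nrm A (c \<odot> x) = cmod c * nrm A x"
    and nrm_mult:
      "x \<in> carrier A \<Longrightarrow> y \<in> carrier A \<Longrightarrow> nrm A (x \<otimes> y) \<le> nrm A x * nrm A y"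
    and cstar_identity: "x \<in> carrier A \<Longrightarrow> nrm A (adj A x \<otimes> x) = (nrm A x)\<^sup>2"
    and complete:
      "range X \<subseteq> carrier A \<Longrightarrow>
       \<forall>e>0. \<exists>N. \<forall>m\<ge>N. \<forall>n\<ge>N. nrm A (X m \<ominus> X n) < e \<Longrightarrow>
       \<exists>x\<in>carrier A. (\<lambda>n. nrm A (X n \<ominus> x)) \<longlonglongrightarrow> 0"

definition finite_dimensional :: "'a cstar \<Rightarrow> bool" where
  "finite_dimensional A \<longleftrightarrow>
     (\<exists>S. finite S \<and> S \<subseteq> carrier A \<and>
        (\<forall>x\<in>carrier A. \<exists>c. x = (\<Oplus>\<^bsub>A\<^esub>s\<in>S. c s \<odot>\<^bsub>A\<^esub> s)))"

section \<open>States and completely positive maps\<close>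

definition subspace_of :: "'a cstar \<Rightarrow> 'a set \<Rightarrow> bool" where
  "subspace_of A E \<longleftrightarrow> E \<subseteq> carrier A \<and> \<zero>\<^bsub>A\<^esub> \<in> E \<and>
     (\<forall>x\<in>E. \<forall>y\<in>E. x \<oplus>\<^bsub>A\<^esub> y \<in> E) \<and> (\<forall>c. \<forall>x\<in>E. c \<odot>\<^bsub>A\<^esub> x \<in> E)"

definition operator_system :: "'a cstar \<Rightarrow> 'a set \<Rightarrow> bool" where
  "operator_system A E \<longleftrightarrow> subspace_of A E \<and> \<one>\<^bsub>A\<^esub> \<in> E \<and> (\<forall>x\<in>E. adj A x \<in> E)"

definition linear_map_on :: "'a cstar \<Rightarrow> 'a set \<Rightarrow> 'b cstar \<Rightarrow> ('a \<Rightarrow> 'b) \<Rightarrow> bool" where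
  "linear_map_on A E B f \<longleftrightarrow> f ` E \<subseteq> carrier B \<and>
     (\<forall>x\<in>E. \<forall>y\<in>E. f (x \<oplus>\<^bsub>A\<^esub> y) = f x \<oplus>\<^bsub>B\<^esub> f y) \<and>
     (\<forall>c. \<forall>x\<in>E. f (c \<odot>\<^bsub>A\<^esub> x) = c \<odot>\<^bsub>B\<^esub> f x)"

definition linear_functional :: "'a cstar \<Rightarrow> ('a \<Rightarrow> complex) \<Rightarrow> bool" where
  "linear_functional A f \<longleftrightarrow>
     (\<forall>x\<in>carrier A. \<forall>y\<in>carrier A. f (x \<oplus>\<^bsub>A\<^esub> y) = f x + f y) \<and>
     (\<forall>c. \<forall>x\<in>carrier A. f (c \<odot>\<^bsub>A\<^esub> x) = c * f x)"

definition state :: "'a cstar \<Rightarrow> ('a \<Rightarrow> complex) \<Rightarrow> bool" where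
  "state A f \<longleftrightarrow> linear_functional A f \<and> f \<one>\<^bsub>A\<^esub> = 1 \<and>
     (\<forall>x\<in>carrier A. f (adj A x \<otimes>\<^bsub>A\<^esub> x) \<in> \<real>\<^sub>\<ge>\<^sub>0)"

text \<open>An n by n matrix over A is a function on indices below n. It is positive in the C*-algebra
  of n by n matrices over A iff it is of the form Y* Y.\<close>

definition matrix_pos :: "'a cstar \<Rightarrow> nat \<Rightarrow> (nat \<Rightarrow> nat \<Rightarrow> 'a) \<Rightarrow> bool" where
  "matrix_pos A n X \<longleftrightarrow>
     (\<exists>Y. (\<forall>i<n. \<forall>j<n. Y i j \<in> carrier A) \<and>
        (\<forall>i<n. \<forall>j<n. X i j = (\<Oplus>\<^bsub>A\<^esub>k\<in>{..<n}. adj A (Y k i) \<otimes>\<^bsub>A\<^esub> Y k j)))"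

text \<open>For maps defined on an operator system E in A, positivity of matrices over E is positivity
  over A.\<close>

definition cp_on :: "'a cstar \<Rightarrow> 'a set \<Rightarrow> 'b cstar \<Rightarrow> ('a \<Rightarrow> 'b) \<Rightarrow> bool" where
  "cp_on A E B f \<longleftrightarrow> linear_map_on A E B f \<and>
     (\<forall>n X. (\<forall>i<n. \<forall>j<n. X i j \<in> E) \<longrightarrow> matrix_pos A n X \<longrightarrow> matrix_pos B n (\<lambda>i j. f (X i j)))"

definition ucp :: "'a cstar \<Rightarrow> 'b cstar \<Rightarrow> ('a \<Rightarrow> 'b) \<Rightarrow> bool" where
  "ucp A B f \<longleftrightarrow> cp_on A (carrier A) B f \<and> f \<one>\<^bsub>A\<^esub> = \<one>\<^bsub>B\<^esub>"

definition unital_complete_order_embedding ::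
  "'a cstar \<Rightarrow> 'd cstar \<Rightarrow> ('a \<Rightarrow> 'd) \<Rightarrow> bool" where
  "unital_complete_order_embedding A D \<iota> \<longleftrightarrow> ucp A D \<iota> \<and> inj_on \<iota> (carrier A) \<and>
     (\<forall>n X. (\<forall>i<n. \<forall>j<n. X i j \<in> carrier A) \<longrightarrow>
        matrix_pos D n (\<lambda>i j. \<iota> (X i j)) \<longrightarrow> matrix_pos A n X)"

text \<open>D is injective if every completely positive map into D from an operator system E in a unital
  C*-algebra F extends to F. A HOL formula cannot quantify over types, so the carriers of the test
  algebras F are sets of elements of the type \<^typ>\<open>'d set\<close>. This is no restriction:
  if D is nonzero, it has a faithful representation on a Hilbert space with an orthonormal basis of
  cardinality at most that of D, and the algebra of bounded operators on this space has an isomorphic copy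
  on a subset of \<^typ>\<open>'d set\<close>. Extending the identity of D to this copy and
  applying Arveson's theorem gives the extension property for all F.\<close>

definition injective_cstar :: "'d cstar \<Rightarrow> bool" where
  "injective_cstar D \<longleftrightarrow> cstar_algebra D \<and>
     (\<forall>(F :: 'd set cstar) E f. cstar_algebra F \<longrightarrow> operator_system F E \<longrightarrow> cp_on F E D f \<longrightarrow>
        (\<exists>g. cp_on F (carrier F) D g \<and> (\<forall>x\<in>E. g x = f x)))"

section \<open>Von Neumann entropy on finite-dimensional C*-algebras\<close>

definition projection :: "'a cstar \<Rightarrow> 'a \<Rightarrow> bool" where
  "projection B p \<longleftrightarrow> p \<in> carrier B \<and> adj B p = p \<and> p \<otimes>\<^bsub>B\<^esub> p = p"

definition minimal_projection :: "'a cstar \<Rightarrow> 'a \<Rightarrow> bool" where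
  "minimal_projection B p \<longleftrightarrow> projection B p \<and> p \<noteq> \<zero>\<^bsub>B\<^esub> \<and>
     (\<forall>q. projection B q \<and> p \<otimes>\<^bsub>B\<^esub> q = q \<longrightarrow> q = \<zero>\<^bsub>B\<^esub> \<or> q = p)"

text \<open>On the carrier of a finite-dimensional B there is exactly one such functional; its values
  elsewhere are irrelevant.\<close>

definition canonical_trace :: "'a cstar \<Rightarrow> 'a \<Rightarrow> complex" where
  "canonical_trace B = (SOME \<tau>. linear_functional B \<tau> \<and>
     (\<forall>x\<in>carrier B. \<forall>y\<in>carrier B. \<tau> (x \<otimes>\<^bsub>B\<^esub> y) = \<tau> (y \<otimes>\<^bsub>B\<^esub> x)) \<and>
     (\<forall>p. minimal_projection B p \<longrightarrow> \<tau> p = 1))"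

definition density_operator :: "'a cstar \<Rightarrow> ('a \<Rightarrow> complex) \<Rightarrow> 'a" where
  "density_operator B f = (THE r. r \<in> carrier B \<and>
     (\<forall>x\<in>carrier B. f x = canonical_trace B (r \<otimes>\<^bsub>B\<^esub> x)))"

definition spectrum :: "'a cstar \<Rightarrow> 'a \<Rightarrow> complex set" where
  "spectrum B a = {z. (z \<odot>\<^bsub>B\<^esub> \<one>\<^bsub>B\<^esub>) \<ominus>\<^bsub>B\<^esub> a \<notin> Units B}"

definition poly_eval :: "'a cstar \<Rightarrow> complex poly \<Rightarrow> 'a \<Rightarrow> 'a" where
  "poly_eval B p a = (\<Oplus>\<^bsub>B\<^esub>k\<in>{..degree p}. coeff p k \<odot>\<^bsub>B\<^esub> (a [^]\<^bsub>B\<^esub> k))"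

text \<open>Continuous functional calculus for a self-adjoint element a of a finite-dimensional
  C*-algebra: the spectrum is a finite set of reals, so f(a) = p(a) for any polynomial p that agrees with f
  there.\<close>

definition fun_calc :: "'a cstar \<Rightarrow> (real \<Rightarrow> real) \<Rightarrow> 'a \<Rightarrow> 'a" where
  "fun_calc B f a = (THE b. \<exists>p. (\<forall>z\<in>spectrum B a. poly p z = of_real (f (Re z))) \<and>
     b = poly_eval B p a)"

text \<open>Here 0 log 0 = 0, since \<^term>\<open>0 * ln (0::real)\<close> is 0.\<close>

definition von_neumann_entropy :: "'a cstar \<Rightarrow> ('a \<Rightarrow> complex) \<Rightarrow> real" where
  "von_neumann_entropy B f =
     - Re (canonical_trace B (fun_calc B (\<lambda>t. t * ln t) (density_operator B f)))"

section \<open>Local state approximation entropy\<close>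

text \<open>Every finite-dimensional C*-algebra has an isomorphic copy whose carrier is a set of
  elements of type \<^typ>\<open>nat \<Rightarrow> complex\<close> (finitely supported coordinate
  sequences), so letting B range over the algebras on this type loses nothing.\<close>

type_synonym coords = "nat \<Rightarrow> complex"

definition CPA :: "'a cstar \<Rightarrow> 'd cstar \<Rightarrow> ('a \<Rightarrow> 'd) \<Rightarrow> 'a set \<Rightarrow> real \<Rightarrow>
    (('a \<Rightarrow> coords) \<times> (coords \<Rightarrow> 'd) \<times> coords cstar) set" where
  "CPA A D \<iota> \<Omega> \<delta> = {(\<phi>, \<psi>, B).
     cstar_algebra B \<and> finite_dimensional B \<and> ucp A B \<phi> \<and> ucp B D \<psi> \<and>
     (\<forall>x\<in>\<Omega>. nrm D (\<psi> (\<phi> x) \<ominus>\<^bsub>D\<^esub> \<iota> x) < \<delta>)}"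

definition state_extensions ::
  "'a cstar \<Rightarrow> 'd cstar \<Rightarrow> ('a \<Rightarrow> 'd) \<Rightarrow> ('a \<Rightarrow> complex) \<Rightarrow> ('d \<Rightarrow> complex) set" where
  "state_extensions A D \<iota> \<sigma> = {\<omega>. state D \<omega> \<and> (\<forall>x\<in>carrier A. \<omega> (\<iota> x) = \<sigma> x)}"

definition cpe :: "'a cstar \<Rightarrow> 'd cstar \<Rightarrow> ('a \<Rightarrow> 'd) \<Rightarrow> ('d \<Rightarrow> complex) \<Rightarrow>
    'a set \<Rightarrow> real \<Rightarrow> ereal" where
  "cpe A D \<iota> \<omega> \<Omega> \<delta> =
     (INF (\<phi>, \<psi>, B)\<in>CPA A D \<iota> \<Omega> \<delta>. ereal (von_neumann_entropy B (\<omega> \<circ> \<psi>)))"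

definition orbit_set :: "('a \<Rightarrow> 'a) \<Rightarrow> 'a set \<Rightarrow> nat \<Rightarrow> 'a set" where
  "orbit_set \<theta> \<Omega> n = (\<Union>i<n. (\<theta> ^^ i) ` \<Omega>)"

definition hm :: "'a cstar \<Rightarrow> 'd cstar \<Rightarrow> ('a \<Rightarrow> 'd) \<Rightarrow> ('a \<Rightarrow> complex) \<Rightarrow> ('a \<Rightarrow> 'a) \<Rightarrow> ereal" where
  "hm A D \<iota> \<sigma> \<theta> =
     (SUP \<omega>\<in>state_extensions A D \<iota> \<sigma>.
      SUP \<Omega>\<in>{\<Omega>. finite \<Omega> \<and> \<Omega> \<subseteq> carrier A}.
      SUP \<delta>\<in>{0<..}.
        limsup (\<lambda>n. ereal (1 / real n) * cpe A D \<iota> \<omega> (orbit_set \<theta> \<Omega> n) \<delta>))"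

section \<open>Kolmogorov--Sinai entropy\<close>

definition partition_entropy :: "'x measure \<Rightarrow> 'x set set \<Rightarrow> real" where
  "partition_entropy M P = - (\<Sum>A\<in>P. measure M A * ln (measure M A))"

text \<open>The join of the preimages of P under the first n iterates of T. It may contain the empty set,
  which does not contribute to the entropy.\<close>

definition iterated_join :: "'x measure \<Rightarrow> ('x \<Rightarrow> 'x) \<Rightarrow> 'x set set \<Rightarrow> nat \<Rightarrow> 'x set set" where
  "iterated_join M T P n =
     {(\<Inter>i<n. (T ^^ i) -` A i) \<inter> space M | A. \<forall>i<n. A i \<in> P}"

definition KS_entropy_partition :: "'x measure \<Rightarrow> ('x \<Rightarrow> 'x) \<Rightarrow> 'x set set \<Rightarrow> real" where
  "KS_entropy_partition M T P = lim (\<lambda>n. partition_entropy M (iterated_join M T P n) / real n)"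

definition KS_entropy :: "'x measure \<Rightarrow> ('x \<Rightarrow> 'x) \<Rightarrow> ereal" where
  "KS_entropy M T =
     (SUP P\<in>{P. finite P \<and> P \<subseteq> sets M \<and> partition_on (space M) P}.
        ereal (KS_entropy_partition M T P))"

section \<open>Continuous functions on a compact space\<close>

definition C_alg :: "('x::topological_space \<Rightarrow> complex) cstar" where
  "C_alg = \<lparr> carrier = {f. continuous_on UNIV f},
     monoid.mult = (\<lambda>f g x. f x * g x), one = (\<lambda>x. 1), zero = (\<lambda>x. 0), add = (\<lambda>f g x. f x + g x),
     scale = (\<lambda>c f x. c * f x), adj = (\<lambda>f x. cnj (f x)), nrm = (\<lambda>f. SUP x. cmod (f x)) \<rparr>"

definition measure_state :: "'x measure \<Rightarrow> ('x \<Rightarrow> complex) \<Rightarrow> complex" where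
  "measure_state M f = (\<integral>x. f x \<partial>M)"

definition induced_aut :: "('x \<Rightarrow> 'x) \<Rightarrow> ('x \<Rightarrow> complex) \<Rightarrow> ('x \<Rightarrow> complex)" where
  "induced_aut T f = f \<circ> T"

end

theory Submission
  imports Defs "HOL-Computational_Algebra.Fundamental_Theorem_Algebra"
begin

text \<open>Let X be the space and \<mu> the measure. For a finite Borel partition P let H n be the Shannon entropy of
the partition of X into the cells of the words of length n over P, that is, of the sets of points whose
orbit meets prescribed members of P at the times below n. Both inequalities compare H n, up to an error
n \<epsilon>, with the entropy of a state on a finite-dimensional C*-algebra B. The link is a soft version of P: a
continuous partition of unity (g_A), A in P, such that g_B has integral at most \<eta> over A whenever A \<noteq> B
(partition_of_unity_near_partition). The products of the functions g_(I j) o T^j, one for each word I,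
are again a partition of unity, and their joint distribution with the cells is almost diagonal in each
letter.

Lower bound (entropy_of_approximation_ge). Suppose that \<iota> is approximated by \<psi> o \<phi> through B on the
functions g_A o T^j. The images under \<phi> of the products are positive elements of B with sum 1, so they
describe a measurement on B. Suppose that \<omega> o \<psi> is also decomposed into positive functionals, one for
each cell. Preparing a cell and then measuring gives a joint distribution of words, and its mutual
information is at most the von Neumann entropy of \<omega> o \<psi> (accessible_information_le_entropy). If both
words almost always agree in each letter, a Fano type estimate (cond_shannon_words_le, cond_shannon_le)
shows that the mutual information is at least H n - n \<epsilon>. The extension \<omega> of \<mu> has to be chosen so that
it decomposes along the cells. In a commutative D one would restrict a measure. In general a Hahn-Banach
argument for functions on X with values in D yields positive functionals W_S on D, additive in the Borel set S,
with W_S (\<iota> f) equal to the integral of f over S (measured_extension); then \<omega> = W_X, and the functionals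
are W_S o \<psi> for the cells S.

Upper bound (cpe_orbit_le). Let the members of P be small compared with the modulus of continuity of the
given functions. Evaluation at one point in the support of each product, followed by recombination with
the products as weights, approximates the identity of C(X) through C^N. The recombination is completely
positive because a sum of matrices Y_t* Y_t with nonnegative continuous weights is R* R for a continuous
matrix function R (continuous_matrix_factorization). Every extension \<omega> of \<mu> pulls back to the probability
vector of the integrals of the products, whose Shannon entropy is at most H n + n \<epsilon>, again because the
joint distribution with the cells is almost diagonal (shannon_product_unity_le).

Finally H n / n converges to the entropy of T with respect to P (KS_limit), and \<epsilon> is arbitrary.\<close>

section \<open>Square roots and positive elements\<close>

context cstar_algebra
begin

lemma scale_zero_left: "x \<in> carrier A \<Longrightarrow> 0 \<odot> x = \<zero>"
  by (metis a_assoc add.inv_unique' add.l_cancel_one' scale_add_left scale_closed add_0)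

lemma scale_zero_right: "c \<odot> \<zero> = \<zero>"
  by (metis add.l_cancel_one' l_zero scale_add_right scale_closed zero_closed)

lemma scale_uminus_one: "x \<in> carrier A \<Longrightarrow> (-1) \<odot> x = \<ominus> x"
proof -
  assume x: "x \<in> carrier A"
  have "x \<oplus> (-1) \<odot> x = (1 + (-1)) \<odot> x"
    using x by (simp only: scale_add_left scale_one)
  hence "x \<oplus> (-1) \<odot> x = \<zero>" using x by (simp add: scale_zero_left)
  thus ?thesis using x by (metis minus_equality a_comm scale_closed)
qed

lemma minus_scale: "x \<in> carrier A \<Longrightarrow> y \<in> carrier A \<Longrightarrow> x \<ominus> y = x \<oplus> (-1) \<odot> y"
  by (simp add: a_minus_def scale_uminus_one)

lemma scale_minus: "x \<in> carrier A \<Longrightarrow> y \<in> carrier A \<Longrightarrow> c \<odot> (x \<ominus> y) = c \<odot> x \<ominus> c \<odot> y"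
  by (simp add: minus_scale scale_add_right scale_closed scale_scale mult.commute)

lemma adj_zero: "adj A \<zero> = \<zero>"
  by (metis adj_scale scale_zero_left zero_closed adj_closed complex_cnj_zero)

lemma adj_one: "adj A \<one> = \<one>"
  by (metis adj_adj adj_closed adj_mult l_one one_closed)

lemma adj_minus: "x \<in> carrier A \<Longrightarrow> y \<in> carrier A \<Longrightarrow> adj A (x \<ominus> y) = adj A x \<ominus> adj A y"
  by (simp add: minus_scale adj_add adj_scale adj_closed scale_closed)

lemma minus_minus_cancel: "x \<in> carrier A \<Longrightarrow> y \<in> carrier A \<Longrightarrow> x \<ominus> (x \<ominus> y) = y"
  by (simp add: a_minus_def minus_add r_neg1 a_assoc[symmetric] r_neg)

lemma minus_add_cancel: "x \<in> carrier A \<Longrightarrow> y \<in> carrier A \<Longrightarrow> (x \<ominus> y) \<oplus> y = x"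
  by (simp add: a_minus_def a_assoc l_neg)

lemma minus_eq_zeroD: "x \<in> carrier A \<Longrightarrow> y \<in> carrier A \<Longrightarrow> x \<ominus> y = \<zero> \<Longrightarrow> x = y"
  by (metis l_zero minus_add_cancel)

lemma mult_minus_right:
  "x \<in> carrier A \<Longrightarrow> y \<in> carrier A \<Longrightarrow> z \<in> carrier A \<Longrightarrow> x \<otimes> (y \<ominus> z) = x \<otimes> y \<ominus> x \<otimes> z"
  by (simp add: a_minus_def r_distr r_minus)

lemma mult_minus_left:
  "x \<in> carrier A \<Longrightarrow> y \<in> carrier A \<Longrightarrow> z \<in> carrier A \<Longrightarrow> (y \<ominus> z) \<otimes> x = y \<otimes> x \<ominus> z \<otimes> x"
  by (simp add: a_minus_def l_distr l_minus)

lemma nrm_zero: "nrm A \<zero> = 0"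
  using nrm_eq_0 by blast

lemma nrm_minus_commute: "x \<in> carrier A \<Longrightarrow> y \<in> carrier A \<Longrightarrow> nrm A (x \<ominus> y) = nrm A (y \<ominus> x)"
proof -
  assume xy: "x \<in> carrier A" "y \<in> carrier A"
  have "y \<ominus> x = (-1) \<odot> (x \<ominus> y)"
    using xy by (simp add: minus_scale scale_add_right scale_scale scale_closed scale_one a_comm)
  thus ?thesis using xy by (simp add: nrm_scale)
qed

lemma nrm_triangle_minus:
  "x \<in> carrier A \<Longrightarrow> y \<in> carrier A \<Longrightarrow> nrm A (x \<ominus> y) \<le> nrm A x + nrm A y"
  using nrm_triangle[of x "(-1) \<odot> y"] by (simp add: minus_scale scale_closed nrm_scale)

lemma nrm_triangle_via:
  assumes "x \<in> carrier A" "y \<in> carrier A" "z \<in> carrier A"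
  shows "nrm A (x \<ominus> z) \<le> nrm A (x \<ominus> y) + nrm A (y \<ominus> z)"
proof -
  have "x \<ominus> z = (x \<ominus> y) \<oplus> (y \<ominus> z)"
    using assms by (simp add: a_minus_def a_assoc r_neg2 r_neg1)
  thus ?thesis using assms nrm_triangle by simp
qed

lemma nrm_adj: "x \<in> carrier A \<Longrightarrow> nrm A (adj A x) = nrm A x"
proof -
  have le: "nrm A x \<le> nrm A (adj A x)" if x: "x \<in> carrier A" for x
  proof -
    have "(nrm A x)\<^sup>2 \<le> nrm A (adj A x) * nrm A x"
      using x nrm_mult[of "adj A x" x] by (simp add: cstar_identity[symmetric] adj_closed)
    thus ?thesis using nrm_nonneg[OF x] nrm_nonneg[of "adj A x"] x adj_closed
      by (metis mult_le_cancel_right power2_eq_square linorder_not_less less_eq_real_def)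
  qed
  assume x: "x \<in> carrier A"
  show ?thesis using le[OF x] le[of "adj A x"] x by (simp add: adj_closed adj_adj)
qed

lemma nrm_one_le: "nrm A \<one> \<le> 1"
proof -
  have "(nrm A \<one>)\<^sup>2 = nrm A \<one>" using cstar_identity[of \<one>] by (simp add: adj_one)
  thus ?thesis by (auto simp: power2_eq_square)
qed

definition selfadj :: "'a \<Rightarrow> bool" where
  "selfadj x \<longleftrightarrow> x \<in> carrier A \<and> adj A x = x"

lemma selfadjD: "selfadj x \<Longrightarrow> x \<in> carrier A" "selfadj x \<Longrightarrow> adj A x = x"
  by (auto simp: selfadj_def)

lemma selfadj_nrm_square: "selfadj x \<Longrightarrow> nrm A (x \<otimes> x) = (nrm A x)\<^sup>2"
  using cstar_identity[of x] by (auto simp: selfadj_def)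

lemma selfadj_one: "selfadj \<one>" by (simp add: selfadj_def adj_one)
lemma selfadj_add: "selfadj x \<Longrightarrow> selfadj y \<Longrightarrow> selfadj (x \<oplus> y)"
  by (simp add: selfadj_def adj_add)
lemma selfadj_minus: "selfadj x \<Longrightarrow> selfadj y \<Longrightarrow> selfadj (x \<ominus> y)"
  by (simp add: selfadj_def adj_minus)
lemma selfadj_scale: "selfadj x \<Longrightarrow> selfadj (complex_of_real t \<odot> x)"
  by (simp add: selfadj_def adj_scale scale_closed)
lemma selfadj_mult: "selfadj x \<Longrightarrow> selfadj y \<Longrightarrow> x \<otimes> y = y \<otimes> x \<Longrightarrow> selfadj (x \<otimes> y)"
  by (simp add: selfadj_def adj_mult)
lemma selfadj_square: "selfadj x \<Longrightarrow> selfadj (x \<otimes> x)"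
  by (simp add: selfadj_mult)
lemma selfadj_adj_mult: "x \<in> carrier A \<Longrightarrow> selfadj (adj A x \<otimes> x)"
  by (simp add: selfadj_def adj_mult adj_closed adj_adj)

lemma limit_unique:
  assumes "x \<in> carrier A" "y \<in> carrier A" "\<And>n. X n \<in> carrier A"
    "(\<lambda>n. nrm A (X n \<ominus> x)) \<longlonglongrightarrow> 0" "(\<lambda>n. nrm A (X n \<ominus> y)) \<longlonglongrightarrow> 0"
  shows "x = y"
proof -
  have "(\<lambda>n. nrm A (X n \<ominus> x) + nrm A (X n \<ominus> y)) \<longlonglongrightarrow> 0 + 0"
    using assms by (intro tendsto_intros)
  moreover have "nrm A (x \<ominus> y) \<le> nrm A (X n \<ominus> x) + nrm A (X n \<ominus> y)" for n
    using nrm_triangle_via[of x "X n" y] assms nrm_minus_commute by metis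
  ultimately have "nrm A (x \<ominus> y) \<le> 0"
    by (intro LIMSEQ_le_const) auto
  hence "nrm A (x \<ominus> y) = 0" using nrm_nonneg[of "x \<ominus> y"] assms by simp
  thus ?thesis using assms nrm_eq_0 minus_eq_zeroD by simp
qed

definition commutes :: "'a \<Rightarrow> 'a \<Rightarrow> bool" where
  "commutes x y \<longleftrightarrow> x \<otimes> y = y \<otimes> x"

lemma commutes_sym: "commutes x y \<Longrightarrow> commutes y x" by (simp add: commutes_def)

lemma commutes_one: "x \<in> carrier A \<Longrightarrow> commutes x \<one>" by (simp add: commutes_def)

lemma commutes_add:
  "\<lbrakk>x \<in> carrier A; y \<in> carrier A; z \<in> carrier A; commutes z x; commutes z y\<rbrakk> \<Longrightarrow> commutes z (x \<oplus> y)"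
  by (simp add: commutes_def r_distr l_distr)

lemma commutes_minus:
  "\<lbrakk>x \<in> carrier A; y \<in> carrier A; z \<in> carrier A; commutes z x; commutes z y\<rbrakk> \<Longrightarrow> commutes z (x \<ominus> y)"
  by (simp add: commutes_def mult_minus_right mult_minus_left)

lemma commutes_scale:
  "\<lbrakk>x \<in> carrier A; z \<in> carrier A; commutes z x\<rbrakk> \<Longrightarrow> commutes z (c \<odot> x)"
  by (simp add: commutes_def scale_mult_left scale_mult_right)

lemma commutes_mult:
  "\<lbrakk>x \<in> carrier A; y \<in> carrier A; z \<in> carrier A; commutes z x; commutes z y\<rbrakk> \<Longrightarrow> commutes z (x \<otimes> y)"
  unfolding commutes_def by (metis m_assoc)

lemma square_diff:
  assumes "u \<in> carrier A" "v \<in> carrier A"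
  shows "u \<otimes> u \<ominus> v \<otimes> v = u \<otimes> (u \<ominus> v) \<oplus> (u \<ominus> v) \<otimes> v"
  using assms
  by (simp add: mult_minus_right mult_minus_left)
     (simp add: a_minus_def a_assoc r_neg1 r_neg2 l_neg)

text \<open>The iteration of sqrt_iter below with c = 1. It dominates the norms of the iterates and of their
differences for every c of norm at most 1, so its monotone convergence makes the latter a Cauchy sequence.\<close>

primrec sqrt_bound :: "nat \<Rightarrow> real" where
  "sqrt_bound 0 = 0"
| "sqrt_bound (Suc n) = (1 + (sqrt_bound n)\<^sup>2) / 2"

lemma sqrt_bound_range: "0 \<le> sqrt_bound n \<and> sqrt_bound n \<le> 1"
proof (induction n)
  case (Suc n)
  then have "(sqrt_bound n)\<^sup>2 \<le> 1" by (simp add: power_le_one)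
  then show ?case by simp
qed simp

lemma sqrt_bound_Cauchy: "Cauchy sqrt_bound"
proof -
  have "incseq sqrt_bound"
  proof (rule incseq_SucI)
    fix n
    have "0 \<le> (1 - sqrt_bound n)\<^sup>2" by simp
    then show "sqrt_bound n \<le> sqrt_bound (Suc n)" by (simp add: power2_eq_square algebra_simps)
  qed
  then have "convergent sqrt_bound"
    using sqrt_bound_range by (intro Bseq_mono_convergent BseqI'[where K=1]) (auto simp: incseq_def)
  then show ?thesis using Cauchy_convergent_iff by blast
qed

text \<open>The fixed points y of this iteration satisfy 2 y = c + y y, that is (1 - y) (1 - y) = 1 - c.\<close>

primrec sqrt_iter :: "'a \<Rightarrow> nat \<Rightarrow> 'a" where
  "sqrt_iter c 0 = \<zero>"
| "sqrt_iter c (Suc n) = (1/2) \<odot> (c \<oplus> sqrt_iter c n \<otimes> sqrt_iter c n)"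

text \<open>The power series of the square root at 1, in the form of the iteration above. Working inside the closed unit
ball gives convergence even for nrm A c = 1. All iterates commute with everything that commutes with c,
and so does the limit; this replaces functional calculus below.\<close>

lemma sqrt_one_minus:
  assumes c: "selfadj c" and c1: "nrm A c \<le> 1"
  shows "\<exists>y. selfadj y \<and> nrm A y \<le> 1 \<and> (\<forall>z\<in>carrier A. commutes z c \<longrightarrow> commutes z y) \<and>
     (\<one> \<ominus> y) \<otimes> (\<one> \<ominus> y) = \<one> \<ominus> c"
proof -
  let ?y = "sqrt_iter c" and ?r = sqrt_bound
  note [simp] = selfadjD(1)[OF c] scale_closed
  have sa: "selfadj (?y n)" for n
  proof (induction n)
    case 0 show ?case by (simp add: selfadj_def adj_zero)
  next
    case (Suc n)
    show ?case using selfadj_scale[OF selfadj_add[OF c selfadj_square[OF Suc]], of "1/2"] by simp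
  qed
  note [simp] = selfadjD(1)[OF sa]
  have bd: "nrm A (?y n) \<le> ?r n" for n
  proof (induction n)
    case (Suc n)
    have "nrm A (c \<oplus> ?y n \<otimes> ?y n) \<le> 1 + (?r n)\<^sup>2"
      using nrm_triangle[of c "?y n \<otimes> ?y n"] c1 selfadj_nrm_square[OF sa[of n]] Suc
        power_mono[OF Suc nrm_nonneg, of 2] by simp
    then show ?case by (simp add: nrm_scale)
  qed (simp add: nrm_zero)
  \<comment> \<open>The difference of squares u u - v v = u (u - v) + (u - v) v turns the recursion into that of sqrt_bound.\<close>
  have step: "nrm A (?y (Suc n) \<ominus> ?y n) \<le> ?r (Suc n) - ?r n" for n
  proof (induction n)
    case 0
    show ?case using c1 by (simp add: a_minus_def nrm_scale)
  next
    case (Suc n)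
    let ?u = "?y (Suc n)" and ?v = "?y n"
    have "?y (Suc (Suc n)) \<ominus> ?u = (1/2) \<odot> ((c \<oplus> ?u \<otimes> ?u) \<ominus> (c \<oplus> ?v \<otimes> ?v))"
      using scale_minus[of "c \<oplus> ?u \<otimes> ?u" "c \<oplus> ?v \<otimes> ?v" "1/2"] by simp
    also have "(c \<oplus> ?u \<otimes> ?u) \<ominus> (c \<oplus> ?v \<otimes> ?v) = ?u \<otimes> ?u \<ominus> ?v \<otimes> ?v"
      using selfadjD(1)[OF sa[of "Suc n"]]
      by (simp add: a_minus_def minus_add a_assoc a_comm a_lcomm r_neg r_neg1 r_neg2 del: sqrt_iter.simps)
    also have "\<dots> = ?u \<otimes> (?u \<ominus> ?v) \<oplus> (?u \<ominus> ?v) \<otimes> ?v"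
      using sa selfadjD by (intro square_diff) auto
    finally have eq: "nrm A (?y (Suc (Suc n)) \<ominus> ?u) = nrm A (?u \<otimes> (?u \<ominus> ?v) \<oplus> (?u \<ominus> ?v) \<otimes> ?v) / 2"
      using selfadjD(1)[OF sa[of "Suc n"]] by (simp add: nrm_scale del: sqrt_iter.simps)
    have cu: "?u \<in> carrier A" "?v \<in> carrier A" using sa selfadjD by auto
    have "nrm A (?u \<otimes> (?u \<ominus> ?v) \<oplus> (?u \<ominus> ?v) \<otimes> ?v)
       \<le> nrm A ?u * nrm A (?u \<ominus> ?v) + nrm A (?u \<ominus> ?v) * nrm A ?v"
      by (rule order_trans[OF nrm_triangle add_mono[OF nrm_mult nrm_mult]]) (use cu in \<open>auto simp del: sqrt_iter.simps\<close>)
    also have "\<dots> \<le> ?r (Suc n) * (?r (Suc n) - ?r n) + (?r (Suc n) - ?r n) * ?r n"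
      using bd[of "Suc n"] bd[of n] Suc nrm_nonneg[of ?u] nrm_nonneg[of ?v] nrm_nonneg[of "?u \<ominus> ?v"] cu
        sqrt_bound_range[of n] sqrt_bound_range[of "Suc n"]
      by (intro add_mono mult_mono) (auto simp del: sqrt_iter.simps sqrt_bound.simps)
    also have "\<dots> = (?r (Suc n))\<^sup>2 - (?r n)\<^sup>2"
      by (simp add: power2_eq_square algebra_simps del: sqrt_bound.simps)
    finally show ?case using eq
      by (simp add: field_simps del: sqrt_iter.simps)
  qed
  have diff: "n \<le> m \<Longrightarrow> nrm A (?y m \<ominus> ?y n) \<le> ?r m - ?r n" for m n
  proof (induction m rule: dec_induct)
    case base show ?case by (simp add: a_minus_def r_neg nrm_zero)
  next
    case (step m)
    have "nrm A (?y (Suc m) \<ominus> ?y n) \<le> nrm A (?y (Suc m) \<ominus> ?y m) + nrm A (?y m \<ominus> ?y n)"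
      using sa selfadjD by (intro nrm_triangle_via) auto
    then show ?case using step \<open>\<And>n. nrm A (?y (Suc n) \<ominus> ?y n) \<le> ?r (Suc n) - ?r n\<close>[of m] by linarith
  qed
  have "\<forall>e>0. \<exists>N. \<forall>m\<ge>N. \<forall>n\<ge>N. nrm A (?y m \<ominus> ?y n) < e"
  proof (intro allI impI)
    fix e :: real assume "e > 0"
    then obtain N where N: "\<And>m n. m \<ge> N \<Longrightarrow> n \<ge> N \<Longrightarrow> \<bar>?r m - ?r n\<bar> < e"
      using sqrt_bound_Cauchy unfolding Cauchy_def dist_real_def by blast
    have "nrm A (?y m \<ominus> ?y n) < e" if "m \<ge> N" "n \<ge> N" for m n
    proof (cases "n \<le> m")
      case True then show ?thesis using diff[of n m] N[OF that] by linarith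
    next
      case False
      then have "nrm A (?y m \<ominus> ?y n) = nrm A (?y n \<ominus> ?y m)" by (simp add: nrm_minus_commute)
      then show ?thesis using diff[of m n] N[OF that] False by linarith
    qed
    then show "\<exists>N. \<forall>m\<ge>N. \<forall>n\<ge>N. nrm A (?y m \<ominus> ?y n) < e" by blast
  qed
  then obtain y where y[simp]: "y \<in> carrier A" and lim: "(\<lambda>n. nrm A (?y n \<ominus> y)) \<longlonglongrightarrow> 0"
    using complete[of ?y] by (metis (no_types, lifting) image_subsetI selfadjD(1) sa)
  have "(\<lambda>n. nrm A (?y n \<ominus> adj A y)) \<longlonglongrightarrow> 0"
  proof -
    have "nrm A (?y n \<ominus> adj A y) = nrm A (?y n \<ominus> y)" for n
      using nrm_adj[of "?y n \<ominus> y"] by (simp add: adj_minus selfadjD(2)[OF sa])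
    then show ?thesis using lim by simp
  qed
  then have "adj A y = y" using limit_unique[of "adj A y" y ?y] lim by (simp add: adj_closed)
  then have say: "selfadj y" by (simp add: selfadj_def)
  have "nrm A y \<le> 1"
  proof -
    have "nrm A y \<le> 1 + nrm A (?y n \<ominus> y)" for n
    proof -
      have "?y n \<ominus> (?y n \<ominus> y) = y" by (simp add: minus_minus_cancel)
      then have "nrm A y \<le> nrm A (?y n) + nrm A (?y n \<ominus> y)"
        using nrm_triangle_minus[of "?y n" "?y n \<ominus> y"] by simp
      then show ?thesis using bd[of n] sqrt_bound_range[of n] by linarith
    qed
    moreover have "(\<lambda>n. 1 + nrm A (?y n \<ominus> y)) \<longlonglongrightarrow> 1 + 0" using lim by (intro tendsto_intros)
    ultimately show ?thesis by (intro LIMSEQ_le_const) auto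
  qed
  moreover have "commutes z y" if z[simp]: "z \<in> carrier A" and zc: "commutes z c" for z
  proof -
    have cn: "commutes z (?y n)" for n
    proof (induction n)
      case 0 show ?case by (simp add: commutes_def)
    next
      case (Suc n) then show ?case using zc
        by (simp add: commutes_scale commutes_add commutes_mult)
    qed
    have "(\<lambda>n. nrm A z * nrm A (?y n \<ominus> y)) \<longlonglongrightarrow> nrm A z * 0" using lim by (intro tendsto_intros)
    then have l0: "(\<lambda>n. nrm A z * nrm A (?y n \<ominus> y)) \<longlonglongrightarrow> 0" by simp
    have 1: "(\<lambda>n. nrm A (z \<otimes> ?y n \<ominus> z \<otimes> y)) \<longlonglongrightarrow> 0"
    proof (rule Lim_null_comparison[OF _ l0])
      show "\<forall>\<^sub>F n in sequentially. norm (nrm A (z \<otimes> ?y n \<ominus> z \<otimes> y)) \<le> nrm A z * nrm A (?y n \<ominus> y)"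
        using nrm_mult[of z "?y n \<ominus> y" for n] by (simp add: mult_minus_right nrm_nonneg)
    qed
    have 2: "(\<lambda>n. nrm A (z \<otimes> ?y n \<ominus> y \<otimes> z)) \<longlonglongrightarrow> 0"
    proof (rule Lim_null_comparison[OF _ l0])
      show "\<forall>\<^sub>F n in sequentially. norm (nrm A (z \<otimes> ?y n \<ominus> y \<otimes> z)) \<le> nrm A z * nrm A (?y n \<ominus> y)"
        using nrm_mult[of "?y n \<ominus> y" z for n] cn unfolding commutes_def
        by (simp add: mult_minus_left nrm_nonneg mult.commute)
    qed
    show ?thesis unfolding commutes_def by (rule limit_unique[OF _ _ _ 1 2]) auto
  qed
  moreover have "(\<one> \<ominus> y) \<otimes> (\<one> \<ominus> y) = \<one> \<ominus> c"
  proof -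
    have 1: "(\<lambda>n. nrm A (?y (Suc n) \<ominus> y)) \<longlonglongrightarrow> 0" using lim by (rule LIMSEQ_Suc)
    have 2: "(\<lambda>n. nrm A (?y (Suc n) \<ominus> (1/2) \<odot> (c \<oplus> y \<otimes> y))) \<longlonglongrightarrow> 0"
    proof (rule Lim_null_comparison[OF _ lim], intro always_eventually allI)
      fix n
      let ?u = "?y n"
      have "?y (Suc n) \<ominus> (1/2) \<odot> (c \<oplus> y \<otimes> y) = (1/2) \<odot> ((c \<oplus> ?u \<otimes> ?u) \<ominus> (c \<oplus> y \<otimes> y))"
        by (simp add: scale_minus)
      also have "(c \<oplus> ?u \<otimes> ?u) \<ominus> (c \<oplus> y \<otimes> y) = ?u \<otimes> ?u \<ominus> y \<otimes> y"
        by (simp add: a_minus_def minus_add a_assoc a_comm a_lcomm r_neg r_neg1 r_neg2)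
      also have "\<dots> = ?u \<otimes> (?u \<ominus> y) \<oplus> (?u \<ominus> y) \<otimes> y" by (intro square_diff) auto
      finally have eq: "nrm A (?y (Suc n) \<ominus> (1/2) \<odot> (c \<oplus> y \<otimes> y)) = nrm A (?u \<otimes> (?u \<ominus> y) \<oplus> (?u \<ominus> y) \<otimes> y) / 2"
        by (simp add: nrm_scale del: sqrt_iter.simps)
      have "nrm A (?u \<otimes> (?u \<ominus> y) \<oplus> (?u \<ominus> y) \<otimes> y)
         \<le> nrm A ?u * nrm A (?u \<ominus> y) + nrm A (?u \<ominus> y) * nrm A y"
        by (rule order_trans[OF nrm_triangle add_mono[OF nrm_mult nrm_mult]]) auto
      also have "\<dots> \<le> 1 * nrm A (?u \<ominus> y) + nrm A (?u \<ominus> y) * 1"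
        using bd[of n] sqrt_bound_range[of n] \<open>nrm A y \<le> 1\<close> nrm_nonneg
        by (intro add_mono mult_mono) auto
      finally show "norm (nrm A (?y (Suc n) \<ominus> (1/2) \<odot> (c \<oplus> y \<otimes> y))) \<le> nrm A (?y n \<ominus> y)"
        using eq nrm_nonneg[of "?y (Suc n) \<ominus> (1/2) \<odot> (c \<oplus> y \<otimes> y)"] selfadjD(1)[OF sa[of "Suc n"]]
        by (simp del: sqrt_iter.simps)
    qed
    have "y = (1/2) \<odot> (c \<oplus> y \<otimes> y)"
      by (rule limit_unique[OF _ _ _ 1 2]) (auto simp del: sqrt_iter.simps simp: selfadjD(1)[OF sa])
    then have "2 \<odot> y = 2 \<odot> ((1/2) \<odot> (c \<oplus> y \<otimes> y))" by simp
    also have "\<dots> = c \<oplus> y \<otimes> y" by (simp add: scale_scale scale_one del: scale_add_right)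
    finally have 2: "y \<oplus> y = c \<oplus> y \<otimes> y" using scale_add_left[of y 1 1] by (simp add: scale_one)
    have "(\<one> \<ominus> y) \<otimes> (\<one> \<ominus> y) = \<one> \<ominus> (y \<oplus> y) \<oplus> y \<otimes> y"
      by (simp add: mult_minus_left mult_minus_right)
         (simp add: a_minus_def minus_add a_assoc a_comm a_lcomm)
    also have "\<dots> = \<one> \<ominus> c" unfolding 2
      by (simp add: a_minus_def minus_add a_assoc l_neg)
    finally show ?thesis .
  qed
  ultimately show ?thesis using say by blast
qed

text \<open>Both h + \<i> k and h - \<i> k have squared norm nrm A (h h + k k) by the C*-identity, since the
mixed terms cancel, and 2 h is their sum.\<close>

lemma commuting_square_norm_le:
  assumes h: "selfadj h" and k: "selfadj k" and hk: "commutes h k"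
  shows "nrm A (h \<otimes> h) \<le> nrm A (h \<otimes> h \<oplus> k \<otimes> k)"
proof -
  note [simp] = selfadjD[OF h] selfadjD[OF k] scale_closed
  let ?N = "nrm A (h \<otimes> h \<oplus> k \<otimes> k)"
  have z: "(nrm A (h \<oplus> s \<odot> k))\<^sup>2 = ?N" if s: "cnj s = - s" "s * s = -1" for s
  proof -
    have "adj A (h \<oplus> s \<odot> k) \<otimes> (h \<oplus> s \<odot> k) = (h \<oplus> (- s) \<odot> k) \<otimes> (h \<oplus> s \<odot> k)"
      using s by (simp add: adj_add adj_scale)
    also have "\<dots> = h \<otimes> h \<oplus> (s \<odot> (h \<otimes> k) \<oplus> (- s) \<odot> (h \<otimes> k)) \<oplus> k \<otimes> k"
      using s hk[unfolded commutes_def]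
      by (simp add: r_distr l_distr scale_mult_left scale_mult_right scale_scale scale_add_right scale_one)
         (simp add: a_assoc a_comm a_lcomm)
    also have "s \<odot> (h \<otimes> k) \<oplus> (- s) \<odot> (h \<otimes> k) = \<zero>"
      using scale_add_left[of "h \<otimes> k" s "-s"] by (simp add: scale_zero_left)
    finally show ?thesis using cstar_identity[of "h \<oplus> s \<odot> k"] by simp
  qed
  have "2 \<odot> h = (h \<oplus> \<i> \<odot> k) \<oplus> (h \<oplus> (-\<i>) \<odot> k)"
  proof -
    have "(h \<oplus> \<i> \<odot> k) \<oplus> (h \<oplus> (-\<i>) \<odot> k) = (h \<oplus> h) \<oplus> (\<i> \<odot> k \<oplus> (-\<i>) \<odot> k)"
      by (simp add: a_assoc a_comm a_lcomm)
    also have "\<i> \<odot> k \<oplus> (-\<i>) \<odot> k = \<zero>"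
      using scale_add_left[of k "\<i>" "-\<i>"] by (simp add: scale_zero_left)
    also have "h \<oplus> h = 2 \<odot> h" using scale_add_left[of h 1 1] by (simp add: scale_one)
    finally show ?thesis by simp
  qed
  then have "2 * nrm A h \<le> nrm A (h \<oplus> \<i> \<odot> k) + nrm A (h \<oplus> (-\<i>) \<odot> k)"
    using nrm_triangle[of "h \<oplus> \<i> \<odot> k" "h \<oplus> (-\<i>) \<odot> k"] nrm_scale[of h 2] by simp
  moreover have "nrm A (h \<oplus> \<i> \<odot> k) = sqrt ?N" "nrm A (h \<oplus> (-\<i>) \<odot> k) = sqrt ?N"
    using z[of "\<i>"] z[of "-\<i>"] nrm_nonneg[of "h \<oplus> \<i> \<odot> k"] nrm_nonneg[of "h \<oplus> (-\<i>) \<odot> k"]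
    by (auto intro: real_sqrt_unique[symmetric])
  ultimately have "nrm A h \<le> sqrt ?N" by simp
  then have "(nrm A h)\<^sup>2 \<le> (sqrt ?N)\<^sup>2" using nrm_nonneg[of h] by (intro power_mono) auto
  then show ?thesis using nrm_nonneg[of "h \<otimes> h \<oplus> k \<otimes> k"] selfadj_nrm_square[OF h] by simp
qed

lemma nrm_one_minus_square_le:
  assumes h: "selfadj h" and h1: "nrm A h \<le> 1"
  shows "nrm A (\<one> \<ominus> h \<otimes> h) \<le> 1"
proof -
  note [simp] = selfadjD[OF h]
  have "nrm A (h \<otimes> h) \<le> 1" using selfadj_nrm_square[OF h] nrm_nonneg[of h] h1
    by (simp add: power_le_one)
  then obtain y where y: "selfadj y" "commutes h y" "(\<one> \<ominus> y) \<otimes> (\<one> \<ominus> y) = \<one> \<ominus> h \<otimes> h"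
    using sqrt_one_minus[OF selfadj_square[OF h]] commutes_def m_assoc by (metis selfadjD(1) h)
  let ?s = "\<one> \<ominus> y"
  have s: "selfadj ?s" "commutes ?s h"
    using y by (auto intro!: selfadj_minus selfadj_one commutes_minus commutes_one simp: selfadjD commutes_sym[of h])
       (simp add: commutes_def commutes_minus mult_minus_left mult_minus_right selfadjD)
  have "nrm A (?s \<otimes> ?s) \<le> nrm A (?s \<otimes> ?s \<oplus> h \<otimes> h)"
    using s h by (intro commuting_square_norm_le) auto
  also have "?s \<otimes> ?s \<oplus> h \<otimes> h = \<one>" unfolding y(3) by (simp add: minus_add_cancel)
  finally show ?thesis using nrm_one_le y(3) by simp
qed

text \<open>For self-adjoint x the condition says that the spectrum lies in [0, 2 t]. It is stable under sums by the
triangle inequality, whereas sums of elements y* y are not visibly of the same form. That both notions of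
positivity agree is shown in norm_pos_adj_mult.\<close>

definition norm_pos :: "'a \<Rightarrow> bool" where
  "norm_pos x \<longleftrightarrow> selfadj x \<and> (\<exists>t\<ge>0. nrm A (complex_of_real t \<odot> \<one> \<ominus> x) \<le> t)"

lemma norm_pos_selfadj: "norm_pos x \<Longrightarrow> selfadj x" by (simp add: norm_pos_def)

lemma norm_pos_add:
  assumes "norm_pos x" "norm_pos y" shows "norm_pos (x \<oplus> y)"
proof -
  obtain s t where st: "s \<ge> 0" "t \<ge> 0" "nrm A (complex_of_real s \<odot> \<one> \<ominus> x) \<le> s"
    "nrm A (complex_of_real t \<odot> \<one> \<ominus> y) \<le> t" using assms by (auto simp: norm_pos_def)
  have c[simp]: "x \<in> carrier A" "y \<in> carrier A" using assms by (auto simp: norm_pos_def selfadj_def)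
  have "complex_of_real (s + t) \<odot> \<one> \<ominus> (x \<oplus> y)
      = (complex_of_real s \<odot> \<one> \<ominus> x) \<oplus> (complex_of_real t \<odot> \<one> \<ominus> y)"
    by (simp add: a_minus_def minus_add a_assoc a_comm a_lcomm scale_closed scale_add_left)
  then have "nrm A (complex_of_real (s + t) \<odot> \<one> \<ominus> (x \<oplus> y)) \<le> s + t"
    using st nrm_triangle[of "complex_of_real s \<odot> \<one> \<ominus> x" "complex_of_real t \<odot> \<one> \<ominus> y"]
    by (simp add: scale_closed)
  then show ?thesis using assms st selfadj_add unfolding norm_pos_def
    by (metis add_nonneg_nonneg)
qed

lemma norm_pos_scale:
  assumes "norm_pos x" "r \<ge> 0" shows "norm_pos (complex_of_real r \<odot> x)"
proof -
  obtain t where t: "t \<ge> 0" "nrm A (complex_of_real t \<odot> \<one> \<ominus> x) \<le> t" using assms by (auto simp: norm_pos_def)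
  have c[simp]: "x \<in> carrier A" using assms by (auto simp: norm_pos_def selfadj_def)
  have "complex_of_real (r * t) \<odot> \<one> \<ominus> complex_of_real r \<odot> x = complex_of_real r \<odot> (complex_of_real t \<odot> \<one> \<ominus> x)"
    by (simp add: scale_minus scale_closed scale_scale)
  then have "nrm A (complex_of_real (r * t) \<odot> \<one> \<ominus> complex_of_real r \<odot> x) \<le> r * t"
    using t assms(2) by (simp add: nrm_scale scale_closed mult_left_mono)
  then show ?thesis using assms t selfadj_scale unfolding norm_pos_def
    by (metis mult_nonneg_nonneg)
qed

lemma norm_pos_t_minus:
  assumes "selfadj d" "nrm A d \<le> t" shows "norm_pos (complex_of_real t \<odot> \<one> \<ominus> d)"
proof -
  have "t \<ge> 0" using assms nrm_nonneg[of d] by (auto simp: selfadj_def)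
  moreover have "selfadj (complex_of_real t \<odot> \<one> \<ominus> d)"
    using assms by (intro selfadj_minus selfadj_scale selfadj_one)
  moreover have "complex_of_real t \<odot> \<one> \<ominus> (complex_of_real t \<odot> \<one> \<ominus> d) = d"
    using assms by (intro minus_minus_cancel) (auto simp: scale_closed selfadjD)
  ultimately show ?thesis using assms unfolding norm_pos_def by metis
qed

lemma norm_pos_one_minus:
  assumes "selfadj d" "nrm A d \<le> 1" shows "norm_pos (\<one> \<ominus> d)"
  using norm_pos_t_minus[OF assms] by (simp add: scale_one)

text \<open>Rescaling reduces this to sqrt_one_minus. The root again has the form 1 - y up to a positive factor,
and hence is positive itself.\<close>

lemma norm_pos_sqrt:
  assumes x: "norm_pos x"
  shows "\<exists>r. norm_pos r \<and> r \<otimes> r = x \<and> (\<forall>z\<in>carrier A. commutes z x \<longrightarrow> commutes z r)"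
proof -
  obtain t0 where t0: "t0 \<ge> 0" "nrm A (complex_of_real t0 \<odot> \<one> \<ominus> x) \<le> t0" using assms by (auto simp: norm_pos_def)
  have sx: "selfadj x" and c[simp]: "x \<in> carrier A" using assms by (auto simp: norm_pos_def selfadj_def)
  define t where "t = t0 + 1"
  let ?T = "complex_of_real t"
  have t: "t > 0" using t0 t_def by simp
  have tn: "nrm A (?T \<odot> \<one> \<ominus> x) \<le> t"
  proof -
    have "?T \<odot> \<one> \<ominus> x = (complex_of_real t0 \<odot> \<one> \<ominus> x) \<oplus> \<one>"
      by (simp add: t_def scale_add_left scale_one a_minus_def a_assoc a_comm a_lcomm scale_closed)
    then show ?thesis using nrm_triangle[of "complex_of_real t0 \<odot> \<one> \<ominus> x" \<one>] t0 nrm_one_le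
      by (simp add: scale_closed t_def)
  qed
  define d where "d = complex_of_real (1/t) \<odot> (?T \<odot> \<one> \<ominus> x)"
  have sd: "selfadj d" unfolding d_def by (intro selfadj_scale selfadj_minus selfadj_one sx)
  have d1: "nrm A d \<le> 1" unfolding d_def using tn t by (simp add: nrm_scale scale_closed norm_divide)
  have xd: "x = ?T \<odot> (\<one> \<ominus> d)"
  proof -
    have "?T \<odot> (\<one> \<ominus> d) = ?T \<odot> \<one> \<ominus> ?T \<odot> d" using sd by (simp add: scale_minus selfadjD)
    also have "?T \<odot> d = ?T \<odot> \<one> \<ominus> x" using t unfolding d_def by (simp add: scale_scale scale_closed scale_one)
    finally show ?thesis by (simp add: minus_minus_cancel scale_closed)
  qed
  obtain y where y: "selfadj y" "nrm A y \<le> 1" "\<And>z. z \<in> carrier A \<Longrightarrow> commutes z d \<Longrightarrow> commutes z y"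
     "(\<one> \<ominus> y) \<otimes> (\<one> \<ominus> y) = \<one> \<ominus> d" using sqrt_one_minus[OF sd d1] by blast
  define r where "r = complex_of_real (sqrt t) \<odot> (\<one> \<ominus> y)"
  have yc[simp]: "y \<in> carrier A" "d \<in> carrier A" using y sd by (auto simp: selfadjD)
  have "norm_pos r" unfolding r_def using y t by (intro norm_pos_scale norm_pos_one_minus) auto
  moreover have "r \<otimes> r = x"
    using t y(4) unfolding r_def xd
    by (simp add: scale_mult_left scale_mult_right scale_closed scale_scale flip: of_real_mult)
  moreover have "commutes z r" if z[simp]: "z \<in> carrier A" and "commutes z x" for z
  proof -
    have "commutes z d" unfolding d_def using that
      by (intro commutes_scale commutes_minus commutes_one) (auto simp: scale_closed)
    then have "commutes z y" using y by simp
    then show ?thesis unfolding r_def by (intro commutes_scale commutes_minus commutes_one) auto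
  qed
  ultimately show ?thesis by blast
qed

lemma norm_pos_square:
  assumes h: "selfadj h" shows "norm_pos (h \<otimes> h)"
proof -
  define t where "t = nrm A h + 1"
  have c[simp]: "h \<in> carrier A" using h by (simp add: selfadjD)
  have t: "t > 0" using nrm_nonneg[of h] by (simp add: t_def)
  let ?k = "complex_of_real (1/t) \<odot> h"
  have "nrm A ?k \<le> 1" using t by (simp add: nrm_scale norm_divide t_def)
  then have n: "nrm A (\<one> \<ominus> ?k \<otimes> ?k) \<le> 1" using h by (intro nrm_one_minus_square_le selfadj_scale)
  then have "norm_pos (?k \<otimes> ?k)"
    using selfadj_square[OF selfadj_scale[OF h, of "1/t"]] unfolding norm_pos_def
    by (intro conjI exI[of _ 1]) (auto simp: scale_one)
  then have "norm_pos (complex_of_real (t * t) \<odot> (?k \<otimes> ?k))" using t by (intro norm_pos_scale) auto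
  also have "complex_of_real (t * t) \<odot> (?k \<otimes> ?k) = h \<otimes> h"
    using t by (simp add: scale_mult_left scale_mult_right scale_closed scale_scale scale_one)
  finally show ?thesis .
qed

lemma real_imag_parts:
  assumes x: "x \<in> carrier A"
  obtains h k where "selfadj h" "selfadj k" "x = h \<oplus> \<i> \<odot> k" "adj A x = h \<oplus> (-\<i>) \<odot> k"
proof -
  note [simp] = x adj_closed scale_closed
  define h where "h = complex_of_real (1/2) \<odot> (x \<oplus> adj A x)"
  define k where "k = (-\<i>/2) \<odot> (x \<ominus> adj A x)"
  have h: "selfadj h" unfolding h_def selfadj_def by (simp add: adj_scale adj_add adj_adj a_comm)
  have k: "selfadj k" unfolding k_def selfadj_def
    by (simp add: adj_scale adj_minus adj_adj) (simp add: minus_scale scale_add_right scale_scale a_comm)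
  have ik: "\<i> \<odot> k = (1/2) \<odot> x \<oplus> (-(1/2)) \<odot> adj A x" "(-\<i>) \<odot> k = (-(1/2)) \<odot> x \<oplus> (1/2) \<odot> adj A x"
    unfolding k_def by (simp_all add: minus_scale scale_add_right scale_scale)
  have halves: "(1/2) \<odot> z \<oplus> (1/2) \<odot> z = z" "(1/2) \<odot> z \<oplus> (-(1/2)) \<odot> z = \<zero>" if "z \<in> carrier A" for z
    using scale_add_left[of z "1/2" "1/2"] scale_add_left[of z "1/2" "-(1/2)"] that
    by (simp_all add: scale_one scale_zero_left)
  have "h \<oplus> \<i> \<odot> k = ((1/2) \<odot> x \<oplus> (1/2) \<odot> x) \<oplus> ((1/2) \<odot> adj A x \<oplus> (-(1/2)) \<odot> adj A x)"
    unfolding ik unfolding h_def by (simp add: scale_add_right a_assoc a_comm a_lcomm)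
  moreover have "h \<oplus> (-\<i>) \<odot> k = ((1/2) \<odot> x \<oplus> (-(1/2)) \<odot> x) \<oplus> ((1/2) \<odot> adj A x \<oplus> (1/2) \<odot> adj A x)"
    unfolding ik unfolding h_def by (simp add: scale_add_right a_assoc a_comm a_lcomm)
  ultimately show ?thesis using that[OF h k] by (simp add: halves)
qed

text \<open>If b* b is negative, this identity makes b b* positive: it is a sum of squares minus b* b.\<close>

lemma adj_mult_add_mult_adj:
  assumes h: "selfadj h" and k: "selfadj k" and b: "b = h \<oplus> \<i> \<odot> k" "adj A b = h \<oplus> (-\<i>) \<odot> k"
  shows "b \<otimes> adj A b \<oplus> adj A b \<otimes> b = (h \<otimes> h \<oplus> h \<otimes> h) \<oplus> (k \<otimes> k \<oplus> k \<otimes> k)"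
proof -
  note [simp] = selfadjD[OF h] selfadjD[OF k] scale_closed
  have cancel: "\<i> \<odot> z \<oplus> (-\<i>) \<odot> z = \<zero>" if "z \<in> carrier A" for z
    using that scale_add_left[of z "\<i>" "-\<i>"] by (simp add: scale_zero_left)
  have "b \<otimes> adj A b \<oplus> adj A b \<otimes> b
     = ((h \<otimes> h \<oplus> h \<otimes> h) \<oplus> (k \<otimes> k \<oplus> k \<otimes> k)) \<oplus>
       ((\<i> \<odot> (h \<otimes> k) \<oplus> (-\<i>) \<odot> (h \<otimes> k)) \<oplus> (\<i> \<odot> (k \<otimes> h) \<oplus> (-\<i>) \<odot> (k \<otimes> h)))"
    unfolding b(2) unfolding b(1)
    by (simp add: r_distr l_distr scale_mult_left scale_mult_right scale_scale scale_add_right scale_one)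
       (simp add: a_assoc a_comm a_lcomm)
  then show ?thesis by (simp add: cancel)
qed

text \<open>The crucial step towards the positivity of y* y: b* b = - s s is impossible for b \<noteq> 0. It is proved by
norm estimates. Normalise to nrm A b = 1 and put w = s s, which then has norm 1. The element x = b b* is
positive of norm 1, so 1 - x has norm at most 1. Since w b* = - b* b b*, the element m = b (1 + w) has
adjoint b* (1 - x), so its norm is at most 1. On the other hand
m* m = - w (1 + w) (1 + w) = - ((2 w) (2 w) + p p) with p = s (1 - w), and this has norm at least 4.\<close>

lemma negative_square_imp_zero:
  assumes b: "b \<in> carrier A" and s: "selfadj s" and eq: "adj A b \<otimes> b \<oplus> s \<otimes> s = \<zero>"
  shows "b = \<zero>"
proof (rule ccontr)
  note [simp] = b selfadjD[OF s] adj_closed scale_closed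
  assume "b \<noteq> \<zero>"
  then have R0: "nrm A b > 0" using nrm_eq_0[of b] nrm_nonneg[of b] by simp
  define c where "c = complex_of_real (1 / nrm A b)"
  define b' where "b' = c \<odot> b"
  define w where "w = (c \<odot> s) \<otimes> (c \<odot> s)"
  let ?s = "c \<odot> s"
  have b'[simp]: "b' \<in> carrier A" "w \<in> carrier A" "?s \<in> carrier A" by (auto simp: b'_def w_def)
  have ss: "selfadj ?s" using s unfolding c_def by (rule selfadj_scale)
  have "adj A b' \<otimes> b' \<oplus> w = (c * c) \<odot> (adj A b \<otimes> b \<oplus> s \<otimes> s)"
    unfolding b'_def w_def by (simp add: c_def adj_scale scale_mult_left scale_mult_right scale_scale scale_add_right)
  then have eq': "adj A b' \<otimes> b' \<oplus> w = \<zero>" using eq by (simp add: scale_zero_right)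
  have zw: "adj A b' \<otimes> b' = \<ominus> w" by (rule minus_equality[OF eq', symmetric]) simp_all
  have nb: "nrm A b' = 1" using R0 by (simp add: b'_def c_def nrm_scale norm_divide)
  have nw: "(nrm A ?s)\<^sup>2 = 1"
  proof -
    have "nrm A w = nrm A (adj A b' \<otimes> b')" unfolding zw using nrm_scale[of w "-1"] by (simp add: scale_uminus_one)
    then show ?thesis using nb selfadj_nrm_square[OF ss] by (simp add: cstar_identity w_def)
  qed
  let ?x = "b' \<otimes> adj A b'"
  have sx: "selfadj ?x" by (simp add: selfadj_def adj_mult adj_adj)
  \<comment> \<open>b b* = (b b* + b* b) + w, a sum of squares of self-adjoint elements\<close>
  have "norm_pos ?x"
  proof -
    obtain h k where hk: "selfadj h" "selfadj k" "b' = h \<oplus> \<i> \<odot> k" "adj A b' = h \<oplus> (-\<i>) \<odot> k"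
      using real_imag_parts[OF b'(1)] by blast
    have "?x = (?x \<oplus> adj A b' \<otimes> b') \<oplus> w" unfolding zw by (simp add: a_assoc l_neg)
    also have "\<dots> = ((h \<otimes> h \<oplus> h \<otimes> h) \<oplus> (k \<otimes> k \<oplus> k \<otimes> k)) \<oplus> w"
      using adj_mult_add_mult_adj[OF hk] by simp
    finally show ?thesis unfolding w_def using hk ss by (metis norm_pos_add norm_pos_square)
  qed
  then obtain r where r: "norm_pos r" "r \<otimes> r = ?x" using norm_pos_sqrt by blast
  have "(nrm A r)\<^sup>2 = 1"
    using selfadj_nrm_square[OF norm_pos_selfadj[OF r(1)]] cstar_identity[of "adj A b'"] nb r(2)
    by (simp add: adj_adj nrm_adj)
  then have "nrm A r \<le> 1" using nrm_nonneg[of r] r norm_pos_selfadj selfadjD by (metis power2_le_imp_le zero_le_one order_refl one_power2)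
  then have x1: "nrm A (\<one> \<ominus> ?x) \<le> 1" using nrm_one_minus_square_le[OF norm_pos_selfadj[OF r(1)]] r(2) by simp
  let ?m = "b' \<otimes> (\<one> \<oplus> w)"
  have sw: "selfadj w" unfolding w_def by (rule selfadj_square[OF ss])
  have am: "adj A ?m = adj A b' \<otimes> (\<one> \<ominus> ?x)"
  proof -
    have "adj A ?m = (\<one> \<oplus> w) \<otimes> adj A b'"
      using sw by (simp add: adj_mult adj_add adj_one selfadjD)
    also have "\<dots> = adj A b' \<oplus> w \<otimes> adj A b'" by (simp add: l_distr)
    also have "\<dots> = adj A b' \<otimes> (\<one> \<ominus> ?x)"
      using arg_cong[OF zw, of "a_inv A"]
      by (simp add: mult_minus_right m_assoc) (simp add: a_minus_def l_minus[symmetric] m_assoc[symmetric])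
    finally show ?thesis .
  qed
  have "nrm A ?m \<le> 1"
  proof -
    have "nrm A ?m = nrm A (adj A b' \<otimes> (\<one> \<ominus> ?x))" using am nrm_adj[of ?m] by simp
    also have "\<dots> \<le> nrm A (adj A b') * nrm A (\<one> \<ominus> ?x)" by (rule nrm_mult) auto
    finally show ?thesis using x1 nb by (simp add: nrm_adj)
  qed
  then have m1: "nrm A (adj A ?m \<otimes> ?m) \<le> 1"
    using cstar_identity[of ?m] nrm_nonneg[of ?m] by (simp add: power_le_one)
  let ?p = "?s \<otimes> (\<one> \<ominus> w)" and ?q = "complex_of_real 2 \<odot> w"
  have cs: "commutes ?s w" unfolding w_def commutes_def by (simp add: m_assoc)
  have cs1: "commutes ?s (\<one> \<ominus> w)" using cs by (intro commutes_minus commutes_one) auto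
  have p: "selfadj ?p" using cs1 ss sw unfolding commutes_def by (intro selfadj_mult selfadj_minus selfadj_one) auto
  have q: "selfadj ?q" using sw by (rule selfadj_scale)
  have ww: "commutes w ?s" "commutes w (\<one> \<ominus> w)"
    using cs by (auto simp: commutes_sym intro!: commutes_minus commutes_one) (simp add: commutes_def)
  have qp: "commutes ?q ?p"
    by (rule commutes_sym, rule commutes_scale) (auto intro!: commutes_sym[OF commutes_mult] ww)
  have "adj A ?m \<otimes> ?m = \<ominus> (w \<otimes> (\<one> \<oplus> w) \<otimes> (\<one> \<oplus> w))"
  proof -
    have "adj A ?m \<otimes> ?m = (\<one> \<oplus> w) \<otimes> (adj A b' \<otimes> b') \<otimes> (\<one> \<oplus> w)"
      using sw by (simp add: adj_mult adj_add adj_one selfadjD m_assoc)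
    also have "\<dots> = \<ominus> (w \<otimes> (\<one> \<oplus> w) \<otimes> (\<one> \<oplus> w))"
      unfolding zw
      by (simp add: r_minus l_minus l_distr r_distr m_assoc) (simp add: minus_add a_assoc a_comm a_lcomm)
    finally show ?thesis .
  qed
  also have "w \<otimes> (\<one> \<oplus> w) \<otimes> (\<one> \<oplus> w) = ?q \<otimes> ?q \<oplus> ?p \<otimes> ?p"
  proof -
    have "?p \<otimes> ?p = w \<otimes> (\<one> \<ominus> w) \<otimes> (\<one> \<ominus> w)"
    proof -
      have "?p \<otimes> ?p = ?s \<otimes> ((\<one> \<ominus> w) \<otimes> ?s) \<otimes> (\<one> \<ominus> w)" by (simp add: m_assoc)
      also have "(\<one> \<ominus> w) \<otimes> ?s = ?s \<otimes> (\<one> \<ominus> w)" using cs1 by (simp add: commutes_def)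
      also have "?s \<otimes> (?s \<otimes> (\<one> \<ominus> w)) \<otimes> (\<one> \<ominus> w) = w \<otimes> (\<one> \<ominus> w) \<otimes> (\<one> \<ominus> w)"
        unfolding w_def by (simp add: m_assoc)
      finally show ?thesis .
    qed
    also have "\<dots> = w \<oplus> (-2) \<odot> (w \<otimes> w) \<oplus> w \<otimes> w \<otimes> w"
    proof -
      have e: "(-2) \<odot> z = \<ominus> z \<oplus> \<ominus> z" if "z \<in> carrier A" for z
        using that scale_add_left[of z "-1" "-1"] by (simp add: scale_uminus_one)
      show ?thesis
      by (simp add: mult_minus_right mult_minus_left m_assoc e) (simp add: a_minus_def a_assoc minus_add a_comm a_lcomm)
    qed
    finally have pp: "?p \<otimes> ?p = w \<oplus> (-2) \<odot> (w \<otimes> w) \<oplus> w \<otimes> w \<otimes> w" .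
    have qq: "?q \<otimes> ?q = 4 \<odot> (w \<otimes> w)" by (simp add: scale_mult_left scale_mult_right scale_scale)
    have "?q \<otimes> ?q \<oplus> ?p \<otimes> ?p = w \<oplus> (4 \<odot> (w \<otimes> w) \<oplus> (-2) \<odot> (w \<otimes> w)) \<oplus> w \<otimes> w \<otimes> w"
      unfolding pp qq by (simp add: a_assoc a_comm a_lcomm)
    also have "4 \<odot> (w \<otimes> w) \<oplus> (-2) \<odot> (w \<otimes> w) = w \<otimes> w \<oplus> w \<otimes> w"
      using scale_add_left[of "w \<otimes> w" 4 "-2"] scale_add_left[of "w \<otimes> w" 1 1] by (simp add: scale_one)
    finally show ?thesis by (simp add: l_distr r_distr m_assoc) (simp add: a_assoc)
  qed
  finally have "nrm A (adj A ?m \<otimes> ?m) = nrm A (?q \<otimes> ?q \<oplus> ?p \<otimes> ?p)"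
    using nrm_scale[of "?q \<otimes> ?q \<oplus> ?p \<otimes> ?p" "-1"] by (simp add: scale_uminus_one)
  then have "nrm A (?q \<otimes> ?q) \<le> 1" using commuting_square_norm_le[OF q p qp] m1 by simp
  moreover have "nrm A (?q \<otimes> ?q) = 4 * ((nrm A ?s)\<^sup>2)\<^sup>2"
    using selfadj_nrm_square[OF q] selfadj_nrm_square[OF ss] by (simp add: nrm_scale w_def power_mult_distrib)
  ultimately show False using nw by simp
qed

lemma selfadj_square_zero: "selfadj x \<Longrightarrow> x \<otimes> x = \<zero> \<Longrightarrow> x = \<zero>"
  using selfadj_nrm_square[of x] nrm_eq_0[of x] by (simp add: nrm_zero selfadjD)

lemma adj_mult_self_zero: "x \<in> carrier A \<Longrightarrow> adj A x \<otimes> x = \<zero> \<Longrightarrow> x = \<zero>"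
  using cstar_identity[of x] nrm_eq_0[of x] by (simp add: nrm_zero)

text \<open>Let a = y* y, let g be the positive root of a a, and v = g - a, twice the negative part of a. Then
a v = - g v, so (y v)* (y v) + (q v) (q v) = 0 where q is the root of g. By
negative_square_imp_zero this forces y v = 0, hence v = 0 and a = g.\<close>

lemma norm_pos_adj_mult:
  assumes y: "y \<in> carrier A" shows "norm_pos (adj A y \<otimes> y)"
proof -
  define a where "a = adj A y \<otimes> y"
  have a: "selfadj a" unfolding a_def by (rule selfadj_adj_mult[OF y])
  note [simp] = y selfadjD[OF a]
  obtain g where g: "norm_pos g" "g \<otimes> g = a \<otimes> a" "\<And>z. z \<in> carrier A \<Longrightarrow> commutes z (a \<otimes> a) \<Longrightarrow> commutes z g"
    using norm_pos_sqrt[OF norm_pos_square[OF a]] by blast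
  have sg: "selfadj g" using g by (simp add: norm_pos_selfadj)
  obtain q where q: "norm_pos q" "q \<otimes> q = g" "\<And>z. z \<in> carrier A \<Longrightarrow> commutes z g \<Longrightarrow> commutes z q"
    using norm_pos_sqrt[OF g(1)] by blast
  have sq: "selfadj q" using q by (simp add: norm_pos_selfadj)
  note [simp] = selfadjD[OF sg] selfadjD[OF sq]
  have ag: "commutes a g" by (rule g(3)) (simp_all add: commutes_def m_assoc)
  have aq: "commutes a q" by (rule q(3)[OF _ ag]) simp
  have gq: "commutes g q" unfolding commutes_def q(2)[symmetric] by (simp add: m_assoc)
  define v where "v = g \<ominus> a"
  have sv: "selfadj v" unfolding v_def by (rule selfadj_minus[OF sg a])
  note [simp] = selfadjD[OF sv]
  have qv: "commutes q v" unfolding v_def using gq aq by (intro commutes_minus) (auto simp: commutes_sym)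
  have av: "a \<otimes> v = \<ominus> (g \<otimes> v)"
    unfolding v_def using ag[unfolded commutes_def] g(2)
    by (simp add: mult_minus_right) (simp add: a_minus_def minus_add a_comm)
  let ?t = "q \<otimes> v"
  have st: "selfadj ?t" using sq sv qv by (intro selfadj_mult) (auto simp: commutes_def)
  have tt: "?t \<otimes> ?t = g \<otimes> v \<otimes> v"
  proof -
    have "?t \<otimes> ?t = q \<otimes> (v \<otimes> q) \<otimes> v" by (simp add: m_assoc)
    also have "v \<otimes> q = q \<otimes> v" using qv by (simp add: commutes_def)
    also have "q \<otimes> (q \<otimes> v) \<otimes> v = (q \<otimes> q) \<otimes> v \<otimes> v" by (simp add: m_assoc)
    finally show ?thesis by (simp only: q(2))
  qed
  have "adj A (y \<otimes> v) \<otimes> (y \<otimes> v) = v \<otimes> (a \<otimes> v)"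
    by (simp add: adj_mult m_assoc a_def adj_closed)
  also have "\<dots> = \<ominus> (v \<otimes> g \<otimes> v)" unfolding av by (simp add: r_minus m_assoc)
  also have "v \<otimes> g = g \<otimes> v" unfolding v_def using ag[unfolded commutes_def]
    by (simp add: mult_minus_right mult_minus_left)
  finally have "adj A (y \<otimes> v) \<otimes> (y \<otimes> v) \<oplus> ?t \<otimes> ?t = \<zero>" unfolding tt by (simp add: l_neg)
  then have "y \<otimes> v = \<zero>" by (rule negative_square_imp_zero[OF _ st, rotated]) simp
  have "?t \<otimes> ?t = \<zero>" using \<open>adj A (y \<otimes> v) \<otimes> (y \<otimes> v) \<oplus> ?t \<otimes> ?t = \<zero>\<close>
    unfolding \<open>y \<otimes> v = \<zero>\<close> by (simp add: adj_zero)
  then have "q \<otimes> v = \<zero>" by (rule selfadj_square_zero[OF st])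
  then have gv: "g \<otimes> v = \<zero>" unfolding q(2)[symmetric] by (simp add: m_assoc)
  then have av0: "a \<otimes> v = \<zero>" using av by simp
  have "v \<otimes> v = g \<otimes> v \<ominus> a \<otimes> v" unfolding v_def by (rule mult_minus_left) simp_all
  then have "v \<otimes> v = \<zero>" unfolding gv av0 by (simp add: a_minus_def)
  then have "v = \<zero>" by (rule selfadj_square_zero[OF sv])
  then have "g \<ominus> a = \<zero>" by (simp only: v_def)
  then have "g = a" by (rule minus_eq_zeroD[rotated 2]) simp_all
  then show ?thesis using g(1) a_def by simp
qed

definition positive :: "'a \<Rightarrow> bool" where
  "positive x \<longleftrightarrow> (\<exists>y\<in>carrier A. x = adj A y \<otimes> y)"

lemma positive_iff_norm_pos: "positive x \<longleftrightarrow> norm_pos x"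
proof
  assume "norm_pos x"
  then obtain r where "norm_pos r" "r \<otimes> r = x" using norm_pos_sqrt by blast
  then show "positive x" 
    using selfadjD[OF norm_pos_selfadj[of r]] unfolding positive_def by (intro bexI[of _ r]) simp_all
qed (auto simp: positive_def norm_pos_adj_mult)

lemma positive_selfadj: "positive x \<Longrightarrow> selfadj x"
  by (simp add: positive_iff_norm_pos norm_pos_selfadj)

lemma positive_carrier: "positive x \<Longrightarrow> x \<in> carrier A"
  by (simp add: positive_selfadj selfadjD)

lemma positive_add: "positive x \<Longrightarrow> positive y \<Longrightarrow> positive (x \<oplus> y)"
  by (simp add: positive_iff_norm_pos norm_pos_add)

lemma positive_scale: "positive x \<Longrightarrow> r \<ge> 0 \<Longrightarrow> positive (complex_of_real r \<odot> x)"
  by (simp add: positive_iff_norm_pos norm_pos_scale)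

lemma positive_adj_mult: "y \<in> carrier A \<Longrightarrow> positive (adj A y \<otimes> y)"
  by (auto simp: positive_def)

lemma positive_t_minus:
  "selfadj d \<Longrightarrow> nrm A d \<le> t \<Longrightarrow> positive (complex_of_real t \<odot> \<one> \<ominus> d)"
  by (simp add: positive_iff_norm_pos norm_pos_t_minus)

lemma positive_sqrt: "positive x \<Longrightarrow> \<exists>r. selfadj r \<and> r \<otimes> r = x"
  using norm_pos_sqrt norm_pos_selfadj positive_iff_norm_pos by blast

text \<open>With commuting roots r of x and q of 1 - x, the sum r r + q q is 1, so commuting_square_norm_le
applies.\<close>

lemma positive_nrm_le_one:
  assumes "positive x" "positive (\<one> \<ominus> x)" shows "nrm A x \<le> 1"
proof -
  obtain r where r: "norm_pos r" "r \<otimes> r = x" using norm_pos_sqrt assms positive_iff_norm_pos by blast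
  obtain q where q: "norm_pos q" "q \<otimes> q = \<one> \<ominus> x" "\<And>z. z \<in> carrier A \<Longrightarrow> commutes z (\<one> \<ominus> x) \<Longrightarrow> commutes z q"
    using norm_pos_sqrt assms positive_iff_norm_pos by metis
  have c[simp]: "r \<in> carrier A" "q \<in> carrier A" "x \<in> carrier A"
    using r q assms by (auto simp: norm_pos_def selfadjD positive_carrier)
  have "commutes r x" unfolding commutes_def r(2)[symmetric] by (simp add: m_assoc)
  then have "commutes r q" by (intro q(3) commutes_minus commutes_one) auto
  then have "nrm A (r \<otimes> r) \<le> nrm A (r \<otimes> r \<oplus> q \<otimes> q)"
    using r q by (intro commuting_square_norm_le) (auto simp: norm_pos_selfadj)
  also have "r \<otimes> r \<oplus> q \<otimes> q = \<one>" unfolding r(2) q(2) using a_comm[of "\<one> \<ominus> x" x] minus_add_cancel[of \<one> x] by (simp del: a_comm)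
  finally show ?thesis using r(2) nrm_one_le by simp
qed

lemma positive_antisym:
  assumes "positive x" "positive (\<ominus> x)" shows "x = \<zero>"
proof -
  obtain y s where y: "y \<in> carrier A" "x = adj A y \<otimes> y" and s: "selfadj s" "s \<otimes> s = \<ominus> x"
    using assms positive_sqrt positive_def by metis
  have "adj A y \<otimes> y \<oplus> s \<otimes> s = \<zero>" unfolding s using y by (simp add: r_neg adj_closed)
  then have "y = \<zero>" using negative_square_imp_zero y s by blast
  then show ?thesis using y by (simp add: adj_zero)
qed

end

section \<open>Polynomials in an element and eigenprojections\<close>

text \<open>Gaussian elimination of one index s at a time.\<close>

lemma nontrivial_relation:
  fixes c :: "'i \<Rightarrow> 's \<Rightarrow> complex"
  assumes "finite S" "finite I" "card S < card I"
  shows "\<exists>l. (\<exists>i\<in>I. l i \<noteq> 0) \<and> (\<forall>s\<in>S. (\<Sum>i\<in>I. l i * c i s) = 0)"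
  using assms
proof (induction S arbitrary: I c rule: finite_induct)
  case empty
  then have "I \<noteq> {}" by auto
  then show ?case by (intro exI[of _ "\<lambda>_. 1"]) auto
next
  case (insert s S)
  show ?case
  proof (cases "\<forall>i\<in>I. c i s = 0")
    case True
    then show ?thesis using insert.IH[of I c] insert.prems insert.hyps by auto
  next
    case False
    then obtain j where j: "j \<in> I" "c j s \<noteq> 0" by blast
    define d where "d i t = c i t - c i s / c j s * c j t" for i t
    have "card S < card (I - {j})" using insert j by auto
    then obtain l where l: "\<exists>i\<in>I - {j}. l i \<noteq> 0" "\<forall>t\<in>S. (\<Sum>i\<in>I - {j}. l i * d i t) = 0"
      using insert.IH[of "I - {j}" d] insert.prems by auto
    define lj where "lj = - (\<Sum>i\<in>I - {j}. l i * c i s) / c j s"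
    define l' where "l' = l(j := lj)"
    have sum: "(\<Sum>i\<in>I. l' i * c i t) = lj * c j t + (\<Sum>i\<in>I - {j}. l i * c i t)" for t
      using j insert.prems(1) by (subst sum.remove[of _ j]) (auto simp: l'_def intro!: sum.cong)
    have "(\<Sum>i\<in>I. l' i * c i t) = 0" if t: "t \<in> S" for t
    proof -
      have "(\<Sum>i\<in>I - {j}. l i * c i t) = (\<Sum>i\<in>I - {j}. l i * d i t) + (\<Sum>i\<in>I - {j}. l i * c i s / c j s * c j t)"
        by (simp add: d_def sum.distrib[symmetric] algebra_simps)
      also have "\<dots> = - lj * c j t"
        using l(2) t j by (simp add: lj_def sum_distrib_right[symmetric] sum_divide_distrib[symmetric])
      finally show ?thesis unfolding sum by simp
    qed
    moreover have "(\<Sum>i\<in>I. l' i * c i s) = 0" unfolding sum lj_def using j by simp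
    moreover have "\<exists>i\<in>I. l' i \<noteq> 0" using l(1) by (auto simp: l'_def)
    ultimately show ?thesis by blast
  qed
qed

lemma interpolation_polynomial:
  fixes g :: "complex \<Rightarrow> complex"
  assumes "finite Z" shows "\<exists>p. \<forall>z\<in>Z. poly p z = g z"
  using assms
proof (induction Z rule: finite_induct)
  case (insert w Z)
  then obtain p where p: "\<forall>z\<in>Z. poly p z = g z" by blast
  define m where "m = (\<Prod>z\<in>Z. [:-z, 1:])"
  have m: "poly m z = (\<Prod>y\<in>Z. z - y)" for z by (simp add: m_def poly_prod)
  have "poly m w \<noteq> 0" using insert unfolding m by auto
  moreover have "poly m z = 0" if "z \<in> Z" for z using that insert(1) unfolding m by auto
  ultimately have "\<forall>z\<in>insert w Z. poly (p + smult ((g w - poly p w) / poly m w) m) z = g z"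
    using p by auto
  then show ?case by blast
qed auto

context cstar_algebra
begin

lemma finsum_scale:
  assumes "finite I" "\<And>i. i \<in> I \<Longrightarrow> x i \<in> carrier A"
  shows "c \<odot> (\<Oplus>i\<in>I. x i) = (\<Oplus>i\<in>I. c \<odot> x i)"
  using assms
proof (induction I rule: finite_induct)
  case (insert i I)
  then have "x \<in> insert i I \<rightarrow> carrier A" "(\<lambda>i. c \<odot> x i) \<in> I \<rightarrow> carrier A" by (auto simp: scale_closed)
  then show ?case using insert by (simp add: finsum_insert scale_add_right finsum_closed scale_closed Pi_def)
qed (simp add: scale_zero_right)

lemma finsum_adj:
  assumes "finite I" "\<And>i. i \<in> I \<Longrightarrow> x i \<in> carrier A"
  shows "adj A (\<Oplus>i\<in>I. x i) = (\<Oplus>i\<in>I. adj A (x i))"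
  using assms
proof (induction I rule: finite_induct)
  case (insert i I)
  then have "x \<in> insert i I \<rightarrow> carrier A" "(\<lambda>i. adj A (x i)) \<in> I \<rightarrow> carrier A" by (auto simp: adj_closed)
  then show ?case using insert by (simp add: finsum_insert adj_add finsum_closed adj_closed Pi_def)
qed (simp add: adj_zero)

lemma linear_functional_zero: "linear_functional A f \<Longrightarrow> f \<zero> = 0"
  unfolding linear_functional_def by (metis mult_zero_left scale_zero_left zero_closed)

lemma linear_functional_minus:
  "linear_functional A f \<Longrightarrow> x \<in> carrier A \<Longrightarrow> y \<in> carrier A \<Longrightarrow> f (x \<ominus> y) = f x - f y"
  by (simp add: minus_scale linear_functional_def scale_closed)

lemma linear_functional_finsum:
  assumes f: "linear_functional A f" and "finite I" "\<And>i. i \<in> I \<Longrightarrow> x i \<in> carrier A"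
  shows "f (\<Oplus>i\<in>I. x i) = (\<Sum>i\<in>I. f (x i))"
  using assms(2,3)
proof (induction I rule: finite_induct)
  case (insert i I)
  then show ?case using f by (simp add: finsum_insert finsum_closed linear_functional_def Pi_def)
qed (simp add: linear_functional_zero[OF f])

lemma scale_cancel: "x \<in> carrier A \<Longrightarrow> x \<noteq> \<zero> \<Longrightarrow> c \<odot> x = d \<odot> x \<Longrightarrow> c = d"
proof -
  assume x: "x \<in> carrier A" "x \<noteq> \<zero>" and eq: "c \<odot> x = d \<odot> x"
  have "(c - d) \<odot> x = c \<odot> x \<oplus> (-d) \<odot> x" using scale_add_left[of x c "-d"] x by simp
  also have "\<dots> = (d + (-d)) \<odot> x" unfolding eq by (simp only: scale_add_left x)
  finally have "nrm A ((c - d) \<odot> x) = 0" using x by (simp add: scale_zero_left nrm_zero)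
  then show "c = d" using x nrm_eq_0[of x] by (simp add: nrm_scale)
qed

lemma scale_eq_zero: "x \<in> carrier A \<Longrightarrow> c \<odot> x = \<zero> \<Longrightarrow> c = 0 \<or> x = \<zero>"
  using scale_cancel[of x c 0] by (auto simp: scale_zero_left)

lemma finsum_linear_combination:
  assumes "finite I" "finite S" "S \<subseteq> carrier A"
  shows "(\<Oplus>i\<in>I. l i \<odot> (\<Oplus>s\<in>S. c i s \<odot> s)) = (\<Oplus>s\<in>S. (\<Sum>i\<in>I. l i * c i s) \<odot> s)"
  using assms(1)
proof (induction I rule: finite_induct)
  case empty
  have "(\<Oplus>s\<in>S. 0 \<odot> s) = (\<Oplus>s\<in>S. \<zero>)"
    using assms by (intro finsum_cong') (auto simp: scale_zero_left)
  then show ?case by simp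
next
  case (insert i I)
  have cl: "(\<Oplus>s\<in>S. c j s \<odot> s) \<in> carrier A" for j using assms by (intro finsum_closed) (auto simp: scale_closed)
  have "(\<Oplus>i\<in>insert i I. l i \<odot> (\<Oplus>s\<in>S. c i s \<odot> s))
     = l i \<odot> (\<Oplus>s\<in>S. c i s \<odot> s) \<oplus> (\<Oplus>s\<in>S. (\<Sum>i\<in>I. l i * c i s) \<odot> s)"
    using insert cl by (subst finsum_insert) (auto simp: scale_closed)
  also have "l i \<odot> (\<Oplus>s\<in>S. c i s \<odot> s) = (\<Oplus>s\<in>S. (l i * c i s) \<odot> s)"
    using assms by (subst finsum_scale) (auto simp: scale_closed scale_scale intro!: finsum_cong')
  also have "\<dots> \<oplus> (\<Oplus>s\<in>S. (\<Sum>i\<in>I. l i * c i s) \<odot> s) = (\<Oplus>s\<in>S. (l i * c i s) \<odot> s \<oplus> (\<Sum>i\<in>I. l i * c i s) \<odot> s)"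
    using assms by (subst finsum_addf) (auto simp: scale_closed)
  also have "\<dots> = (\<Oplus>s\<in>S. (\<Sum>i\<in>insert i I. l i * c i s) \<odot> s)"
    using insert assms by (intro finsum_cong') (auto simp: scale_closed scale_add_left)
  finally show ?case .
qed

lemma poly_eval_extend:
  assumes a: "a \<in> carrier A" and N: "degree p \<le> N"
  shows "poly_eval A p a = (\<Oplus>k\<in>{..N}. coeff p k \<odot> (a [^] k))"
  unfolding poly_eval_def
  by (rule add.finprod_mono_neutral_cong_left)
     (use a N in \<open>auto simp: scale_closed coeff_eq_0 scale_zero_left\<close>)

lemma poly_eval_closed: "a \<in> carrier A \<Longrightarrow> poly_eval A p a \<in> carrier A"
  unfolding poly_eval_def by (intro finsum_closed) (auto simp: scale_closed)

lemma poly_eval_pCons: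
  assumes a: "a \<in> carrier A"
  shows "poly_eval A (pCons c p) a = c \<odot> \<one> \<oplus> a \<otimes> poly_eval A p a"
proof -
  have "poly_eval A (pCons c p) a = (\<Oplus>k\<in>{..Suc (degree p)}. coeff (pCons c p) k \<odot> (a [^] k))"
    using a by (intro poly_eval_extend) (auto simp: degree_pCons_le)
  also have "\<dots> = (\<Oplus>k\<in>{..degree p}. coeff (pCons c p) (Suc k) \<odot> (a [^] Suc k)) \<oplus> coeff (pCons c p) 0 \<odot> (a [^] (0::nat))"
    using a by (intro finsum_Suc2) (auto simp: scale_closed)
  also have "(\<Oplus>k\<in>{..degree p}. coeff (pCons c p) (Suc k) \<odot> (a [^] Suc k)) = (\<Oplus>k\<in>{..degree p}. a \<otimes> (coeff p k \<odot> (a [^] k)))"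
  proof (intro finsum_cong')
    fix k
    have "a [^] Suc k = a \<otimes> (a [^] k)" using a by (rule nat_pow_Suc2)
    then show "coeff (pCons c p) (Suc k) \<odot> (a [^] Suc k) = a \<otimes> (coeff p k \<odot> (a [^] k))"
      using a by (simp only: scale_mult_right nat_pow_closed coeff_pCons_Suc)
  qed (use a in \<open>auto simp: scale_closed\<close>)
  also have "\<dots> = a \<otimes> poly_eval A p a"
    unfolding poly_eval_def using a by (intro finsum_rdistr[symmetric]) (auto simp: scale_closed)
  finally show ?thesis using a poly_eval_closed[OF a] by (simp add: a_comm scale_closed)
qed

lemma poly_eval_0: "a \<in> carrier A \<Longrightarrow> poly_eval A 0 a = \<zero>"
  unfolding poly_eval_def by (simp add: scale_zero_left)

lemma poly_eval_commutes:
  assumes [simp]: "a \<in> carrier A" "z \<in> carrier A" and "commutes z a"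
  shows "commutes z (poly_eval A p a)"
proof (induction p)
  case 0 show ?case by (simp add: poly_eval_0 commutes_def)
next
  case (pCons c p)
  then show ?case using assms
    by (simp add: poly_eval_pCons poly_eval_closed commutes_add commutes_mult commutes_scale commutes_one scale_closed)
qed

lemma poly_eval_smult:
  assumes [simp]: "a \<in> carrier A"
  shows "poly_eval A (smult c p) a = c \<odot> poly_eval A p a"
proof (induction p)
  case 0 show ?case by (simp add: poly_eval_0 scale_zero_right)
next
  case (pCons d p)
  then show ?case
    by (simp add: poly_eval_pCons poly_eval_closed scale_closed scale_add_right scale_scale scale_mult_right)
qed

lemma poly_eval_add:
  assumes [simp]: "a \<in> carrier A"
  shows "poly_eval A (p + q) a = poly_eval A p a \<oplus> poly_eval A q a"
proof -
  let ?N = "max (degree p) (degree q)"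
  have "degree (p + q) \<le> ?N" by (rule degree_add_le_max)
  then have "poly_eval A (p + q) a = (\<Oplus>k\<in>{..?N}. coeff p k \<odot> (a [^] k) \<oplus> coeff q k \<odot> (a [^] k))"
    by (subst poly_eval_extend[where N="?N"]) (auto simp: scale_add_left scale_closed intro!: finsum_cong')
  also have "\<dots> = poly_eval A p a \<oplus> poly_eval A q a"
    by (subst (1 2) poly_eval_extend[where N="?N"]) (auto simp: finsum_addf scale_closed)
  finally show ?thesis .
qed

lemma poly_eval_linear_factor:
  assumes [simp]: "a \<in> carrier A"
  shows "poly_eval A ([:-\<alpha>, 1:] * p) a = (a \<otimes> poly_eval A p a) \<oplus> (-\<alpha>) \<odot> poly_eval A p a"
proof -
  have "[:-\<alpha>, 1:] * p = pCons 0 p + smult (-\<alpha>) p" by simp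
  then show ?thesis
    by (simp only: poly_eval_add[OF assms] poly_eval_smult[OF assms])
       (simp add: poly_eval_pCons poly_eval_closed scale_zero_left)
qed

lemma poly_eval_eigen:
  assumes [simp]: "a \<in> carrier A" "c \<in> carrier A" and eig: "a \<otimes> c = \<alpha> \<odot> c"
  shows "poly_eval A p a \<otimes> c = poly p \<alpha> \<odot> c"
proof (induction p)
  case 0 show ?case by (simp add: poly_eval_0 scale_zero_left)
next
  case (pCons d p)
  have "poly_eval A (pCons d p) a \<otimes> c = d \<odot> c \<oplus> a \<otimes> (poly_eval A p a \<otimes> c)"
    by (simp add: poly_eval_pCons poly_eval_closed l_distr m_assoc scale_closed scale_mult_left)
  also have "\<dots> = d \<odot> c \<oplus> (poly p \<alpha> * \<alpha>) \<odot> c" unfolding pCons by (simp add: scale_mult_right eig scale_scale)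
  finally show ?case by (simp add: scale_add_left mult.commute)
qed

lemma poly_eval_adj_eigen:
  assumes [simp]: "selfadj a" "c \<in> carrier A" and eig: "a \<otimes> c = \<alpha> \<odot> c"
  shows "adj A (poly_eval A p a) \<otimes> c = cnj (poly p (cnj \<alpha>)) \<odot> c"
proof (induction p)
  case 0 show ?case by (simp add: poly_eval_0 scale_zero_left adj_zero selfadjD(1)[OF assms(1)])
next
  case (pCons d p)
  note [simp] = selfadjD[OF assms(1)]
  have "adj A (poly_eval A (pCons d p) a) \<otimes> c = cnj d \<odot> c \<oplus> adj A (poly_eval A p a) \<otimes> (a \<otimes> c)"
    by (simp add: poly_eval_pCons poly_eval_closed l_distr m_assoc scale_closed scale_mult_left adj_add adj_mult adj_scale adj_one adj_closed)
  also have "\<dots> = cnj d \<odot> c \<oplus> (\<alpha> * cnj (poly p (cnj \<alpha>))) \<odot> c" unfolding eig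
    by (simp add: scale_mult_right pCons scale_scale adj_closed poly_eval_closed)
  finally show ?case by (simp add: scale_add_left mult.commute)
qed

lemma projectionD:
  "projection A p \<Longrightarrow> p \<in> carrier A" "projection A p \<Longrightarrow> adj A p = p" "projection A p \<Longrightarrow> p \<otimes> p = p"
  by (auto simp: projection_def)

lemma projection_positive: "projection A p \<Longrightarrow> positive p"
  unfolding positive_def by (metis projectionD)

lemma projection_complement: "projection A p \<Longrightarrow> projection A (\<one> \<ominus> p)"
  unfolding projection_def
  by (auto simp: adj_minus adj_one mult_minus_left mult_minus_right) (simp add: a_minus_def r_neg)

end

locale fd_cstar = cstar_algebra +
  assumes fd: "finite_dimensional A"
begin

definition dim_bound :: nat where
  "dim_bound = (SOME N. \<exists>S. finite S \<and> card S = N \<and> S \<subseteq> carrier A \<and>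
        (\<forall>x\<in>carrier A. \<exists>c. x = (\<Oplus>s\<in>S. c s \<odot> s)))"

lemma dependent:
  assumes I: "finite I" "card I > dim_bound" and x: "\<And>i. i \<in> I \<Longrightarrow> x i \<in> carrier A"
  shows "\<exists>l. (\<exists>i\<in>I. l i \<noteq> 0) \<and> (\<Oplus>i\<in>I. l i \<odot> x i) = \<zero>"
proof -
  have "\<exists>N. \<exists>S. finite S \<and> card S = N \<and> S \<subseteq> carrier A \<and> (\<forall>x\<in>carrier A. \<exists>c. x = (\<Oplus>s\<in>S. c s \<odot> s))"
    using fd unfolding finite_dimensional_def by blast
  from someI_ex[OF this] obtain S where S: "finite S" "card S = dim_bound" "S \<subseteq> carrier A"
    "\<forall>x\<in>carrier A. \<exists>c. x = (\<Oplus>s\<in>S. c s \<odot> s)" unfolding dim_bound_def[symmetric] by blast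
  have "\<forall>i\<in>I. \<exists>c. x i = (\<Oplus>s\<in>S. c s \<odot> s)" using S(4) x by blast
  then obtain c where c: "\<And>i. i \<in> I \<Longrightarrow> x i = (\<Oplus>s\<in>S. c i s \<odot> s)" by metis
  obtain l where l: "\<exists>i\<in>I. l i \<noteq> 0" "\<forall>s\<in>S. (\<Sum>i\<in>I. l i * c i s) = 0"
    using nontrivial_relation[of S I c] S I by auto
  have cl: "(\<Oplus>s\<in>S. c i s \<odot> s) \<in> carrier A" for i using S by (intro finsum_closed) (auto simp: scale_closed)
  have "(\<Oplus>i\<in>I. l i \<odot> x i) = (\<Oplus>i\<in>I. l i \<odot> (\<Oplus>s\<in>S. c i s \<odot> s))"
    using c cl by (intro finsum_cong') (auto simp: scale_closed)
  also have "\<dots> = (\<Oplus>s\<in>S. (\<Sum>i\<in>I. l i * c i s) \<odot> s)" by (rule finsum_linear_combination[OF I(1) S(1,3)])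
  also have "\<dots> = (\<Oplus>s\<in>S. \<zero>)" using l(2) S(3) by (intro finsum_cong') (auto simp: scale_zero_left)
  finally show ?thesis using l(1) by auto
qed

text \<open>Choose p of least degree with p(a) e = 0 and split off a linear factor, p = (X - \<alpha>) p'. Then c = p'(a) e is
nonzero with a c = \<alpha> c. Because c is a polynomial in a times e, multiplication by c* acts on c as a scalar,
so c* c is a multiple of c and of its own square, and it becomes a projection after scaling.\<close>

lemma eigenprojection:
  assumes a: "selfadj a" and e: "projection A e" "e \<noteq> \<zero>" and ae: "commutes e a"
  obtains q \<alpha> where "projection A q" "q \<noteq> \<zero>" "e \<otimes> q = q" "a \<otimes> q = complex_of_real \<alpha> \<odot> q"
proof -
  note [simp] = selfadjD[OF a] projectionD[OF e(1)] scale_closed poly_eval_closed adj_closed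
  let ?Q = "\<lambda>p. p \<noteq> 0 \<and> poly_eval A p a \<otimes> e = \<zero>"
  \<comment> \<open>More powers of a than the dimension allows are linearly dependent.\<close>
  have "\<exists>p. ?Q p"
  proof -
    obtain l where l: "\<exists>i\<in>{..dim_bound}. l i \<noteq> 0" "(\<Oplus>i\<in>{..dim_bound}. l i \<odot> (a [^] i \<otimes> e)) = \<zero>"
      using dependent[of "{..dim_bound}" "\<lambda>i. a [^] i \<otimes> e"] by auto
    define p where "p = (\<Sum>i\<le>dim_bound. monom (l i) i)"
    have cf: "coeff p k = (if k \<le> dim_bound then l k else 0)" for k
      by (simp add: p_def coeff_sum coeff_monom)
    have "poly_eval A p a = (\<Oplus>k\<in>{..dim_bound}. coeff p k \<odot> (a [^] k))"
      by (intro poly_eval_extend) (auto simp: cf intro!: degree_le)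
    then have "poly_eval A p a \<otimes> e = (\<Oplus>k\<in>{..dim_bound}. (coeff p k \<odot> (a [^] k)) \<otimes> e)"
      by (simp add: finsum_ldistr)
    also have "\<dots> = (\<Oplus>i\<in>{..dim_bound}. l i \<odot> (a [^] i \<otimes> e))"
      by (intro finsum_cong') (auto simp: cf scale_mult_left)
    finally have "poly_eval A p a \<otimes> e = \<zero>" using l(2) by simp
    moreover have "p \<noteq> 0" using l(1) cf by (metis atMost_iff coeff_0)
    ultimately show ?thesis by blast
  qed
  then obtain p where p: "?Q p" "\<And>p'. ?Q p' \<Longrightarrow> degree p \<le> degree p'"
    using ex_has_least_nat[of ?Q _ degree] by blast
  have "degree p \<noteq> 0"
  proof
    assume "degree p = 0"
    then obtain k where k: "p = [:k:]" by (rule degree_eq_zeroE)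
    then have "k \<odot> e = \<zero>" using p(1) by (simp add: poly_eval_pCons poly_eval_0 scale_mult_left)
    then show False using scale_eq_zero[of e k] e p(1) k by simp
  qed
  then obtain \<alpha> where "poly p \<alpha> = 0"
    using fundamental_theorem_of_algebra[of p] constant_degree[of p] by auto
  then obtain p' where p': "p = [:-\<alpha>, 1:] * p'" using poly_eq_0_iff_dvd by (metis dvdE)
  have p'0: "p' \<noteq> 0" using p(1) p' by auto
  then have "degree p = Suc (degree p')" unfolding p' by (subst degree_mult_eq) auto
  then have c0: "poly_eval A p' a \<otimes> e \<noteq> \<zero>" using p(2)[of p'] p'0 by auto
  define c where "c = poly_eval A p' a \<otimes> e"
  have cc[simp]: "c \<in> carrier A" by (simp add: c_def)
  have ec: "e \<otimes> c = c"
  proof -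
    have "e \<otimes> c = (e \<otimes> poly_eval A p' a) \<otimes> e" by (simp add: c_def m_assoc)
    also have "e \<otimes> poly_eval A p' a = poly_eval A p' a \<otimes> e"
      using poly_eval_commutes[of a e p'] ae by (simp add: commutes_def)
    finally show ?thesis by (simp add: c_def m_assoc)
  qed
  have ac: "a \<otimes> c = \<alpha> \<odot> c"
  proof -
    have "a \<otimes> c \<oplus> (-\<alpha>) \<odot> c = \<zero>"
      using p(1) unfolding p' poly_eval_linear_factor[OF selfadjD(1)[OF a]] c_def
      by (simp add: l_distr m_assoc scale_mult_left)
    moreover have "\<alpha> \<odot> c \<oplus> (-\<alpha>) \<odot> c = \<zero>" using scale_add_left[of c \<alpha> "-\<alpha>"] by (simp add: scale_zero_left)
    ultimately show ?thesis by (metis add.right_cancel cc scale_closed m_closed selfadjD(1)[OF a])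
  qed
  define \<beta> where "\<beta> = cnj (poly p' (cnj \<alpha>))"
  define d where "d = adj A c \<otimes> c"
  have dsa: "selfadj d" unfolding d_def by (rule selfadj_adj_mult) simp
  note [simp] = selfadjD[OF dsa]
  have d0: "d \<noteq> \<zero>" using adj_mult_self_zero[OF cc] c0 unfolding d_def c_def by blast
  have dc: "d = \<beta> \<odot> c"
  proof -
    have "d = e \<otimes> (adj A (poly_eval A p' a) \<otimes> c)"
      unfolding d_def by (subst (1) c_def) (simp add: adj_mult m_assoc)
    also have "\<dots> = \<beta> \<odot> c" by (simp add: poly_eval_adj_eigen[OF a cc ac] \<beta>_def scale_mult_right ec)
    finally show ?thesis .
  qed
  define \<gamma> where "\<gamma> = poly p' \<alpha>"
  have cc2: "c \<otimes> c = \<gamma> \<odot> c"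
  proof -
    have "c \<otimes> c = poly_eval A p' a \<otimes> (e \<otimes> c)" by (subst (1) c_def) (simp add: m_assoc)
    then show ?thesis unfolding ec using poly_eval_eigen[of a c \<alpha> p'] ac by (simp add: \<gamma>_def)
  qed
  have ad: "a \<otimes> d = \<alpha> \<odot> d" unfolding dc by (simp add: scale_mult_right ac scale_scale mult.commute)
  have real: "\<alpha> = cnj \<alpha>"
  proof -
    have "adj A (a \<otimes> c) \<otimes> c = adj A c \<otimes> (a \<otimes> c)" by (simp add: adj_mult m_assoc)
    then have "cnj \<alpha> \<odot> d = \<alpha> \<odot> d" unfolding ac by (simp add: adj_scale scale_mult_left scale_mult_right d_def)
    then show ?thesis using scale_cancel[of d] d0 by auto
  qed
  define \<kappa> where "\<kappa> = \<beta> * \<gamma>"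
  have dd: "d \<otimes> d = \<kappa> \<odot> d"
    unfolding dc by (simp add: scale_mult_left scale_mult_right scale_scale cc2 \<kappa>_def mult_ac)
  \<comment> \<open>d is self-adjoint and nonzero, so its square is nonzero.\<close>
  have k0: "\<kappa> \<noteq> 0" using dd selfadj_square_zero[OF dsa] d0 by (metis scale_zero_left selfadjD(1)[OF dsa])
  have kr: "cnj \<kappa> = \<kappa>"
  proof -
    have "cnj \<kappa> \<odot> d = adj A (d \<otimes> d)" unfolding dd by (simp add: adj_scale)
    also have "\<dots> = \<kappa> \<odot> d" by (subst adj_mult) (simp_all add: dd)
    finally show ?thesis using scale_cancel[of d] d0 by auto
  qed
  define q where "q = (1/\<kappa>) \<odot> d"
  have "projection A q" unfolding projection_def q_def using k0 kr
    by (simp add: adj_scale scale_mult_left scale_mult_right dd scale_scale)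
  moreover have "q \<noteq> \<zero>" using scale_eq_zero[of d "1/\<kappa>"] k0 d0 by (auto simp: q_def)
  moreover have "e \<otimes> q = q" unfolding q_def dc by (simp add: scale_mult_right ec)
  moreover have "a \<otimes> q = \<alpha> \<odot> q" unfolding q_def by (simp add: scale_mult_right ad scale_scale mult.commute)
  moreover have "\<alpha> = complex_of_real (Re \<alpha>)" using real by (metis Reals_cnj_iff of_real_Re)
  ultimately show ?thesis using that[of q "Re \<alpha>"] by simp
qed

end

section \<open>Spectral resolutions and the trace in finite dimension\<close>

context fd_cstar
begin

text \<open>A decomposition of 1 into nonzero orthogonal projections that commute with a.\<close>

definition resolution :: "'a \<Rightarrow> 'a set \<Rightarrow> bool" where
  "resolution a E \<longleftrightarrow> finite E \<and> (\<forall>e\<in>E. projection A e \<and> e \<noteq> \<zero> \<and> commutes e a) \<and>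
     (\<forall>e\<in>E. \<forall>f\<in>E. e \<noteq> f \<longrightarrow> e \<otimes> f = \<zero>) \<and> (\<Oplus>e\<in>E. e) = \<one>"

lemma resolution_card: assumes "resolution a E" shows "card E \<le> dim_bound"
proof (rule ccontr)
  assume "\<not> card E \<le> dim_bound"
  moreover have E: "finite E" "\<And>e. e \<in> E \<Longrightarrow> projection A e" "\<And>e. e \<in> E \<Longrightarrow> e \<noteq> \<zero>"
    "\<And>e f. e \<in> E \<Longrightarrow> f \<in> E \<Longrightarrow> e \<noteq> f \<Longrightarrow> e \<otimes> f = \<zero>" using assms by (auto simp: resolution_def)
  ultimately obtain l where l: "\<exists>i\<in>E. l i \<noteq> 0" "(\<Oplus>i\<in>E. l i \<odot> i) = \<zero>"
    using dependent[of E "\<lambda>x. x"] projectionD by auto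
  then obtain e where e: "e \<in> E" "l e \<noteq> 0" by blast
  have ec: "e \<in> carrier A" using E(2)[OF e(1)] by (rule projectionD)
  have "\<zero> = e \<otimes> (\<Oplus>i\<in>E. l i \<odot> i)" using ec l by simp
  also have "\<dots> = (\<Oplus>i\<in>E. e \<otimes> (l i \<odot> i))"
    using E ec projectionD(1) by (intro finsum_rdistr) (auto simp: scale_closed)
  also have "\<dots> = (\<Oplus>i\<in>E. if e = i then l e \<odot> e else \<zero>)"
    using E e ec projectionD by (intro finsum_cong') (auto simp: scale_closed scale_mult_right scale_zero_right)
  also have "\<dots> = l e \<odot> e" using E(1) e(1) ec by (subst finsum_singleton) (auto simp: scale_closed)
  finally show False using scale_eq_zero[OF ec] e(2) E(3)[OF e(1)] by metis
qed

lemma resolution_one: "\<exists>E. resolution a E" if "a \<in> carrier A"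
proof (cases "\<one> = \<zero>")
  case True
  then show ?thesis by (intro exI[of _ "{}"]) (simp add: resolution_def)
next
  case False
  then show ?thesis using that
    by (intro exI[of _ "{\<one>}"]) (auto simp: resolution_def projection_def adj_one commutes_def)
qed

text \<open>A projection strictly below e yields a finer resolution: replace e by q and e - q.\<close>

lemma resolution_split:
  assumes R: "resolution a E" and a: "a \<in> carrier A" and e: "e \<in> E"
    and q: "projection A q" "q \<noteq> \<zero>" "q \<noteq> e" "e \<otimes> q = q" "commutes q a"
  shows "\<exists>E'. resolution a E' \<and> card E' > card E"
proof -
  have E: "finite E" "\<And>e. e \<in> E \<Longrightarrow> projection A e" "\<And>e. e \<in> E \<Longrightarrow> e \<noteq> \<zero>" "\<And>e. e \<in> E \<Longrightarrow> commutes e a"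
    "\<And>e f. e \<in> E \<Longrightarrow> f \<in> E \<Longrightarrow> e \<noteq> f \<Longrightarrow> e \<otimes> f = \<zero>" "(\<Oplus>e\<in>E. e) = \<one>"
    using R by (auto simp: resolution_def)
  note [simp] = a projectionD[OF q(1)] projectionD[OF E(2)[OF e]]
  have Ec: "f \<in> E \<Longrightarrow> f \<in> carrier A" for f using E(2) projectionD by blast
  have qe: "q \<otimes> e = q"
  proof -
    have "adj A (e \<otimes> q) = q \<otimes> e" by (simp add: adj_mult)
    then show ?thesis using q(4) by simp
  qed
  define r where "r = e \<ominus> q"
  have rc[simp]: "r \<in> carrier A" by (simp add: r_def)
  have rp: "projection A r" unfolding projection_def r_def
    by (simp add: adj_minus mult_minus_left mult_minus_right qe q(4)) (simp add: a_minus_def r_neg)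
  have r0: "r \<noteq> \<zero>" using q(3) unfolding r_def by (metis minus_eq_zeroD projectionD(1) E(2) e q(1))
  have qr: "q \<otimes> r = \<zero>" "r \<otimes> q = \<zero>" unfolding r_def
    by (simp_all add: mult_minus_left mult_minus_right qe q(4)) (simp_all add: a_minus_def r_neg)
  have qf: "q \<otimes> f = \<zero>" "f \<otimes> q = \<zero>" if f: "f \<in> E - {e}" for f
  proof -
    have fe: "e \<otimes> f = \<zero>" "f \<otimes> e = \<zero>" using f E(5)[of e f] E(5)[of f e] e by auto
    have "q \<otimes> f = q \<otimes> (e \<otimes> f)" using qe f Ec by (metis DiffD1 m_assoc projectionD(1) E(2) e q(1))
    then show "q \<otimes> f = \<zero>" using fe by simp
    have "f \<otimes> q = (f \<otimes> e) \<otimes> q" using q(4) f Ec[of f] by (simp add: m_assoc)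
    then show "f \<otimes> q = \<zero>" using fe by simp
  qed
  have rf: "r \<otimes> f = \<zero>" "f \<otimes> r = \<zero>" if f: "f \<in> E - {e}" for f
  proof -
    have fe: "e \<otimes> f = \<zero>" "f \<otimes> e = \<zero>" using f E(5)[of e f] E(5)[of f e] e by auto
    show "r \<otimes> f = \<zero>" "f \<otimes> r = \<zero>" unfolding r_def using f Ec[of f]
      by (simp_all add: mult_minus_left mult_minus_right fe qf[OF f]) (simp_all add: a_minus_def)
  qed
  have nin: "q \<notin> E - {e}" "r \<notin> E - {e}" "q \<noteq> r"
    using qf[of q] rf[of r] qr q(2) r0 projectionD(3)[OF rp] projectionD(3)[OF q(1)] by metis+
  let ?E = "insert q (insert r (E - {e}))"
  have "card ?E = Suc (Suc (card (E - {e})))" using nin E(1) by simp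
  moreover have "card E = Suc (card (E - {e}))" using E(1) e by (metis card.remove)
  ultimately have "card ?E > card E" by simp
  moreover have "resolution a ?E" unfolding resolution_def
  proof (intro conjI ballI impI)
    show "finite ?E" using E(1) by simp
    fix f assume f: "f \<in> ?E"
    then show "projection A f" "f \<noteq> \<zero>" using E rp q r0 by auto
    have "commutes r a" unfolding r_def
      using E(4)[OF e] q(5) by (intro commutes_sym[OF commutes_minus]) (auto intro: commutes_sym)
    then show "commutes f a" using f E(4) q(5) by auto
    fix g assume g: "g \<in> ?E" and fg: "f \<noteq> g"
    show "f \<otimes> g = \<zero>" using f g fg qf rf qr E(5) by auto
  next
    have "(\<Oplus>e\<in>?E. e) = q \<oplus> (r \<oplus> (\<Oplus>e\<in>E-{e}. e))"
      using nin E(1) Ec by (subst finsum_insert, simp, simp, force, force, subst finsum_insert) auto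
    also have "\<dots> = (q \<oplus> r) \<oplus> (\<Oplus>e\<in>E-{e}. e)" using Ec by (subst a_assoc) (auto intro!: finsum_closed)
    also have "q \<oplus> r = e" unfolding r_def by (simp add: a_minus_def a_lcomm r_neg)
    also have "e \<oplus> (\<Oplus>e\<in>E-{e}. e) = (\<Oplus>e\<in>insert e (E-{e}). e)"
      using E(1) Ec e by (subst finsum_insert) auto
    also have "insert e (E - {e}) = E" using e by auto
    finally show "(\<Oplus>e\<in>?E. e) = \<one>" using E(6) by simp
  qed
  ultimately show ?thesis by blast
qed

text \<open>A resolution with as many members as possible cannot be split. By eigenprojection its members are
then eigenprojections of a. A projection q below such a member e satisfies a q = \<alpha> q, so it commutes with a
and would also split the resolution; hence e is minimal in the whole algebra.\<close>

theorem spectral_resolution: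
  assumes a: "selfadj a"
  obtains E \<alpha> where "resolution a E" "\<And>e. e \<in> E \<Longrightarrow> minimal_projection A e"
    "\<And>e. e \<in> E \<Longrightarrow> a \<otimes> e = complex_of_real (\<alpha> e) \<odot> e"
proof -
  have ac[simp]: "a \<in> carrier A" using a by (rule selfadjD)
  obtain E where E: "resolution a E" "\<And>E'. resolution a E' \<Longrightarrow> card E' \<le> card E"
    using ex_has_greatest_nat[of "resolution a" _ card "Suc dim_bound"] resolution_one[OF ac] resolution_card
    by (metis less_Suc_eq_le)
  \<comment> \<open>by maximality of E\<close>
  have nosplit: "q = e" if "e \<in> E" "projection A q" "q \<noteq> \<zero>" "e \<otimes> q = q" "commutes q a" for e q
    using resolution_split[OF E(1) ac that(1,2,3) _ that(4,5)] E(2) by (metis linorder_not_less)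
  have scal: "\<exists>\<alpha>. a \<otimes> e = complex_of_real \<alpha> \<odot> e" if e: "e \<in> E" for e
  proof -
    have ep: "projection A e" "e \<noteq> \<zero>" "commutes e a" using E(1) e by (auto simp: resolution_def)
    obtain q \<alpha> where q: "projection A q" "q \<noteq> \<zero>" "e \<otimes> q = q" "a \<otimes> q = complex_of_real \<alpha> \<odot> q"
      using eigenprojection[OF a ep] by blast
    have "adj A (a \<otimes> q) = q \<otimes> a" using projectionD[OF q(1)] selfadjD[OF a] by (subst adj_mult) simp_all
    moreover have "adj A (a \<otimes> q) = complex_of_real \<alpha> \<odot> q" unfolding q(4) using q(1) by (simp add: adj_scale projectionD)
    ultimately have "commutes q a" using q(4) by (simp add: commutes_def)
    then have "q = e" using nosplit e q by blast
    then show ?thesis using q by blast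
  qed
  then obtain \<alpha> where \<alpha>: "\<And>e. e \<in> E \<Longrightarrow> a \<otimes> e = complex_of_real (\<alpha> e) \<odot> e" by metis
  have "minimal_projection A e" if e: "e \<in> E" for e
  proof -
    have ep: "projection A e" "e \<noteq> \<zero>" "commutes e a" using E(1) e by (auto simp: resolution_def)
    have "q = \<zero> \<or> q = e" if q: "projection A q" "e \<otimes> q = q" for q
    proof -
      note [simp] = projectionD[OF ep(1)] projectionD[OF q(1)]
      have "a \<otimes> q = (a \<otimes> e) \<otimes> q" using q(2) by (simp add: m_assoc)
      also have "\<dots> = complex_of_real (\<alpha> e) \<odot> q" unfolding \<alpha>[OF e] by (simp add: scale_mult_left q(2))
      finally have aq: "a \<otimes> q = complex_of_real (\<alpha> e) \<odot> q" .
      have "adj A (a \<otimes> q) = q \<otimes> a" using selfadjD[OF a] by (subst adj_mult) simp_all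
      moreover have "adj A (a \<otimes> q) = complex_of_real (\<alpha> e) \<odot> q" unfolding aq by (simp add: adj_scale)
      ultimately have "commutes q a" using aq by (simp add: commutes_def)
      then show ?thesis using nosplit[OF e q(1) _ q(2)] by blast
    qed
    then show ?thesis using ep by (auto simp: minimal_projection_def)
  qed
  then show ?thesis using that E(1) \<alpha> by blast
qed

lemma resolutionD:
  assumes "resolution a E"
  shows "finite E" "\<And>e. e \<in> E \<Longrightarrow> projection A e" "\<And>e. e \<in> E \<Longrightarrow> e \<in> carrier A"
    "\<And>e. e \<in> E \<Longrightarrow> e \<noteq> \<zero>" "\<And>e. e \<in> E \<Longrightarrow> commutes e a" "(\<Oplus>e\<in>E. e) = \<one>"
    "\<And>e f. e \<in> E \<Longrightarrow> f \<in> E \<Longrightarrow> e \<noteq> f \<Longrightarrow> e \<otimes> f = \<zero>"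
  using assms by (auto simp: resolution_def projectionD)

lemma minimal_projectionD:
  "minimal_projection A p \<Longrightarrow> projection A p" "minimal_projection A p \<Longrightarrow> p \<noteq> \<zero>"
  "minimal_projection A p \<Longrightarrow> p \<in> carrier A" "minimal_projection A p \<Longrightarrow> adj A p = p"
  "minimal_projection A p \<Longrightarrow> p \<otimes> p = p"
  by (auto simp: minimal_projection_def projectionD)

lemma resolution_expand:
  assumes R: "resolution a E" and x: "x \<in> carrier A"
  shows "x = (\<Oplus>e\<in>E. x \<otimes> e)"
proof -
  have "x = x \<otimes> (\<Oplus>e\<in>E. e)" using x resolutionD(6)[OF R] by simp
  also have "\<dots> = (\<Oplus>e\<in>E. x \<otimes> e)" using x resolutionD[OF R] by (intro finsum_rdistr) auto
  finally show ?thesis .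
qed

text \<open>The corner algebra of a minimal projection consists of scalars, because every self-adjoint element of it has an
eigenprojection below e, which can only be e.\<close>

lemma minimal_corner:
  assumes e: "minimal_projection A e" and x: "x \<in> carrier A"
  shows "\<exists>c. e \<otimes> x \<otimes> e = c \<odot> e"
proof -
  note [simp] = minimal_projectionD(3,4,5)[OF e]
  have sa: "\<exists>c. e \<otimes> h \<otimes> e = c \<odot> e" if h: "selfadj h" for h
  proof -
    note [simp] = selfadjD[OF h]
    let ?a = "e \<otimes> h \<otimes> e"
    have a: "selfadj ?a" by (simp add: selfadj_def adj_mult m_assoc)
    have ea: "e \<otimes> ?a = ?a" "?a \<otimes> e = ?a"
      by (simp_all add: m_assoc[symmetric]) (simp add: m_assoc)
    obtain q \<alpha> where q: "projection A q" "q \<noteq> \<zero>" "e \<otimes> q = q" "?a \<otimes> q = complex_of_real \<alpha> \<odot> q"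
      using eigenprojection[OF a minimal_projectionD(1,2)[OF e]] ea unfolding commutes_def by metis
    have "q = e" using e q unfolding minimal_projection_def by blast
    then show ?thesis using q(4) ea by auto
  qed
  obtain h k where hk: "selfadj h" "selfadj k" "x = h \<oplus> \<i> \<odot> k" by (rule real_imag_parts[OF x])
  obtain c d where cd: "e \<otimes> h \<otimes> e = c \<odot> e" "e \<otimes> k \<otimes> e = d \<odot> e" using sa hk by metis
  note [simp] = selfadjD[OF hk(1)] selfadjD[OF hk(2)] scale_closed
  have "e \<otimes> x \<otimes> e = e \<otimes> h \<otimes> e \<oplus> \<i> \<odot> (e \<otimes> k \<otimes> e)"
    unfolding hk(3) by (simp add: r_distr l_distr scale_mult_left scale_mult_right)
  also have "\<dots> = (c + \<i> * d) \<odot> e" unfolding cd by (simp add: scale_scale scale_add_left)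
  finally show ?thesis by blast
qed

definition corner :: "'a \<Rightarrow> 'a \<Rightarrow> complex" where
  "corner e x = (THE c. e \<otimes> x \<otimes> e = c \<odot> e)"

lemma corner_eqI:
  assumes e: "minimal_projection A e" and "e \<otimes> x \<otimes> e = c \<odot> e" shows "corner e x = c"
  unfolding corner_def using assms scale_cancel minimal_projectionD[OF e]
  by (intro the_equality) auto

lemma corner: "minimal_projection A e \<Longrightarrow> x \<in> carrier A \<Longrightarrow> e \<otimes> x \<otimes> e = corner e x \<odot> e"
  using minimal_corner corner_eqI by metis

lemma corner_linear:
  assumes e: "minimal_projection A e" shows "linear_functional A (corner e)"
proof -
  note [simp] = minimal_projectionD(3,4,5)[OF e] scale_closed
  show ?thesis unfolding linear_functional_def
  proof (intro conjI allI ballI)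
    fix x y assume [simp]: "x \<in> carrier A" "y \<in> carrier A"
    have "e \<otimes> (x \<oplus> y) \<otimes> e = e \<otimes> x \<otimes> e \<oplus> e \<otimes> y \<otimes> e" by (simp add: r_distr l_distr)
    also have "\<dots> = (corner e x + corner e y) \<odot> e" by (simp add: corner[OF e] scale_add_left)
    finally show "corner e (x \<oplus> y) = corner e x + corner e y" by (rule corner_eqI[OF e])
  next
    fix c x assume [simp]: "x \<in> carrier A"
    have "e \<otimes> (c \<odot> x) \<otimes> e = c \<odot> (e \<otimes> x \<otimes> e)" by (simp add: scale_mult_left scale_mult_right)
    also have "\<dots> = (c * corner e x) \<odot> e" by (simp add: corner[OF e] scale_scale)
    finally show "corner e (c \<odot> x) = c * corner e x" by (rule corner_eqI[OF e])
  qed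
qed

text \<open>Both sides are the scalars of u w and w u for u = e x f and w = f y e, and u w u = u (w u) compares them.\<close>

lemma corner_swap:
  assumes e: "minimal_projection A e" and f: "minimal_projection A f"
    and x: "x \<in> carrier A" and y: "y \<in> carrier A"
  shows "corner e (x \<otimes> f \<otimes> y) = corner f (y \<otimes> e \<otimes> x)"
proof -
  note [simp] = minimal_projectionD(3,4,5)[OF e] minimal_projectionD(3,4,5)[OF f] x y
  let ?u = "e \<otimes> x \<otimes> f" and ?w = "f \<otimes> y \<otimes> e"
  let ?\<alpha> = "corner e (x \<otimes> f \<otimes> y)" and ?\<beta> = "corner f (y \<otimes> e \<otimes> x)"
  have ff: "f \<otimes> (f \<otimes> z) = f \<otimes> z" "e \<otimes> (e \<otimes> z) = e \<otimes> z" if "z \<in> carrier A" for z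
    using that by (simp_all add: m_assoc[symmetric])
  have uw: "?u \<otimes> ?w = ?\<alpha> \<odot> e" using corner[OF e, of "x \<otimes> f \<otimes> y"] by (simp add: m_assoc ff)
  have wu: "?w \<otimes> ?u = ?\<beta> \<odot> f" using corner[OF f, of "y \<otimes> e \<otimes> x"] by (simp add: m_assoc ff)
  have "?\<alpha> \<odot> ?u = (?\<alpha> \<odot> e) \<otimes> ?u" by (simp add: scale_mult_left m_assoc ff)
  also have "\<dots> = ?u \<otimes> (?w \<otimes> ?u)" unfolding uw[symmetric] by (simp add: m_assoc)
  also have "\<dots> = ?\<beta> \<odot> ?u" unfolding wu by (simp add: scale_mult_right m_assoc)
  finally have eq: "?\<alpha> \<odot> ?u = ?\<beta> \<odot> ?u" .
  show ?thesis
  proof (cases "?u = \<zero>")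
    case False then show ?thesis using scale_cancel[OF _ False eq] by simp
  next
    case True
    have "?\<alpha> \<odot> e = \<zero>" using uw unfolding True by simp
    moreover have "?\<beta> \<odot> f = \<zero>" using wu unfolding True by simp
    ultimately show ?thesis using scale_eq_zero minimal_projectionD(2,3) e f by metis
  qed
qed

text \<open>The three conditions in the description of the canonical trace.\<close>

definition trace_spec :: "('a \<Rightarrow> complex) \<Rightarrow> bool" where
  "trace_spec \<tau> \<longleftrightarrow> linear_functional A \<tau> \<and>
     (\<forall>x\<in>carrier A. \<forall>y\<in>carrier A. \<tau> (x \<otimes> y) = \<tau> (y \<otimes> x)) \<and>
     (\<forall>p. minimal_projection A p \<longrightarrow> \<tau> p = 1)"

text \<open>The sum of the corner functionals of a decomposition of 1 into minimal projections. The trace property and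
the value 1 on minimal projections both follow from corner_swap, because 1 = \<Sum> e may be inserted between
the factors.\<close>

lemma trace_exists: "\<exists>\<tau>. trace_spec \<tau>"
proof -
  obtain E where E: "resolution \<one> E" "\<And>e. e \<in> E \<Longrightarrow> minimal_projection A e"
    using spectral_resolution[OF selfadj_one] by metis
  note R = resolutionD[OF E(1)]
  note lin = corner_linear[OF E(2)]
  define \<tau> where "\<tau> x = (\<Sum>e\<in>E. corner e x)" for x
  have "linear_functional A \<tau>" using lin unfolding linear_functional_def \<tau>_def
    by (auto simp: sum.distrib sum_distrib_left)
  moreover have "\<tau> (x \<otimes> y) = \<tau> (y \<otimes> x)" if xy: "x \<in> carrier A" "y \<in> carrier A" for x y
  proof -
    have exp: "\<tau> (x \<otimes> y) = (\<Sum>e\<in>E. \<Sum>f\<in>E. corner e (x \<otimes> f \<otimes> y))"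
      if xy: "x \<in> carrier A" "y \<in> carrier A" for x y
    proof -
      have "x \<otimes> y = (\<Oplus>f\<in>E. x \<otimes> f) \<otimes> y" using resolution_expand[OF E(1) xy(1)] by simp
      also have "\<dots> = (\<Oplus>f\<in>E. x \<otimes> f \<otimes> y)" using R xy by (intro finsum_ldistr) auto
      finally have "corner e (x \<otimes> y) = (\<Sum>f\<in>E. corner e (x \<otimes> f \<otimes> y))" if "e \<in> E" for e
        using linear_functional_finsum[OF lin[OF that] R(1), of "\<lambda>f. x \<otimes> f \<otimes> y"] R xy by auto
      then show ?thesis by (simp add: \<tau>_def)
    qed
    have "\<tau> (x \<otimes> y) = (\<Sum>e\<in>E. \<Sum>f\<in>E. corner f (y \<otimes> e \<otimes> x))"
      unfolding exp[OF xy] using corner_swap E(2) xy by (intro sum.cong) auto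
    also have "\<dots> = \<tau> (y \<otimes> x)" unfolding exp[OF xy(2,1)] by (rule sum.swap)
    finally show ?thesis .
  qed
  moreover have "\<tau> p = 1" if p: "minimal_projection A p" for p
  proof -
    have "\<tau> p = (\<Sum>e\<in>E. corner e (\<one> \<otimes> p \<otimes> \<one>))" using minimal_projectionD(3)[OF p] by (simp add: \<tau>_def)
    also have "\<dots> = (\<Sum>e\<in>E. corner p (\<one> \<otimes> e \<otimes> \<one>))" using corner_swap p E(2) by (intro sum.cong) auto
    also have "\<dots> = corner p (\<Oplus>e\<in>E. e)"
      using linear_functional_finsum[OF corner_linear[OF p] R(1), of "\<lambda>e. e"] R by simp
    also have "\<dots> = 1" unfolding R(6) using minimal_projectionD[OF p]
      by (intro corner_eqI[OF p]) (simp add: scale_one)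
    finally show ?thesis .
  qed
  ultimately show ?thesis unfolding trace_spec_def by blast
qed

abbreviation tr :: "'a \<Rightarrow> complex" where "tr \<equiv> canonical_trace A"

lemma canonical_trace_spec: "trace_spec tr"
  using someI_ex[OF trace_exists] unfolding trace_spec_def canonical_trace_def .

lemma tr_linear: "linear_functional A tr" using canonical_trace_spec by (simp add: trace_spec_def)
lemma tr_comm: "x \<in> carrier A \<Longrightarrow> y \<in> carrier A \<Longrightarrow> tr (x \<otimes> y) = tr (y \<otimes> x)"
  using canonical_trace_spec by (simp add: trace_spec_def)
lemma tr_minimal: "minimal_projection A p \<Longrightarrow> tr p = 1" using canonical_trace_spec by (simp add: trace_spec_def)

lemma positive_scaled_projection:
  assumes e: "projection A e" "e \<noteq> \<zero>" and p: "positive (c \<odot> e)"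
  shows "\<exists>r\<ge>0. c = complex_of_real r"
proof -
  note [simp] = projectionD[OF e(1)]
  have "cnj c \<odot> e = c \<odot> e" using positive_selfadj[OF p] by (simp add: selfadj_def adj_scale)
  then have "cnj c = c" by (rule scale_cancel[OF projectionD(1)[OF e(1)] e(2)])
  then have c: "c = complex_of_real (Re c)" by (metis Reals_cnj_iff of_real_Re)
  have "Re c \<ge> 0"
  proof (rule ccontr)
    assume neg: "\<not> Re c \<ge> 0"
    have "positive (complex_of_real (- Re c) \<odot> e)"
      using neg projection_positive[OF e(1)] by (intro positive_scale) auto
    also have "complex_of_real (- Re c) \<odot> e = \<ominus> (c \<odot> e)"
    proof -
      have "complex_of_real (- Re c) = (-1) * c" using arg_cong[OF c, of uminus] by simp
      then show ?thesis by (simp only: scale_scale[symmetric] projectionD(1)[OF e(1)] scale_uminus_one scale_closed)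
    qed
    finally have "c \<odot> e = \<zero>" using positive_antisym[OF p] by blast
    then show False using scale_eq_zero[of e c] e neg by auto
  qed
  then show ?thesis using c by blast
qed

lemma positive_conjugate:
  assumes "positive x" "z \<in> carrier A" shows "positive (adj A z \<otimes> x \<otimes> z)"
proof -
  obtain y where y: "y \<in> carrier A" "x = adj A y \<otimes> y" using assms by (auto simp: positive_def)
  have "adj A z \<otimes> x \<otimes> z = adj A (y \<otimes> z) \<otimes> (y \<otimes> z)"
    using y assms by (simp add: adj_mult adj_closed m_assoc)
  then show ?thesis using positive_adj_mult y assms by simp
qed

lemma tr_positive:
  assumes a: "positive a"
  shows "\<exists>r\<ge>0. tr a = complex_of_real r" and "tr a = 0 \<Longrightarrow> a = \<zero>"
proof -
  have sa: "selfadj a" and [simp]: "a \<in> carrier A" using a by (auto simp: positive_selfadj positive_carrier)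
  obtain E \<alpha> where E: "resolution a E" "\<And>e. e \<in> E \<Longrightarrow> minimal_projection A e"
    "\<And>e. e \<in> E \<Longrightarrow> a \<otimes> e = complex_of_real (\<alpha> e) \<odot> e" using spectral_resolution[OF sa] by metis
  note R = resolutionD[OF E(1)]
  have \<alpha>: "\<alpha> e \<ge> 0" if e: "e \<in> E" for e
  proof -
    note [simp] = minimal_projectionD(3,4,5)[OF E(2)[OF e]]
    have "adj A e \<otimes> a \<otimes> e = complex_of_real (\<alpha> e) \<odot> e"
      by (simp add: m_assoc E(3)[OF e] scale_mult_right)
    then have "positive (complex_of_real (\<alpha> e) \<odot> e)" using positive_conjugate[OF a, of e] by simp
    then show ?thesis using positive_scaled_projection R(2,4) e by (metis of_real_eq_iff)
  qed
  have "tr a = (\<Sum>e\<in>E. tr (a \<otimes> e))"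
    using linear_functional_finsum[OF tr_linear R(1), of "\<lambda>e. a \<otimes> e"] R resolution_expand[OF E(1), of a] by simp
  also have "\<dots> = (\<Sum>e\<in>E. complex_of_real (\<alpha> e))"
    using tr_linear tr_minimal E(2,3) R unfolding linear_functional_def by (intro sum.cong) auto
  finally have t: "tr a = complex_of_real (\<Sum>e\<in>E. \<alpha> e)" by simp
  then show "\<exists>r\<ge>0. tr a = complex_of_real r" using \<alpha> sum_nonneg by blast
  assume "tr a = 0"
  then have "(\<Sum>e\<in>E. \<alpha> e) = 0" using t by (metis of_real_eq_0_iff)
  then have "\<And>e. e \<in> E \<Longrightarrow> \<alpha> e = 0" using \<alpha> sum_nonneg_eq_0_iff[OF R(1), of \<alpha>] by blast
  then have "a = (\<Oplus>e\<in>E. \<zero>)"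
    using R by (subst resolution_expand[OF E(1)], simp, intro finsum_cong') (auto simp: E(3) scale_zero_left)
  then show "a = \<zero>" by simp
qed

text \<open>Gram-Schmidt for the inner product tr (y* x), which is definite by tr_positive. A new vector s adds
the component w of s* that is orthogonal to the preceding span; if w pairs to zero with s then s already
lies in that span.\<close>

lemma riesz_aux:
  assumes f: "linear_functional A f" and S: "finite S" "S \<subseteq> carrier A"
  shows "\<exists>c. \<forall>x\<in>S. tr ((\<Oplus>s\<in>S. c s \<odot> adj A s) \<otimes> x) = f x"
  using S f
proof (induction S arbitrary: f rule: finite_induct)
  case (insert s S)
  note f = insert.prems(2)
  have S: "finite S" "S \<subseteq> carrier A" and s[simp]: "s \<in> carrier A" using insert by auto
  have cl: "(\<Oplus>t\<in>S. c t \<odot> adj A t) \<in> carrier A" for c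
    using S by (intro finsum_closed) (auto simp: scale_closed adj_closed)
  have lin: "linear_functional A (\<lambda>x. tr (adj A s \<otimes> x))"
    using tr_linear unfolding linear_functional_def by (auto simp: r_distr scale_mult_right adj_closed scale_closed)
  obtain c0 where c0: "\<forall>x\<in>S. tr ((\<Oplus>s\<in>S. c0 s \<odot> adj A s) \<otimes> x) = f x"
    using insert.IH[OF S(2) f] by blast
  obtain c1 where c1: "\<forall>x\<in>S. tr ((\<Oplus>s\<in>S. c1 s \<odot> adj A s) \<otimes> x) = tr (adj A s \<otimes> x)"
    using insert.IH[OF S(2) lin] by blast
  define r0 where "r0 = (\<Oplus>s\<in>S. c0 s \<odot> adj A s)"
  define r1 where "r1 = (\<Oplus>s\<in>S. c1 s \<odot> adj A s)"
  define w where "w = adj A s \<ominus> r1"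
  have [simp]: "r0 \<in> carrier A" "r1 \<in> carrier A" "w \<in> carrier A"
    unfolding w_def r0_def r1_def using cl by (auto simp: adj_closed)
  have trl: "tr (x \<oplus> y) = tr x + tr y" "tr (x \<ominus> y) = tr x - tr y" "tr (c \<odot> x) = c * tr x"
    if "x \<in> carrier A" "y \<in> carrier A" for x y c
    using that tr_linear linear_functional_minus[OF tr_linear] by (auto simp: linear_functional_def)
  have w0: "tr (w \<otimes> x) = 0" if "x \<in> S" for x
    using that S c1 unfolding w_def r1_def[symmetric]
    by (subst mult_minus_left) (auto simp: adj_closed trl r1_def[symmetric])
  define \<kappa> where "\<kappa> = (if tr (w \<otimes> s) = 0 then 0 else (f s - tr (r0 \<otimes> s)) / tr (w \<otimes> s))"
  define r where "r = r0 \<oplus> \<kappa> \<odot> w"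
  have trr: "tr (r \<otimes> x) = tr (r0 \<otimes> x) + \<kappa> * tr (w \<otimes> x)" if "x \<in> carrier A" for x
    using that unfolding r_def by (simp add: l_distr scale_closed scale_mult_left trl)
  have onS: "tr (r \<otimes> x) = f x" if "x \<in> S" for x
    using trr[of x] w0[OF that] c0 that S unfolding r0_def by auto
  \<comment> \<open>If w pairs to zero with s, then w = 0 and s is the combination adj A r1 of the elements of S.\<close>
  have ons: "tr (r \<otimes> s) = f s"
  proof (cases "tr (w \<otimes> s) = 0")
    case False then show ?thesis using trr[of s] by (simp add: \<kappa>_def)
  next
    case True
    have ar1: "adj A r1 = (\<Oplus>t\<in>S. cnj (c1 t) \<odot> t)"
      unfolding r1_def using S by (subst finsum_adj) (auto simp: adj_closed scale_closed adj_scale adj_adj intro!: finsum_cong')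
    have exp: "g (adj A r1) = (\<Sum>t\<in>S. cnj (c1 t) * g t)" if g: "linear_functional A g" for g
      unfolding ar1 using S g by (subst linear_functional_finsum[OF g]) (auto simp: scale_closed linear_functional_def subset_iff intro!: sum.cong)
    have glin: "linear_functional A (\<lambda>x. tr (y \<otimes> x))" if "y \<in> carrier A" for y
      using that tr_linear unfolding linear_functional_def by (auto simp: r_distr scale_mult_right adj_closed scale_closed)
    have "tr (w \<otimes> adj A r1) = 0" using exp[OF glin[of w]] w0 by simp
    then have "tr (w \<otimes> (s \<ominus> adj A r1)) = 0" using True by (simp add: mult_minus_right adj_closed trl)
    moreover have "s \<ominus> adj A r1 = adj A w" unfolding w_def by (simp add: adj_minus adj_closed adj_adj)
    ultimately have "tr (adj A (adj A w) \<otimes> adj A w) = 0" by (simp add: adj_adj)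
    then have "adj A (adj A w) \<otimes> adj A w = \<zero>" by (intro tr_positive(2) positive_adj_mult) (auto simp: adj_closed)
    then have "adj A w = \<zero>" by (rule adj_mult_self_zero[rotated]) (simp add: adj_closed)
    then have "s \<ominus> adj A r1 = \<zero>" using \<open>s \<ominus> adj A r1 = adj A w\<close> by simp
    then have seq: "s = adj A r1" by (rule minus_eq_zeroD[rotated 2]) (simp_all add: adj_closed)
    have "f s = (\<Sum>t\<in>S. cnj (c1 t) * f t)" by (subst seq) (rule exp[OF f])
    also have "\<dots> = (\<Sum>t\<in>S. cnj (c1 t) * tr (r0 \<otimes> t))" using c0 unfolding r0_def by simp
    also have "\<dots> = tr (r0 \<otimes> s)" using exp[OF glin[of r0]] seq by simp
    finally show ?thesis using trr[of s] True by simp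
  qed
  define c where "c t = (if t = s then \<kappa> else c0 t - \<kappa> * c1 t)" for t
  have "(\<Oplus>t\<in>insert s S. c t \<odot> adj A t) = \<kappa> \<odot> adj A s \<oplus> (\<Oplus>t\<in>S. c t \<odot> adj A t)"
    using insert.hyps S by (subst finsum_insert) (auto simp: c_def scale_closed adj_closed)
  also have "(\<Oplus>t\<in>S. c t \<odot> adj A t) = (\<Oplus>t\<in>S. c0 t \<odot> adj A t \<oplus> (- \<kappa>) \<odot> (c1 t \<odot> adj A t))"
  proof (intro finsum_cong')
    fix t assume t: "t \<in> S"
    then have "c t = c0 t + (- \<kappa> * c1 t)" using insert.hyps by (auto simp: c_def)
    then show "c t \<odot> adj A t = c0 t \<odot> adj A t \<oplus> (- \<kappa>) \<odot> (c1 t \<odot> adj A t)"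
      using t S scale_add_left[of "adj A t" "c0 t" "- \<kappa> * c1 t"] scale_scale[of "adj A t" "- \<kappa>" "c1 t"]
      by (simp only: adj_closed subsetD)
  qed (use S in \<open>auto simp: scale_closed adj_closed\<close>)
  also have "\<dots> = r0 \<oplus> (\<Oplus>t\<in>S. (- \<kappa>) \<odot> (c1 t \<odot> adj A t))" unfolding r0_def
    using S by (intro finsum_addf) (auto simp: scale_closed adj_closed)
  also have "(\<Oplus>t\<in>S. (- \<kappa>) \<odot> (c1 t \<odot> adj A t)) = (- \<kappa>) \<odot> r1" unfolding r1_def
    using S by (intro finsum_scale[symmetric]) (auto simp: scale_closed adj_closed)
  also have "\<kappa> \<odot> adj A s \<oplus> (r0 \<oplus> (- \<kappa>) \<odot> r1) = r"
    unfolding r_def w_def by (simp add: minus_scale scale_add_right scale_scale scale_closed adj_closed a_lcomm)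
  finally have "(\<Oplus>t\<in>insert s S. c t \<odot> adj A t) = r" .
  then show ?case using onS ons by (intro exI[of _ c]) auto
qed simp

text \<open>This makes the definite description of the density operator meaningful.\<close>

lemma riesz:
  assumes f: "linear_functional A f"
  shows "\<exists>!r. r \<in> carrier A \<and> (\<forall>x\<in>carrier A. f x = tr (r \<otimes> x))"
proof -
  obtain S where S: "finite S" "S \<subseteq> carrier A" "\<forall>x\<in>carrier A. \<exists>c. x = (\<Oplus>s\<in>S. c s \<odot> s)"
    using fd unfolding finite_dimensional_def by blast
  obtain c where c: "\<forall>x\<in>S. tr ((\<Oplus>s\<in>S. c s \<odot> adj A s) \<otimes> x) = f x" using riesz_aux[OF f S(1,2)] by blast
  define r where "r = (\<Oplus>s\<in>S. c s \<odot> adj A s)"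
  have r: "r \<in> carrier A" unfolding r_def using S by (intro finsum_closed) (auto simp: scale_closed adj_closed)
  have glin: "linear_functional A (\<lambda>x. tr (r \<otimes> x))"
    using r tr_linear unfolding linear_functional_def by (auto simp: r_distr scale_mult_right scale_closed)
  have "f x = tr (r \<otimes> x)" if x: "x \<in> carrier A" for x
  proof -
    obtain d where d: "x = (\<Oplus>s\<in>S. d s \<odot> s)" using S x by blast
    have exp: "g x = (\<Sum>t\<in>S. d t * g t)" if g: "linear_functional A g" for g
      unfolding d using S g by (subst linear_functional_finsum[OF g]) (auto simp: scale_closed linear_functional_def subset_iff intro!: sum.cong)
    show ?thesis using exp[OF f] exp[OF glin] c unfolding r_def by simp
  qed
  moreover have "r' = r" if r': "r' \<in> carrier A" "\<forall>x\<in>carrier A. f x = tr (r' \<otimes> x)"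
      and eq: "\<forall>x\<in>carrier A. f x = tr (r \<otimes> x)" for r'
  proof -
    let ?z = "r \<ominus> r'"
    have z: "?z \<in> carrier A" using r r' by simp
    have "tr (?z \<otimes> adj A ?z) = 0"
    proof -
      have "?z \<otimes> adj A ?z = r \<otimes> adj A ?z \<ominus> r' \<otimes> adj A ?z" using r r' z by (intro mult_minus_left adj_closed)
      then have "tr (?z \<otimes> adj A ?z) = tr (r \<otimes> adj A ?z) - tr (r' \<otimes> adj A ?z)"
        using linear_functional_minus[OF tr_linear, of "r \<otimes> adj A ?z" "r' \<otimes> adj A ?z"] r r' adj_closed[OF z]
        by (simp only: m_closed)
      also have "\<dots> = f (adj A ?z) - f (adj A ?z)" using eq r'(2) adj_closed[OF z] by metis
      finally show ?thesis by simp
    qed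
    then have "tr (adj A (adj A ?z) \<otimes> adj A ?z) = 0" using z by (simp only: adj_adj)
    then have "adj A (adj A ?z) \<otimes> adj A ?z = \<zero>" using z by (intro tr_positive(2) positive_adj_mult adj_closed)
    then have "adj A ?z = \<zero>" by (rule adj_mult_self_zero[OF adj_closed[OF z]])
    then have "?z = \<zero>" using adj_adj[OF z] adj_zero by metis
    then show ?thesis using minus_eq_zeroD[OF r r'(1)] by blast
  qed
  ultimately show ?thesis using r by metis
qed

end

section \<open>Positive functionals and the spectral form of the entropy\<close>

context cstar_algebra
begin

definition positive_functional :: "('a \<Rightarrow> complex) \<Rightarrow> bool" where
  "positive_functional f \<longleftrightarrow> linear_functional A f \<and> (\<forall>x\<in>carrier A. f (adj A x \<otimes> x) \<in> \<real>\<^sub>\<ge>\<^sub>0)"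

lemma positive_functionalD: "positive_functional f \<Longrightarrow> positive x \<Longrightarrow> f x \<in> \<real>\<^sub>\<ge>\<^sub>0"
  by (auto simp: positive_functional_def positive_def)

lemma positive_functional_linear: "positive_functional f \<Longrightarrow> linear_functional A f"
  by (simp add: positive_functional_def)

lemma positive_one: "positive \<one>"
  unfolding positive_def by (intro bexI[of _ \<one>]) (auto simp: adj_one)

lemma lfD:
  assumes "linear_functional A f"
  shows "\<And>x y. x \<in> carrier A \<Longrightarrow> y \<in> carrier A \<Longrightarrow> f (x \<oplus> y) = f x + f y"
    "\<And>x y. x \<in> carrier A \<Longrightarrow> y \<in> carrier A \<Longrightarrow> f (x \<ominus> y) = f x - f y"
    "\<And>c x. x \<in> carrier A \<Longrightarrow> f (c \<odot> x) = c * f x"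
  using assms linear_functional_minus by (auto simp: linear_functional_def)

lemma positive_functional_selfadj:
  assumes f: "positive_functional f" and h: "selfadj h"
  shows "f h = complex_of_real (Re (f h))"
proof -
  let ?t = "complex_of_real (nrm A h)"
  note l = lfD[OF positive_functional_linear[OF f]]
  have "f (?t \<odot> \<one> \<ominus> h) \<in> \<real>\<^sub>\<ge>\<^sub>0" using positive_functionalD[OF f positive_t_minus[OF h]] by simp
  moreover have "f (?t \<odot> \<one> \<ominus> h) = ?t * f \<one> - f h" using l selfadjD[OF h] by (simp add: scale_closed)
  moreover have "f \<one> \<in> \<real>\<^sub>\<ge>\<^sub>0" using positive_functionalD[OF f positive_one] .
  ultimately show ?thesis by (auto simp: complex_nonneg_Reals_iff complex_eq_iff)
qed

lemma positive_functional_adj: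
  assumes f: "positive_functional f" and x: "x \<in> carrier A"
  shows "f (adj A x) = cnj (f x)"
proof -
  obtain h k where hk: "selfadj h" "selfadj k" "x = h \<oplus> \<i> \<odot> k" "adj A x = h \<oplus> (-\<i>) \<odot> k"
    by (rule real_imag_parts[OF x])
  note l = lfD[OF positive_functional_linear[OF f]]
  have "f x = f h + \<i> * f k" "f (adj A x) = f h + (-\<i>) * f k"
    unfolding hk(4) unfolding hk(3) using l selfadjD[OF hk(1)] selfadjD[OF hk(2)] by (simp_all add: scale_closed)
  moreover have "cnj (f h) = f h" "cnj (f k) = f k"
    using positive_functional_selfadj[OF f hk(1)] positive_functional_selfadj[OF f hk(2)]
    by (metis complex_cnj_complex_of_real)+
  ultimately show ?thesis by simp
qed

text \<open>Both nrm A h - h and nrm A h + h are positive.\<close>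

lemma positive_functional_bounded:
  assumes f: "positive_functional f" and h: "selfadj h"
  shows "\<bar>Re (f h)\<bar> \<le> nrm A h * Re (f \<one>)"
proof -
  note l = lfD[OF positive_functional_linear[OF f]]
  have *: "Re (f k) \<le> nrm A k * Re (f \<one>)" if k: "selfadj k" for k
  proof -
    have "f (complex_of_real (nrm A k) \<odot> \<one> \<ominus> k) \<in> \<real>\<^sub>\<ge>\<^sub>0" using positive_functionalD[OF f positive_t_minus[OF k]] by simp
    moreover have "f (complex_of_real (nrm A k) \<odot> \<one> \<ominus> k) = complex_of_real (nrm A k) * f \<one> - f k"
      using l selfadjD[OF k] by (simp add: scale_closed)
    ultimately show ?thesis by (auto simp: complex_nonneg_Reals_iff)
  qed
  have hc: "h \<in> carrier A" using h by (rule selfadjD)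
  have "selfadj ((-1) \<odot> h)" using selfadj_scale[OF h, of "-1"] by simp
  from *[OF this] *[OF h] show ?thesis using hc l(3)[of h "-1"] by (simp add: nrm_scale)
qed

end

context fd_cstar
begin

text \<open>On each eigenprojection the element a acts as a scalar.\<close>

lemma poly_eval_resolution:
  assumes E: "resolution a E" and a: "a \<in> carrier A" and eig: "\<And>e. e \<in> E \<Longrightarrow> a \<otimes> e = \<alpha> e \<odot> e"
  shows "poly_eval A p a = (\<Oplus>e\<in>E. poly p (\<alpha> e) \<odot> e)"
proof -
  note R = resolutionD[OF E]
  have "poly_eval A p a = (\<Oplus>e\<in>E. poly_eval A p a \<otimes> e)"
    by (rule resolution_expand[OF E poly_eval_closed[OF a]])
  also have "\<dots> = (\<Oplus>e\<in>E. poly p (\<alpha> e) \<odot> e)"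
    using R(3) poly_eval_eigen[OF a _ eig] by (intro finsum_cong') (auto simp: scale_closed)
  finally show ?thesis .
qed

lemma spectrum_resolution:
  assumes E: "resolution a E" and a: "a \<in> carrier A" and eig: "\<And>e. e \<in> E \<Longrightarrow> a \<otimes> e = \<alpha> e \<odot> e"
  shows "spectrum A a = \<alpha> ` E"
proof (intro equalityI subsetI)
  note R = resolutionD[OF E]
  fix z assume "z \<in> \<alpha> ` E"
  then obtain e where e: "e \<in> E" "z = \<alpha> e" by blast
  have [simp]: "e \<in> carrier A" using R e by blast
  have 0: "(z \<odot> \<one> \<ominus> a) \<otimes> e = \<zero>" using a eig[OF e(1)] e(2)
    by (simp add: mult_minus_left scale_closed scale_mult_left) (simp add: a_minus_def r_neg scale_closed)
  have "z \<odot> \<one> \<ominus> a \<notin> Units A"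
  proof
    assume "z \<odot> \<one> \<ominus> a \<in> Units A"
    then obtain v where v: "v \<in> carrier A" "v \<otimes> (z \<odot> \<one> \<ominus> a) = \<one>" by (auto simp: Units_def)
    have "e = (v \<otimes> (z \<odot> \<one> \<ominus> a)) \<otimes> e" unfolding v(2) by simp
    also have "\<dots> = v \<otimes> ((z \<odot> \<one> \<ominus> a) \<otimes> e)" using v(1) a by (intro m_assoc) (auto simp: scale_closed)
    also have "\<dots> = \<zero>" unfolding 0 using v(1) by simp
    finally show False using R(4)[OF e(1)] by blast
  qed
  then show "z \<in> spectrum A a" by (simp add: spectrum_def)
next
  note R = resolutionD[OF E]
  fix z assume z: "z \<in> spectrum A a"
  show "z \<in> \<alpha> ` E"
  proof (rule ccontr)
    assume nz: "z \<notin> \<alpha> ` E"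
    let ?u = "z \<odot> \<one> \<ominus> a"
    define v where "v = (\<Oplus>e\<in>E. (1 / (z - \<alpha> e)) \<odot> e)"
    have u: "?u \<in> carrier A" using a by (simp add: scale_closed)
    have v: "v \<in> carrier A" unfolding v_def using R by (intro finsum_closed) (auto simp: scale_closed)
    have ue: "?u \<otimes> e = (z - \<alpha> e) \<odot> e" "e \<otimes> ?u = (z - \<alpha> e) \<odot> e" if e: "e \<in> E" for e
    proof -
      have ec: "e \<in> carrier A" using R e by blast
      have m: "z \<odot> e \<ominus> \<alpha> e \<odot> e = (z - \<alpha> e) \<odot> e"
        using scale_add_left[OF ec, of z "- \<alpha> e"] ec by (simp add: minus_scale scale_closed scale_scale)
      show "?u \<otimes> e = (z - \<alpha> e) \<odot> e" using a ec eig[OF e] m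
        by (simp add: mult_minus_left scale_closed scale_mult_left)
      have "e \<otimes> a = \<alpha> e \<odot> e" using R(5)[OF e] eig[OF e] by (simp add: commutes_def)
      then show "e \<otimes> ?u = (z - \<alpha> e) \<odot> e" using a ec m
        by (simp add: mult_minus_right scale_closed scale_mult_right)
    qed
    have nzd: "z - \<alpha> e \<noteq> 0" if "e \<in> E" for e using nz that by auto
    have "?u \<otimes> v = (\<Oplus>e\<in>E. ?u \<otimes> ((1 / (z - \<alpha> e)) \<odot> e))"
      unfolding v_def using R u by (intro finsum_rdistr) (auto simp: scale_closed)
    also have "\<dots> = (\<Oplus>e\<in>E. e)"
      using R u ue nzd by (intro finsum_cong') (auto simp: scale_mult_right scale_scale scale_one)
    finally have uv: "?u \<otimes> v = \<one>" using R(6) by simp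
    have "v \<otimes> ?u = (\<Oplus>e\<in>E. ((1 / (z - \<alpha> e)) \<odot> e) \<otimes> ?u)"
      unfolding v_def using R u by (intro finsum_ldistr) (auto simp: scale_closed)
    also have "\<dots> = (\<Oplus>e\<in>E. e)"
      using R u ue nzd by (intro finsum_cong') (auto simp: scale_mult_left scale_scale scale_one)
    finally have "v \<otimes> ?u = \<one>" using R(6) by simp
    then have "?u \<in> Units A" using uv u v unfolding Units_def by blast
    then show False using z by (simp add: spectrum_def)
  qed
qed

lemma fun_calc_resolution:
  assumes E: "resolution a E" and a: "a \<in> carrier A"
    and eig: "\<And>e. e \<in> E \<Longrightarrow> a \<otimes> e = complex_of_real (\<alpha> e) \<odot> e"
  shows "fun_calc A g a = (\<Oplus>e\<in>E. complex_of_real (g (\<alpha> e)) \<odot> e)"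
proof -
  note R = resolutionD[OF E]
  have sp: "spectrum A a = (\<lambda>e. complex_of_real (\<alpha> e)) ` E" by (rule spectrum_resolution[OF E a eig])
  have pe: "poly_eval A p a = (\<Oplus>e\<in>E. complex_of_real (g (\<alpha> e)) \<odot> e)"
    if "\<forall>z\<in>spectrum A a. poly p z = complex_of_real (g (Re z))" for p
  proof -
    have "poly_eval A p a = (\<Oplus>e\<in>E. poly p (complex_of_real (\<alpha> e)) \<odot> e)"
      by (rule poly_eval_resolution[OF E a]) (rule eig)
    also have "\<dots> = (\<Oplus>e\<in>E. complex_of_real (g (\<alpha> e)) \<odot> e)"
      using that R(3) unfolding sp by (intro finsum_cong') (auto simp: scale_closed)
    finally show ?thesis .
  qed
  obtain p where p: "\<forall>z\<in>spectrum A a. poly p z = complex_of_real (g (Re z))"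
    using interpolation_polynomial[of "spectrum A a" "\<lambda>z. complex_of_real (g (Re z))"] R(1) unfolding sp by auto
  show ?thesis unfolding fun_calc_def
  proof (rule the_equality)
    show "\<exists>p. (\<forall>z\<in>spectrum A a. poly p z = complex_of_real (g (Re z))) \<and> (\<Oplus>e\<in>E. complex_of_real (g (\<alpha> e)) \<odot> e) = poly_eval A p a"
      using p pe[OF p] by metis
  qed (use pe in blast)
qed

lemma tr_positive_functional: "positive_functional tr"
  unfolding positive_functional_def using tr_linear tr_positive(1)[OF positive_adj_mult]
  by (metis nonneg_Reals_of_real_iff)

lemma state_positive_functional: "state A f \<Longrightarrow> positive_functional f"
  by (auto simp: state_def positive_functional_def)

text \<open>The spectral resolution of the density operator. The later estimates only use the weights m e
and the projections e, not the functional calculus.\<close>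

theorem entropy_spectral:
  assumes \<rho>: "state A \<rho>"
  obtains E m where "finite E" "\<And>e. e \<in> E \<Longrightarrow> minimal_projection A e" "(\<Oplus>e\<in>E. e) = \<one>"
    "\<And>e f. e \<in> E \<Longrightarrow> f \<in> E \<Longrightarrow> e \<noteq> f \<Longrightarrow> e \<otimes> f = \<zero>"
    "\<And>e. e \<in> E \<Longrightarrow> m e \<ge> 0" "\<And>e. e \<in> E \<Longrightarrow> \<rho> e = complex_of_real (m e)"
    "\<And>x. x \<in> carrier A \<Longrightarrow> \<rho> x = (\<Sum>e\<in>E. complex_of_real (m e) * tr (e \<otimes> x))"
    "von_neumann_entropy A \<rho> = - (\<Sum>e\<in>E. m e * ln (m e))"
proof -
  have lin: "linear_functional A \<rho>" and pf: "positive_functional \<rho>"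
    using \<rho> state_positive_functional by (auto simp: state_def)
  define r where "r = density_operator A \<rho>"
  have r: "r \<in> carrier A" "\<And>x. x \<in> carrier A \<Longrightarrow> \<rho> x = tr (r \<otimes> x)"
    using theI'[OF riesz[OF lin]] unfolding r_def density_operator_def by blast+
  have "adj A r = r"
  proof -
    have "\<rho> x = tr (adj A r \<otimes> x)" if x: "x \<in> carrier A" for x
    proof -
      have "tr (adj A r \<otimes> x) = tr (adj A (adj A x \<otimes> r))" using x r(1) by (simp add: adj_mult adj_closed adj_adj)
      also have "\<dots> = cnj (tr (adj A x \<otimes> r))" using x r(1)
        by (intro positive_functional_adj[OF tr_positive_functional]) (auto simp: adj_closed)
      also have "tr (adj A x \<otimes> r) = tr (r \<otimes> adj A x)" using x r(1) by (intro tr_comm) (auto simp: adj_closed)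
      also have "\<dots> = cnj (\<rho> x)" using r(2)[of "adj A x"] positive_functional_adj[OF pf x] x by (simp add: adj_closed)
      finally show ?thesis by simp
    qed
    then show ?thesis using riesz[OF lin] r adj_closed by metis
  qed
  then have sr: "selfadj r" using r by (simp add: selfadj_def)
  obtain E m where E: "resolution r E" "\<And>e. e \<in> E \<Longrightarrow> minimal_projection A e"
    "\<And>e. e \<in> E \<Longrightarrow> r \<otimes> e = complex_of_real (m e) \<odot> e" by (rule spectral_resolution[OF sr]) blast
  note R = resolutionD[OF E(1)]
  have re: "\<rho> e = complex_of_real (m e)" if e: "e \<in> E" for e
    using r(2)[OF R(3)[OF e]] E(3)[OF e] lfD(3)[OF tr_linear R(3)[OF e]] tr_minimal[OF E(2)[OF e]] by simp
  have m0: "m e \<ge> 0" if e: "e \<in> E" for e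
    using positive_functionalD[OF pf projection_positive[OF R(2)[OF e]]] re[OF e] by simp
  have exp: "\<rho> x = (\<Sum>e\<in>E. complex_of_real (m e) * tr (e \<otimes> x))" if x: "x \<in> carrier A" for x
  proof -
    have "r \<otimes> x = (\<Oplus>e\<in>E. complex_of_real (m e) \<odot> e) \<otimes> x"
      using resolution_expand[OF E(1) r(1)] R(3) E(3) r(1) by (metis (mono_tags, lifting) finsum_cong' Pi_I m_closed)
    also have "\<dots> = (\<Oplus>e\<in>E. (complex_of_real (m e) \<odot> e) \<otimes> x)"
      using R x by (intro finsum_ldistr) (auto simp: scale_closed)
    also have "\<dots> = (\<Oplus>e\<in>E. complex_of_real (m e) \<odot> (e \<otimes> x))"
      using R x by (intro finsum_cong') (auto simp: scale_closed scale_mult_left)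
    finally show ?thesis using r(2)[OF x] linear_functional_finsum[OF tr_linear R(1), of "\<lambda>e. complex_of_real (m e) \<odot> (e \<otimes> x)"] R x
        lfD(3)[OF tr_linear] by (simp add: scale_closed)
  qed
  have "von_neumann_entropy A \<rho> = - Re (tr (\<Oplus>e\<in>E. complex_of_real (m e * ln (m e)) \<odot> e))"
    unfolding von_neumann_entropy_def r_def[symmetric]
    using fun_calc_resolution[OF E(1) r(1) E(3), of "\<lambda>t. t * ln t"] by simp
  also have "tr (\<Oplus>e\<in>E. complex_of_real (m e * ln (m e)) \<odot> e) = (\<Sum>e\<in>E. tr (complex_of_real (m e * ln (m e)) \<odot> e))"
    using R by (intro linear_functional_finsum[OF tr_linear]) (auto simp: scale_closed)
  also have "\<dots> = (\<Sum>e\<in>E. complex_of_real (m e * ln (m e)))"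
    using lfD(3)[OF tr_linear] R(3) tr_minimal[OF E(2)] by (intro sum.cong) auto
  finally have "von_neumann_entropy A \<rho> = - (\<Sum>e\<in>E. m e * ln (m e))" by simp
  then show ?thesis using that R E(2) m0 re exp by blast
qed

section \<open>Accessible information and entropy\<close>

text \<open>For a minimal projection e the element x e x is a scalar multiple of a projection, and the scalar is
tr (e x x). So x e x is at most tr (e x x) times 1.\<close>

lemma positive_functional_rank_one:
  assumes f: "positive_functional f" and e: "minimal_projection A e" and x: "selfadj x"
  shows "Re (f (x \<otimes> e \<otimes> x)) \<le> Re (f \<one>) * Re (tr (e \<otimes> (x \<otimes> x)))"
proof -
  note [simp] = minimal_projectionD(3,4,5)[OF e] selfadjD[OF x] scale_closed
  note l = lfD[OF positive_functional_linear[OF f]]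
  let ?y = "x \<otimes> e \<otimes> x"
  define c where "c = corner e (x \<otimes> x)"
  have ce: "e \<otimes> x \<otimes> x \<otimes> e = c \<odot> e" using corner[OF e, of "x \<otimes> x"] by (simp add: c_def m_assoc)
  have "positive (adj A (x \<otimes> e) \<otimes> (x \<otimes> e))" by (rule positive_adj_mult) simp
  also have "adj A (x \<otimes> e) \<otimes> (x \<otimes> e) = c \<odot> e" using ce by (simp add: adj_mult m_assoc)
  finally obtain \<gamma> where \<gamma>: "\<gamma> \<ge> 0" "c = complex_of_real \<gamma>"
    using positive_scaled_projection minimal_projectionD(1,2)[OF e] by blast
  have "tr (e \<otimes> (x \<otimes> x)) = tr (e \<otimes> (e \<otimes> (x \<otimes> x)))" by (simp add: m_assoc[symmetric])
  also have "\<dots> = tr (e \<otimes> (x \<otimes> x) \<otimes> e)" by (intro tr_comm) auto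
  also have "e \<otimes> (x \<otimes> x) \<otimes> e = c \<odot> e" using ce by (simp add: m_assoc)
  also have "tr (c \<odot> e) = complex_of_real \<gamma>" using lfD(3)[OF tr_linear, of e c] tr_minimal[OF e] \<gamma> by simp
  finally have t: "tr (e \<otimes> (x \<otimes> x)) = complex_of_real \<gamma>" .
  have yy: "?y \<otimes> ?y = c \<odot> ?y"
  proof -
    have "?y \<otimes> ?y = x \<otimes> (e \<otimes> x \<otimes> x \<otimes> e) \<otimes> x" by (simp add: m_assoc)
    also have "\<dots> = c \<odot> ?y" unfolding ce by (simp add: scale_mult_right scale_mult_left)
    finally show ?thesis .
  qed
  have ya: "adj A ?y = ?y" by (simp add: adj_mult m_assoc)
  show ?thesis
  proof (cases "\<gamma> = 0")
    case True
    then have "?y \<otimes> ?y = \<zero>" unfolding yy using \<gamma> by (simp add: scale_zero_left)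
    then have "?y = \<zero>" using selfadj_square_zero[of ?y] ya by (simp add: selfadj_def)
    then show ?thesis using t True linear_functional_zero[OF positive_functional_linear[OF f]] by simp
  next
    case False
    let ?q = "complex_of_real (1/\<gamma>) \<odot> ?y"
    have "projection A ?q" unfolding projection_def using False \<gamma> ya yy
      by (simp add: adj_scale scale_mult_left scale_mult_right scale_scale)
    then have "positive (\<one> \<ominus> ?q)" by (intro projection_positive projection_complement)
    then have "f (\<one> \<ominus> ?q) \<in> \<real>\<^sub>\<ge>\<^sub>0" by (rule positive_functionalD[OF f])
    moreover have "f (\<one> \<ominus> ?q) = f \<one> - complex_of_real (1/\<gamma>) * f ?y" using l(2)[of \<one> ?q] l(3)[of ?y] by simp
    ultimately have "Re (f ?y) / \<gamma> \<le> Re (f \<one>)" by (simp add: complex_nonneg_Reals_iff)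
    then show ?thesis using False \<gamma> unfolding t by (simp add: field_simps)
  qed
qed

text \<open>This is f (w* w) \<ge> 0 for w = e x - z e.\<close>

lemma compression_bound:
  assumes f: "positive_functional f" and e: "projection A e" and x: "selfadj x"
  shows "2 * z * Re (f (e \<otimes> x)) - z\<^sup>2 * Re (f e) \<le> Re (f (x \<otimes> e \<otimes> x))"
proof -
  note [simp] = projectionD[OF e] selfadjD[OF x] scale_closed
  note l = lfD[OF positive_functional_linear[OF f]]
  let ?z = "complex_of_real z"
  let ?w = "e \<otimes> x \<ominus> ?z \<odot> e"
  have ee: "e \<otimes> (e \<otimes> y) = e \<otimes> y" if "y \<in> carrier A" for y using that by (simp add: m_assoc[symmetric])
  have "adj A ?w \<otimes> ?w = (x \<otimes> e \<ominus> ?z \<odot> e) \<otimes> (e \<otimes> x \<ominus> ?z \<odot> e)"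
    by (simp add: adj_minus adj_mult adj_scale)
  also have "\<dots> = (x \<otimes> e \<otimes> x \<ominus> ?z \<odot> (e \<otimes> x)) \<ominus> (?z \<odot> (x \<otimes> e) \<ominus> (?z * ?z) \<odot> e)"
    by (simp add: mult_minus_left mult_minus_right scale_mult_left scale_mult_right scale_scale scale_minus m_assoc ee)
  finally have "f (adj A ?w \<otimes> ?w) = (f (x \<otimes> e \<otimes> x) - ?z * f (e \<otimes> x)) - (?z * f (x \<otimes> e) - (?z * ?z) * f e)"
    using l by simp
  moreover have "f (adj A ?w \<otimes> ?w) \<in> \<real>\<^sub>\<ge>\<^sub>0" by (intro positive_functionalD[OF f] positive_adj_mult) simp
  moreover have "f (x \<otimes> e) = cnj (f (e \<otimes> x))" using positive_functional_adj[OF f, of "e \<otimes> x"] by (simp add: adj_mult)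
  ultimately show ?thesis by (simp add: complex_nonneg_Reals_iff power2_eq_square)
qed

text \<open>The variance of a measurement: the sum over i of f ((x i - X) (P i) (x i - X)) is nonnegative.\<close>

lemma povm_square_bound:
  fixes x :: "'i \<Rightarrow> real"
  assumes f: "positive_functional f" and I: "finite I" and P: "\<And>i. i \<in> I \<Longrightarrow> positive (P i)"
    and P1: "(\<Oplus>i\<in>I. P i) = \<one>"
  defines "X \<equiv> (\<Oplus>i\<in>I. complex_of_real (x i) \<odot> P i)"
  shows "selfadj X" and "Re (f (X \<otimes> X)) \<le> (\<Sum>i\<in>I. (x i)\<^sup>2 * Re (f (P i)))"
proof -
  note l = lfD[OF positive_functional_linear[OF f]]
  note lf = linear_functional_finsum[OF positive_functional_linear[OF f] I]
  have Pc: "i \<in> I \<Longrightarrow> P i \<in> carrier A" for i using P positive_carrier by blast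
  have Xc: "X \<in> carrier A" unfolding X_def using Pc by (intro finsum_closed) (auto simp: scale_closed)
  have "adj A X = X" unfolding X_def
    using Pc positive_selfadj[OF P] I by (subst finsum_adj) (auto simp: scale_closed adj_scale adj_closed selfadj_def intro!: finsum_cong')
  then show sX: "selfadj X" using Xc by (simp add: selfadj_def)
  have summand_nonneg: "0 \<le> (x i)\<^sup>2 * Re (f (P i)) - x i * Re (f (P i \<otimes> X)) - x i * Re (f (X \<otimes> P i)) + Re (f (X \<otimes> P i \<otimes> X))"
    if i: "i \<in> I" for i
  proof -
    note [simp] = Pc[OF i] Xc scale_closed
    let ?c = "complex_of_real (x i)"
    let ?z = "?c \<odot> \<one> \<ominus> X"
    have "selfadj ?z" using sX by (intro selfadj_minus selfadj_scale selfadj_one)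
    then have za: "adj A ?z = ?z" by (rule selfadjD)
    have "f (adj A ?z \<otimes> P i \<otimes> ?z) \<in> \<real>\<^sub>\<ge>\<^sub>0" by (intro positive_functionalD[OF f] positive_conjugate P[OF i]) simp
    moreover have "adj A ?z \<otimes> P i \<otimes> ?z = ((?c * ?c) \<odot> P i \<ominus> ?c \<odot> (P i \<otimes> X)) \<ominus> (?c \<odot> (X \<otimes> P i) \<ominus> X \<otimes> P i \<otimes> X)"
    proof -
      have "adj A ?z \<otimes> P i = ?c \<odot> P i \<ominus> X \<otimes> P i" unfolding za by (simp add: mult_minus_left scale_mult_left)
      then have "adj A ?z \<otimes> P i \<otimes> ?z = (?c \<odot> P i \<ominus> X \<otimes> P i) \<otimes> ?z" by simp
      also have "\<dots> = ?c \<odot> P i \<otimes> ?z \<ominus> X \<otimes> P i \<otimes> ?z" by (simp add: mult_minus_left)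
      also have "?c \<odot> P i \<otimes> ?z = (?c * ?c) \<odot> P i \<ominus> ?c \<odot> (P i \<otimes> X)"
        by (simp add: mult_minus_right scale_mult_left scale_mult_right scale_scale scale_minus)
      also have "X \<otimes> P i \<otimes> ?z = ?c \<odot> (X \<otimes> P i) \<ominus> X \<otimes> P i \<otimes> X"
        by (simp add: mult_minus_right scale_mult_right)
      finally show ?thesis .
    qed
    ultimately show ?thesis using l by (simp add: complex_nonneg_Reals_iff power2_eq_square algebra_simps)
  qed
  have XX: "f (X \<otimes> X) = (\<Sum>i\<in>I. complex_of_real (x i) * f (P i \<otimes> X))"
  proof -
    have "X \<otimes> X = (\<Oplus>i\<in>I. complex_of_real (x i) \<odot> P i \<otimes> X)"
      by (subst (1) X_def) (use Pc Xc I in \<open>auto simp: scale_closed intro!: finsum_ldistr\<close>)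
    then show ?thesis using lf[of "\<lambda>i. complex_of_real (x i) \<odot> P i \<otimes> X"] Pc Xc l(3) by (simp add: scale_closed scale_mult_left)
  qed
  have XX2: "f (X \<otimes> X) = (\<Sum>i\<in>I. complex_of_real (x i) * f (X \<otimes> P i))"
  proof -
    have "X \<otimes> X = (\<Oplus>i\<in>I. X \<otimes> complex_of_real (x i) \<odot> P i)"
      by (subst (2) X_def) (use Pc Xc I in \<open>auto simp: scale_closed intro!: finsum_rdistr\<close>)
    then show ?thesis using lf[of "\<lambda>i. X \<otimes> complex_of_real (x i) \<odot> P i"] Pc Xc l(3) by (simp add: scale_closed scale_mult_right)
  qed
  have XX3: "f (X \<otimes> X) = (\<Sum>i\<in>I. f (X \<otimes> P i \<otimes> X))"
  proof -
    have "X \<otimes> X = (X \<otimes> (\<Oplus>i\<in>I. P i)) \<otimes> X" unfolding P1 using Xc by simp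
    also have "X \<otimes> (\<Oplus>i\<in>I. P i) = (\<Oplus>i\<in>I. X \<otimes> P i)" using Pc Xc I by (intro finsum_rdistr) auto
    also have "\<dots> \<otimes> X = (\<Oplus>i\<in>I. X \<otimes> P i \<otimes> X)" using Pc Xc I by (intro finsum_ldistr) auto
    finally show ?thesis using lf[of "\<lambda>i. X \<otimes> P i \<otimes> X"] Pc Xc by simp
  qed
  have "0 \<le> (\<Sum>i\<in>I. (x i)\<^sup>2 * Re (f (P i)) - x i * Re (f (P i \<otimes> X)) - x i * Re (f (X \<otimes> P i)) + Re (f (X \<otimes> P i \<otimes> X)))"
    by (intro sum_nonneg summand_nonneg)
  also have "\<dots> = (\<Sum>i\<in>I. (x i)\<^sup>2 * Re (f (P i))) - Re (f (X \<otimes> X)) - Re (f (X \<otimes> X)) + Re (f (X \<otimes> X))"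
    by (subst (1) XX, subst (1) XX2, subst (1) XX3) (simp add: sum.distrib sum_subtractf)
  finally show "Re (f (X \<otimes> X)) \<le> (\<Sum>i\<in>I. (x i)\<^sup>2 * Re (f (P i)))" by simp
qed

end

text \<open>Integration over t: the difference of the two logarithmic sums with arguments shifted by t has a
nonnegative derivative. It tends to 0 at infinity because the total weights agree, so it is at most 0 at t = 0.\<close>

lemma ln_sum_le_of_resolvent_le:
  fixes u b :: "'j \<Rightarrow> real" and v m :: "'k \<Rightarrow> real"
  assumes fin: "finite J" "finite K"
    and b: "\<And>j. j \<in> J \<Longrightarrow> b j > 0" and m: "\<And>k. k \<in> K \<Longrightarrow> m k > 0"
    and total: "sum u J = sum v K"
    and res: "\<And>t. t > 0 \<Longrightarrow> (\<Sum>j\<in>J. u j / (b j + t)) \<le> (\<Sum>k\<in>K. v k / (m k + t))"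
  shows "(\<Sum>k\<in>K. v k * ln (m k)) \<le> (\<Sum>j\<in>J. u j * ln (b j))"
proof -
  define G where "G t = (\<Sum>k\<in>K. v k * ln (m k + t)) - (\<Sum>j\<in>J. u j * ln (b j + t))" for t
  have mono: "G 0 \<le> G L" if L: "L > 0" for L
  proof (rule DERIV_nonneg_imp_increasing_open[of 0 L G])
    show "0 \<le> L" using L by simp
    fix t :: real assume t: "0 < t" "t < L"
    have "(G has_real_derivative (\<Sum>k\<in>K. v k / (m k + t)) - (\<Sum>j\<in>J. u j / (b j + t))) (at t)"
      unfolding G_def using b m t
      by (auto intro!: derivative_eq_intros sum.cong add_pos_pos simp: divide_inverse mult.commute)
    then show "\<exists>y. DERIV G t :> y \<and> 0 \<le> y" using res[OF t(1)] by (intro exI conjI) auto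
  next
    show "continuous_on {0..L} G"
      unfolding G_def using b m
      by (intro continuous_intros) (auto simp: add_pos_nonneg less_imp_neq[symmetric] dest: add_pos_nonneg)
  qed
  have lim: "((\<lambda>L. \<Sum>i\<in>I. w i * ln (1 + d i / L)) \<longlongrightarrow> 0) at_top" for I and w d :: "'z \<Rightarrow> real"
  proof -
    have "((\<lambda>L. w i * ln (1 + d i / L)) \<longlongrightarrow> w i * ln (1 + 0)) at_top" for i
      by (intro tendsto_intros tendsto_divide_0[OF tendsto_const]) (auto intro: filterlim_at_top_imp_at_infinity filterlim_ident)
    then have "((\<lambda>L. \<Sum>i\<in>I. w i * ln (1 + d i / L)) \<longlongrightarrow> (\<Sum>i\<in>I. w i * ln (1 + 0))) at_top"
      by (intro tendsto_sum)
    then show ?thesis by simp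
  qed
  have "((\<lambda>L. (\<Sum>k\<in>K. v k * ln (1 + m k / L)) - (\<Sum>j\<in>J. u j * ln (1 + b j / L))) \<longlongrightarrow> 0 - 0) at_top"
    by (intro tendsto_diff lim)
  moreover have "\<forall>\<^sub>F L in at_top. (\<Sum>k\<in>K. v k * ln (1 + m k / L)) - (\<Sum>j\<in>J. u j * ln (1 + b j / L)) = G L"
    using eventually_gt_at_top[of "0::real"]
  proof eventually_elim
    case (elim L)
    have "(\<Sum>i\<in>I. w i * ln (1 + d i / L)) = (\<Sum>i\<in>I. w i * ln (d i + L)) - sum w I * ln L"
      if "\<And>i. i \<in> I \<Longrightarrow> d i > 0" for I and w d :: "'z \<Rightarrow> real"
    proof -
      have "w i * ln (1 + d i / L) = w i * ln (d i + L) - w i * ln L" if "i \<in> I" for i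
      proof -
        have "1 + d i / L = (d i + L) / L" using elim by (simp add: field_simps)
        moreover have "d i > 0" using \<open>\<And>i. i \<in> I \<Longrightarrow> d i > 0\<close> that .
        ultimately show ?thesis using elim by (simp add: ln_div algebra_simps)
      qed
      then show ?thesis by (simp add: sum_subtractf sum_distrib_right)
    qed
    from this[of K m v] this[of J b u] show ?case using total b m by (simp add: G_def)
  qed
  ultimately have "(G \<longlongrightarrow> 0) at_top" by (simp add: filterlim_cong)
  moreover have "\<forall>\<^sub>F L in at_top. G 0 \<le> G L"
    using eventually_gt_at_top[of "0::real"] by eventually_elim (rule mono)
  ultimately have "G 0 \<le> 0" by (intro tendsto_lowerbound) auto
  then show ?thesis by (simp add: G_def)
qed

context fd_cstar
begin

text \<open>For each eigenprojection e of the density of \<rho>, with eigenvalue m e, compression_bound with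
z = 1 / (m e + t) bounds 2 f (e x) - f e / (m e + t) by (m e + t) f (x e x). The part with m e is estimated by
positive_functional_rank_one, which after summation over e produces \<rho> (x x), and the part with t
produces f (x x).\<close>

lemma resolvent_bound:
  assumes f: "positive_functional f" and x: "selfadj x"
    and E: "finite E" "\<And>e. e \<in> E \<Longrightarrow> minimal_projection A e" "(\<Oplus>e\<in>E. e) = \<one>"
    and m: "\<And>e. e \<in> E \<Longrightarrow> m e \<ge> 0"
    and \<rho>: "\<And>x. x \<in> carrier A \<Longrightarrow> \<rho> x = (\<Sum>e\<in>E. complex_of_real (m e) * tr (e \<otimes> x))"
    and t: "t > 0"
  shows "2 * Re (f x) \<le> Re (f \<one>) * Re (\<rho> (x \<otimes> x)) + t * Re (f (x \<otimes> x)) + (\<Sum>e\<in>E. Re (f e) / (m e + t))"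
proof -
  have xc: "x \<in> carrier A" using x by (rule selfadjD)
  have ec: "e \<in> E \<Longrightarrow> e \<in> carrier A" for e using E(2) minimal_projectionD(3) by blast
  note lf = linear_functional_finsum[OF positive_functional_linear[OF f] E(1)]
  have fx: "f x = (\<Sum>e\<in>E. f (e \<otimes> x))"
  proof -
    have "x = (\<Oplus>e\<in>E. e) \<otimes> x" using E(3) xc by simp
    also have "\<dots> = (\<Oplus>e\<in>E. e \<otimes> x)" using E(1) xc ec by (intro finsum_ldistr) auto
    finally show ?thesis using lf[of "\<lambda>e. e \<otimes> x"] ec xc by simp
  qed
  have fxx: "f (x \<otimes> x) = (\<Sum>e\<in>E. f (x \<otimes> e \<otimes> x))"
  proof -
    have "x \<otimes> x = x \<otimes> (\<Oplus>e\<in>E. e) \<otimes> x" using E(3) xc by simp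
    also have "x \<otimes> (\<Oplus>e\<in>E. e) = (\<Oplus>e\<in>E. x \<otimes> e)" using E(1) xc ec by (intro finsum_rdistr) auto
    also have "\<dots> \<otimes> x = (\<Oplus>e\<in>E. x \<otimes> e \<otimes> x)" using E(1) xc ec by (intro finsum_ldistr) auto
    finally show ?thesis using lf[of "\<lambda>e. x \<otimes> e \<otimes> x"] ec xc by simp
  qed
  have one: "2 * Re (f (e \<otimes> x)) - Re (f e) / (m e + t)
      \<le> m e * (Re (f \<one>) * Re (tr (e \<otimes> (x \<otimes> x)))) + t * Re (f (x \<otimes> e \<otimes> x))" if e: "e \<in> E" for e
  proof -
    let ?s = "m e + t"
    have s: "?s > 0" using m[OF e] t by simp
    have "2 * (1 / ?s) * Re (f (e \<otimes> x)) - (1 / ?s)\<^sup>2 * Re (f e) \<le> Re (f (x \<otimes> e \<otimes> x))"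
      by (rule compression_bound[OF f minimal_projectionD(1)[OF E(2)[OF e]] x])
    then have "?s * (2 * (1 / ?s) * Re (f (e \<otimes> x)) - (1 / ?s)\<^sup>2 * Re (f e)) \<le> ?s * Re (f (x \<otimes> e \<otimes> x))"
      using s by (intro mult_left_mono) auto
    also have "?s * (2 * (1 / ?s) * Re (f (e \<otimes> x)) - (1 / ?s)\<^sup>2 * Re (f e)) = 2 * Re (f (e \<otimes> x)) - Re (f e) / ?s"
      using s by (simp add: power2_eq_square right_diff_distrib)
    also have "?s * Re (f (x \<otimes> e \<otimes> x)) = m e * Re (f (x \<otimes> e \<otimes> x)) + t * Re (f (x \<otimes> e \<otimes> x))"
      by (simp add: distrib_right)
    also have "m e * Re (f (x \<otimes> e \<otimes> x)) \<le> m e * (Re (f \<one>) * Re (tr (e \<otimes> (x \<otimes> x))))"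
      using positive_functional_rank_one[OF f E(2)[OF e] x] m[OF e] by (intro mult_left_mono) auto
    finally show ?thesis by simp
  qed
  have "(\<Sum>e\<in>E. 2 * Re (f (e \<otimes> x)) - Re (f e) / (m e + t))
     \<le> (\<Sum>e\<in>E. m e * (Re (f \<one>) * Re (tr (e \<otimes> (x \<otimes> x)))) + t * Re (f (x \<otimes> e \<otimes> x)))"
    by (intro sum_mono one)
  then show ?thesis unfolding fxx \<rho>[OF m_closed[OF xc xc]] fx
    by (simp add: sum.distrib sum_subtractf sum_distrib_left mult_ac)
qed

text \<open>Holevo's bound, weakened by replacing the Holevo quantity by the entropy of the average state. Here w a is the
probability of preparing a, s i that of the outcome i. For each a and t > 0 apply resolvent_bound to
X = \<Sum> x i P i with x i = p a i / (w a s i + t p a i), which is the choice optimal for the resulting quadratic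
bound. Summed over a, the inequality compares the resolvents of the numbers w a s i / p a i, weighted by p a i,
with those of the eigenvalues m e, weighted by m e, and ln_sum_le_of_resolvent_le turns it into
the claim.\<close>

theorem accessible_information_le_entropy:
  fixes F :: "'k \<Rightarrow> 'a \<Rightarrow> complex" and P :: "'i \<Rightarrow> 'a"
  assumes \<rho>: "state A \<rho>" and K: "finite K"
    and F: "\<And>a. a \<in> K \<Longrightarrow> positive_functional (F a)"
    and sumF: "\<And>x. x \<in> carrier A \<Longrightarrow> \<rho> x = (\<Sum>a\<in>K. F a x)"
    and I: "finite I" and P: "\<And>i. i \<in> I \<Longrightarrow> positive (P i)" and P1: "(\<Oplus>i\<in>I. P i) = \<one>"
  defines "p \<equiv> \<lambda>a i. Re (F a (P i))"
  shows "(\<Sum>(a,i)\<in>K\<times>I. p a i * ln (p a i / ((\<Sum>j\<in>I. p a j) * (\<Sum>b\<in>K. p b i)))) \<le> von_neumann_entropy A \<rho>"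
proof -
  obtain E m where E: "finite E" "\<And>e. e \<in> E \<Longrightarrow> minimal_projection A e" "(\<Oplus>e\<in>E. e) = \<one>"
    and m: "\<And>e. e \<in> E \<Longrightarrow> m e \<ge> 0" and \<rho>e: "\<And>e. e \<in> E \<Longrightarrow> \<rho> e = complex_of_real (m e)"
    and \<rho>x: "\<And>x. x \<in> carrier A \<Longrightarrow> \<rho> x = (\<Sum>e\<in>E. complex_of_real (m e) * tr (e \<otimes> x))"
    and S: "von_neumann_entropy A \<rho> = - (\<Sum>e\<in>E. m e * ln (m e))"
    by (rule entropy_spectral[OF \<rho>]) blast
  have Pc: "i \<in> I \<Longrightarrow> P i \<in> carrier A" for i using P positive_carrier by blast
  have ec: "e \<in> E \<Longrightarrow> e \<in> carrier A" for e using E(2) minimal_projectionD(3) by blast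
  define w where "w a = (\<Sum>j\<in>I. p a j)" for a
  define s where "s i = (\<Sum>b\<in>K. p b i)" for i
  have pp: "p a i \<ge> 0" if "a \<in> K" "i \<in> I" for a i
    using positive_functionalD[OF F[OF that(1)] P[OF that(2)]] by (simp add: p_def complex_nonneg_Reals_iff)
  have F1: "Re (F a \<one>) = w a" if "a \<in> K" for a
    using linear_functional_finsum[OF positive_functional_linear[OF F[OF that]] I, of P] Pc unfolding P1 w_def p_def by simp
  have \<rho>P: "Re (\<rho> (P i)) = s i" if "i \<in> I" for i using sumF[OF Pc[OF that]] by (simp add: s_def p_def)
  have wpos: "w a \<ge> p a i" if "a \<in> K" "i \<in> I" for a i
    unfolding w_def using that pp I by (intro member_le_sum) auto
  have spos: "s i \<ge> p a i" if "a \<in> K" "i \<in> I" for a i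
    unfolding s_def using that pp K by (intro member_le_sum[of a K "\<lambda>b. p b i"]) auto
  have res: "(\<Sum>i\<in>I. (p a i)\<^sup>2 / (w a * s i + t * p a i)) \<le> (\<Sum>e\<in>E. Re (F a e) / (m e + t))"
    if a: "a \<in> K" and t: "t > 0" for a t
  proof -
    define d where "d i = w a * s i + t * p a i" for i
    define x where "x i = p a i / d i" for i
    define X where "X = (\<Oplus>i\<in>I. complex_of_real (x i) \<odot> P i)"
    have X: "selfadj X" "Re (F a (X \<otimes> X)) \<le> (\<Sum>i\<in>I. (x i)\<^sup>2 * p a i)"
      using povm_square_bound[OF F[OF a] I P P1, of x] unfolding X_def p_def by auto
    have \<rho>XX: "Re (\<rho> (X \<otimes> X)) \<le> (\<Sum>i\<in>I. (x i)\<^sup>2 * s i)"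
      using povm_square_bound(2)[OF state_positive_functional[OF \<rho>] I P P1, of x] \<rho>P unfolding X_def by simp
    have fX: "Re (F a X) = (\<Sum>i\<in>I. x i * p a i)"
      unfolding X_def using linear_functional_finsum[OF positive_functional_linear[OF F[OF a]] I, of "\<lambda>i. complex_of_real (x i) \<odot> P i"]
        lfD(3)[OF positive_functional_linear[OF F[OF a]]] Pc by (simp add: scale_closed p_def)
    have w0: "w a \<ge> 0" using pp a unfolding w_def by (intro sum_nonneg) auto
    have "2 * (\<Sum>i\<in>I. x i * p a i) \<le> w a * Re (\<rho> (X \<otimes> X)) + t * Re (F a (X \<otimes> X)) + (\<Sum>e\<in>E. Re (F a e) / (m e + t))"
      using resolvent_bound[OF F[OF a] X(1) E m \<rho>x t] fX F1[OF a] by simp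
    also have "\<dots> \<le> w a * (\<Sum>i\<in>I. (x i)\<^sup>2 * s i) + t * (\<Sum>i\<in>I. (x i)\<^sup>2 * p a i) + (\<Sum>e\<in>E. Re (F a e) / (m e + t))"
      using X(2) \<rho>XX w0 t by (intro add_mono mult_left_mono) auto
    also have "w a * (\<Sum>i\<in>I. (x i)\<^sup>2 * s i) + t * (\<Sum>i\<in>I. (x i)\<^sup>2 * p a i) = (\<Sum>i\<in>I. (x i)\<^sup>2 * d i)"
      by (simp add: d_def sum_distrib_left sum.distrib[symmetric] algebra_simps)
    also have "\<dots> = (\<Sum>i\<in>I. (p a i)\<^sup>2 / d i)"
      by (intro sum.cong) (auto simp: x_def power2_eq_square)
    also have "2 * (\<Sum>i\<in>I. x i * p a i) = 2 * (\<Sum>i\<in>I. (p a i)\<^sup>2 / d i)"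
      by (simp add: x_def power2_eq_square)
    finally show ?thesis by (simp add: d_def)
  qed
  \<comment> \<open>Terms with p a i = 0 or m e = 0 vanish on both sides; removing them makes all arguments of ln positive.\<close>
  define J where "J = {(a,i) \<in> K \<times> I. p a i > 0}"
  define E' where "E' = {e \<in> E. m e > 0}"
  define u where "u = (\<lambda>(a,i). p a i)"
  define b where "b = (\<lambda>(a,i). w a * s i / p a i)"
  have J: "finite J" "J \<subseteq> K \<times> I" unfolding J_def using K I by (auto intro: finite_subset[of _ "K \<times> I"])
  have J0: "p a i = 0" if "(a,i) \<in> K \<times> I - J" for a i using that pp[of a i] by (force simp: J_def)
  have E'0: "m e = 0" if "e \<in> E - E'" for e using that m[of e] by (force simp: E'_def)
  have "(\<Sum>e\<in>E'. m e * ln (m e)) \<le> (\<Sum>j\<in>J. u j * ln (b j))"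
  proof (rule ln_sum_le_of_resolvent_le[OF J(1)])
    show "finite E'" using E(1) by (simp add: E'_def)
    show "0 < b j" if j: "j \<in> J" for j
    proof -
      obtain a i where ai: "j = (a,i)" "a \<in> K" "i \<in> I" "p a i > 0" using j by (auto simp: J_def)
      then have "w a > 0" "s i > 0" using wpos[of a i] spos[of a i] by auto
      then show ?thesis using ai by (simp add: b_def)
    qed
    show "0 < m e" if "e \<in> E'" for e using that by (simp add: E'_def)
    have "sum u J = (\<Sum>j\<in>K\<times>I. u j)" using J J0 K I by (intro sum.mono_neutral_left) (auto simp: u_def)
    also have "\<dots> = (\<Sum>a\<in>K. w a)" by (simp add: u_def w_def sum.cartesian_product)
    also have "\<dots> = Re (\<rho> \<one>)" using sumF[OF one_closed] F1 by simp
    also have "\<rho> \<one> = (\<Sum>e\<in>E. \<rho> e)"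
      using linear_functional_finsum[of \<rho> E "\<lambda>e. e"] \<rho> E(1) ec unfolding E(3) state_def by blast
    also have "Re (\<Sum>e\<in>E. \<rho> e) = (\<Sum>e\<in>E. m e)" by (simp add: \<rho>e)
    also have "\<dots> = sum m E'" using E(1) E'0 by (intro sum.mono_neutral_right) (auto simp: E'_def)
    finally show "sum u J = sum m E'" .
    fix t :: real assume t: "t > 0"
    have "(\<Sum>j\<in>J. u j / (b j + t)) = (\<Sum>j\<in>J. case j of (a,i) \<Rightarrow> (p a i)\<^sup>2 / (w a * s i + t * p a i))"
    proof (intro sum.cong refl)
      fix j assume "j \<in> J"
      then obtain a i where ai: "j = (a,i)" "p a i > 0" by (auto simp: J_def)
      have "b j + t = (w a * s i + t * p a i) / p a i" using ai by (simp add: b_def field_simps)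
      then show "u j / (b j + t) = (case j of (a,i) \<Rightarrow> (p a i)\<^sup>2 / (w a * s i + t * p a i))"
        using ai by (simp add: u_def power2_eq_square)
    qed
    also have "\<dots> = (\<Sum>j\<in>K\<times>I. case j of (a,i) \<Rightarrow> (p a i)\<^sup>2 / (w a * s i + t * p a i))"
      using J J0 K I by (intro sum.mono_neutral_left) auto
    also have "\<dots> = (\<Sum>a\<in>K. \<Sum>i\<in>I. (p a i)\<^sup>2 / (w a * s i + t * p a i))" by (simp add: sum.cartesian_product)
    also have "\<dots> \<le> (\<Sum>a\<in>K. \<Sum>e\<in>E. Re (F a e) / (m e + t))" by (intro sum_mono res t)
    also have "\<dots> = (\<Sum>e\<in>E. \<Sum>a\<in>K. Re (F a e) / (m e + t))" by (rule sum.swap)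
    also have "\<dots> = (\<Sum>e\<in>E. m e / (m e + t))"
    proof (intro sum.cong refl)
      fix e assume e: "e \<in> E"
      have "(\<Sum>a\<in>K. Re (F a e)) = Re (\<rho> e)" using sumF[OF ec[OF e]] by simp
      then show "(\<Sum>a\<in>K. Re (F a e) / (m e + t)) = m e / (m e + t)"
        using \<rho>e[OF e] by (simp add: sum_divide_distrib[symmetric])
    qed
    also have "\<dots> = (\<Sum>e\<in>E'. m e / (m e + t))" using E(1) E'0 by (intro sum.mono_neutral_right) (auto simp: E'_def)
    finally show "(\<Sum>j\<in>J. u j / (b j + t)) \<le> (\<Sum>e\<in>E'. m e / (m e + t))" .
  qed
  also have "(\<Sum>e\<in>E'. m e * ln (m e)) = (\<Sum>e\<in>E. m e * ln (m e))"
    using E(1) E'0 by (intro sum.mono_neutral_left) (auto simp: E'_def)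
  also have "(\<Sum>j\<in>J. u j * ln (b j)) = (\<Sum>j\<in>J. case j of (a,i) \<Rightarrow> - (p a i * ln (p a i / (w a * s i))))"
  proof (intro sum.cong refl)
    fix j assume "j \<in> J"
    then obtain a i where ai: "j = (a,i)" "a \<in> K" "i \<in> I" "p a i > 0" by (auto simp: J_def)
    then have "w a > 0" "s i > 0" using wpos[of a i] spos[of a i] by auto
    then show "u j * ln (b j) = (case j of (a,i) \<Rightarrow> - (p a i * ln (p a i / (w a * s i))))"
      using ai by (simp add: u_def b_def ln_div ln_mult algebra_simps)
  qed
  also have "\<dots> = (\<Sum>j\<in>K\<times>I. case j of (a,i) \<Rightarrow> - (p a i * ln (p a i / (w a * s i))))"
    using J J0 K I by (intro sum.mono_neutral_left) auto
  also have "\<dots> = - (\<Sum>(a,i)\<in>K\<times>I. p a i * ln (p a i / (w a * s i)))"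
    by (simp add: sum_negf[symmetric] case_prod_unfold)
  finally show ?thesis unfolding S by (simp add: w_def s_def)
qed

end

section \<open>The Hahn-Banach theorem on a carrier\<close>

text \<open>A real vector space on a set of elements of an arbitrary type. The version of the Hahn-Banach theorem below is
applied to a space of functions with values in the carrier of a C*-algebra.\<close>

locale real_vector_carrier =
  fixes V :: "'v set" and pl :: "'v \<Rightarrow> 'v \<Rightarrow> 'v" and sc :: "real \<Rightarrow> 'v \<Rightarrow> 'v" and z :: 'v
  assumes pl_closed: "u \<in> V \<Longrightarrow> v \<in> V \<Longrightarrow> pl u v \<in> V"
    and sc_closed: "u \<in> V \<Longrightarrow> sc r u \<in> V" and z_closed: "z \<in> V"
    and pl_assoc: "u \<in> V \<Longrightarrow> v \<in> V \<Longrightarrow> w \<in> V \<Longrightarrow> pl (pl u v) w = pl u (pl v w)"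
    and pl_comm: "u \<in> V \<Longrightarrow> v \<in> V \<Longrightarrow> pl u v = pl v u"
    and pl_zero: "u \<in> V \<Longrightarrow> pl z u = u"
    and sc_pl: "u \<in> V \<Longrightarrow> v \<in> V \<Longrightarrow> sc r (pl u v) = pl (sc r u) (sc r v)"
    and sc_add: "u \<in> V \<Longrightarrow> sc (r + s) u = pl (sc r u) (sc s u)"
    and sc_sc: "u \<in> V \<Longrightarrow> sc r (sc s u) = sc (r * s) u"
    and sc_one: "u \<in> V \<Longrightarrow> sc 1 u = u"
    and sc_zero: "u \<in> V \<Longrightarrow> sc 0 u = z"
begin

lemma pl_lcomm: "u \<in> V \<Longrightarrow> v \<in> V \<Longrightarrow> w \<in> V \<Longrightarrow> pl u (pl v w) = pl v (pl u w)"
  by (simp add: pl_assoc[symmetric] pl_comm[of u v])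

lemma pl_interchange:
  "\<lbrakk>a \<in> V; b \<in> V; s \<in> V; t \<in> V\<rbrakk> \<Longrightarrow> pl (pl a b) (pl s t) = pl (pl a s) (pl b t)"
  by (simp add: pl_assoc pl_closed pl_lcomm[of b s t])

definition sublinear :: "('v \<Rightarrow> real) \<Rightarrow> bool" where
  "sublinear p \<longleftrightarrow> (\<forall>u\<in>V. \<forall>v\<in>V. p (pl u v) \<le> p u + p v) \<and> (\<forall>u\<in>V. \<forall>r\<ge>0. p (sc r u) = r * p u)"

lemma sublinearD:
  assumes "sublinear p"
  shows "\<And>u v. u \<in> V \<Longrightarrow> v \<in> V \<Longrightarrow> p (pl u v) \<le> p u + p v"
    "\<And>u r. u \<in> V \<Longrightarrow> r \<ge> 0 \<Longrightarrow> p (sc r u) = r * p u" "p z = 0"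
proof -
  have "p (sc 0 z) = 0 * p z" using assms z_closed unfolding sublinear_def by blast
  then show "p z = 0" by (simp add: sc_zero z_closed)
qed (use assms in \<open>auto simp: sublinear_def\<close>)

lemma sc_neg: "u \<in> V \<Longrightarrow> pl u (sc (-1) u) = z"
  using sc_add[of u 1 "-1"] by (simp add: sc_one sc_zero)

lemma sublinear_neg: "sublinear p \<Longrightarrow> u \<in> V \<Longrightarrow> - p (sc (-1) u) \<le> p u"
  using sublinearD(1)[of p u "sc (-1) u"] sublinearD(3)[of p] by (simp add: sc_closed sc_neg)

text \<open>Functions are normalised to 0 outside the carrier so that the pointwise order is antisymmetric.\<close>

definition minorants :: "('v \<Rightarrow> real) \<Rightarrow> ('v \<Rightarrow> real) set" where
  "minorants p0 = {p. sublinear p \<and> (\<forall>u\<in>V. p u \<le> p0 u) \<and> (\<forall>u. u \<notin> V \<longrightarrow> p u = 0)}"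

text \<open>Zorn's lemma: the pointwise infimum of a chain of sublinear functionals is sublinear. It is finite because
each of them is bounded below by - p0 (- u).\<close>

lemma minimal_minorant:
  assumes p0: "sublinear p0"
  shows "\<exists>p\<in>minorants p0. \<forall>q\<in>minorants p0. (\<forall>u. q u \<le> p u) \<longrightarrow> q = p"
proof -
  let ?P = "\<lambda>p q :: 'v \<Rightarrow> real. \<forall>u. q u \<le> p u"
  let ?S = "minorants p0"
  have "partial_order_on ?S (relation_of ?P ?S)"
  proof (rule partial_order_on_relation_ofI)
    fix a b c :: "'v \<Rightarrow> real"
    assume "?P a b" "?P b c" then show "?P a c" by (meson order_trans)
  next
    fix a b :: "'v \<Rightarrow> real" assume "?P a b" "?P b a" then show "a = b" by (meson antisym ext)
  qed auto
  then show ?thesis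
  proof (rule predicate_Zorn)
    fix C assume C: "C \<in> Chains (relation_of ?P ?S)"
    have CS: "C \<subseteq> ?S" using C by (auto simp: Chains_def relation_of_def)
    have cmp: "?P p q \<or> ?P q p" if "p \<in> C" "q \<in> C" for p q
      using C that by (auto simp: Chains_def relation_of_def)
    show "\<exists>u\<in>?S. \<forall>a\<in>C. ?P a u"
    proof (cases "C = {}")
      case True
      have "sublinear (\<lambda>u. if u \<in> V then p0 u else 0)"
        using p0 by (auto simp: sublinear_def pl_closed sc_closed)
      then have "(\<lambda>u. if u \<in> V then p0 u else 0) \<in> ?S" by (simp add: minorants_def)
      then show ?thesis using True by blast
    next
      case False
      define q where "q u = (if u \<in> V then INF p\<in>C. p u else 0)" for u
      \<comment> \<open>a lower bound valid for all members of the chain, so that the infima are finite\<close>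
      have lb: "- p0 (sc (-1) u) \<le> p u" if "p \<in> C" "u \<in> V" for p u
      proof -
        have "sublinear p" "p (sc (-1) u) \<le> p0 (sc (-1) u)" using CS that sc_closed by (auto simp: minorants_def)
        then show ?thesis using sublinear_neg[of p u] that by linarith
      qed
      have bdd: "bdd_below ((\<lambda>p. p u) ` C)" if "u \<in> V" for u using lb that by (intro bdd_belowI2) auto
      have qle: "q u \<le> p u" if "p \<in> C" for p u
        using that bdd CS by (auto simp: q_def minorants_def intro: cINF_lower)
      have ge: "c \<le> q u" if "u \<in> V" "\<And>p. p \<in> C \<Longrightarrow> c \<le> p u" for c u
        using that False by (auto simp: q_def intro: cINF_greatest)
      have sub: "q (pl u v) \<le> q u + q v" if uv: "u \<in> V" "v \<in> V" for u v
      proof -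
        have 1: "q (pl u v) \<le> p u + p' v" if pp: "p \<in> C" "p' \<in> C" for p p'
        proof -
          obtain r where r: "r \<in> C" "\<forall>u. r u \<le> p u" "\<forall>u. r u \<le> p' u" using cmp[OF pp] pp by blast
          have "q (pl u v) \<le> r (pl u v)" by (rule qle[OF r(1)])
          also have "\<dots> \<le> r u + r v" using r(1) CS uv sublinearD(1) by (auto simp: minorants_def)
          also have "\<dots> \<le> p u + p' v" using r by (intro add_mono) auto
          finally show ?thesis .
        qed
        have "q (pl u v) - p' v \<le> q u" if "p' \<in> C" for p' using 1 that uv by (intro ge) (auto simp: algebra_simps)
        then have "q (pl u v) - q u \<le> q v" using uv by (intro ge) (auto simp: algebra_simps)
        then show ?thesis by linarith
      qed
      have hom: "q (sc r u) = r * q u" if u: "u \<in> V" and r: "r \<ge> 0" for u r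
      proof (cases "r = 0")
        case True
        have pz: "p z = 0" if "p \<in> C" for p using CS that sublinearD(3) by (auto simp: minorants_def)
        obtain p where "p \<in> C" using False by blast
        then have "q z = 0" using qle[of p z] ge[of z 0] pz z_closed by fastforce
        then show ?thesis using True by (simp add: sc_zero u)
      next
        case rn: False
        have le: "s * q w \<le> q (sc s w)" if "w \<in> V" "s > 0" for s w
        proof (rule ge)
          show "sc s w \<in> V" using that by (simp add: sc_closed)
          fix p assume p: "p \<in> C"
          then have "p (sc s w) = s * p w" using CS that sublinearD(2)[of p w s] by (auto simp: minorants_def)
          then show "s * q w \<le> p (sc s w)" using qle[OF p, of w] that by simp
        qed
        have "(1/r) * q (sc r u) \<le> q (sc (1/r) (sc r u))" using r rn u by (intro le) (auto simp: sc_closed)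
        then have "q (sc r u) \<le> r * q u" using r rn u by (simp add: sc_sc sc_one field_simps)
        then show ?thesis using le[OF u, of r] r rn by simp
      qed
      obtain p where p: "p \<in> C" using False by blast
      have "q u \<le> p0 u" if "u \<in> V" for u using qle[OF p, of u] CS p that by (force simp: minorants_def)
      then have "q \<in> ?S" using sub hom by (simp add: minorants_def sublinear_def) (simp add: q_def)
      then show ?thesis using qle by blast
    qed
  qed
qed

text \<open>A minimal sublinear functional p is linear. For fixed v the functional
q u = inf (p (u + t v) - t p v) over t \<ge> 0 is sublinear and below p, so it equals p; t = 1 then gives
p u + p v \<le> p (u + v).\<close>

theorem dominated_linear_functional:
  assumes p0: "sublinear p0"
  shows "\<exists>L. (\<forall>u\<in>V. \<forall>v\<in>V. L (pl u v) = L u + L v) \<and> (\<forall>u\<in>V. \<forall>r. L (sc r u) = r * L u) \<and> (\<forall>u\<in>V. L u \<le> p0 u)"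
proof -
  obtain p where p: "p \<in> minorants p0" and min: "\<And>q. q \<in> minorants p0 \<Longrightarrow> (\<forall>u. q u \<le> p u) \<Longrightarrow> q = p"
    using minimal_minorant[OF p0] by blast
  have sp: "sublinear p" and pp0: "\<And>u. u \<in> V \<Longrightarrow> p u \<le> p0 u" and pV: "\<And>u. u \<notin> V \<Longrightarrow> p u = 0"
    using p by (auto simp: minorants_def)
  note P = sublinearD[OF sp]
  have super: "p u + p v \<le> p (pl u v)" if uv: "u \<in> V" "v \<in> V" for u v
  proof -
    let ?f = "\<lambda>u t. p (pl u (sc t v)) - t * p v"
    define q where "q u = (if u \<in> V then INF t\<in>{0..}. ?f u t else 0)" for u
    have lb: "- p (sc (-1) u) \<le> ?f u t" if u: "u \<in> V" and t: "t \<ge> 0" for u t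
    proof -
      have "pl (pl u (sc t v)) (sc (-1) u) = pl (sc t v) (pl u (sc (-1) u))"
        using u uv by (simp only: pl_comm[of u "sc t v"] pl_assoc sc_closed)
      then have "sc t v = pl (pl u (sc t v)) (sc (-1) u)"
        using u uv by (simp only: sc_neg pl_comm[of "sc t v" z] sc_closed z_closed pl_zero)
      then have "t * p v \<le> p (pl u (sc t v)) + p (sc (-1) u)"
        using P(1)[of "pl u (sc t v)" "sc (-1) u"] P(2)[OF uv(2) t] u uv by (simp add: pl_closed sc_closed)
      then show ?thesis by linarith
    qed
    have bdd: "bdd_below (?f u ` {0..})" if "u \<in> V" for u using lb that by (intro bdd_belowI2) auto
    have qle: "q u \<le> ?f u t" if "u \<in> V" "t \<ge> 0" for u t
      using that bdd by (auto simp: q_def intro: cINF_lower)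
    have ge: "c \<le> q u" if "u \<in> V" "\<And>t. t \<ge> 0 \<Longrightarrow> c \<le> ?f u t" for c u
      using that by (auto simp: q_def intro: cINF_greatest)
    have q0: "q u = 0" if "u \<notin> V" for u using that by (simp add: q_def)
    have qp: "q u \<le> p u" for u
      using qle[of u 0] by (cases "u \<in> V") (auto simp: sc_zero uv pl_comm[of u z] z_closed pl_zero q_def pV)
    have sub: "q (pl a b) \<le> q a + q b" if ab: "a \<in> V" "b \<in> V" for a b
    proof -
      have 1: "q (pl a b) \<le> ?f a s + ?f b t" if st: "s \<ge> 0" "t \<ge> 0" for s t
      proof -
        have eq: "pl (pl a b) (sc (s + t) v) = pl (pl a (sc s v)) (pl b (sc t v))"
          using ab uv by (simp only: sc_add pl_interchange sc_closed)
        have "q (pl a b) \<le> ?f (pl a b) (s + t)" using ab st by (intro qle) (auto simp: pl_closed)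
        also have "p (pl (pl a b) (sc (s + t) v)) \<le> p (pl a (sc s v)) + p (pl b (sc t v))"
          unfolding eq using ab uv by (intro P(1)) (auto simp: pl_closed sc_closed)
        finally show ?thesis by (simp add: algebra_simps)
      qed
      have "q (pl a b) - ?f b t \<le> q a" if "t \<ge> 0" for t
      proof (rule ge[OF ab(1)])
        fix s :: real assume "s \<ge> 0" then show "q (pl a b) - ?f b t \<le> ?f a s" using 1[of s t] that by linarith
      qed
      then have "q (pl a b) - q a \<le> q b" by (intro ge[OF ab(2)]) (smt (verit))
      then show ?thesis by linarith
    qed
    have hom: "q (sc r a) = r * q a" if a: "a \<in> V" and r: "r \<ge> 0" for a r
    proof (cases "r = 0")
      case True
      have "0 \<le> q z" using uv P(2) by (intro ge) (auto simp: z_closed pl_zero sc_closed)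
      then have "q z = 0" using qp[of z] P(3) by simp
      then show ?thesis using True by (simp add: sc_zero a)
    next
      case rn: False
      have le: "s * q w \<le> q (sc s w)" if w: "w \<in> V" and s: "s > 0" for s w
      proof (rule ge)
        show "sc s w \<in> V" using w by (simp add: sc_closed)
        fix t :: real assume t: "t \<ge> 0"
        have "pl (sc s w) (sc t v) = sc s (pl w (sc (t / s) v))"
          using w uv s by (simp add: sc_pl sc_closed sc_sc)
        then have "?f (sc s w) t = s * ?f w (t / s)"
          using P(2)[of "pl w (sc (t/s) v)" s] w uv s by (simp add: pl_closed sc_closed algebra_simps)
        moreover have "q w \<le> ?f w (t / s)" using t s w by (intro qle) auto
        ultimately show "s * q w \<le> ?f (sc s w) t" using s by simp
      qed
      have "(1/r) * q (sc r a) \<le> q (sc (1/r) (sc r a))" using r rn a by (intro le) (auto simp: sc_closed)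
      then have "q (sc r a) \<le> r * q a" using r rn a by (simp add: sc_sc sc_one field_simps)
      then show ?thesis using le[OF a, of r] r rn by simp
    qed
    have "q \<in> minorants p0" unfolding minorants_def sublinear_def
      using sub hom order_trans[OF qp pp0] q0 by auto
    then have "q = p" using min qp by blast
    then show ?thesis using qle[OF uv(1), of 1] by (simp add: sc_one uv)
  qed
  have add: "p (pl u v) = p u + p v" if "u \<in> V" "v \<in> V" for u v
    using super[OF that] P(1)[OF that] by linarith
  have "p (sc r u) = r * p u" if u: "u \<in> V" for u r
  proof (cases "r \<ge> 0")
    case True then show ?thesis using P(2) u by blast
  next
    case False
    have "sc r u = sc (-1) (sc (-r) u)" using u by (simp add: sc_sc)
    moreover have "p (sc (-r) u) + p (sc (-1) (sc (-r) u)) = 0"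
      using add[of "sc (-r) u" "sc (-1) (sc (-r) u)"] sc_neg[of "sc (-r) u"] u P(3) by (simp add: sc_closed)
    moreover have "p (sc (-r) u) = - r * p u" using P(2)[OF u, of "-r"] False by simp
    ultimately show ?thesis by simp
  qed
  then show ?thesis using add pp0 by blast
qed

end

section \<open>Extending a measure to positive functionals\<close>

context cstar_algebra
begin

definition re_part :: "'a \<Rightarrow> 'a" where "re_part d = (1/2) \<odot> (d \<oplus> adj A d)"
definition im_part :: "'a \<Rightarrow> 'a" where "im_part d = (-\<i>/2) \<odot> (d \<ominus> adj A d)"

lemma re_part_selfadj: "d \<in> carrier A \<Longrightarrow> selfadj (re_part d)"
  unfolding re_part_def selfadj_def by (simp add: adj_scale adj_add adj_adj adj_closed scale_closed a_comm)

lemma im_part_selfadj: "d \<in> carrier A \<Longrightarrow> selfadj (im_part d)"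
  unfolding im_part_def selfadj_def
  by (simp add: adj_scale adj_minus adj_adj adj_closed scale_closed)
     (simp add: minus_scale scale_add_right scale_scale adj_closed scale_closed a_comm)

lemma re_part_add: "d \<in> carrier A \<Longrightarrow> e \<in> carrier A \<Longrightarrow> re_part (d \<oplus> e) = re_part d \<oplus> re_part e"
  unfolding re_part_def
  by (simp add: scale_add_right adj_add adj_closed scale_closed) (simp add: a_assoc a_comm a_lcomm adj_closed scale_closed)

lemma im_part_add: "d \<in> carrier A \<Longrightarrow> e \<in> carrier A \<Longrightarrow> im_part (d \<oplus> e) = im_part d \<oplus> im_part e"
  unfolding im_part_def
  by (simp add: minus_scale scale_add_right adj_add adj_closed scale_closed)
     (simp add: a_assoc a_comm a_lcomm adj_closed scale_closed)

lemma re_part_scale: "d \<in> carrier A \<Longrightarrow> re_part (complex_of_real r \<odot> d) = complex_of_real r \<odot> re_part d"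
  unfolding re_part_def by (simp add: scale_add_right adj_scale adj_closed scale_closed scale_scale mult.commute)

lemma im_part_scale: "d \<in> carrier A \<Longrightarrow> im_part (complex_of_real r \<odot> d) = complex_of_real r \<odot> im_part d"
  unfolding im_part_def
  by (simp add: minus_scale scale_add_right adj_scale adj_closed scale_closed scale_scale mult.commute)

lemma re_part_i: "d \<in> carrier A \<Longrightarrow> re_part (\<i> \<odot> d) = complex_of_real (-1) \<odot> im_part d"
  unfolding re_part_def im_part_def
  by (simp add: minus_scale scale_add_right adj_scale adj_closed scale_closed scale_scale)

lemma im_part_i: "d \<in> carrier A \<Longrightarrow> im_part (\<i> \<odot> d) = re_part d"
  unfolding re_part_def im_part_def
  by (simp add: minus_scale scale_add_right adj_scale adj_closed scale_closed scale_scale)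

lemma re_im_part_of_selfadj:
  assumes h: "selfadj h" shows "re_part h = h" "im_part h = \<zero>"
proof -
  note [simp] = selfadjD[OF h]
  have "h \<oplus> h = 2 \<odot> h" using scale_add_left[of h 1 1] by (simp add: scale_one)
  then show "re_part h = h" unfolding re_part_def by (simp add: scale_scale scale_one)
  show "im_part h = \<zero>" unfolding im_part_def by (simp add: a_minus_def r_neg scale_zero_right)
qed

text \<open>If J embeds the real functions on X and reflects positivity, each evaluation f \<mapsto> f x extends to a state
of A, and integrating such states over B would give W B. A measurable choice of states is avoided by applying
the Hahn-Banach theorem once, on the space V of bounded functions F from X to the self-adjoint part of A. The
dominating functional p0 integrates pointwise upper bounds: h is admissible if for each x some f with
J f \<ge> F x satisfies f x \<le> h x. For a dominated linear functional L put W B d = L (1_B d). Then W B is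
positive since p0 (- F) \<le> 0 for positive F. Moreover L (1_B (J f)) is at most the integral of f over B, and
equality follows from the same bound for - f. Additivity in B is linearity of L.\<close>

theorem measured_extension:
  fixes J :: "('x::topological_space \<Rightarrow> real) \<Rightarrow> 'a" and M :: "'x measure"
  assumes M: "prob_space M" "sets M = sets borel" and X: "compact (UNIV :: 'x set)"
    and Jsa: "\<And>f. continuous_on UNIV f \<Longrightarrow> selfadj (J f)"
    and Jadd: "\<And>f g. continuous_on UNIV f \<Longrightarrow> continuous_on UNIV g \<Longrightarrow> J (\<lambda>y. f y + g y) = J f \<oplus> J g"
    and Jscale: "\<And>f r. continuous_on UNIV f \<Longrightarrow> J (\<lambda>y. r * f y) = complex_of_real r \<odot> J f"
    and Jone: "J (\<lambda>_. 1) = \<one>"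
    and Jpos: "\<And>f. continuous_on UNIV f \<Longrightarrow> positive (J f) \<Longrightarrow> (\<forall>y. 0 \<le> f y)"
  shows "\<exists>W. (\<forall>B. positive_functional (W B)) \<and>
     (\<forall>B\<in>sets M. \<forall>f. continuous_on UNIV f \<longrightarrow> W B (J f) = complex_of_real (\<integral>x. indicator B x * f x \<partial>M)) \<and>
     (\<forall>(K :: 'k set) B d. finite K \<longrightarrow> disjoint_family_on B K \<longrightarrow> d \<in> carrier A \<longrightarrow>
         W (\<Union>a\<in>K. B a) d = (\<Sum>a\<in>K. W (B a) d))"
proof -
  interpret prob_space M by (rule M)
  define V where "V = {F :: 'x \<Rightarrow> 'a. (\<forall>x. selfadj (F x)) \<and> (\<exists>c. \<forall>x. nrm A (F x) \<le> c)}"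
  define pl where "pl F G x = F x \<oplus> G x" for F G :: "'x \<Rightarrow> 'a" and x
  define sc where "sc r F x = complex_of_real r \<odot> F x" for r :: real and F :: "'x \<Rightarrow> 'a" and x
  have Vsa: "F \<in> V \<Longrightarrow> selfadj (F x)" and Vc: "F \<in> V \<Longrightarrow> F x \<in> carrier A" for F x
    by (auto simp: V_def selfadjD)
  have space: "space M = UNIV" using M(2) sets_eq_imp_space_eq by fastforce
  have Jc: "continuous_on UNIV f \<Longrightarrow> J f \<in> carrier A" for f using Jsa selfadjD by blast
  have J0: "J (\<lambda>_. 0) = \<zero>" using Jscale[of "\<lambda>_. 1" 0] Jone by (simp add: scale_zero_left)
  have Jconst: "J (\<lambda>_. c) = complex_of_real c \<odot> \<one>" for c using Jscale[of "\<lambda>_. 1" c] Jone by simp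
  interpret real_vector_carrier V pl sc "\<lambda>_. \<zero>"
  proof
    fix u v w :: "'x \<Rightarrow> 'a" and r s :: real
    assume u: "u \<in> V"
    note [simp] = Vc[OF u] scale_closed
    show "sc r u \<in> V"
    proof -
      obtain c where c: "\<And>x. nrm A (u x) \<le> c" using u by (auto simp: V_def)
      have "nrm A (sc r u x) \<le> \<bar>r\<bar> * c" for x using c[of x] by (simp add: sc_def nrm_scale mult_left_mono)
      then show ?thesis using u selfadj_scale by (auto simp: V_def sc_def[abs_def])
    qed
    show "pl (\<lambda>_. \<zero>) u = u" by (simp add: pl_def[abs_def])
    show "sc (r + s) u = pl (sc r u) (sc s u)" "sc r (sc s u) = sc (r * s) u" "sc 1 u = u" "sc 0 u = (\<lambda>_. \<zero>)"
      by (simp_all add: pl_def[abs_def] sc_def[abs_def] scale_add_left scale_scale scale_one scale_zero_left)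
    assume v: "v \<in> V"
    note [simp] = Vc[OF v]
    show "pl u v \<in> V"
    proof -
      obtain c d where c: "\<And>x. nrm A (u x) \<le> c" "\<And>x. nrm A (v x) \<le> d" using u v by (auto simp: V_def)
      have "nrm A (pl u v x) \<le> c + d" for x using c[of x] nrm_triangle[of "u x" "v x"] by (auto simp: pl_def intro: order_trans)
      then show ?thesis using u v selfadj_add by (auto simp: V_def pl_def[abs_def])
    qed
    show "pl u v = pl v u" "sc r (pl u v) = pl (sc r u) (sc r v)"
      by (simp_all add: pl_def[abs_def] sc_def[abs_def] scale_add_right a_comm)
    assume w: "w \<in> V"
    show "pl (pl u v) w = pl u (pl v w)" using Vc[OF w] by (simp add: pl_def[abs_def] a_assoc)
  next
    show "(\<lambda>_. \<zero>) \<in> V" by (auto simp: V_def selfadj_def adj_zero nrm_zero)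
  qed
  define maj where "maj F = {h. integrable M h \<and> (\<forall>x. \<exists>f. continuous_on UNIV f \<and> positive (J f \<ominus> F x) \<and> f x \<le> h x)}" for F
  define p0 where "p0 F = (INF h\<in>maj F. \<integral>x. h x \<partial>M)" for F
  \<comment> \<open>Constant upper bounds show that p0 is defined on all of V.\<close>
  have const_maj: "(\<lambda>_. c) \<in> maj F" if "F \<in> V" "\<And>x. nrm A (F x) \<le> c" for F c
    unfolding maj_def using that Vsa by (auto intro!: exI[of _ "\<lambda>_. c"] simp: Jconst positive_t_minus)
  have maj_ne: "maj F \<noteq> {}" if F: "F \<in> V" for F
  proof -
    obtain c where "\<And>x. nrm A (F x) \<le> c" using F by (auto simp: V_def)
    then show ?thesis using const_maj[OF F] by blast
  qed
  \<comment> \<open>Here positivity is reflected from A to functions: J (f + c) is positive, so f + c is nonnegative.\<close>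
  have maj_lb: "- c \<le> (\<integral>x. h x \<partial>M)" if F: "F \<in> V" "\<And>x. nrm A (F x) \<le> c" and h: "h \<in> maj F" for F c h
  proof -
    have "- c \<le> h x" for x
    proof -
      obtain f where f: "continuous_on UNIV f" "positive (J f \<ominus> F x)" "f x \<le> h x" using h by (auto simp: maj_def)
      have Fc: "F x \<in> carrier A" using Vc F by blast
      have "selfadj (complex_of_real (-1) \<odot> F x)" by (rule selfadj_scale[OF Vsa[OF F(1)]])
      then have "positive (complex_of_real c \<odot> \<one> \<ominus> complex_of_real (-1) \<odot> F x)"
        using F Fc by (intro positive_t_minus) (auto simp: nrm_scale)
      also have "complex_of_real c \<odot> \<one> \<ominus> complex_of_real (-1) \<odot> F x = complex_of_real c \<odot> \<one> \<oplus> F x"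
        using Fc by (simp add: scale_uminus_one a_minus_def)
      finally have "positive ((J f \<ominus> F x) \<oplus> (complex_of_real c \<odot> \<one> \<oplus> F x))" using f(2) positive_add by blast
      also have "(J f \<ominus> F x) \<oplus> (complex_of_real c \<odot> \<one> \<oplus> F x) = J f \<oplus> J (\<lambda>_. c)"
        using Fc Jc[OF f(1)] by (simp add: Jconst a_minus_def a_assoc a_lcomm[of "\<ominus> F x"] l_neg scale_closed)
      also have "\<dots> = J (\<lambda>y. f y + c)" using f(1) by (simp add: Jadd)
      finally have "0 \<le> f x + c" using Jpos[of "\<lambda>y. f y + c"] continuous_on_add[OF f(1) continuous_on_const] by blast
      then show ?thesis using f(3) by simp
    qed
    moreover have "integrable M h" using h by (simp add: maj_def)
    ultimately have "(\<integral>x. - c \<partial>M) \<le> (\<integral>x. h x \<partial>M)" by (intro integral_mono) auto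
    then show ?thesis by (simp add: prob_space)
  qed
  have bdd: "bdd_below ((\<lambda>h. \<integral>x. h x \<partial>M) ` maj F)" if F: "F \<in> V" for F
  proof -
    obtain c where "\<And>x. nrm A (F x) \<le> c" using F by (auto simp: V_def)
    then show ?thesis using maj_lb[OF F] by (intro bdd_belowI2) auto
  qed
  have p0_le: "p0 F \<le> (\<integral>x. h x \<partial>M)" if "F \<in> V" "h \<in> maj F" for F h
    unfolding p0_def using that bdd by (intro cINF_lower)
  have p0_ge: "c \<le> p0 F" if "F \<in> V" "\<And>h. h \<in> maj F \<Longrightarrow> c \<le> (\<integral>x. h x \<partial>M)" for F c
    unfolding p0_def using that maj_ne by (intro cINF_greatest) auto
  have p0_zero: "p0 (\<lambda>_. \<zero>) = 0"
  proof (rule antisym)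
    show "p0 (\<lambda>_. \<zero>) \<le> 0" using p0_le[OF z_closed const_maj[OF z_closed, of 0]] by (simp add: nrm_zero)
    show "0 \<le> p0 (\<lambda>_. \<zero>)" using maj_lb[OF z_closed, of 0] by (intro p0_ge[OF z_closed]) (simp add: nrm_zero)
  qed
  have "sublinear p0" unfolding sublinear_def
  proof (intro conjI ballI allI impI)
    fix F G assume F: "F \<in> V" and G: "G \<in> V"
    have 1: "p0 (pl F G) \<le> (\<integral>x. h x \<partial>M) + (\<integral>x. k x \<partial>M)" if h: "h \<in> maj F" and k: "k \<in> maj G" for h k
    proof -
      have "(\<lambda>x. h x + k x) \<in> maj (pl F G)" unfolding maj_def
      proof (intro CollectI conjI allI)
        show "integrable M (\<lambda>x. h x + k x)" using h k by (auto simp: maj_def)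
        fix x
        obtain f where f: "continuous_on UNIV f" "positive (J f \<ominus> F x)" "f x \<le> h x" using h by (auto simp: maj_def)
        obtain g where g: "continuous_on UNIV g" "positive (J g \<ominus> G x)" "g x \<le> k x" using k by (auto simp: maj_def)
        have "J (\<lambda>y. f y + g y) \<ominus> pl F G x = (J f \<ominus> F x) \<oplus> (J g \<ominus> G x)"
          using Jc[OF f(1)] Jc[OF g(1)] Vc[OF F] Vc[OF G] f g
          by (simp add: Jadd pl_def a_minus_def minus_add a_assoc a_lcomm)
        then have "positive (J (\<lambda>y. f y + g y) \<ominus> pl F G x)" using f g positive_add by simp
        then show "\<exists>f. continuous_on UNIV f \<and> positive (J f \<ominus> pl F G x) \<and> f x \<le> h x + k x"
          using f g by (intro exI[of _ "\<lambda>y. f y + g y"]) (auto intro: continuous_intros)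
      qed
      then have "p0 (pl F G) \<le> (\<integral>x. h x + k x \<partial>M)" using F G by (intro p0_le pl_closed)
      then show ?thesis using h k by (simp add: maj_def)
    qed
    have "p0 (pl F G) - (\<integral>x. k x \<partial>M) \<le> p0 F" if "k \<in> maj G" for k
      using 1 that by (intro p0_ge[OF F]) (auto simp: algebra_simps)
    then have "p0 (pl F G) - p0 F \<le> p0 G" by (intro p0_ge[OF G]) (smt (verit))
    then show "p0 (pl F G) \<le> p0 F + p0 G" by linarith
  next
    fix F and r :: real assume F: "F \<in> V" and r: "r \<ge> 0"
    show "p0 (sc r F) = r * p0 F"
    proof (cases "r = 0")
      case True then show ?thesis using p0_zero F by (simp add: sc_zero)
    next
      case rn: False
      have le: "p0 (sc s G) \<le> s * p0 G" if G: "G \<in> V" and s: "s > 0" for G s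
      proof -
        have "p0 (sc s G) \<le> s * (\<integral>x. h x \<partial>M)" if h: "h \<in> maj G" for h
        proof -
          have "(\<lambda>x. s * h x) \<in> maj (sc s G)" unfolding maj_def
          proof (intro CollectI conjI allI)
            show "integrable M (\<lambda>x. s * h x)" using h by (auto simp: maj_def)
            fix x
            obtain f where f: "continuous_on UNIV f" "positive (J f \<ominus> G x)" "f x \<le> h x" using h by (auto simp: maj_def)
            have "J (\<lambda>y. s * f y) \<ominus> sc s G x = complex_of_real s \<odot> (J f \<ominus> G x)"
              using Jc[OF f(1)] Vc[OF G] f by (simp add: Jscale sc_def scale_minus)
            then have "positive (J (\<lambda>y. s * f y) \<ominus> sc s G x)" using f positive_scale s by simp
            then show "\<exists>f. continuous_on UNIV f \<and> positive (J f \<ominus> sc s G x) \<and> f x \<le> s * h x"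
              using f s by (intro exI[of _ "\<lambda>y. s * f y"]) (auto intro: continuous_intros)
          qed
          then have "p0 (sc s G) \<le> (\<integral>x. s * h x \<partial>M)" using G by (intro p0_le sc_closed)
          then show ?thesis by simp
        qed
        then have "(1/s) * p0 (sc s G) \<le> p0 G" using s by (intro p0_ge[OF G]) (simp add: field_simps)
        then show ?thesis using s by (simp add: field_simps)
      qed
      have "p0 (sc (1/r) (sc r F)) \<le> (1/r) * p0 (sc r F)" using F r rn by (intro le sc_closed) auto
      then have "r * p0 F \<le> p0 (sc r F)" using F r rn by (simp add: sc_sc sc_one field_simps)
      then show ?thesis using le[OF F, of r] r rn by simp
    qed
  qed
  then obtain L where Ladd: "\<And>u v. u \<in> V \<Longrightarrow> v \<in> V \<Longrightarrow> L (pl u v) = L u + L v"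
    and Lsc: "\<And>u r. u \<in> V \<Longrightarrow> L (sc r u) = r * L u" and Lle: "\<And>u. u \<in> V \<Longrightarrow> L u \<le> p0 u"
    using dominated_linear_functional by blast
  have Lz: "L (\<lambda>_. \<zero>) = 0" using Lsc[OF z_closed, of 0] sc_zero[OF z_closed] by simp
  have Lpos: "0 \<le> L F" if F: "F \<in> V" "\<And>x. positive (F x)" for F
  proof -
    have "(\<lambda>_. 0) \<in> maj (sc (-1) F)" unfolding maj_def
    proof (intro CollectI conjI allI)
      fix x
      have "J (\<lambda>_. 0) \<ominus> sc (-1) F x = F x"
        using Vc[OF F(1)] by (simp add: J0 sc_def scale_uminus_one a_minus_def)
      then show "\<exists>f. continuous_on UNIV f \<and> positive (J f \<ominus> sc (-1) F x) \<and> f x \<le> 0"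
        using F by (intro exI[of _ "\<lambda>_. 0"]) auto
    qed auto
    from p0_le[OF sc_closed[OF F(1)] this] have "p0 (sc (-1) F) \<le> 0" by simp
    then show ?thesis using Lle[OF sc_closed[OF F(1), of "-1"]] Lsc[OF F(1), of "-1"] by simp
  qed
  define G where "G B h x = (if x \<in> B then h else \<zero>)" for B :: "'x set" and h x
  have GV: "G B h \<in> V" if h: "selfadj h" for B h
    unfolding V_def G_def using h selfadjD(1)[OF h] nrm_nonneg[of h]
    by (auto simp: selfadj_def adj_zero nrm_zero intro!: exI[of _ "nrm A h"])
  have Gadd: "G B (h \<oplus> k) = pl (G B h) (G B k)" if "selfadj h" "selfadj k" for B h k
    using that by (auto simp: G_def pl_def fun_eq_iff)
  have Gsc: "G B (complex_of_real r \<odot> h) = sc r (G B h)" for B h r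
    by (auto simp: G_def sc_def fun_eq_iff scale_zero_right)
  define ell where "ell B h = L (G B h)" for B h
  have ladd: "ell B (h \<oplus> k) = ell B h + ell B k" if "selfadj h" "selfadj k" for B h k
    using that by (simp add: ell_def Gadd Ladd GV)
  have lsc: "ell B (complex_of_real r \<odot> h) = r * ell B h" if "selfadj h" for B h r
    using that by (simp add: ell_def Gsc Lsc GV)
  have lpos: "0 \<le> ell B h" if h: "positive h" for B h
  proof -
    have "positive \<zero>" unfolding positive_def by (intro bexI[of _ \<zero>]) (auto simp: adj_zero)
    then show ?thesis unfolding ell_def using h by (intro Lpos GV) (auto simp: positive_selfadj G_def)
  qed
  have lzero: "ell B \<zero> = 0" for B 
  proof -
    have "G B \<zero> = (\<lambda>_. \<zero>)" by (simp add: G_def fun_eq_iff)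
    then show ?thesis unfolding ell_def using Lz by simp
  qed
  have lle: "ell B (J f) \<le> (\<integral>x. indicator B x * f x \<partial>M)" if B: "B \<in> sets M" and f: "continuous_on UNIV f" for B f
  proof -
    have "(\<lambda>x. indicator B x * f x) \<in> maj (G B (J f))" unfolding maj_def
    proof (intro CollectI conjI allI)
      have "compact (f ` UNIV)" using f X by (rule compact_continuous_image)
      then have "bounded (range f)" by (rule compact_imp_bounded)
      then obtain c where c: "\<And>x. \<bar>f x\<bar> \<le> c" by (auto simp: bounded_iff)
      have "f \<in> borel_measurable borel" using f by (rule borel_measurable_continuous_onI)
      then have fm: "f \<in> borel_measurable M" using M(2) by (simp cong: measurable_cong_sets)
      show "integrable M (\<lambda>x. indicator B x * f x)"
        using B fm c by (intro integrable_const_bound[of _ c]) (auto simp: indicator_def intro: order_trans[OF abs_ge_zero])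
      fix x
      have z: "J f \<ominus> J f = \<zero>" "\<zero> \<ominus> \<zero> = \<zero>" using Jc[OF f] by (simp_all add: a_minus_def r_neg)
      have "positive \<zero>" unfolding positive_def by (intro bexI[of _ \<zero>]) (auto simp: adj_zero)
      then show "\<exists>g. continuous_on UNIV g \<and> positive (J g \<ominus> G B (J f) x) \<and> g x \<le> indicator B x * f x"
        using f z J0 by (cases "x \<in> B") (auto simp: G_def intro: exI[of _ f] exI[of _ "\<lambda>_. 0"])
    qed
    then show ?thesis using Lle[OF GV[OF Jsa[OF f]]] p0_le[OF GV[OF Jsa[OF f]]] unfolding ell_def by (meson order_trans)
  qed
  have leq: "ell B (J f) = (\<integral>x. indicator B x * f x \<partial>M)" if B: "B \<in> sets M" and f: "continuous_on UNIV f" for B f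
  proof (rule antisym[OF lle[OF that]])
    have "ell B (J (\<lambda>y. (-1) * f y)) \<le> (\<integral>x. indicator B x * ((-1) * f x) \<partial>M)"
      using f by (intro lle[OF B]) (auto intro: continuous_intros)
    also have "J (\<lambda>y. (-1) * f y) = complex_of_real (-1) \<odot> J f" by (rule Jscale[OF f])
    also have "ell B (complex_of_real (-1) \<odot> J f) = - ell B (J f)" using lsc[OF Jsa[OF f], of B "-1"] by simp
    finally show "(\<integral>x. indicator B x * f x \<partial>M) \<le> ell B (J f)" by simp
  qed
  have lunion: "ell (\<Union>a\<in>K. B a) h = (\<Sum>a\<in>K. ell (B a) h)"
    if "finite K" "disjoint_family_on B K" and h: "selfadj h" for K :: "'k set" and B h
    using that(1,2)
  proof (induction K rule: finite_induct)
    case empty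
    have "G {} h = (\<lambda>_. \<zero>)" by (simp add: G_def fun_eq_iff)
    then show ?case by (simp add: ell_def Lz)
  next
    case (insert a K)
    have disj: "B a \<inter> (\<Union>a\<in>K. B a) = {}" using insert by (auto simp: disjoint_family_on_def)
    have "G (\<Union>a\<in>insert a K. B a) h = pl (G (B a) h) (G (\<Union>a\<in>K. B a) h)"
    proof
      fix x
      show "G (\<Union>a\<in>insert a K. B a) h x = pl (G (B a) h) (G (\<Union>a\<in>K. B a) h) x"
        using disj selfadjD(1)[OF h] unfolding G_def pl_def by (cases "x \<in> B a"; cases "x \<in> (\<Union>a\<in>K. B a)") auto
    qed
    moreover have "disjoint_family_on B K" using insert.prems by (auto simp: disjoint_family_on_def)
    ultimately show ?case using insert h by (simp add: ell_def Ladd GV)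
  qed
  define W where "W B d = complex_of_real (ell B (re_part d)) + \<i> * complex_of_real (ell B (im_part d))" for B d
  have Wadd: "W B (d \<oplus> e) = W B d + W B e" if "d \<in> carrier A" "e \<in> carrier A" for B d e
    using that unfolding W_def
    by (simp add: re_part_add im_part_add ladd re_part_selfadj im_part_selfadj) (simp add: algebra_simps)
  have Wr: "W B (complex_of_real r \<odot> d) = r * W B d" if "d \<in> carrier A" for B r d
    using that unfolding W_def
    by (simp add: re_part_scale im_part_scale lsc re_part_selfadj im_part_selfadj) (simp add: algebra_simps)
  have Wi: "W B (\<i> \<odot> d) = \<i> * W B d" if d: "d \<in> carrier A" for B d
    unfolding W_def re_part_i[OF d] im_part_i[OF d] lsc[OF im_part_selfadj[OF d]]
    by (simp add: algebra_simps)
  have Wc: "W B (c \<odot> d) = c * W B d" if d: "d \<in> carrier A" for B c d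
  proof -
    have c: "complex_of_real (Re c) + \<i> * complex_of_real (Im c) = c" by (rule complex_eq[symmetric])
    have "c \<odot> d = (complex_of_real (Re c) + \<i> * complex_of_real (Im c)) \<odot> d" by (subst c) (rule refl)
    also have "\<dots> = complex_of_real (Re c) \<odot> d \<oplus> \<i> \<odot> (complex_of_real (Im c) \<odot> d)"
      using d by (simp add: scale_add_left scale_scale)
    finally have "W B (c \<odot> d) = complex_of_real (Re c) * W B d + \<i> * (complex_of_real (Im c) * W B d)"
      using d by (simp add: Wadd Wr Wi scale_closed)
    also have "\<dots> = (complex_of_real (Re c) + \<i> * complex_of_real (Im c)) * W B d" by (simp add: algebra_simps)
    finally show ?thesis unfolding c .
  qed
  have Wsa: "W B h = complex_of_real (ell B h)" if "selfadj h" for B h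
    using re_im_part_of_selfadj[OF that] by (simp add: W_def lzero)
  have "positive_functional (W B)" for B
    unfolding positive_functional_def linear_functional_def
  proof (intro conjI ballI allI)
    fix x assume x: "x \<in> carrier A"
    show "W B (adj A x \<otimes> x) \<in> \<real>\<^sub>\<ge>\<^sub>0"
      unfolding Wsa[OF selfadj_adj_mult[OF x]] using lpos[OF positive_adj_mult[OF x]] by simp
  qed (use Wadd Wc in auto)
  moreover have "W B (J f) = complex_of_real (\<integral>x. indicator B x * f x \<partial>M)" if "B \<in> sets M" "continuous_on UNIV f" for B f
    using Wsa[OF Jsa[OF that(2)]] leq[OF that] by simp
  moreover have "W (\<Union>a\<in>K. B a) d = (\<Sum>a\<in>K. W (B a) d)"
    if "finite K" "disjoint_family_on B K" "d \<in> carrier A" for K :: "'k set" and B d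
    unfolding W_def lunion[OF that(1,2) re_part_selfadj[OF that(3)]] lunion[OF that(1,2) im_part_selfadj[OF that(3)]]
    by (simp add: sum.distrib sum_distrib_left)
  ultimately show ?thesis by blast
qed

end

section \<open>Shannon entropy of words\<close>

text \<open>From ln u \<le> u - 1.\<close>

lemma gibbs_inequality:
  fixes p q :: "'j \<Rightarrow> real"
  assumes "\<And>j. j \<in> J \<Longrightarrow> p j \<ge> 0" "\<And>j. j \<in> J \<Longrightarrow> q j \<ge> 0" "\<And>j. j \<in> J \<Longrightarrow> p j > 0 \<Longrightarrow> q j > 0"
    and "sum q J \<le> sum p J"
  shows "(\<Sum>j\<in>J. p j * ln (q j / p j)) \<le> 0"
proof -
  have "p j * ln (q j / p j) \<le> q j - p j" if j: "j \<in> J" for j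
  proof (cases "p j = 0")
    case False
    then have pq: "p j > 0" "q j > 0" using assms(1,3)[OF j] by auto
    then have "ln (q j / p j) \<le> q j / p j - 1" by (intro ln_le_minus_one) auto
    then have "p j * ln (q j / p j) \<le> p j * (q j / p j - 1)" using pq by (intro mult_left_mono) auto
    also have "p j * (q j / p j - 1) = q j - p j" using pq by (simp add: right_diff_distrib)
    finally show ?thesis .
  qed (use assms(2)[OF j] in simp)
  then have "(\<Sum>j\<in>J. p j * ln (q j / p j)) \<le> (\<Sum>j\<in>J. q j - p j)" by (rule sum_mono)
  then show ?thesis using assms(4) by (simp add: sum_subtractf)
qed

definition shannon :: "'i set \<Rightarrow> ('i \<Rightarrow> real) \<Rightarrow> real" where
  "shannon I p = - (\<Sum>i\<in>I. p i * ln (p i))"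

text \<open>The entropy of the second coordinate i given the first coordinate a, for the joint distribution p.\<close>

definition cond_shannon :: "'k set \<Rightarrow> 'l set \<Rightarrow> ('k \<Rightarrow> 'l \<Rightarrow> real) \<Rightarrow> real" where
  "cond_shannon K L p = - (\<Sum>(a,i)\<in>K\<times>L. p a i * ln (p a i / (\<Sum>j\<in>L. p a j)))"

text \<open>A crude substitute for Fano's inequality, for joint distributions whose off-diagonal entries are at most \<eta>. A
diagonal term is at most s - p, the off-diagonal mass of its row; an off-diagonal term is at most
2 (sqrt (p a i)), because - ln r \<le> 1 / r for r = sqrt (p a i).\<close>

lemma cond_shannon_le:
  fixes p :: "'k \<Rightarrow> 'k \<Rightarrow> real"
  assumes K: "finite K" and p: "\<And>a i. a \<in> K \<Longrightarrow> i \<in> K \<Longrightarrow> p a i \<ge> 0"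
    and le1: "\<And>a. a \<in> K \<Longrightarrow> (\<Sum>i\<in>K. p a i) \<le> 1"
    and off: "\<And>a i. a \<in> K \<Longrightarrow> i \<in> K \<Longrightarrow> a \<noteq> i \<Longrightarrow> p a i \<le> \<eta>" and \<eta>: "\<eta> \<ge> 0"
  shows "cond_shannon K K p \<le> (real (card K))\<^sup>2 * (\<eta> + 2 * sqrt \<eta>)"
proof -
  define s where "s a = (\<Sum>i\<in>K. p a i)" for a
  have ps: "p a i \<le> s a" if "a \<in> K" "i \<in> K" for a i
    unfolding s_def using that p K by (intro member_le_sum) auto
  define b where "b a i = (if a = i then real (card K) * \<eta> else 2 * sqrt \<eta>)" for a i :: 'k
  have "- (p a i * ln (p a i / s a)) \<le> b a i" if ai: "a \<in> K" "i \<in> K" for a i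
  proof (cases "p a i = 0")
    case True
    then show ?thesis using \<eta> by (simp add: b_def)
  next
    case False
    then have pos: "p a i > 0" "s a > 0" using p[OF ai] ps[OF ai] by auto
    show ?thesis
    proof (cases "a = i")
      case True
      have "ln (s a / p a i) \<le> s a / p a i - 1" using pos by (intro ln_le_minus_one) auto
      then have "p a i * ln (s a / p a i) \<le> p a i * (s a / p a i - 1)" using pos by (intro mult_left_mono) auto
      also have "\<dots> = s a - p a i" using pos by (simp add: field_simps)
      also have "\<dots> = (\<Sum>j\<in>K-{i}. p a j)" unfolding s_def using K ai by (simp add: sum.remove[of K i])
      also have "\<dots> \<le> (\<Sum>j\<in>K-{i}. \<eta>)" using off ai True by (intro sum_mono) auto
      also have "\<dots> \<le> real (card K) * \<eta>" using \<eta> K by (simp add: mult_right_mono card_Diff1_le)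
      finally show ?thesis using pos True by (simp add: b_def ln_div algebra_simps)
    next
      case False
      have s1: "s a \<le> 1" using le1[OF ai(1)] by (simp add: s_def)
      define r where "r = sqrt (p a i)"
      have r: "r > 0" and rr: "p a i = r * r" using pos by (simp_all add: r_def)
      have "ln (1 / r) \<le> 1 / r - 1" using r by (intro ln_le_minus_one) auto
      then have "r * r * (2 * ln (1 / r)) \<le> r * r * (2 * (1 / r))" using r by (intro mult_left_mono) auto
      then have "- (p a i * ln (p a i)) \<le> 2 * r" using r unfolding rr by (simp add: ln_div ln_mult)
      moreover have "r \<le> sqrt \<eta>" using off[OF ai False] by (simp add: r_def)
      moreover have "p a i * ln (s a) \<le> 0" using pos s1 by (simp add: mult_nonneg_nonpos)
      ultimately show ?thesis using False pos by (simp add: b_def ln_div algebra_simps)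
    qed
  qed
  then have "cond_shannon K K p \<le> (\<Sum>(a,i)\<in>K\<times>K. b a i)"
    unfolding cond_shannon_def s_def[symmetric] sum_negf[symmetric] by (intro sum_mono) auto
  also have "\<dots> = (\<Sum>a\<in>K. \<Sum>i\<in>K. b a i)" by (simp add: sum.cartesian_product)
  also have "\<dots> = (\<Sum>a\<in>K. real (card K) * \<eta> + real (card K - 1) * (2 * sqrt \<eta>))"
  proof (intro sum.cong refl)
    fix a assume a: "a \<in> K"
    have "(\<Sum>i\<in>K-{a}. b a i) = (\<Sum>i\<in>K-{a}. 2 * sqrt \<eta>)" by (intro sum.cong) (auto simp: b_def)
    then show "(\<Sum>i\<in>K. b a i) = real (card K) * \<eta> + real (card K - 1) * (2 * sqrt \<eta>)"
      using K a by (simp add: sum.remove[of K a] b_def)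
  qed
  also have "\<dots> \<le> (\<Sum>a\<in>K. real (card K) * \<eta> + real (card K) * (2 * sqrt \<eta>))"
    using \<eta> by (intro sum_mono add_left_mono mult_right_mono) auto
  also have "\<dots> = (real (card K))\<^sup>2 * (\<eta> + 2 * sqrt \<eta>)" by (simp add: power2_eq_square algebra_simps)
  finally show ?thesis .
qed

abbreviation words :: "nat \<Rightarrow> 'k set \<Rightarrow> (nat \<Rightarrow> 'k) set" where
  "words n K \<equiv> PiE {..<n} (\<lambda>_. K)"

lemma finite_words: "finite K \<Longrightarrow> finite (words n K)"
  by (intro finite_PiE) auto

definition letter_marginal :: "nat \<Rightarrow> 'k set \<Rightarrow> ((nat \<Rightarrow> 'k) \<Rightarrow> (nat \<Rightarrow> 'k) \<Rightarrow> real) \<Rightarrow> nat \<Rightarrow> 'k \<Rightarrow> 'k \<Rightarrow> real" where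
  "letter_marginal n K p j x y = (\<Sum>(a,i)\<in>{(a,i)\<in>words n K \<times> words n K. a j = x \<and> i j = y}. p a i)"

lemma sum_letter_marginal:
  assumes K: "finite K" and j: "j < n"
  shows "(\<Sum>(a,i)\<in>words n K \<times> words n K. p a i * f (a j) (i j)) = (\<Sum>(x,y)\<in>K\<times>K. letter_marginal n K p j x y * f x y)"
proof -
  let ?W = "words n K \<times> words n K"
  let ?g = "\<lambda>(a,i). (a j, i j)"
  have "(\<Sum>xy\<in>K\<times>K. \<Sum>ai\<in>{ai\<in>?W. ?g ai = xy}. case ai of (a,i) \<Rightarrow> p a i * f (a j) (i j))
     = (\<Sum>ai\<in>?W. case ai of (a,i) \<Rightarrow> p a i * f (a j) (i j))"
    using K j finite_words[OF K, of n] by (intro sum.group) (auto simp: PiE_mem)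
  also have "(\<Sum>xy\<in>K\<times>K. \<Sum>ai\<in>{ai\<in>?W. ?g ai = xy}. case ai of (a,i) \<Rightarrow> p a i * f (a j) (i j))
     = (\<Sum>(x,y)\<in>K\<times>K. letter_marginal n K p j x y * f x y)"
    unfolding letter_marginal_def
    by (intro sum.cong) (auto simp: sum_distrib_right intro!: sum.cong)
  finally show ?thesis by simp
qed

text \<open>Subadditivity of conditional entropy: the conditional entropy of a word is at most the sum of those of its letters,
each given only the corresponding letter of the other word. This is Gibbs' inequality against the
subprobability s a (\<Prod>j. r j (a j) (i j)), where s is the first marginal and r j the conditional probability of the
letters at position j.\<close>

theorem cond_shannon_words_le:
  fixes p :: "(nat \<Rightarrow> 'k) \<Rightarrow> (nat \<Rightarrow> 'k) \<Rightarrow> real"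
  assumes K: "finite K" and p: "\<And>a i. a \<in> words n K \<Longrightarrow> i \<in> words n K \<Longrightarrow> p a i \<ge> 0"
  shows "cond_shannon (words n K) (words n K) p \<le> (\<Sum>j<n. cond_shannon K K (letter_marginal n K p j))"
proof -
  let ?W = "words n K"
  have fW: "finite ?W" by (rule finite_words[OF K])
  define P where "P = letter_marginal n K p"
  define s where "s a = (\<Sum>i\<in>?W. p a i)" for a
  define S where "S j x = (\<Sum>y\<in>K. P j x y)" for j x
  define r where "r j x y = P j x y / S j x" for j x y
  have fin: "finite {(a,i)\<in>?W \<times> ?W. a j = x \<and> i j = y}" for j x y
    by (rule finite_subset[of _ "?W \<times> ?W"]) (use fW in auto)
  have P0: "P j x y \<ge> 0" for j x y
    unfolding P_def letter_marginal_def using p by (intro sum_nonneg) auto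
  have pP: "p a i \<le> P j (a j) (i j)" if "a \<in> ?W" "i \<in> ?W" for a i j
  proof -
    have "(case (a,i) of (a,i) \<Rightarrow> p a i) \<le> (\<Sum>(a',i')\<in>{(a',i')\<in>?W \<times> ?W. a' j = a j \<and> i' j = i j}. p a' i')"
      using that p fin by (intro member_le_sum) auto
    then show ?thesis by (simp add: P_def letter_marginal_def)
  qed
  have S0: "S j x \<ge> 0" for j x unfolding S_def using P0 by (intro sum_nonneg) auto
  have PS: "P j x y \<le> S j x" if "y \<in> K" for j x y unfolding S_def using that P0 K by (intro member_le_sum) auto
  have r0: "r j x y \<ge> 0" for j x y unfolding r_def using P0 S0 by simp
  have s0: "s a \<ge> 0" if "a \<in> ?W" for a unfolding s_def using that p by (intro sum_nonneg) auto
  have ps: "p a i \<le> s a" if "a \<in> ?W" "i \<in> ?W" for a i unfolding s_def using that p fW by (intro member_le_sum) auto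
  have rpos: "r j (a j) (i j) > 0" if "a \<in> ?W" "i \<in> ?W" "p a i > 0" "j < n" for a i j
  proof -
    have "P j (a j) (i j) > 0" using pP[OF that(1,2), of j] that by linarith
    moreover have "i j \<in> K" using that by (auto simp: PiE_mem)
    ultimately have "S j (a j) > 0" using PS[of "i j" j "a j"] by linarith
    then show ?thesis using \<open>P j (a j) (i j) > 0\<close> by (simp add: r_def)
  qed
  \<comment> \<open>the comparison measure for the inequality of Gibbs\<close>
  define q where "q = (\<lambda>(a,i). s a * (\<Prod>j<n. r j (a j) (i j)))"
  have "(\<Sum>ai\<in>?W\<times>?W. (case ai of (a,i) \<Rightarrow> p a i) * ln (q ai / (case ai of (a,i) \<Rightarrow> p a i))) \<le> 0"
  proof (rule gibbs_inequality)
    show "\<And>ai. ai \<in> ?W\<times>?W \<Longrightarrow> (case ai of (a,i) \<Rightarrow> p a i) \<ge> 0" using p by auto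
    show "\<And>ai. ai \<in> ?W\<times>?W \<Longrightarrow> q ai \<ge> 0" using s0 r0 by (auto simp: q_def intro!: mult_nonneg_nonneg prod_nonneg)
    fix ai assume "ai \<in> ?W\<times>?W" "(case ai of (a,i) \<Rightarrow> p a i) > 0"
    then obtain a i where ai: "ai = (a,i)" "a \<in> ?W" "i \<in> ?W" "p a i > 0" by auto
    then have "s a > 0" using ps[of a i] by auto
    then show "q ai > 0" using rpos ai by (auto simp: q_def intro!: mult_pos_pos prod_pos)
  next
    have "sum q (?W\<times>?W) = (\<Sum>a\<in>?W. \<Sum>i\<in>?W. s a * (\<Prod>j<n. r j (a j) (i j)))"
      by (simp add: q_def sum.cartesian_product)
    also have "\<dots> = (\<Sum>a\<in>?W. s a * (\<Prod>j<n. \<Sum>y\<in>K. r j (a j) y))"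
      using K by (subst prod_sum_PiE) (auto simp: sum_distrib_left)
    also have "\<dots> \<le> (\<Sum>a\<in>?W. s a * 1)"
    proof (intro sum_mono mult_left_mono s0)
      fix a
      have "(\<Sum>y\<in>K. r j (a j) y) \<le> 1" for j
        unfolding r_def by (simp add: sum_divide_distrib[symmetric] S_def[symmetric] divide_le_eq_1)
      moreover have "(\<Sum>y\<in>K. r j (a j) y) \<ge> 0" for j using r0 by (intro sum_nonneg) auto
      ultimately show "(\<Prod>j<n. \<Sum>y\<in>K. r j (a j) y) \<le> 1" by (intro prod_le_1) auto
    qed
    also have "\<dots> = (\<Sum>ai\<in>?W\<times>?W. case ai of (a,i) \<Rightarrow> p a i)" by (simp add: s_def sum.cartesian_product)
    finally show "sum q (?W\<times>?W) \<le> (\<Sum>ai\<in>?W\<times>?W. case ai of (a,i) \<Rightarrow> p a i)" .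
  qed
  moreover have "(case ai of (a,i) \<Rightarrow> p a i) * ln (q ai / (case ai of (a,i) \<Rightarrow> p a i))
      = - (case ai of (a,i) \<Rightarrow> p a i * ln (p a i / s a)) + (\<Sum>j<n. case ai of (a,i) \<Rightarrow> p a i * ln (r j (a j) (i j)))"
    if ai_in: "ai \<in> ?W\<times>?W" for ai
  proof -
    obtain a i where ai: "ai = (a,i)" "a \<in> ?W" "i \<in> ?W" using ai_in by auto
    show ?thesis
    proof (cases "p a i = 0")
      case False
      then have pos: "p a i > 0" using p[OF ai(2,3)] by simp
      then have spos: "s a > 0" using ps[OF ai(2,3)] by simp
      have rp: "\<And>j. j < n \<Longrightarrow> r j (a j) (i j) > 0" using rpos ai pos by blast
      have lnq: "ln (q ai / p a i) = ln (s a) + (\<Sum>j<n. ln (r j (a j) (i j))) - ln (p a i)"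
      proof -
        have pp: "(\<Prod>j<n. r j (a j) (i j)) > 0" using rp by (intro prod_pos) auto
        have "ln (\<Prod>j<n. r j (a j) (i j)) = (\<Sum>j<n. ln (r j (a j) (i j)))"
          by (intro ln_prod) (metis finite_lessThan lessThan_iff less_irrefl rp)+
        moreover have "ln (s a * R / p a i) = ln (s a) + ln R - ln (p a i)" if "R > 0" for R
          using pos spos that by (simp add: ln_div ln_mult)
        ultimately show ?thesis using pp by (simp only: q_def ai(1) prod.case)
      qed
      have lnp: "ln (p a i / s a) = ln (p a i) - ln (s a)" using pos spos by (simp add: ln_div)
      show ?thesis unfolding ai(1) prod.case lnq[unfolded ai(1)] lnp
        by (simp add: sum_distrib_left algebra_simps)
    qed (simp add: ai)
  qed
  ultimately have "0 \<ge> (\<Sum>ai\<in>?W\<times>?W. - (case ai of (a,i) \<Rightarrow> p a i * ln (p a i / s a)) + (\<Sum>j<n. case ai of (a,i) \<Rightarrow> p a i * ln (r j (a j) (i j))))"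
    by simp
  also have "(\<Sum>ai\<in>?W\<times>?W. - (case ai of (a,i) \<Rightarrow> p a i * ln (p a i / s a)) + (\<Sum>j<n. case ai of (a,i) \<Rightarrow> p a i * ln (r j (a j) (i j))))
     = cond_shannon ?W ?W p + (\<Sum>ai\<in>?W\<times>?W. \<Sum>j<n. case ai of (a,i) \<Rightarrow> p a i * ln (r j (a j) (i j)))"
    by (simp only: cond_shannon_def s_def sum.distrib sum_negf)
  also have "(\<Sum>ai\<in>?W\<times>?W. \<Sum>j<n. case ai of (a,i) \<Rightarrow> p a i * ln (r j (a j) (i j)))
     = (\<Sum>j<n. \<Sum>(a,i)\<in>?W\<times>?W. p a i * ln (r j (a j) (i j)))" by (rule sum.swap)
  also have "\<dots> = (\<Sum>j<n. \<Sum>(x,y)\<in>K\<times>K. P j x y * ln (r j x y))"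
    unfolding P_def using K by (intro sum.cong refl sum_letter_marginal) auto
  also have "\<dots> = - (\<Sum>j<n. cond_shannon K K (P j))"
    by (simp add: cond_shannon_def r_def S_def sum_negf)
  finally show ?thesis by (simp add: P_def)
qed

text \<open>The entropy of i is at most that of the pair (a, i).\<close>

theorem shannon_output_le:
  assumes fin: "finite A" "finite I" and p: "\<And>a i. a \<in> A \<Longrightarrow> i \<in> I \<Longrightarrow> p a i \<ge> 0"
  shows "shannon I (\<lambda>i. \<Sum>a\<in>A. p a i) \<le> shannon A (\<lambda>a. \<Sum>i\<in>I. p a i) + cond_shannon A I p"
proof -
  define s where "s a = (\<Sum>i\<in>I. p a i)" for a
  define t where "t i = (\<Sum>a\<in>A. p a i)" for i
  have ps: "p a i \<le> s a" if "a \<in> A" "i \<in> I" for a i unfolding s_def using that p fin by (intro member_le_sum) auto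
  have pt: "p a i \<le> t i" if "a \<in> A" "i \<in> I" for a i
    unfolding t_def using that p fin by (intro member_le_sum[of a A "\<lambda>b. p b i"]) auto
  have "shannon I t = (\<Sum>i\<in>I. \<Sum>a\<in>A. - (p a i * ln (t i)))"
    by (simp add: shannon_def t_def sum_distrib_right sum_negf)
  also have "\<dots> = (\<Sum>a\<in>A. \<Sum>i\<in>I. - (p a i * ln (t i)))" by (rule sum.swap)
  also have "\<dots> \<le> (\<Sum>a\<in>A. \<Sum>i\<in>I. - (p a i * ln (p a i / s a)) - p a i * ln (s a))"
  proof (intro sum_mono)
    fix a i assume ai: "a \<in> A" "i \<in> I"
    show "- (p a i * ln (t i)) \<le> - (p a i * ln (p a i / s a)) - p a i * ln (s a)"
    proof (cases "p a i = 0")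
      case False
      then have pos: "p a i > 0" using p[OF ai] by simp
      then have "ln (p a i) \<le> ln (t i)" "s a > 0" using pt[OF ai] ps[OF ai] by auto
      then show ?thesis using pos by (simp add: ln_div algebra_simps)
    qed simp
  qed
  also have "\<dots> = (\<Sum>a\<in>A. \<Sum>i\<in>I. - (p a i * ln (p a i / s a))) - (\<Sum>a\<in>A. \<Sum>i\<in>I. p a i * ln (s a))"
    by (simp add: sum_subtractf)
  also have "(\<Sum>a\<in>A. \<Sum>i\<in>I. - (p a i * ln (p a i / s a))) = cond_shannon A I p"
    by (simp add: cond_shannon_def s_def sum.cartesian_product sum_negf)
  also have "(\<Sum>a\<in>A. \<Sum>i\<in>I. p a i * ln (s a)) = - shannon A s"
    by (simp add: shannon_def s_def sum_distrib_right)
  finally show ?thesis by (simp add: s_def[abs_def] t_def[abs_def])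
qed

text \<open>The entropy of a is the mutual information plus the conditional entropy of a given i.\<close>

theorem shannon_source_le:
  assumes fin: "finite A" "finite I" and p: "\<And>a i. a \<in> A \<Longrightarrow> i \<in> I \<Longrightarrow> p a i \<ge> 0"
  shows "shannon A (\<lambda>a. \<Sum>i\<in>I. p a i) \<le>
     (\<Sum>(a,i)\<in>A\<times>I. p a i * ln (p a i / ((\<Sum>j\<in>I. p a j) * (\<Sum>b\<in>A. p b i)))) + cond_shannon I A (\<lambda>i a. p a i)"
proof -
  define s where "s a = (\<Sum>i\<in>I. p a i)" for a
  define t where "t i = (\<Sum>a\<in>A. p a i)" for i
  have ps: "p a i \<le> s a" if "a \<in> A" "i \<in> I" for a i unfolding s_def using that p fin by (intro member_le_sum) auto
  have pt: "p a i \<le> t i" if "a \<in> A" "i \<in> I" for a i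
    unfolding t_def using that p fin by (intro member_le_sum[of a A "\<lambda>b. p b i"]) auto
  have "shannon A s = (\<Sum>a\<in>A. \<Sum>i\<in>I. - (p a i * ln (s a)))"
    by (simp add: shannon_def s_def sum_distrib_right sum_negf)
  also have "\<dots> = (\<Sum>a\<in>A. \<Sum>i\<in>I. p a i * ln (p a i / (s a * t i)) - p a i * ln (p a i / t i))"
  proof (intro sum.cong refl)
    fix a i assume ai: "a \<in> A" "i \<in> I"
    show "- (p a i * ln (s a)) = p a i * ln (p a i / (s a * t i)) - p a i * ln (p a i / t i)"
    proof (cases "p a i = 0")
      case False
      then have pos: "p a i > 0" using p[OF ai] by simp
      then have "t i > 0" "s a > 0" using pt[OF ai] ps[OF ai] by auto
      then show ?thesis using pos by (simp add: ln_div ln_mult algebra_simps)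
    qed simp
  qed
  also have "\<dots> = (\<Sum>a\<in>A. \<Sum>i\<in>I. p a i * ln (p a i / (s a * t i))) - (\<Sum>a\<in>A. \<Sum>i\<in>I. p a i * ln (p a i / t i))"
    by (simp add: sum_subtractf)
  also have "(\<Sum>a\<in>A. \<Sum>i\<in>I. p a i * ln (p a i / t i)) = (\<Sum>i\<in>I. \<Sum>a\<in>A. p a i * ln (p a i / t i))" by (rule sum.swap)
  also have "\<dots> = - cond_shannon I A (\<lambda>i a. p a i)"
    by (simp add: cond_shannon_def t_def sum.cartesian_product)
  finally show ?thesis by (simp add: s_def[abs_def] t_def[abs_def] sum.cartesian_product)
qed

text \<open>Fekete's lemma: division of n by a fixed m with remainder bounds the upper limit by a m / m.\<close>

lemma subadditive_convergent:
  fixes a :: "nat \<Rightarrow> real"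
  assumes sub: "\<And>m n. a (m + n) \<le> a m + a n" and nonneg: "\<And>n. a n \<ge> 0"
  shows "convergent (\<lambda>n. a n / real n)"
proof -
  define l where "l = (INF n\<in>{1..}. a n / real n)"
  have bdd: "bdd_below ((\<lambda>n. a n / real n) ` {1..})" using nonneg by (intro bdd_belowI2[of _ 0]) auto
  have lle: "l \<le> a n / real n" if "n \<ge> 1" for n unfolding l_def using that bdd by (intro cINF_lower) auto
  have mult: "a (k * m) \<le> real k * a m + a 0" for k m
  proof (induction k)
    case (Suc k)
    then show ?case using sub[of m "k * m"] by (simp add: algebra_simps)
  qed simp
  have "(\<lambda>n. a n / real n) \<longlonglongrightarrow> l"
  proof (rule LIMSEQ_I)
    fix e :: real assume e: "e > 0"
    have "\<exists>m\<in>{1..}. a m / real m < l + e / 2"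
      using cINF_less_iff[OF _ bdd, of "l + e/2"] e unfolding l_def by auto
    then obtain m where m: "m \<ge> 1" "a m / real m < l + e / 2" by auto
    define C where "C = (\<Sum>r<m. a r) + a 0"
    have aC: "a r + a 0 \<le> C" if "r < m" for r
      unfolding C_def using that nonneg by (intro add_right_mono member_le_sum) auto
    have bound: "a n / real n \<le> a m / real m + C / real n" if n: "n \<ge> 1" for n
    proof -
      have "a n = a (n div m * m + n mod m)" by simp
      also have "\<dots> \<le> a (n div m * m) + a (n mod m)" by (rule sub)
      also have "\<dots> \<le> real (n div m) * a m + a 0 + a (n mod m)" using mult by simp
      also have "\<dots> \<le> real (n div m) * a m + C" using aC[of "n mod m"] m by simp
      finally have "a n \<le> real (n div m) * a m + C" .
      moreover have "real (n div m) * real m \<le> real n"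
        by (metis div_times_less_eq_dividend of_nat_le_iff of_nat_mult)
      then have "real (n div m) \<le> real n / real m" using m by (simp add: field_simps)
      then have "real (n div m) * a m \<le> real n / real m * a m" using nonneg by (intro mult_right_mono)
      ultimately have "a n \<le> real n / real m * a m + C" by linarith
      then have "a n / real n \<le> (real n / real m * a m + C) / real n" using n by (intro divide_right_mono) auto
      also have "\<dots> = a m / real m + C / real n" using n by (simp add: field_simps)
      finally show ?thesis .
    qed
    obtain N where N: "real N > 2 * C / e" using reals_Archimedean2 by blast
    show "\<exists>N. \<forall>n\<ge>N. norm (a n / real n - l) < e"
    proof (intro exI[of _ "max 1 N"] allI impI)
      fix n assume n: "max 1 N \<le> n"
      have "real n > 2 * C / e" using N n by (smt (verit) max.bounded_iff of_nat_le_iff)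
      then have "C / real n < e / 2" using n e by (simp add: field_simps)
      then have "a n / real n < l + e" using bound[of n] m n by linarith
      moreover have "l \<le> a n / real n" using lle n by simp
      ultimately show "norm (a n / real n - l) < e" by simp
    qed
  qed
  then show ?thesis by (rule convergentI)
qed

section \<open>Partitions and Kolmogorov--Sinai entropy\<close>

text \<open>The sets with such approximations form a \<sigma>-algebra. It contains the closed sets, since a closed set is the
intersection of its open neighbourhoods of radius 1 / n.\<close>

lemma closed_open_regular:
  fixes M :: "'x::metric_space measure"
  assumes M: "finite_measure M" "sets M = sets borel" and A: "A \<in> sets M"
  shows "\<forall>e>0. \<exists>F U. closed F \<and> open U \<and> F \<subseteq> A \<and> A \<subseteq> U \<and> measure M (U - F) < e"
proof -
  interpret finite_measure M by (rule M)
  have space: "space M = UNIV" using sets_eq_imp_space_eq[OF M(2)] by simp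
  have cs: "closed F \<Longrightarrow> F \<in> sets M" "open F \<Longrightarrow> F \<in> sets M" for F by (simp_all add: M(2))
  have "A \<in> sigma_sets UNIV (Collect closed)" using A M(2) by (simp add: borel_eq_closed)
  then show ?thesis
  proof (induction rule: sigma_sets.induct)
    case (Basic C)
    then have C: "closed C" by simp
    show ?case
    proof (intro allI impI)
      fix e :: real assume e: "e > 0"
      show "\<exists>F U. closed F \<and> open U \<and> F \<subseteq> C \<and> C \<subseteq> U \<and> measure M (U - F) < e"
      proof (cases "C = {}")
        case True then show ?thesis using e by (intro exI[of _ "{}"]) auto
      next
        case False
        define U where "U n = {x. infdist x C < 1 / real (Suc n)}" for n
        have opU: "open (U n)" for n unfolding U_def
          by (intro open_Collect_less continuous_intros)
        have dec: "decseq (\<lambda>n. U n - C)"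
        proof (rule decseq_SucI)
          fix n
          have "1 / real (Suc (Suc n)) \<le> 1 / real (Suc n)" by (simp add: frac_le)
          then show "U (Suc n) - C \<subseteq> U n - C" unfolding U_def by auto
        qed
        have "(\<Inter>n. U n - C) = {}"
        proof -
          have "x \<in> C" if x: "\<And>n. x \<in> U n" for x
          proof -
            have "infdist x C \<le> 0"
            proof (rule ccontr)
              assume "\<not> infdist x C \<le> 0"
              then obtain n where "inverse (real (Suc n)) < infdist x C" using reals_Archimedean[of "infdist x C"] by auto
              then show False using x[of n] by (simp add: U_def inverse_eq_divide)
            qed
            then show ?thesis using in_closed_iff_infdist_zero[OF C False] infdist_nonneg[of x C] by auto
          qed
          then show ?thesis by auto
        qed
        moreover have "(\<lambda>n. measure M (U n - C)) \<longlonglongrightarrow> measure M (\<Inter>n. U n - C)"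
          using dec opU C cs by (intro finite_Lim_measure_decseq) auto
        ultimately have "(\<lambda>n. measure M (U n - C)) \<longlonglongrightarrow> 0" by (simp only: measure_empty)
        then have "\<forall>\<^sub>F n in sequentially. measure M (U n - C) < e" using e by (rule order_tendstoD)
        then obtain n where n: "measure M (U n - C) < e" using eventually_happens'[OF sequentially_bot] by blast
        have "C \<subseteq> U n" using False by (auto simp: U_def)
        then show ?thesis using n C opU by blast
      qed
    qed
  next
    case Empty
    show ?case by (intro allI impI exI[of _ "{}"]) auto
  next
    case (Compl B)
    show ?case
    proof (intro allI impI)
      fix e :: real assume e: "e > 0"
      from Compl.IH[rule_format, OF e] obtain F U
        where FU: "closed F" "open U" "F \<subseteq> B" "B \<subseteq> U" "measure M (U - F) < e" by (elim exE conjE)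
      moreover have "(- F) - (- U) = U - F" by auto
      ultimately show "\<exists>F U. closed F \<and> open U \<and> F \<subseteq> UNIV - B \<and> UNIV - B \<subseteq> U \<and> measure M (U - F) < e"
        by (rule_tac exI[of _ "- U"], rule_tac exI[of _ "- F"]) auto
    qed
  next
    case (Union B)
    show ?case
    proof (intro allI impI)
      fix e :: real assume e: "e > 0"
      have "\<exists>F U. closed F \<and> open U \<and> F \<subseteq> B i \<and> B i \<subseteq> U \<and> measure M (U - F) < e / 2 * (1/2) ^ Suc i" for i :: nat
        by (rule Union.IH[of i, rule_format]) (use e in simp)
      then have "\<forall>i. \<exists>Y. closed (fst Y) \<and> open (snd Y) \<and> fst Y \<subseteq> B i \<and> B i \<subseteq> snd Y
          \<and> measure M (snd Y - fst Y) < e / 2 * (1/2) ^ Suc i"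
        by (simp only: split_paired_Ex fst_conv snd_conv) blast
      then obtain Y where Y: "\<forall>i. closed (fst (Y i)) \<and> open (snd (Y i)) \<and> fst (Y i) \<subseteq> B i \<and> B i \<subseteq> snd (Y i)
          \<and> measure M (snd (Y i) - fst (Y i)) < e / 2 * (1/2) ^ Suc i"
        by (rule choice[THEN exE])
      define F where "F i = fst (Y i)" for i
      define U where "U i = snd (Y i)" for i
      have FU: "\<And>i. closed (F i)" "\<And>i. open (U i)" "\<And>i. F i \<subseteq> B i" "\<And>i. B i \<subseteq> U i"
        "\<And>i. measure M (U i - F i) < e / 2 * (1/2) ^ Suc i"
        using Y unfolding F_def U_def by blast+
      let ?FU = "\<Union>i. F i" and ?UU = "\<Union>i. U i"
      have ms: "?FU \<in> sets M" "?UU \<in> sets M" "\<And>i. U i - F i \<in> sets M" using FU cs by auto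
      have sm: "(\<lambda>i. e / 2 * (1/2::real) ^ Suc i) sums (e / 2 * 1)" by (intro sums_mult power_half_series)
      have sm2: "summable (\<lambda>i. measure M (U i - F i))"
        by (rule summable_comparison_test'[OF sums_summable[OF sm], of 0]) (use FU(5) in \<open>auto intro: less_imp_le\<close>)
      have "measure M (?UU - ?FU) \<le> measure M (\<Union>i. U i - F i)"
        using ms by (intro finite_measure_mono) auto
      also have "\<dots> \<le> (\<Sum>i. measure M (U i - F i))"
        using ms sm2 by (intro finite_measure_subadditive_countably) auto
      also have "\<dots> \<le> (\<Sum>i. e / 2 * (1/2::real) ^ Suc i)"
        using FU(5) sm2 sums_summable[OF sm] by (intro suminf_le) (auto intro: less_imp_le)
      also have "\<dots> = e / 2" using sums_unique[OF sm] by simp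
      finally have 1: "measure M (?UU - ?FU) \<le> e / 2" .
      define G where "G n = (\<Union>i<n. F i)" for n
      have clG: "closed (G n)" for n unfolding G_def using FU(1) by (intro closed_UN) auto
      have "decseq (\<lambda>n. ?FU - G n)" by (rule decseq_SucI) (auto simp: G_def)
      then have "(\<lambda>n. measure M (?FU - G n)) \<longlonglongrightarrow> measure M (\<Inter>n. ?FU - G n)"
        using ms clG cs by (intro finite_Lim_measure_decseq) auto
      moreover have "(\<Inter>n. ?FU - G n) = {}" by (auto simp: G_def)
      ultimately have "(\<lambda>n. measure M (?FU - G n)) \<longlonglongrightarrow> 0" by (simp only: measure_empty)
      then have "\<forall>\<^sub>F n in sequentially. measure M (?FU - G n) < e / 2" using e by (intro order_tendstoD) auto
      then obtain n where n: "measure M (?FU - G n) < e / 2" using eventually_happens'[OF sequentially_bot] by blast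
      have "measure M (?UU - G n) \<le> measure M ((?UU - ?FU) \<union> (?FU - G n))"
        using ms clG cs by (intro finite_measure_mono) auto
      also have "\<dots> \<le> measure M (?UU - ?FU) + measure M (?FU - G n)"
        using ms clG cs by (intro measure_Un_le) auto
      finally have "measure M (?UU - G n) < e" using 1 n by linarith
      moreover have "open ?UU" using FU(2) by blast
      moreover have "G n \<subseteq> (\<Union>i. B i)" using FU(3) by (auto simp: G_def)
      moreover have "(\<Union>i. B i) \<subseteq> ?UU" using FU(4) by (intro UN_mono) auto
      ultimately have "closed (G n) \<and> open ?UU \<and> G n \<subseteq> (\<Union>i. B i) \<and> (\<Union>i. B i) \<subseteq> ?UU \<and> measure M (?UU - G n) < e"
        using clG[of n] by (intro conjI)
      then show "\<exists>F U. closed F \<and> open U \<and> F \<subseteq> (\<Union>i. B i) \<and> (\<Union>i. B i) \<subseteq> U \<and> measure M (U - F) < e"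
        by (intro exI)
    qed
  qed
qed

text \<open>Choose closed sets F A inside A of almost full measure. The open sets V A, obtained from U A by removing all F B
with B \<noteq> A, still cover X, and normalised distances to their complements form a partition of unity
with g B = 0 on F A.\<close>

lemma partition_of_unity_near_partition:
  fixes M :: "'x::metric_space measure" and P :: "'x set set"
  assumes M: "prob_space M" "sets M = sets borel"
    and P: "finite P" "P \<subseteq> sets M" "partition_on UNIV P"
    and U: "\<And>A. A \<in> P \<Longrightarrow> open (U A)" "\<And>A. A \<in> P \<Longrightarrow> A \<subseteq> U A" and \<eta>: "\<eta> > 0"
  obtains g :: "'x set \<Rightarrow> 'x \<Rightarrow> real" where
    "\<And>A. A \<in> P \<Longrightarrow> continuous_on UNIV (g A)" "\<And>A x. A \<in> P \<Longrightarrow> 0 \<le> g A x"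
    "\<And>x. (\<Sum>A\<in>P. g A x) = 1" "\<And>A x. A \<in> P \<Longrightarrow> x \<notin> U A \<Longrightarrow> g A x = 0"
    "\<And>A B. A \<in> P \<Longrightarrow> B \<in> P \<Longrightarrow> A \<noteq> B \<Longrightarrow> (\<integral>x. indicator A x * g B x \<partial>M) \<le> \<eta>"
proof -
  interpret prob_space M by (rule M)
  have cs: "closed F \<Longrightarrow> F \<in> sets M" "open F \<Longrightarrow> F \<in> sets M" for F by (simp_all add: M(2))
  have disj: "A \<in> P \<Longrightarrow> B \<in> P \<Longrightarrow> A \<noteq> B \<Longrightarrow> A \<inter> B = {}" for A B
    using P(3) by (auto simp: partition_on_def disjoint_def)
  have cover: "\<exists>A\<in>P. x \<in> A" for x using P(3) by (auto simp: partition_on_def)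
  have "\<exists>F. closed F \<and> F \<subseteq> A \<and> measure M (A - F) \<le> \<eta>" if A: "A \<in> P" for A
  proof -
    have "A \<in> sets M" using A P(2) by blast
    from closed_open_regular[OF finite_measure_axioms M(2) this, rule_format, OF \<eta>]
    obtain F V where FV: "closed F" "open V" "F \<subseteq> A" "A \<subseteq> V" "measure M (V - F) < \<eta>" by (elim exE conjE)
    have "measure M (A - F) \<le> measure M (V - F)" using FV A P(2) cs by (intro finite_measure_mono) auto
    then show ?thesis using FV by force
  qed
  then obtain F where F: "\<And>A. A \<in> P \<Longrightarrow> closed (F A)" "\<And>A. A \<in> P \<Longrightarrow> F A \<subseteq> A" "\<And>A. A \<in> P \<Longrightarrow> measure M (A - F A) \<le> \<eta>"
    by metis
  define V where "V A = U A \<inter> - (\<Union>B\<in>P-{A}. F B)" for A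
  have V: "open (V A)" if "A \<in> P" for A
    unfolding V_def using that U F P(1) by (intro open_Int open_Compl closed_UN) auto
  have AV: "A \<subseteq> V A" if "A \<in> P" for A
    using that U(2) F(2) disj[OF that] unfolding V_def by blast
  \<comment> \<open>infdist to the empty set is 0 by convention, so V A = UNIV is treated separately.\<close>
  define d where "d A x = (if V A = UNIV then 1 else infdist x (- V A))" for A x
  have dc: "continuous_on UNIV (d A)" for A
    by (cases "V A = UNIV") (auto simp: d_def[abs_def] intro!: continuous_intros)
  have d0: "d A x \<ge> 0" for A x by (simp add: d_def infdist_nonneg)
  have dV: "d A x > 0 \<longleftrightarrow> x \<in> V A" if "A \<in> P" for A x
  proof (cases "V A = UNIV")
    case False
    have "infdist x (- V A) = 0 \<longleftrightarrow> x \<in> - V A"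
      using in_closed_iff_infdist_zero[of "- V A" x] V[OF that] False by auto
    then show ?thesis using False infdist_nonneg[of x "- V A"] by (auto simp: d_def less_le)
  qed (simp add: d_def)
  define D where "D x = (\<Sum>A\<in>P. d A x)" for x
  have D: "D x > 0" for x
  proof -
    obtain A where A: "A \<in> P" "x \<in> A" using cover by blast
    then have "d A x > 0" using dV AV by blast
    then show ?thesis unfolding D_def using A P(1) d0 by (intro sum_pos2[of _ A]) auto
  qed
  define g where "g A x = d A x / D x" for A x
  have gc: "continuous_on UNIV (g A)" for A
    unfolding g_def[abs_def] D_def[abs_def] using D dc
    by (intro continuous_intros) (auto simp: D_def less_imp_neq[symmetric] dest: less_imp_neq)
  have g0: "0 \<le> g A x" for A x unfolding g_def using d0 D[of x] by simp
  have g1: "(\<Sum>A\<in>P. g A x) = 1" for x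
    unfolding g_def using D[of x] by (simp add: sum_divide_distrib[symmetric] D_def[symmetric])
  have gz: "g A x = 0" if "A \<in> P" "x \<notin> V A" for A x
    using dV[OF that(1), of x] d0[of A x] that by (simp add: g_def)
  have gle: "g A x \<le> 1" if "A \<in> P" for A x
    using g1[of x] member_le_sum[OF that, of "\<lambda>A. g A x"] g0 P(1) by simp
  have "(\<integral>x. indicator A x * g B x \<partial>M) \<le> \<eta>" if A: "A \<in> P" and B: "B \<in> P" and AB: "A \<noteq> B" for A B
  proof -
    have le: "indicator A x * g B x \<le> (indicator (A - F A) x :: real)" for x
    proof (cases "x \<in> F A")
      case True
      then have "x \<notin> V B" using A AB unfolding V_def by auto
      then show ?thesis using gz[OF B] by simp
    next
      case False
      then show ?thesis using gle[OF B, of x] by (auto simp: indicator_def)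
    qed
    have gm: "g B \<in> borel_measurable M"
      using borel_measurable_continuous_onI[OF gc[of B]] M(2) by (simp cong: measurable_cong_sets)
    have "(\<integral>x. indicator A x * g B x \<partial>M) \<le> (\<integral>x. indicator (A - F A) x \<partial>M)"
    proof (rule integral_mono)
      show "integrable M (\<lambda>x. indicator A x * g B x)"
        using gm A P(2) g0 gle[OF B] by (intro integrable_const_bound[of _ 1]) (auto simp: indicator_def)
      show "integrable M (indicator (A - F A) :: 'x \<Rightarrow> real)"
        using A P(2) F(1)[OF A] cs by (intro integrable_real_indicator) (auto simp: emeasure_eq_measure)
    qed (rule le)
    also have "\<dots> = measure M (A - F A)" using A P(2) F(1)[OF A] cs by auto
    finally show ?thesis using F(3)[OF A] by linarith
  qed
  then show ?thesis using that[of g] gc g0 g1 gz unfolding V_def by auto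
qed

lemma small_partition:
  assumes X: "compact (UNIV :: 'x::metric_space set)" and r: "r > 0"
  obtains P :: "'x::metric_space set set" where "finite P" "P \<subseteq> sets borel" "partition_on UNIV P"
    "\<And>A. A \<in> P \<Longrightarrow> \<exists>c. A \<subseteq> ball c r"
proof -
  have cov: "UNIV \<subseteq> (\<Union>c\<in>UNIV. ball (c :: 'x) r)"
  proof
    fix x :: 'x
    show "x \<in> (\<Union>c\<in>UNIV. ball c r)" using r by (intro UN_I[of x]) auto
  qed
  obtain C where C: "finite C" "UNIV \<subseteq> (\<Union>c\<in>C. ball (c :: 'x) r)"
    by (rule compactE_image[OF X _ cov]) auto
  obtain N and c :: "nat \<Rightarrow> 'x" where c: "C = c ` {i. i < N}"
    using finite_imp_nat_seg_image_inj_on[OF C(1)] by blast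
  define B where "B i = ball (c i) r - (\<Union>j<i. ball (c j) r)" for i
  let ?P = "B ` {..<N} - {{}}"
  have meas: "B i \<in> sets borel" for i unfolding B_def by (intro sets.Diff sets.finite_UN) auto
  have "\<exists>i<N. x \<in> B i" for x
  proof -
    have "\<exists>i<N. x \<in> ball (c i) r" 
    proof -
      have "x \<in> (\<Union>c\<in>C. ball c r)" using C(2) by (rule subsetD) simp
      then show ?thesis unfolding c by blast
    qed
    then obtain i where i: "i < N" "x \<in> ball (c i) r" "\<And>j. j < i \<Longrightarrow> \<not> (j < N \<and> x \<in> ball (c j) r)"
      using exists_least_iff[of "\<lambda>i. i < N \<and> x \<in> ball (c i) r"] by blast
    then have "x \<in> B i" unfolding B_def by auto
    then show ?thesis using i by blast
  qed
  then have "\<Union>?P = UNIV" by blast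
  moreover have "disjoint ?P"
  proof -
    have "B i \<inter> B j = {}" if "i < j" for i j using that unfolding B_def by auto
    then have d: "i \<noteq> j \<Longrightarrow> B i \<inter> B j = {}" for i j by (metis Int_commute linorder_neqE_nat)
    show ?thesis unfolding disjoint_def
    proof (intro ballI impI)
      fix S S' assume S: "S \<in> ?P" "S' \<in> ?P" "S \<noteq> S'"
      then obtain i j where ij: "S = B i" "S' = B j" by auto
      with S(3) have "i \<noteq> j" by auto
      then show "S \<inter> S' = {}" unfolding ij by (rule d)
    qed
  qed
  ultimately have "partition_on UNIV ?P" by (auto simp: partition_on_def)
  moreover have "\<exists>c. A \<subseteq> ball c r" if "A \<in> ?P" for A using that by (auto simp: B_def)
  ultimately show ?thesis using that[of ?P] meas by blast
qed

text \<open>The points whose orbit spells the word a at the times below n.\<close>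

definition cell :: "('x \<Rightarrow> 'x) \<Rightarrow> nat \<Rightarrow> (nat \<Rightarrow> 'x set) \<Rightarrow> 'x set" where
  "cell T n a = {x. \<forall>i<n. (T ^^ i) x \<in> a i}"

locale finite_borel_partition = prob_space M for M :: "'x::metric_space measure" +
  fixes T :: "'x \<Rightarrow> 'x" and P :: "'x set set"
  assumes sets_M: "sets M = sets borel" and T_cont: "continuous_on UNIV T" and invariant: "distr M M T = M"
    and P: "finite P" "P \<subseteq> sets M" "partition_on UNIV P"
begin

lemma space_UNIV: "space M = UNIV" using sets_eq_imp_space_eq[OF sets_M] by simp

lemma T_measurable: "T \<in> measurable M M"
  using borel_measurable_continuous_onI[OF T_cont] sets_M by (simp cong: measurable_cong_sets)

lemma T_pow_measurable: "T ^^ n \<in> measurable M M"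
proof (induction n)
  case (Suc n) then show ?case using T_measurable by (auto intro: measurable_comp)
qed (simp add: id_def)

lemma T_pow_invariant: "distr M M (T ^^ n) = M"
proof (induction n)
  case 0 show ?case by (simp add: id_def distr_id2)
next
  case (Suc n)
  have "distr M M (T \<circ> T ^^ n) = distr (distr M M (T ^^ n)) M T"
    by (rule distr_distr[symmetric, OF T_measurable T_pow_measurable])
  then show ?case unfolding funpow.simps(2) Suc.IH invariant .
qed

lemma measure_vimage_pow: "S \<in> sets M \<Longrightarrow> measure M ((T ^^ n) -` S) = measure M S"
  using measure_distr[OF T_pow_measurable, of S n] T_pow_invariant[of n] space_UNIV by simp

lemma integral_comp_pow:
  "f \<in> borel_measurable M \<Longrightarrow> (\<integral>x. f ((T ^^ n) x) \<partial>M) = (\<integral>x. (f x :: real) \<partial>M)"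
  using integral_distr[OF T_pow_measurable, of f n] T_pow_invariant[of n] by simp

lemma partition_disjoint: "A \<in> P \<Longrightarrow> B \<in> P \<Longrightarrow> A \<noteq> B \<Longrightarrow> A \<inter> B = {}"
  using P(3) by (auto simp: partition_on_def disjoint_def)

lemma partition_cover: "\<exists>A\<in>P. x \<in> A"
  using P(3) by (auto simp: partition_on_def)

lemma cell_measurable: "a \<in> words n P \<Longrightarrow> cell T n a \<in> sets M"
proof -
  assume a: "a \<in> words n P"
  have "(T ^^ i) -` a i \<in> sets M" if "i < n" for i
    using measurable_sets[OF T_pow_measurable[of i], of "a i"] a that P(2) space_UNIV by (auto simp: PiE_mem)
  then have "(\<Inter>i\<in>{..<n}. (T ^^ i) -` a i \<inter> space M) \<inter> space M \<in> sets M"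
    using sets.top[of M] unfolding space_UNIV by (cases "n = 0") (auto intro!: sets.finite_INT)
  moreover have "(\<Inter>i\<in>{..<n}. (T ^^ i) -` a i \<inter> space M) \<inter> space M = cell T n a"
    by (auto simp: cell_def space_UNIV)
  ultimately show ?thesis by simp
qed

lemma cell_disjoint: "disjoint_family_on (cell T n) (words n P)"
  unfolding disjoint_family_on_def
proof (intro ballI impI)
  fix a b assume ab: "a \<in> words n P" "b \<in> words n P" "a \<noteq> b"
  then obtain i where i: "i < n" "a i \<noteq> b i" by (metis PiE_ext lessThan_iff)
  then have "a i \<inter> b i = {}"
    using PiE_mem[OF ab(1), of i] PiE_mem[OF ab(2), of i] by (intro partition_disjoint) auto
  then show "cell T n a \<inter> cell T n b = {}" using i by (auto simp: cell_def)
qed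

lemma cell_cover: "(\<Union>a\<in>words n P. cell T n a) = UNIV"
proof -
  have "x \<in> (\<Union>a\<in>words n P. cell T n a)" for x
  proof -
    obtain c where c: "\<And>i. c i \<in> P \<and> (T ^^ i) x \<in> c i" 
    proof -
      have "\<forall>i. \<exists>A. A \<in> P \<and> (T ^^ i) x \<in> A" using partition_cover by blast
      from choice[OF this] show ?thesis using that by blast
    qed
    then have "restrict c {..<n} \<in> words n P" "x \<in> cell T n (restrict c {..<n})" by (auto simp: cell_def)
    then show ?thesis by blast
  qed
  then show ?thesis by blast
qed

lemma fin_words: "finite (words n P)" by (rule finite_words[OF P(1)])

definition H :: "nat \<Rightarrow> real" where
  "H n = shannon (words n P) (\<lambda>a. measure M (cell T n a))"

lemma measure_split_words:
  assumes S: "S \<in> sets M"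
  shows "measure M S = (\<Sum>a\<in>words n P. measure M (cell T n a \<inter> S))"
proof -
  have "S = (\<Union>a\<in>words n P. cell T n a \<inter> S)" using cell_cover[of n] by blast
  then have "measure M S = measure M (\<Union>a\<in>words n P. cell T n a \<inter> S)" by simp
  also have "\<dots> = (\<Sum>a\<in>words n P. measure M (cell T n a \<inter> S))"
    using cell_disjoint[of n] cell_measurable S fin_words
    by (intro finite_measure_finite_Union) (auto simp: disjoint_family_on_def)
  finally show ?thesis .
qed

text \<open>Different words with the same cell have an empty cell, so the sum over words repeats only zero terms.\<close>

lemma entropy_iterated_join: "partition_entropy M (iterated_join M T P n) = H n"
proof -
  have eq: "iterated_join M T P n = cell T n ` words n P"
  proof (intro equalityI subsetI)
    fix S assume "S \<in> iterated_join M T P n"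
    then obtain A where A: "\<forall>i<n. A i \<in> P" "S = (\<Inter>i<n. (T ^^ i) -` A i) \<inter> space M" by (auto simp: iterated_join_def)
    have "S = cell T n (restrict A {..<n})" using A by (auto simp: cell_def space_UNIV)
    moreover have "restrict A {..<n} \<in> words n P" using A by auto
    ultimately show "S \<in> cell T n ` words n P" by blast
  next
    fix S assume "S \<in> cell T n ` words n P"
    then obtain a where a: "a \<in> words n P" "S = cell T n a" by blast
    then have "S = (\<Inter>i<n. (T ^^ i) -` a i) \<inter> space M" by (auto simp: cell_def space_UNIV)
    then show "S \<in> iterated_join M T P n" using a unfolding iterated_join_def by (auto simp: PiE_mem)
  qed
  have "(\<Sum>S\<in>cell T n ` words n P. measure M S * ln (measure M S))
     = (\<Sum>a\<in>words n P. measure M (cell T n a) * ln (measure M (cell T n a)))"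
  proof (subst sum.reindex_nontrivial[OF fin_words])
    fix a b assume "a \<in> words n P" "b \<in> words n P" "a \<noteq> b" "cell T n a = cell T n b"
    moreover from this have "cell T n a \<inter> cell T n b = {}"
      using cell_disjoint[of n] unfolding disjoint_family_on_def by blast
    ultimately have "cell T n a = {}" by simp
    then show "measure M (cell T n a) * ln (measure M (cell T n a)) = 0" by simp
  qed simp
  then show ?thesis by (simp add: partition_entropy_def eq H_def shannon_def)
qed

lemma H_nonneg: "H n \<ge> 0"
proof -
  have "measure M (cell T n a) * ln (measure M (cell T n a)) \<le> 0" for a
    using prob_le_1[of "cell T n a"] by (cases "measure M (cell T n a) = 0")
      (auto simp: mult_nonneg_nonpos zero_less_measure_iff)
  then show ?thesis unfolding H_def shannon_def by (simp add: sum_nonpos)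
qed

text \<open>Gibbs' inequality for the joint distribution of the first m and the last n letters against the product of its
marginals. By invariance of the measure the second marginal is the distribution of words of length n.\<close>

lemma H_subadditive: "H (m + n) \<le> H m + H n"
proof -
  define p where "p = (\<lambda>(a,b). measure M (cell T m a \<inter> (T ^^ m) -` cell T n b))"
  define s where "s a = measure M (cell T m a)" for a
  define t where "t b = measure M (cell T n b)" for b
  \<comment> \<open>concatenation of words of lengths m and n; words take the value undefined outside their index range\<close>
  define cat where "cat = (\<lambda>(a,b) i. if i < m then a i else if i < m + n then b (i - m) else undefined :: 'x set)"
  let ?A = "words m P" and ?B = "words n P"
  have cellcat: "cell T (m + n) (cat (a,b)) = cell T m a \<inter> (T ^^ m) -` cell T n b" for a b
  proof -
    have sp: "(\<forall>i<m+n. Q i) \<longleftrightarrow> (\<forall>i<m. Q i) \<and> (\<forall>i<n. Q (m + i))" for Q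
      by (metis add.commute add_less_cancel_left le_Suc_ex linorder_not_le trans_less_add1)
    show ?thesis unfolding cell_def sp cat_def
      by (auto simp: funpow_add[of _ m, THEN fun_cong, simplified comp_def] add.commute[of m] funpow_add)
  qed
  have bm: "(T ^^ m) -` cell T n b \<in> sets M" if "b \<in> ?B" for b
    using measurable_sets[OF T_pow_measurable[of m] cell_measurable[OF that]] space_UNIV by simp
  have bij: "bij_betw cat (?A \<times> ?B) (words (m + n) P)"
  proof (rule bij_betw_byWitness[where f' = "\<lambda>c. (restrict c {..<m}, restrict (\<lambda>i. c (m + i)) {..<n})"])
    show "\<forall>ab\<in>?A \<times> ?B. (restrict (cat ab) {..<m}, restrict (\<lambda>i. cat ab (m + i)) {..<n}) = ab"
      by (auto simp: cat_def fun_eq_iff restrict_def PiE_def extensional_def)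
    show "\<forall>c\<in>words (m + n) P. cat (restrict c {..<m}, restrict (\<lambda>i. c (m + i)) {..<n}) = c"
      by (auto simp: cat_def fun_eq_iff restrict_def PiE_def extensional_def)
    show "cat ` (?A \<times> ?B) \<subseteq> words (m + n) P"
      by (auto simp: cat_def PiE_def extensional_def Pi_def)
    show "(\<lambda>c. (restrict c {..<m}, restrict (\<lambda>i. c (m + i)) {..<n})) ` words (m + n) P \<subseteq> ?A \<times> ?B"
      by (auto simp: PiE_def Pi_def)
  qed
  have Heq: "H (m + n) = - (\<Sum>ab\<in>?A\<times>?B. p ab * ln (p ab))"
    unfolding H_def shannon_def sum.reindex_bij_betw[OF bij, symmetric]
    by (intro arg_cong[where f=uminus] sum.cong) (auto simp: p_def cellcat)
  have sa: "(\<Sum>b\<in>?B. p (a,b)) = s a" if "a \<in> ?A" for a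
  proof -
    have "s a = measure M (\<Union>b\<in>?B. cell T m a \<inter> (T ^^ m) -` cell T n b)"
    proof -
      have "cell T m a = cell T m a \<inter> (T ^^ m) -` (\<Union>b\<in>?B. cell T n b)" unfolding cell_cover by simp
      also have "\<dots> = (\<Union>b\<in>?B. cell T m a \<inter> (T ^^ m) -` cell T n b)" by (simp only: vimage_UN Int_UN_distrib)
      finally show ?thesis unfolding s_def by (rule arg_cong)
    qed
    also have "\<dots> = (\<Sum>b\<in>?B. p (a,b))" unfolding p_def prod.case
      using cell_disjoint[of n] cell_measurable[OF that] bm fin_words
      by (intro finite_measure_finite_Union) (auto simp: disjoint_family_on_def)
    finally show ?thesis by simp
  qed
  have tb: "(\<Sum>a\<in>?A. p (a,b)) = t b" if "b \<in> ?B" for b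
    using measure_split_words[OF bm[OF that], of m] measure_vimage_pow[OF cell_measurable[OF that]] by (simp add: p_def t_def)
  have ps: "p (a,b) \<le> s a" "p (a,b) \<le> t b" if "a \<in> ?A" "b \<in> ?B" for a b
  proof -
    show "p (a,b) \<le> s a" using sa[OF that(1)] member_le_sum[OF that(2), of "\<lambda>b. p (a,b)"] fin_words by (simp add: p_def)
    show "p (a,b) \<le> t b" using tb[OF that(2)] member_le_sum[OF that(1), of "\<lambda>a. p (a,b)"] fin_words by (simp add: p_def)
  qed
  have tot: "sum s ?A = 1" "sum t ?B = 1"
    using measure_split_words[of UNIV m] measure_split_words[of UNIV n] prob_space space_UNIV sets.top[of M] by (auto simp: s_def t_def)
  have "(\<Sum>ab\<in>?A\<times>?B. p ab * ln ((case ab of (a,b) \<Rightarrow> s a * t b) / p ab)) \<le> 0"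
  proof (rule gibbs_inequality)
    show "\<And>ab. ab \<in> ?A\<times>?B \<Longrightarrow> 0 \<le> p ab" by (auto simp: p_def)
    show "\<And>ab. ab \<in> ?A\<times>?B \<Longrightarrow> 0 \<le> (case ab of (a,b) \<Rightarrow> s a * t b)" by (auto simp: s_def t_def)
    fix ab assume "ab \<in> ?A\<times>?B" "0 < p ab"
    then obtain a b where ab: "ab = (a,b)" "a \<in> ?A" "b \<in> ?B" "0 < p (a,b)" by auto
    then have "0 < s a" "0 < t b" using ps[OF ab(2,3)] by linarith+
    then show "0 < (case ab of (a,b) \<Rightarrow> s a * t b)" by (simp add: ab(1))
  next
    have "(\<Sum>ab\<in>?A\<times>?B. case ab of (a,b) \<Rightarrow> s a * t b) = sum s ?A * sum t ?B"
      by (simp add: sum_product sum.cartesian_product)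
    also have "\<dots> = (\<Sum>a\<in>?A. \<Sum>b\<in>?B. p (a,b))" using tot sa by simp
    also have "\<dots> = sum p (?A\<times>?B)" by (simp add: sum.cartesian_product)
    finally show "(\<Sum>ab\<in>?A\<times>?B. case ab of (a,b) \<Rightarrow> s a * t b) \<le> sum p (?A\<times>?B)" by simp
  qed
  also have "(\<Sum>ab\<in>?A\<times>?B. p ab * ln ((case ab of (a,b) \<Rightarrow> s a * t b) / p ab))
     = (\<Sum>ab\<in>?A\<times>?B. (case ab of (a,b) \<Rightarrow> p (a,b) * ln (s a)) + (case ab of (a,b) \<Rightarrow> p (a,b) * ln (t b)) - p ab * ln (p ab))"
  proof (intro sum.cong refl)
    fix ab assume "ab \<in> ?A\<times>?B"
    then obtain a b where ab: "ab = (a,b)" "a \<in> ?A" "b \<in> ?B" by auto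
    show "p ab * ln ((case ab of (a,b) \<Rightarrow> s a * t b) / p ab)
      = (case ab of (a,b) \<Rightarrow> p (a,b) * ln (s a)) + (case ab of (a,b) \<Rightarrow> p (a,b) * ln (t b)) - p ab * ln (p ab)"
    proof (cases "p ab = 0")
      case False
      then have pos: "p (a,b) > 0" using ab by (simp add: p_def zero_less_measure_iff)
      then have "s a > 0" "t b > 0" using ps[OF ab(2,3)] by linarith+
      then show ?thesis using pos by (simp add: ab ln_div ln_mult algebra_simps)
    qed (simp add: ab)
  qed
  also have "\<dots> = (\<Sum>a\<in>?A. \<Sum>b\<in>?B. p (a,b) * ln (s a)) + (\<Sum>a\<in>?A. \<Sum>b\<in>?B. p (a,b) * ln (t b)) + H (m + n)"
    unfolding Heq by (simp add: sum.distrib sum_subtractf sum.cartesian_product)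
  also have "(\<Sum>a\<in>?A. \<Sum>b\<in>?B. p (a,b) * ln (s a)) = - H m"
    using sa by (simp add: sum_distrib_right[symmetric] H_def shannon_def s_def)
  also have "(\<Sum>a\<in>?A. \<Sum>b\<in>?B. p (a,b) * ln (t b)) = - H n"
    by (subst sum.swap) (use tb in \<open>simp add: sum_distrib_right[symmetric] H_def shannon_def t_def\<close>)
  finally show ?thesis by simp
qed

lemma KS_limit: "(\<lambda>n. H n / real n) \<longlonglongrightarrow> KS_entropy_partition M T P"
proof -
  have "convergent (\<lambda>n. H n / real n)" by (rule subadditive_convergent) (auto simp: H_subadditive H_nonneg)
  then show ?thesis unfolding KS_entropy_partition_def entropy_iterated_join by (simp add: convergent_LIMSEQ_iff)
qed

end

section \<open>Continuous matrix-valued functions\<close>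

definition app_mat :: "nat \<Rightarrow> (nat \<Rightarrow> nat \<Rightarrow> 'x \<Rightarrow> complex) \<Rightarrow> 'x \<Rightarrow> (nat \<Rightarrow> complex) \<Rightarrow> nat \<Rightarrow> complex" where
  "app_mat n F x v i = (\<Sum>j<n. F i j x * v j)"

text \<open>The Euclidean norm of the first n coordinates.\<close>

definition l2 :: "nat \<Rightarrow> (nat \<Rightarrow> complex) \<Rightarrow> real" where
  "l2 n v = L2_set (\<lambda>i. cmod (v i)) {..<n}"

text \<open>The n by n matrices over C(X), with the supremum over X of the operator norm on Euclidean n-space. Entries outside
the index range are zero, so that equality in the carrier is equality of functions.\<close>

definition mat_alg :: "nat \<Rightarrow> (nat \<Rightarrow> nat \<Rightarrow> 'x::topological_space \<Rightarrow> complex) cstar" where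
  "mat_alg n = \<lparr> carrier = {F. (\<forall>i j. continuous_on UNIV (F i j)) \<and> (\<forall>i j. \<not> (i < n \<and> j < n) \<longrightarrow> F i j = (\<lambda>_. 0))},
     monoid.mult = (\<lambda>F G i j x. \<Sum>k<n. F i k x * G k j x),
     one = (\<lambda>i j x. if i = j \<and> i < n then 1 else 0), zero = (\<lambda>i j x. 0),
     add = (\<lambda>F G i j x. F i j x + G i j x),
     scale = (\<lambda>c F i j x. c * F i j x), adj = (\<lambda>F i j x. cnj (F j i x)),
     nrm = (\<lambda>F. Inf {c. 0 \<le> c \<and> (\<forall>x v. l2 n (app_mat n F x v) \<le> c * l2 n v)}) \<rparr>"

lemma l2_nonneg: "l2 n v \<ge> 0" by (simp add: l2_def)

lemma l2_member: "i < n \<Longrightarrow> cmod (v i) \<le> l2 n v"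
  unfolding l2_def by (rule member_le_L2_set) auto

lemma l2_le_sum: "l2 n v \<le> (\<Sum>i<n. cmod (v i))"
  unfolding l2_def by (rule L2_set_le_sum) auto

lemma l2_triangle: "l2 n (\<lambda>i. u i + v i) \<le> l2 n u + l2 n v"
proof -
  have "l2 n (\<lambda>i. u i + v i) \<le> L2_set (\<lambda>i. cmod (u i) + cmod (v i)) {..<n}"
    unfolding l2_def by (intro L2_set_mono) (auto intro: norm_triangle_ineq)
  also have "\<dots> \<le> l2 n u + l2 n v" unfolding l2_def by (rule L2_set_triangle_ineq)
  finally show ?thesis .
qed

lemma l2_scale: "l2 n (\<lambda>i. c * v i) = cmod c * l2 n v"
  unfolding l2_def by (simp add: norm_mult L2_set_right_distrib)

definition inner_n :: "nat \<Rightarrow> (nat \<Rightarrow> complex) \<Rightarrow> (nat \<Rightarrow> complex) \<Rightarrow> complex" where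
  "inner_n n u v = (\<Sum>i<n. cnj (u i) * v i)"

lemma inner_self: "inner_n n u u = complex_of_real ((l2 n u)\<^sup>2)"
proof -
  have "inner_n n u u = (\<Sum>i<n. complex_of_real ((cmod (u i))\<^sup>2))"
    unfolding inner_n_def by (intro sum.cong refl) (metis complex_norm_square mult.commute)
  also have "\<dots> = complex_of_real (\<Sum>i<n. (cmod (u i))\<^sup>2)" by simp
  also have "(\<Sum>i<n. (cmod (u i))\<^sup>2) = (l2 n u)\<^sup>2" by (simp add: l2_def L2_set_def sum_nonneg)
  finally show ?thesis .
qed

lemma inner_bound: "cmod (inner_n n u v) \<le> l2 n u * l2 n v"
proof -
  have "cmod (inner_n n u v) \<le> (\<Sum>i<n. \<bar>cmod (u i)\<bar> * \<bar>cmod (v i)\<bar>)"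
    unfolding inner_n_def by (rule order_trans[OF norm_sum]) (simp add: norm_mult)
  also have "\<dots> \<le> l2 n u * l2 n v" unfolding l2_def by (rule L2_set_mult_ineq)
  finally show ?thesis .
qed

lemma inner_adj: "inner_n n (app_mat n F x u) v = inner_n n u (app_mat n (\<lambda>i j x. cnj (F j i x)) x v)"
proof -
  have "inner_n n (app_mat n F x u) v = (\<Sum>i<n. \<Sum>j<n. cnj (F i j x) * cnj (u j) * v i)"
    by (simp add: inner_n_def app_mat_def sum_distrib_right)
  also have "\<dots> = (\<Sum>j<n. \<Sum>i<n. cnj (F i j x) * cnj (u j) * v i)" by (rule sum.swap)
  also have "\<dots> = inner_n n u (app_mat n (\<lambda>i j x. cnj (F j i x)) x v)"
    by (simp add: inner_n_def app_mat_def sum_distrib_left mult_ac)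
  finally show ?thesis .
qed

lemma app_mult: "app_mat n (\<lambda>i j x. \<Sum>k<n. F i k x * G k j x) x v = app_mat n F x (app_mat n G x v)"
proof
  fix i
  have "app_mat n (\<lambda>i j x. \<Sum>k<n. F i k x * G k j x) x v i = (\<Sum>j<n. \<Sum>k<n. F i k x * G k j x * v j)"
    by (simp add: app_mat_def sum_distrib_right)
  also have "\<dots> = (\<Sum>k<n. \<Sum>j<n. F i k x * G k j x * v j)" by (rule sum.swap)
  also have "\<dots> = app_mat n F x (app_mat n G x v) i"
    by (simp add: app_mat_def sum_distrib_left mult_ac)
  finally show "app_mat n (\<lambda>i j x. \<Sum>k<n. F i k x * G k j x) x v i = app_mat n F x (app_mat n G x v) i" .
qed

text \<open>A crude bound, sufficient to pass from uniform convergence of entries to convergence in norm.\<close>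

lemma app_entry_bound:
  assumes "\<And>i j. i < n \<Longrightarrow> j < n \<Longrightarrow> cmod (F i j x) \<le> e" "e \<ge> 0"
  shows "l2 n (app_mat n F x v) \<le> real n * (real n * e) * l2 n v"
proof -
  have "cmod (app_mat n F x v i) \<le> (\<Sum>j<n. e * l2 n v)" if "i < n" for i
    unfolding app_mat_def
    by (rule order_trans[OF norm_sum], intro sum_mono)
       (use assms that l2_member[of _ n v] in \<open>auto simp: norm_mult intro!: mult_mono\<close>)
  then have "(\<Sum>i<n. cmod (app_mat n F x v i)) \<le> (\<Sum>i<n. \<Sum>j<n. e * l2 n v)" by (intro sum_mono) auto
  then show ?thesis using l2_le_sum[of n "app_mat n F x v"] by (simp add: mult.assoc)
qed

context
  fixes n :: nat
  assumes X: "compact (UNIV :: 'x::topological_space set)"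
begin

abbreviation MX :: "(nat \<Rightarrow> nat \<Rightarrow> 'x \<Rightarrow> complex) cstar" where "MX \<equiv> mat_alg n"

lemma entries_bounded:
  assumes "F \<in> carrier MX" shows "\<exists>c\<ge>0. \<forall>i j x. cmod (F i j x) \<le> c"
proof -
  have "\<exists>c. \<forall>x. cmod (F i j x) \<le> c" for i j
  proof -
    have "continuous_on UNIV (F i j)" using assms by (auto simp: mat_alg_def)
    then have "bounded (range (F i j))" by (intro compact_imp_bounded compact_continuous_image X)
    then show ?thesis by (auto simp: bounded_iff)
  qed
  then obtain c where c: "\<And>i j x. cmod (F i j x) \<le> c i j" by metis
  have c0: "0 \<le> c i j" for i j by (rule order_trans[OF norm_ge_zero c])
  define C where "C = (\<Sum>i<n. \<Sum>j<n. c i j)"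
  have C0: "C \<ge> 0" unfolding C_def using c0 by (intro sum_nonneg) auto
  have "cmod (F i j x) \<le> C" for i j x
  proof (cases "i < n \<and> j < n")
    case True
    then have "c i j \<le> (\<Sum>j<n. c i j)" using c0 by (intro member_le_sum) auto
    also have "\<dots> \<le> C" unfolding C_def using True c0 by (intro member_le_sum[of i _ "\<lambda>i. \<Sum>j<n. c i j"]) (auto intro: sum_nonneg)
    finally show ?thesis using c[of i j x] by linarith
  next
    case False
    then have "F i j = (\<lambda>_. 0)" using assms by (auto simp: mat_alg_def)
    then show ?thesis using C0 by simp
  qed
  then show ?thesis using C0 by blast
qed

lemma nrm_le:
  assumes "c \<ge> 0" "\<And>x v. l2 n (app_mat n F x v) \<le> c * l2 n v" shows "nrm MX F \<le> c"
  unfolding mat_alg_def cstar.simps using assms by (intro cInf_lower) (auto intro!: bdd_belowI)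

lemma nrm_bound:
  assumes F: "F \<in> carrier MX" shows "l2 n (app_mat n F x v) \<le> nrm MX F * l2 n v" "nrm MX F \<ge> 0"
proof -
  let ?S = "{c. 0 \<le> c \<and> (\<forall>x v. l2 n (app_mat n F x v) \<le> c * l2 n v)}"
  obtain c where c: "c \<ge> 0" "\<forall>i j x. cmod (F i j x) \<le> c" using entries_bounded[OF F] by blast
  have "real n * (real n * c) \<in> ?S" using app_entry_bound[of n F _ c] c by auto
  then have ne: "?S \<noteq> {}" by blast
  have nr: "nrm MX F = Inf ?S" by (simp add: mat_alg_def)
  show "nrm MX F \<ge> 0" unfolding nr using ne by (intro cInf_greatest) auto
  show "l2 n (app_mat n F x v) \<le> nrm MX F * l2 n v"
  proof (cases "l2 n v = 0")
    case True
    obtain c where "c \<in> ?S" using ne by blast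
    then have "l2 n (app_mat n F x v) \<le> c * l2 n v" by blast
    then show ?thesis using True by simp
  next
    case False
    then have v: "l2 n v > 0" using l2_nonneg[of n v] by simp
    have "l2 n (app_mat n F x v) / l2 n v \<le> Inf ?S"
      using ne v by (intro cInf_greatest) (auto simp: divide_le_eq)
    then show ?thesis unfolding nr using v by (simp add: divide_le_eq)
  qed
qed

lemma entry_le_nrm:
  assumes F: "F \<in> carrier MX" shows "cmod (F i j x) \<le> nrm MX F"
proof (cases "i < n \<and> j < n")
  case True
  let ?e = "\<lambda>k. if k = j then 1 else 0 :: complex"
  have "l2 n ?e = sqrt (\<Sum>k<n. if k = j then 1 else 0)"
    unfolding l2_def L2_set_def by (intro arg_cong[where f=sqrt] sum.cong) auto
  then have e: "l2 n ?e = 1" using True by simp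
  have "app_mat n F x ?e i = (\<Sum>k<n. if k = j then F i k x else 0)"
    unfolding app_mat_def by (intro sum.cong) auto
  then have "F i j x = app_mat n F x ?e i" using True by simp
  then have "cmod (F i j x) \<le> l2 n (app_mat n F x ?e)" using l2_member[of i n "app_mat n F x ?e"] True by simp
  also have "\<dots> \<le> nrm MX F" using nrm_bound(1)[OF F, of x ?e] e by simp
  finally show ?thesis .
next
  case False
  then have "F i j = (\<lambda>_. 0)" using F by (auto simp: mat_alg_def)
  then show ?thesis using nrm_bound(2)[OF F] by simp
qed

lemma mat_closed:
  assumes "F \<in> carrier MX" "G \<in> carrier MX"
  shows "F \<oplus>\<^bsub>MX\<^esub> G \<in> carrier MX" "F \<otimes>\<^bsub>MX\<^esub> G \<in> carrier MX" "c \<odot>\<^bsub>MX\<^esub> F \<in> carrier MX" "adj MX F \<in> carrier MX"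
proof -
  have c: "continuous_on UNIV (F i j)" "continuous_on UNIV (G i j)" for i j using assms by (auto simp: mat_alg_def)
  have z: "\<not> (i < n \<and> j < n) \<Longrightarrow> F i j = (\<lambda>_. 0)" "\<not> (i < n \<and> j < n) \<Longrightarrow> G i j = (\<lambda>_. 0)" for i j
    using assms by (auto simp: mat_alg_def)
  have "continuous_on UNIV (\<lambda>x. \<Sum>k<n. F i k x * G k j x)" for i j by (intro continuous_intros c)
  moreover have "(\<lambda>x. \<Sum>k<n. F i k x * G k j x) = (\<lambda>_. 0)" if "\<not> (i < n \<and> j < n)" for i j
    using that z by (intro ext sum.neutral) (metis mult_zero_left mult_zero_right)
  ultimately show "F \<otimes>\<^bsub>MX\<^esub> G \<in> carrier MX" by (simp add: mat_alg_def)
  have z': "\<not> (i < n \<and> j < n) \<Longrightarrow> F i j x = 0" "\<not> (i < n \<and> j < n) \<Longrightarrow> G i j x = 0" for i j x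
    using z by (metis, metis)
  have "(\<lambda>x. F i j x + G i j x) = (\<lambda>_. 0)" "(\<lambda>x. c * F i j x) = (\<lambda>_. 0)" if "\<not> (i < n \<and> j < n)" for i j
    using z'[OF that] by (simp_all add: fun_eq_iff)
  moreover have "(\<lambda>x. cnj (F j i x)) = (\<lambda>_. 0)" if "\<not> (i < n \<and> j < n)" for i j
    using z'(1)[of j i] that by (auto simp: fun_eq_iff)
  moreover have "continuous_on UNIV (\<lambda>x. F i j x + G i j x)" "continuous_on UNIV (\<lambda>x. c * F i j x)"
     "continuous_on UNIV (\<lambda>x. cnj (F j i x))" for i j by (intro continuous_intros c)+
  ultimately show "F \<oplus>\<^bsub>MX\<^esub> G \<in> carrier MX" "c \<odot>\<^bsub>MX\<^esub> F \<in> carrier MX" "adj MX F \<in> carrier MX"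
    by (simp_all add: mat_alg_def)
qed

lemma mat_zero_one: "\<zero>\<^bsub>MX\<^esub> \<in> carrier MX" "\<one>\<^bsub>MX\<^esub> \<in> carrier MX"
proof -
  show "\<zero>\<^bsub>MX\<^esub> \<in> carrier MX" by (simp add: mat_alg_def)
  have "continuous_on UNIV (\<lambda>x::'x. if i = j \<and> i < n then 1 else 0 :: complex)" for i j
    by (cases "i = j \<and> i < n") auto
  then show "\<one>\<^bsub>MX\<^esub> \<in> carrier MX" by (auto simp: mat_alg_def)
qed

lemma mat_outside: "F \<in> carrier MX \<Longrightarrow> \<not> (i < n \<and> j < n) \<Longrightarrow> F i j x = 0"
  by (auto simp: mat_alg_def)

lemma mat_abelian_group: "abelian_group MX"
proof (rule abelian_groupI)
  fix F assume F: "F \<in> carrier MX"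
  show "\<exists>G\<in>carrier MX. G \<oplus>\<^bsub>MX\<^esub> F = \<zero>\<^bsub>MX\<^esub>"
    by (intro bexI[of _ "(-1) \<odot>\<^bsub>MX\<^esub> F"] mat_closed(3)[OF F F]) (simp add: mat_alg_def)
qed (use mat_closed mat_zero_one in \<open>auto simp: mat_alg_def add_ac\<close>)

lemma mat_monoid: "monoid MX"
proof (rule monoidI)
  fix F G K assume "F \<in> carrier MX" "G \<in> carrier MX" "K \<in> carrier MX"
  show "(F \<otimes>\<^bsub>MX\<^esub> G) \<otimes>\<^bsub>MX\<^esub> K = F \<otimes>\<^bsub>MX\<^esub> (G \<otimes>\<^bsub>MX\<^esub> K)"
  proof (intro ext)
    fix i j x
    have "((F \<otimes>\<^bsub>MX\<^esub> G) \<otimes>\<^bsub>MX\<^esub> K) i j x = (\<Sum>k<n. \<Sum>l<n. F i l x * G l k x * K k j x)"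
      by (simp add: mat_alg_def sum_distrib_right)
    also have "\<dots> = (\<Sum>l<n. \<Sum>k<n. F i l x * G l k x * K k j x)" by (rule sum.swap)
    also have "\<dots> = (F \<otimes>\<^bsub>MX\<^esub> (G \<otimes>\<^bsub>MX\<^esub> K)) i j x"
      by (simp add: mat_alg_def sum_distrib_left mult.assoc)
    finally show "((F \<otimes>\<^bsub>MX\<^esub> G) \<otimes>\<^bsub>MX\<^esub> K) i j x = (F \<otimes>\<^bsub>MX\<^esub> (G \<otimes>\<^bsub>MX\<^esub> K)) i j x" .
  qed
next
  fix F assume F: "F \<in> carrier MX"
  show "\<one>\<^bsub>MX\<^esub> \<otimes>\<^bsub>MX\<^esub> F = F"
  proof (intro ext)
    fix i j x
    have "(\<one>\<^bsub>MX\<^esub> \<otimes>\<^bsub>MX\<^esub> F) i j x = (\<Sum>k<n. (if i = k \<and> i < n then 1 else 0) * F k j x)"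
      unfolding mat_alg_def by simp
    also have "\<dots> = (\<Sum>k<n. if k = i then F k j x else 0)" by (intro sum.cong) auto
    also have "\<dots> = F i j x" using mat_outside[OF F, of i j x] by (cases "i < n") auto
    finally show "(\<one>\<^bsub>MX\<^esub> \<otimes>\<^bsub>MX\<^esub> F) i j x = F i j x" .
  qed
  show "F \<otimes>\<^bsub>MX\<^esub> \<one>\<^bsub>MX\<^esub> = F"
  proof (intro ext)
    fix i j x
    have "(F \<otimes>\<^bsub>MX\<^esub> \<one>\<^bsub>MX\<^esub>) i j x = (\<Sum>k<n. F i k x * (if k = j \<and> k < n then 1 else 0))"
      unfolding mat_alg_def by simp
    also have "\<dots> = (\<Sum>k<n. if k = j then F i k x else 0)" by (intro sum.cong) auto
    also have "\<dots> = F i j x" using mat_outside[OF F, of i j x] by (cases "j < n") auto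
    finally show "(F \<otimes>\<^bsub>MX\<^esub> \<one>\<^bsub>MX\<^esub>) i j x = F i j x" .
  qed
qed (use mat_closed mat_zero_one in auto)

lemma mat_minus:
  assumes "F \<in> carrier MX" "G \<in> carrier MX" shows "F \<ominus>\<^bsub>MX\<^esub> G = (\<lambda>i j x. F i j x - G i j x)"
proof -
  interpret abelian_group MX by (rule mat_abelian_group)
  have "\<ominus>\<^bsub>MX\<^esub> G = (-1) \<odot>\<^bsub>MX\<^esub> G"
    by (rule minus_equality[OF _ assms(2) mat_closed(3)[OF assms(2) assms(2)]]) (simp add: mat_alg_def)
  then show ?thesis by (simp add: a_minus_def) (simp add: mat_alg_def)
qed

lemma nrm_adj_le:
  assumes F: "F \<in> carrier MX" shows "nrm MX (adj MX F) \<le> nrm MX F"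
proof (rule nrm_le[OF nrm_bound(2)[OF F]])
  fix x v
  let ?G = "adj MX F"
  let ?w = "app_mat n ?G x v"
  have adj: "adj MX F = (\<lambda>i j x. cnj (F j i x))" "adj MX ?G = F" by (simp_all add: mat_alg_def)
  have "complex_of_real ((l2 n ?w)\<^sup>2) = inner_n n ?w ?w" by (rule inner_self[symmetric])
  also have "\<dots> = inner_n n v (app_mat n F x ?w)"
    using inner_adj[of n ?G x v ?w] adj by (simp add: mat_alg_def)
  finally have "(l2 n ?w)\<^sup>2 = cmod (inner_n n v (app_mat n F x ?w))" by (metis norm_of_real abs_power2)
  also have "\<dots> \<le> l2 n v * l2 n (app_mat n F x ?w)" by (rule inner_bound)
  also have "\<dots> \<le> l2 n v * (nrm MX F * l2 n ?w)" by (intro mult_left_mono nrm_bound(1)[OF F] l2_nonneg)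
  finally have "l2 n ?w * l2 n ?w \<le> (nrm MX F * l2 n v) * l2 n ?w" by (simp add: power2_eq_square mult_ac)
  then show "l2 n ?w \<le> nrm MX F * l2 n v"
    using l2_nonneg[of n ?w] l2_nonneg[of n v] nrm_bound(2)[OF F]
    by (cases "l2 n ?w = 0") (auto simp: mult_le_cancel_right)
qed

lemma nrm_mult_le:
  assumes F: "F \<in> carrier MX" and G: "G \<in> carrier MX"
  shows "nrm MX (F \<otimes>\<^bsub>MX\<^esub> G) \<le> nrm MX F * nrm MX G"
proof (rule nrm_le)
  show "0 \<le> nrm MX F * nrm MX G" using nrm_bound(2) F G by simp
  fix x v
  have "app_mat n (F \<otimes>\<^bsub>MX\<^esub> G) x v = app_mat n F x (app_mat n G x v)"
    using app_mult[of n F G x v] by (simp add: mat_alg_def)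
  then have "l2 n (app_mat n (F \<otimes>\<^bsub>MX\<^esub> G) x v) \<le> nrm MX F * l2 n (app_mat n G x v)" using nrm_bound(1)[OF F] by simp
  also have "\<dots> \<le> nrm MX F * (nrm MX G * l2 n v)" by (intro mult_left_mono nrm_bound F G)
  finally show "l2 n (app_mat n (F \<otimes>\<^bsub>MX\<^esub> G) x v) \<le> nrm MX F * nrm MX G * l2 n v" by (simp add: mult_ac)
qed

lemma nrm_cstar:
  assumes F: "F \<in> carrier MX" shows "nrm MX (adj MX F \<otimes>\<^bsub>MX\<^esub> F) = (nrm MX F)\<^sup>2"
proof (rule antisym)
  have aF: "adj MX F \<in> carrier MX" by (rule mat_closed(4)[OF F F])
  have "nrm MX (adj MX F \<otimes>\<^bsub>MX\<^esub> F) \<le> nrm MX (adj MX F) * nrm MX F" by (rule nrm_mult_le[OF aF F])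
  also have "\<dots> \<le> nrm MX F * nrm MX F" by (intro mult_right_mono nrm_adj_le nrm_bound(2) F)
  finally show "nrm MX (adj MX F \<otimes>\<^bsub>MX\<^esub> F) \<le> (nrm MX F)\<^sup>2" by (simp add: power2_eq_square)
  let ?P = "adj MX F \<otimes>\<^bsub>MX\<^esub> F"
  have P: "?P \<in> carrier MX" by (rule mat_closed(2)[OF aF F])
  have "nrm MX F \<le> sqrt (nrm MX ?P)"
  proof (rule nrm_le)
    show "0 \<le> sqrt (nrm MX ?P)" using nrm_bound(2)[OF P] by simp
    fix x v
    let ?w = "app_mat n F x v"
    have "complex_of_real ((l2 n ?w)\<^sup>2) = inner_n n ?w ?w" by (rule inner_self[symmetric])
    also have "\<dots> = inner_n n v (app_mat n ?P x v)"
      using inner_adj[of n F x v ?w] app_mult[of n "\<lambda>i j x. cnj (F j i x)" F x v] by (simp add: mat_alg_def)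
    finally have "(l2 n ?w)\<^sup>2 = cmod (inner_n n v (app_mat n ?P x v))" by (metis norm_of_real abs_power2)
    also have "\<dots> \<le> l2 n v * l2 n (app_mat n ?P x v)" by (rule inner_bound)
    also have "\<dots> \<le> l2 n v * (nrm MX ?P * l2 n v)" by (intro mult_left_mono nrm_bound(1)[OF P] l2_nonneg)
    also have "\<dots> = (sqrt (nrm MX ?P) * l2 n v)\<^sup>2" using nrm_bound(2)[OF P] by (simp add: power_mult_distrib power2_eq_square mult_ac)
    finally show "l2 n ?w \<le> sqrt (nrm MX ?P) * l2 n v"
      by (rule power2_le_imp_le) (use l2_nonneg[of n v] nrm_bound(2)[OF P] in simp)
  qed
  then have "(nrm MX F)\<^sup>2 \<le> (sqrt (nrm MX ?P))\<^sup>2" using nrm_bound(2)[OF F] by (intro power_mono)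
  then show "(nrm MX F)\<^sup>2 \<le> nrm MX ?P" using nrm_bound(2)[OF P] by simp
qed

lemma mat_complete:
  assumes X: "range Y \<subseteq> carrier MX"
    and C: "\<forall>e>0. \<exists>N. \<forall>m\<ge>N. \<forall>k\<ge>N. nrm MX (Y m \<ominus>\<^bsub>MX\<^esub> Y k) < e"
  shows "\<exists>F\<in>carrier MX. (\<lambda>m. nrm MX (Y m \<ominus>\<^bsub>MX\<^esub> F)) \<longlonglongrightarrow> 0"
proof -
  have Yc: "Y m \<in> carrier MX" for m using X by blast
  have ent: "cmod (Y m i j x - Y k i j x) \<le> nrm MX (Y m \<ominus>\<^bsub>MX\<^esub> Y k)" for m k i j x
  proof -
    interpret abelian_group MX by (rule mat_abelian_group)
    show ?thesis using entry_le_nrm[OF minus_closed[OF Yc[of m] Yc[of k]], of i j x] by (simp add: mat_minus Yc)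
  qed
  have unif: "\<forall>e>0. \<exists>N. \<forall>m k x. N \<le> m \<and> N \<le> k \<and> True \<longrightarrow> dist (Y m i j x) (Y k i j x) < e" for i j
  proof (intro allI impI)
    fix e :: real assume "e > 0"
    then obtain N where N: "\<And>m k. m \<ge> N \<Longrightarrow> k \<ge> N \<Longrightarrow> nrm MX (Y m \<ominus>\<^bsub>MX\<^esub> Y k) < e" using C by blast
    then show "\<exists>N. \<forall>m k x. N \<le> m \<and> N \<le> k \<and> True \<longrightarrow> dist (Y m i j x) (Y k i j x) < e"
    proof (intro exI[of _ N] allI impI)
      fix m k x assume "N \<le> m \<and> N \<le> k \<and> True"
      then show "dist (Y m i j x) (Y k i j x) < e"
        using ent[of m i j x k] N[of m k] by (simp add: dist_norm)
    qed
  qed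
  have "\<exists>l. \<forall>e>0. \<exists>N. \<forall>m x. N \<le> m \<and> True \<longrightarrow> dist (Y m i j x) (l x) < e" for i j
    using uniformly_convergent_eq_cauchy[of "\<lambda>_. True" "\<lambda>m x. Y m i j x"] unif[of i j] by blast
  then obtain F where F: "\<And>i j e. e > 0 \<Longrightarrow> \<exists>N. \<forall>m x. N \<le> m \<longrightarrow> dist (Y m i j x) (F i j x) < e" by (metis (no_types))
  have contF: "continuous_on UNIV (F i j)" for i j
  proof (rule uniform_limit_theorem[where f="\<lambda>m. Y m i j" and F=sequentially])
    show "\<forall>\<^sub>F m in sequentially. continuous_on UNIV (Y m i j)" using Yc by (auto simp: mat_alg_def)
    show "uniform_limit UNIV (\<lambda>m. Y m i j) (F i j) sequentially"
      unfolding uniform_limit_sequentially_iff using F by blast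
  qed simp
  have F0: "F i j = (\<lambda>_. 0)" if ij: "\<not> (i < n \<and> j < n)" for i j
  proof
    fix x
    have "cmod (F i j x) \<le> e" if e: "e > 0" for e
    proof -
      obtain N where "\<forall>m x. N \<le> m \<longrightarrow> dist (Y m i j x) (F i j x) < e" using F[OF e, of i j] by blast
      then have "dist (Y N i j x) (F i j x) < e" by blast
      then show ?thesis using mat_outside[OF Yc[of N] ij, of x] by (simp add: dist_norm)
    qed
    then have "cmod (F i j x) \<le> 0" by (rule field_le_epsilon[of _ 0, simplified])
    then show "F i j x = 0" by simp
  qed
  have Fc: "F \<in> carrier MX" using contF F0 by (simp add: mat_alg_def)
  have "(\<lambda>m. nrm MX (Y m \<ominus>\<^bsub>MX\<^esub> F)) \<longlonglongrightarrow> 0"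
  proof (rule LIMSEQ_I)
    fix r :: real assume r: "r > 0"
    define w where "w = real n * real n + 1"
    define e where "e = r / (2 * w)"
    have nn: "w > 0" by (simp add: w_def add_nonneg_pos)
    have e: "e > 0" unfolding e_def using r nn by simp
    have nne: "real n * (real n * e) < r"
    proof -
      have "real n * (real n * e) \<le> w * e" using e by (simp add: w_def algebra_simps)
      also have "\<dots> = r / 2" unfolding e_def using nn by simp
      finally show ?thesis using r by simp
    qed
    have "\<exists>N. \<forall>i<n. \<forall>j<n. \<forall>m\<ge>N. \<forall>x. dist (Y m i j x) (F i j x) < e"
    proof -
      obtain N where N: "\<And>i j m x. N i j \<le> m \<Longrightarrow> dist (Y m i j x) (F i j x) < e" using F[OF e] by metis
      let ?N = "\<Sum>i<n. \<Sum>j<n. N i j"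
      have "N i j \<le> ?N" if "i < n" "j < n" for i j
      proof -
        have "N i j \<le> (\<Sum>j<n. N i j)" using that by (intro member_le_sum) auto
        also have "\<dots> \<le> ?N" using that by (intro member_le_sum[of i "{..<n}" "\<lambda>i. \<Sum>j<n. N i j"]) auto
        finally show ?thesis .
      qed
      then show ?thesis using N by (intro exI[of _ ?N] allI impI) (blast intro: order_trans)
    qed
    then obtain N where N: "\<And>i j m x. i < n \<Longrightarrow> j < n \<Longrightarrow> m \<ge> N \<Longrightarrow> dist (Y m i j x) (F i j x) < e" by blast
    show "\<exists>N. \<forall>m\<ge>N. norm (nrm MX (Y m \<ominus>\<^bsub>MX\<^esub> F) - 0) < r"
    proof (intro exI[of _ N] allI impI)
      fix m assume m: "m \<ge> N"
      interpret abelian_group MX by (rule mat_abelian_group)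
      have "nrm MX (Y m \<ominus>\<^bsub>MX\<^esub> F) \<le> real n * (real n * e)"
      proof (rule nrm_le)
        fix x v
        show "l2 n (app_mat n (Y m \<ominus>\<^bsub>MX\<^esub> F) x v) \<le> real n * (real n * e) * l2 n v"
          using N[OF _ _ m] e by (intro app_entry_bound) (auto simp: mat_minus Yc Fc dist_norm intro: less_imp_le)
      qed (use e in simp)
      moreover have "0 \<le> nrm MX (Y m \<ominus>\<^bsub>MX\<^esub> F)" by (rule nrm_bound(2)[OF minus_closed[OF Yc Fc]])
      ultimately show "norm (nrm MX (Y m \<ominus>\<^bsub>MX\<^esub> F) - 0) < r" using nne by simp
    qed
  qed
  then show ?thesis using Fc by blast
qed

theorem mat_cstar_algebra: "cstar_algebra MX"
proof -
  have R: "ring MX"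
  proof (rule ringI[OF mat_abelian_group mat_monoid])
    fix F G K assume "F \<in> carrier MX" "G \<in> carrier MX" "K \<in> carrier MX"
    show "(F \<oplus>\<^bsub>MX\<^esub> G) \<otimes>\<^bsub>MX\<^esub> K = F \<otimes>\<^bsub>MX\<^esub> K \<oplus>\<^bsub>MX\<^esub> G \<otimes>\<^bsub>MX\<^esub> K"
      "K \<otimes>\<^bsub>MX\<^esub> (F \<oplus>\<^bsub>MX\<^esub> G) = K \<otimes>\<^bsub>MX\<^esub> F \<oplus>\<^bsub>MX\<^esub> K \<otimes>\<^bsub>MX\<^esub> G"
      by (simp_all add: mat_alg_def sum.distrib distrib_right distrib_left)
  qed
  show ?thesis
  proof (intro cstar_algebra.intro[OF R] cstar_algebra_axioms.intro)
    fix F G :: "nat \<Rightarrow> nat \<Rightarrow> 'x \<Rightarrow> complex" and c d :: complex assume F: "F \<in> carrier MX"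
    show "c \<odot>\<^bsub>MX\<^esub> F \<in> carrier MX" "adj MX F \<in> carrier MX" by (rule mat_closed(3)[OF F F], rule mat_closed(4)[OF F F])
    show "(c + d) \<odot>\<^bsub>MX\<^esub> F = c \<odot>\<^bsub>MX\<^esub> F \<oplus>\<^bsub>MX\<^esub> d \<odot>\<^bsub>MX\<^esub> F" "c \<odot>\<^bsub>MX\<^esub> d \<odot>\<^bsub>MX\<^esub> F = (c * d) \<odot>\<^bsub>MX\<^esub> F"
      "1 \<odot>\<^bsub>MX\<^esub> F = F" "adj MX (adj MX F) = F" "adj MX (c \<odot>\<^bsub>MX\<^esub> F) = cnj c \<odot>\<^bsub>MX\<^esub> adj MX F"
      by (simp_all add: mat_alg_def algebra_simps)
    show "0 \<le> nrm MX F" by (rule nrm_bound(2)[OF F])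
    show "nrm MX F = 0 \<longleftrightarrow> F = \<zero>\<^bsub>MX\<^esub>"
    proof
      assume "nrm MX F = 0"
      then have "F i j x = 0" for i j x using entry_le_nrm[OF F, of i j x] by simp
      then show "F = \<zero>\<^bsub>MX\<^esub>" by (simp add: mat_alg_def fun_eq_iff)
    next
      assume F0: "F = \<zero>\<^bsub>MX\<^esub>"
      have z: "app_mat n F x v = (\<lambda>i. 0)" for x v unfolding F0 by (simp add: mat_alg_def app_mat_def fun_eq_iff)
      have "l2 n (\<lambda>i. 0) = 0" by (simp add: l2_def L2_set_def)
      then have "nrm MX F \<le> 0" by (intro nrm_le) (simp_all add: z)
      then show "nrm MX F = 0" using nrm_bound(2)[OF F] by simp
    qed
    show "nrm MX (adj MX F \<otimes>\<^bsub>MX\<^esub> F) = (nrm MX F)\<^sup>2" by (rule nrm_cstar[OF F])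
    have le: "nrm MX (c \<odot>\<^bsub>MX\<^esub> F) \<le> cmod c * nrm MX F" if F: "F \<in> carrier MX" for c F
    proof (rule nrm_le)
      fix x v
      have "app_mat n (c \<odot>\<^bsub>MX\<^esub> F) x v = (\<lambda>i. c * app_mat n F x v i)"
        by (simp add: mat_alg_def app_mat_def sum_distrib_left mult.assoc fun_eq_iff)
      then show "l2 n (app_mat n (c \<odot>\<^bsub>MX\<^esub> F) x v) \<le> cmod c * nrm MX F * l2 n v"
        using mult_left_mono[OF nrm_bound(1)[OF F, of x v] norm_ge_zero[of c]] by (simp add: l2_scale mult.assoc)
    qed (use nrm_bound(2)[OF F] in simp)
    show "nrm MX (c \<odot>\<^bsub>MX\<^esub> F) = cmod c * nrm MX F"
    proof (cases "c = 0")
      case True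
      then show ?thesis using le[OF F, of c] nrm_bound(2)[OF mat_closed(3)[OF F F, of c]] by simp
    next
      case False
      have "F = (1/c) \<odot>\<^bsub>MX\<^esub> (c \<odot>\<^bsub>MX\<^esub> F)" using False by (simp add: mat_alg_def)
      then have "nrm MX F \<le> cmod (1/c) * nrm MX (c \<odot>\<^bsub>MX\<^esub> F)" using le[OF mat_closed(3)[OF F F, of c], of "1/c"] by simp
      then have "cmod c * nrm MX F \<le> nrm MX (c \<odot>\<^bsub>MX\<^esub> F)" using False by (simp add: norm_divide field_simps)
      then show ?thesis using le[OF F, of c] by simp
    qed
    assume G: "G \<in> carrier MX"
    show "c \<odot>\<^bsub>MX\<^esub> (F \<oplus>\<^bsub>MX\<^esub> G) = c \<odot>\<^bsub>MX\<^esub> F \<oplus>\<^bsub>MX\<^esub> c \<odot>\<^bsub>MX\<^esub> G"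
      "c \<odot>\<^bsub>MX\<^esub> F \<otimes>\<^bsub>MX\<^esub> G = c \<odot>\<^bsub>MX\<^esub> (F \<otimes>\<^bsub>MX\<^esub> G)" "F \<otimes>\<^bsub>MX\<^esub> c \<odot>\<^bsub>MX\<^esub> G = c \<odot>\<^bsub>MX\<^esub> (F \<otimes>\<^bsub>MX\<^esub> G)"
      "adj MX (F \<oplus>\<^bsub>MX\<^esub> G) = adj MX F \<oplus>\<^bsub>MX\<^esub> adj MX G"
      by (simp_all add: mat_alg_def algebra_simps sum_distrib_left)
    show "adj MX (F \<otimes>\<^bsub>MX\<^esub> G) = adj MX G \<otimes>\<^bsub>MX\<^esub> adj MX F" by (simp add: mat_alg_def mult.commute)
    show "nrm MX (F \<otimes>\<^bsub>MX\<^esub> G) \<le> nrm MX F * nrm MX G" by (rule nrm_mult_le[OF F G])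
    show "nrm MX (F \<oplus>\<^bsub>MX\<^esub> G) \<le> nrm MX F + nrm MX G"
    proof (rule nrm_le)
      fix x v
      have "app_mat n (F \<oplus>\<^bsub>MX\<^esub> G) x v = (\<lambda>i. app_mat n F x v i + app_mat n G x v i)"
        by (simp add: mat_alg_def app_mat_def sum.distrib distrib_right fun_eq_iff)
      then show "l2 n (app_mat n (F \<oplus>\<^bsub>MX\<^esub> G) x v) \<le> (nrm MX F + nrm MX G) * l2 n v"
        using l2_triangle[of n "app_mat n F x v" "app_mat n G x v"] nrm_bound(1)[OF F, of x v] nrm_bound(1)[OF G, of x v]
        by (simp add: distrib_right)
    qed (use nrm_bound(2) F G in simp)
  next
    fix Y :: "nat \<Rightarrow> nat \<Rightarrow> nat \<Rightarrow> 'x \<Rightarrow> complex"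
    assume "range Y \<subseteq> carrier MX" "\<forall>e>0. \<exists>N. \<forall>m\<ge>N. \<forall>k\<ge>N. nrm MX (Y m \<ominus>\<^bsub>MX\<^esub> Y k) < e"
    then show "\<exists>F\<in>carrier MX. (\<lambda>m. nrm MX (Y m \<ominus>\<^bsub>MX\<^esub> F)) \<longlonglongrightarrow> 0" by (rule mat_complete)
  qed
qed

text \<open>Each summand is Z* Z for a continuous Z, built from the square root of the weight. In the C*-algebra of matrices
over C(X) a sum of such elements is again of the form R* R, by positive_add; this supplies the continuous
root R of the sum.\<close>

theorem continuous_matrix_factorization:
  fixes G :: "'t \<Rightarrow> 'x \<Rightarrow> real" and Y :: "'t \<Rightarrow> nat \<Rightarrow> nat \<Rightarrow> complex"
  assumes J: "finite J" and G: "\<And>t. t \<in> J \<Longrightarrow> continuous_on UNIV (G t)" "\<And>t x. t \<in> J \<Longrightarrow> 0 \<le> G t x"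
  obtains R :: "nat \<Rightarrow> nat \<Rightarrow> 'x \<Rightarrow> complex" where "\<And>i j. continuous_on UNIV (R i j)"
    "\<And>i j x. i < n \<Longrightarrow> j < n \<Longrightarrow>
       (\<Sum>t\<in>J. complex_of_real (G t x) * (\<Sum>k<n. cnj (Y t k i) * Y t k j)) = (\<Sum>k<n. cnj (R k i x) * R k j x)"
proof -
  interpret cstar_algebra MX by (rule mat_cstar_algebra)
  define Q where "Q J i j x = (if i < n \<and> j < n then
       (\<Sum>t\<in>J. complex_of_real (G t x) * (\<Sum>k<n. cnj (Y t k i) * Y t k j)) else 0)" for J i j x
  have "\<exists>R\<in>carrier MX. Q J = adj MX R \<otimes>\<^bsub>MX\<^esub> R" using J G
  proof (induction J rule: finite_induct)
    case empty
    have "Q {} = adj MX \<zero>\<^bsub>MX\<^esub> \<otimes>\<^bsub>MX\<^esub> \<zero>\<^bsub>MX\<^esub>" by (simp add: Q_def[abs_def] mat_alg_def fun_eq_iff)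
    then show ?case using mat_zero_one by blast
  next
    case (insert t J)
    define Z where "Z i j x = (if i < n \<and> j < n then complex_of_real (sqrt (G t x)) * Y t i j else 0)" for i j x
    have "continuous_on UNIV (Z i j)" for i j
      unfolding Z_def[abs_def] using insert.prems(1)[of t]
      by (cases "i < n \<and> j < n") (auto intro!: continuous_intros)
    then have Z: "Z \<in> carrier MX" by (auto simp: mat_alg_def Z_def fun_eq_iff)
    have sq: "complex_of_real (sqrt (G t x)) * complex_of_real (sqrt (G t x)) = complex_of_real (G t x)" for x
      using insert.prems(2)[of t x] by (simp flip: of_real_mult)
    have ZZ: "(adj MX Z \<otimes>\<^bsub>MX\<^esub> Z) i j x = (if i < n \<and> j < n then complex_of_real (G t x) * (\<Sum>k<n. cnj (Y t k i) * Y t k j) else 0)" for i j x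
    proof -
      have "(adj MX Z \<otimes>\<^bsub>MX\<^esub> Z) i j x = (\<Sum>k<n. cnj (Z k i x) * Z k j x)" by (simp add: mat_alg_def)
      also have "\<dots> = (\<Sum>k<n. if i < n \<and> j < n then complex_of_real (G t x) * (cnj (Y t k i) * Y t k j) else 0)"
        by (intro sum.cong) (auto simp: Z_def sq[symmetric])
      finally show ?thesis by (auto simp: sum_distrib_left)
    qed
    have "Q (insert t J) = (adj MX Z \<otimes>\<^bsub>MX\<^esub> Z) \<oplus>\<^bsub>MX\<^esub> Q J"
    proof (intro ext)
      fix i j x
      have "((adj MX Z \<otimes>\<^bsub>MX\<^esub> Z) \<oplus>\<^bsub>MX\<^esub> Q J) i j x = (adj MX Z \<otimes>\<^bsub>MX\<^esub> Z) i j x + Q J i j x" by (simp add: mat_alg_def)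
      then show "Q (insert t J) i j x = ((adj MX Z \<otimes>\<^bsub>MX\<^esub> Z) \<oplus>\<^bsub>MX\<^esub> Q J) i j x"
        unfolding ZZ using insert.hyps by (simp add: Q_def)
    qed
    moreover obtain R where R: "R \<in> carrier MX" "Q J = adj MX R \<otimes>\<^bsub>MX\<^esub> R" using insert by auto
    ultimately show ?case
      using positive_add[OF positive_adj_mult[OF Z] positive_adj_mult[OF R(1)]] unfolding positive_def by simp
  qed
  then obtain R where R: "R \<in> carrier MX" "Q J = adj MX R \<otimes>\<^bsub>MX\<^esub> R" by blast
  show ?thesis
  proof (rule that[of R])
    show "continuous_on UNIV (R i j)" for i j using R(1) by (simp add: mat_alg_def)
    fix i j x assume ij: "i < n" "j < n"
    have "Q J i j x = (\<Sum>k<n. cnj (R k i x) * R k j x)" unfolding R(2) by (simp add: mat_alg_def)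
    then show "(\<Sum>t\<in>J. complex_of_real (G t x) * (\<Sum>k<n. cnj (Y t k i) * Y t k j)) = (\<Sum>k<n. cnj (R k i x) * R k j x)"
      using ij by (simp add: Q_def)
  qed
qed

end

section \<open>The algebras C(X) and C^N\<close>

lemma C_alg_simps [simp]:
  "f \<in> carrier C_alg \<longleftrightarrow> continuous_on UNIV f" "f \<otimes>\<^bsub>C_alg\<^esub> g = (\<lambda>x. f x * g x)"
  "f \<oplus>\<^bsub>C_alg\<^esub> g = (\<lambda>x. f x + g x)" "\<one>\<^bsub>C_alg\<^esub> = (\<lambda>x. 1)" "\<zero>\<^bsub>C_alg\<^esub> = (\<lambda>x. 0)"
  "c \<odot>\<^bsub>C_alg\<^esub> f = (\<lambda>x. c * f x)" "adj C_alg f = (\<lambda>x. cnj (f x))"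
  by (simp_all add: C_alg_def)

lemma C_alg_monoid: "abelian_monoid (C_alg :: ('x::topological_space \<Rightarrow> complex) cstar)"
  by (rule abelian_monoidI) (auto simp: add_ac intro!: continuous_intros)

lemma finsum_C_alg:
  fixes f :: "'k \<Rightarrow> 'x::topological_space \<Rightarrow> complex"
  assumes "finite S" "\<And>k. k \<in> S \<Longrightarrow> continuous_on UNIV (f k)"
  shows "finsum C_alg f S = (\<lambda>x. \<Sum>k\<in>S. f k x)"
  using assms
proof (induction S rule: finite_induct)
  case empty
  show ?case using abelian_monoid.finsum_empty[OF C_alg_monoid, of f] by simp
next
  case (insert k S)
  have "finsum C_alg f (insert k S) = f k \<oplus>\<^bsub>C_alg\<^esub> finsum C_alg f S"
    using insert by (intro abelian_monoid.finsum_insert[OF C_alg_monoid]) auto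
  then show ?case using insert by simp
qed

text \<open>Coordinate sequences that vanish from N on, on the type over which the algebras in approximations range.\<close>

definition C_pow :: "nat \<Rightarrow> coords cstar" where
  "C_pow N = \<lparr> carrier = {f. \<forall>i\<ge>N. f i = 0}, monoid.mult = (\<lambda>f g i. f i * g i),
     one = (\<lambda>i. if i < N then 1 else 0), zero = (\<lambda>i. 0), add = (\<lambda>f g i. f i + g i),
     scale = (\<lambda>c f i. c * f i), adj = (\<lambda>f i. cnj (f i)),
     nrm = (\<lambda>f. Max (insert 0 ((\<lambda>i. cmod (f i)) ` {..<N}))) \<rparr>"

lemma C_pow_simps [simp]:
  "f \<in> carrier (C_pow N) \<longleftrightarrow> (\<forall>i\<ge>N. f i = 0)" "f \<otimes>\<^bsub>C_pow N\<^esub> g = (\<lambda>i. f i * g i)"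
  "f \<oplus>\<^bsub>C_pow N\<^esub> g = (\<lambda>i. f i + g i)" "\<one>\<^bsub>C_pow N\<^esub> = (\<lambda>i. if i < N then 1 else 0)" "\<zero>\<^bsub>C_pow N\<^esub> = (\<lambda>i. 0)"
  "c \<odot>\<^bsub>C_pow N\<^esub> f = (\<lambda>i. c * f i)" "adj (C_pow N) f = (\<lambda>i. cnj (f i))"
  by (simp_all add: C_pow_def)

lemma C_pow_nrm_le: "c \<ge> 0 \<Longrightarrow> (\<And>i. i < N \<Longrightarrow> cmod (f i) \<le> c) \<Longrightarrow> nrm (C_pow N) f \<le> c"
  by (auto simp: C_pow_def)

lemma C_pow_nrm_ge: "f \<in> carrier (C_pow N) \<Longrightarrow> cmod (f i) \<le> nrm (C_pow N) f" "0 \<le> nrm (C_pow N) f"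
proof -
  show "0 \<le> nrm (C_pow N) f" by (simp add: C_pow_def)
  assume "f \<in> carrier (C_pow N)"
  then show "cmod (f i) \<le> nrm (C_pow N) f"
    by (cases "i < N") (auto simp: C_pow_def intro!: Max_ge)
qed

lemma C_pow_abelian: "abelian_group (C_pow N)"
proof (rule abelian_groupI)
  fix f assume "f \<in> carrier (C_pow N)"
  then show "\<exists>g\<in>carrier (C_pow N). g \<oplus>\<^bsub>C_pow N\<^esub> f = \<zero>\<^bsub>C_pow N\<^esub>" by (intro bexI[of _ "\<lambda>i. - f i"]) auto
qed (auto simp: add_ac)

lemma C_pow_minus:
  assumes f: "f \<in> carrier (C_pow N)" and g: "g \<in> carrier (C_pow N)"
  shows "f \<ominus>\<^bsub>C_pow N\<^esub> g = (\<lambda>i. f i - g i)"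
proof -
  interpret abelian_group "C_pow N" by (rule C_pow_abelian)
  have "\<ominus>\<^bsub>C_pow N\<^esub> g = (\<lambda>i. - g i)"
    by (rule minus_equality[OF _ g]) (use g in auto)
  then show ?thesis by (simp add: a_minus_def)
qed

lemma C_pow_complete:
  assumes X: "range X \<subseteq> carrier (C_pow N)"
    and C: "\<forall>e>0. \<exists>M. \<forall>m\<ge>M. \<forall>k\<ge>M. nrm (C_pow N) (X m \<ominus>\<^bsub>C_pow N\<^esub> X k) < e"
  shows "\<exists>x\<in>carrier (C_pow N). (\<lambda>m. nrm (C_pow N) (X m \<ominus>\<^bsub>C_pow N\<^esub> x)) \<longlonglongrightarrow> 0"
proof -
  have Xc: "X m \<in> carrier (C_pow N)" for m using X by blast
  have Xz: "N \<le> i \<Longrightarrow> X m i = 0" for m i using Xc[of m] by simp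
  have "Cauchy (\<lambda>m. X m i)" for i
  proof (rule metric_CauchyI)
    fix e :: real assume "e > 0"
    then obtain M where M: "\<And>m k. m \<ge> M \<Longrightarrow> k \<ge> M \<Longrightarrow> nrm (C_pow N) (X m \<ominus>\<^bsub>C_pow N\<^esub> X k) < e" using C by blast
    have "dist (X m i) (X k i) \<le> nrm (C_pow N) (X m \<ominus>\<^bsub>C_pow N\<^esub> X k)" for m k
      using C_pow_nrm_ge(1)[of "\<lambda>i. X m i - X k i" N i] Xz unfolding C_pow_minus[OF Xc Xc] by (simp add: dist_norm)
    then show "\<exists>M. \<forall>m\<ge>M. \<forall>k\<ge>M. dist (X m i) (X k i) < e" using M by (meson le_less_trans)
  qed
  then have "\<exists>l. (\<lambda>m. X m i) \<longlonglongrightarrow> l" for i using Cauchy_convergent_iff convergent_def by blast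
  then obtain x where x: "\<And>i. (\<lambda>m. X m i) \<longlonglongrightarrow> x i" by metis
  have "x i = 0" if "N \<le> i" for i using LIMSEQ_unique[OF x[of i], of 0] Xz[OF that] by simp
  then have xc: "x \<in> carrier (C_pow N)" by simp
  have "(\<lambda>m. \<Sum>i<N. cmod (X m i - x i)) \<longlonglongrightarrow> (\<Sum>i<N. cmod (x i - x i))"
    by (intro tendsto_intros x)
  then have l: "(\<lambda>m. \<Sum>i<N. cmod (X m i - x i)) \<longlonglongrightarrow> 0" by simp
  have "(\<lambda>m. nrm (C_pow N) (X m \<ominus>\<^bsub>C_pow N\<^esub> x)) \<longlonglongrightarrow> 0"
  proof (rule Lim_null_comparison[OF _ l], intro always_eventually allI)
    fix m
    have "nrm (C_pow N) (X m \<ominus>\<^bsub>C_pow N\<^esub> x) \<le> (\<Sum>i<N. cmod (X m i - x i))"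
      unfolding C_pow_minus[OF Xc xc] by (intro C_pow_nrm_le sum_nonneg member_le_sum) auto
    then show "norm (nrm (C_pow N) (X m \<ominus>\<^bsub>C_pow N\<^esub> x)) \<le> (\<Sum>i<N. cmod (X m i - x i))"
      using C_pow_nrm_ge(2) by simp
  qed
  then show ?thesis using xc by blast
qed

lemma C_pow_cstar: "cstar_algebra (C_pow N)"
proof -
  have M: "monoid (C_pow N)" by (rule monoidI) (auto simp: mult_ac fun_eq_iff)
  have R: "ring (C_pow N)"
    by (rule ringI[OF C_pow_abelian M]) (simp_all add: fun_eq_iff distrib_left distrib_right)
  show ?thesis
  proof (intro cstar_algebra.intro[OF R] cstar_algebra_axioms.intro)
    fix f g :: coords and c d :: complex assume f: "f \<in> carrier (C_pow N)"
    note ge = C_pow_nrm_ge(1)[OF f] C_pow_nrm_ge(2)[of N]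
    show "0 \<le> nrm (C_pow N) f" by (rule ge)
    show "nrm (C_pow N) f = 0 \<longleftrightarrow> f = \<zero>\<^bsub>C_pow N\<^esub>"
    proof
      assume "nrm (C_pow N) f = 0"
      then show "f = \<zero>\<^bsub>C_pow N\<^esub>" using ge(1) by (simp add: fun_eq_iff)
    next
      assume "f = \<zero>\<^bsub>C_pow N\<^esub>"
      then have "nrm (C_pow N) f \<le> 0" by (intro C_pow_nrm_le) auto
      then show "nrm (C_pow N) f = 0" using ge(2)[of f] by simp
    qed
    have le: "nrm (C_pow N) (\<lambda>i. c * f i) \<le> cmod c * nrm (C_pow N) f" if "f \<in> carrier (C_pow N)" for c f
      using C_pow_nrm_ge(1)[OF that] C_pow_nrm_ge(2) by (intro C_pow_nrm_le) (auto simp: norm_mult intro: mult_left_mono)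
    show "nrm (C_pow N) (c \<odot>\<^bsub>C_pow N\<^esub> f) = cmod c * nrm (C_pow N) f"
    proof (cases "c = 0")
      case True
      then show ?thesis using le[OF f, of c] ge(2)[of "\<lambda>i. c * f i"] by simp
    next
      case False
      have "nrm (C_pow N) (\<lambda>i. (1/c) * (c * f i)) \<le> cmod (1/c) * nrm (C_pow N) (\<lambda>i. c * f i)"
        using f by (intro le) auto
      then have "cmod c * nrm (C_pow N) f \<le> nrm (C_pow N) (\<lambda>i. c * f i)" using False by (simp add: norm_divide field_simps)
      then show ?thesis using le[OF f, of c] by simp
    qed
    show "nrm (C_pow N) (adj (C_pow N) f \<otimes>\<^bsub>C_pow N\<^esub> f) = (nrm (C_pow N) f)\<^sup>2"
    proof (rule antisym)
      show "nrm (C_pow N) (adj (C_pow N) f \<otimes>\<^bsub>C_pow N\<^esub> f) \<le> (nrm (C_pow N) f)\<^sup>2"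
        using ge by (intro C_pow_nrm_le) (auto simp: norm_mult power2_eq_square intro: mult_mono)
      let ?h = "\<lambda>i. cnj (f i) * f i"
      have h: "?h \<in> carrier (C_pow N)" using f by simp
      have "nrm (C_pow N) f \<le> sqrt (nrm (C_pow N) ?h)"
      proof (rule C_pow_nrm_le)
        fix i
        have "(cmod (f i))\<^sup>2 \<le> nrm (C_pow N) ?h"
          using C_pow_nrm_ge(1)[OF h, of i] by (simp add: norm_mult power2_eq_square)
        then show "cmod (f i) \<le> sqrt (nrm (C_pow N) ?h)" by (rule real_le_rsqrt)
      qed (use C_pow_nrm_ge(2) in simp)
      then have "(nrm (C_pow N) f)\<^sup>2 \<le> (sqrt (nrm (C_pow N) ?h))\<^sup>2" using ge(2)[of f] by (intro power_mono)
      then show "(nrm (C_pow N) f)\<^sup>2 \<le> nrm (C_pow N) (adj (C_pow N) f \<otimes>\<^bsub>C_pow N\<^esub> f)"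
        using C_pow_nrm_ge(2)[of N ?h] by simp
    qed
    assume g: "g \<in> carrier (C_pow N)"
    show "nrm (C_pow N) (f \<oplus>\<^bsub>C_pow N\<^esub> g) \<le> nrm (C_pow N) f + nrm (C_pow N) g"
      using ge C_pow_nrm_ge(1)[OF g] C_pow_nrm_ge(2)
      by (intro C_pow_nrm_le) (auto intro: order_trans[OF norm_triangle_ineq] add_mono)
    show "nrm (C_pow N) (f \<otimes>\<^bsub>C_pow N\<^esub> g) \<le> nrm (C_pow N) f * nrm (C_pow N) g"
      using ge C_pow_nrm_ge(1)[OF g] C_pow_nrm_ge(2) by (intro C_pow_nrm_le) (auto simp: norm_mult intro: mult_mono)
  next
    fix X :: "nat \<Rightarrow> coords"
    assume "range X \<subseteq> carrier (C_pow N)" "\<forall>e>0. \<exists>M. \<forall>m\<ge>M. \<forall>k\<ge>M. nrm (C_pow N) (X m \<ominus>\<^bsub>C_pow N\<^esub> X k) < e"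
    then show "\<exists>x\<in>carrier (C_pow N). (\<lambda>m. nrm (C_pow N) (X m \<ominus>\<^bsub>C_pow N\<^esub> x)) \<longlonglongrightarrow> 0" by (rule C_pow_complete)
  qed (auto simp: algebra_simps fun_eq_iff)
qed

lemma finsum_C_pow:
  assumes "finite S" "\<And>k. k \<in> S \<Longrightarrow> f k \<in> carrier (C_pow N)"
  shows "finsum (C_pow N) f S = (\<lambda>i. \<Sum>k\<in>S. f k i)"
proof -
  interpret abelian_group "C_pow N" by (rule C_pow_abelian)
  show ?thesis using assms
  proof (induction S rule: finite_induct)
    case (insert k S)
    have "finsum (C_pow N) f (insert k S) = f k \<oplus>\<^bsub>C_pow N\<^esub> finsum (C_pow N) f S"
      using insert by (intro finsum_insert) auto
    then show ?case using insert by simp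
  qed simp
qed

definition unit_coord :: "nat \<Rightarrow> coords" where "unit_coord t = (\<lambda>i. if i = t then 1 else 0)"

lemma inj_unit_coord: "inj_on unit_coord S"
  by (rule inj_onI) (metis unit_coord_def zero_neq_one)

lemma C_pow_finite_dimensional: "finite_dimensional (C_pow N)"
  unfolding finite_dimensional_def
proof (intro exI[of _ "unit_coord ` {..<N}"] conjI ballI)
  show "unit_coord ` {..<N} \<subseteq> carrier (C_pow N)" by (auto simp: unit_coord_def)
  fix x assume x: "x \<in> carrier (C_pow N)"
  let ?c = "\<lambda>s. \<Sum>t<N. x t * s t"
  have c: "?c (unit_coord u) = x u" if "u < N" for u
  proof -
    have "?c (unit_coord u) = (\<Sum>t<N. if t = u then x t else 0)" by (intro sum.cong) (auto simp: unit_coord_def)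
    then show ?thesis using that by simp
  qed
  have "(\<Oplus>\<^bsub>C_pow N\<^esub>s\<in>unit_coord ` {..<N}. ?c s \<odot>\<^bsub>C_pow N\<^esub> s) = (\<lambda>i. \<Sum>s\<in>unit_coord ` {..<N}. ?c s * s i)"
    by (subst finsum_C_pow) (auto simp: unit_coord_def)
  also have "\<dots> = (\<lambda>i. \<Sum>u<N. x u * unit_coord u i)"
    by (subst sum.reindex[OF inj_unit_coord]) (auto simp: c fun_eq_iff intro!: sum.cong)
  also have "\<dots> = x"
  proof
    fix i
    have "(\<Sum>u<N. x u * unit_coord u i) = (\<Sum>u<N. if u = i then x u else 0)" by (intro sum.cong) (auto simp: unit_coord_def)
    then show "(\<Sum>u<N. x u * unit_coord u i) = x i" using x by (cases "i < N") auto
  qed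
  finally show "\<exists>c. x = (\<Oplus>\<^bsub>C_pow N\<^esub>s\<in>unit_coord ` {..<N}. c s \<odot>\<^bsub>C_pow N\<^esub> s)" by (intro exI[of _ ?c]) simp
qed simp

lemma C_pow_minimal_projection:
  assumes e: "minimal_projection (C_pow N) e" shows "\<exists>t<N. e = unit_coord t"
proof -
  have e': "projection (C_pow N) e" "e \<noteq> (\<lambda>i. 0)"
    "\<And>q. projection (C_pow N) q \<Longrightarrow> (\<lambda>i. e i * q i) = q \<Longrightarrow> q = (\<lambda>i. 0) \<or> q = e"
    using e by (auto simp: minimal_projection_def)
  obtain t where t: "e t \<noteq> 0" using e'(2) by auto
  have tN: "t < N" using e'(1) t unfolding projection_def C_pow_simps by (meson not_less)
  have "e t * e t = e t" using e'(1) by (auto simp: projection_def fun_eq_iff)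
  then have "e t = 1" using t by simp
  then have "(\<lambda>i. e i * unit_coord t i) = unit_coord t" by (auto simp: unit_coord_def)
  moreover have "projection (C_pow N) (unit_coord t)" using tN by (auto simp: projection_def unit_coord_def)
  moreover have "unit_coord t \<noteq> (\<lambda>i. 0)" by (metis unit_coord_def zero_neq_one)
  ultimately show ?thesis using e'(3) tN by metis
qed

text \<open>The minimal projections in entropy_spectral are forced to be the unit coordinates.\<close>

lemma C_pow_entropy:
  assumes \<rho>: "state (C_pow N) \<rho>"
  shows "von_neumann_entropy (C_pow N) \<rho> = shannon {..<N} (\<lambda>t. Re (\<rho> (unit_coord t)))"
proof -
  interpret fd_cstar "C_pow N"
    by (intro fd_cstar.intro C_pow_cstar fd_cstar_axioms.intro C_pow_finite_dimensional)
  obtain E m where E: "finite E" "\<And>e. e \<in> E \<Longrightarrow> minimal_projection (C_pow N) e" "(\<Oplus>\<^bsub>C_pow N\<^esub>e\<in>E. e) = \<one>\<^bsub>C_pow N\<^esub>"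
    and m: "\<And>e. e \<in> E \<Longrightarrow> \<rho> e = complex_of_real (m e)"
    and S: "von_neumann_entropy (C_pow N) \<rho> = - (\<Sum>e\<in>E. m e * ln (m e))"
    by (rule entropy_spectral[OF \<rho>]) blast
  have "E = unit_coord ` {..<N}"
  proof (intro equalityI subsetI)
    fix e assume "e \<in> E" then show "e \<in> unit_coord ` {..<N}" using C_pow_minimal_projection[OF E(2)] by blast
  next
    fix u assume "u \<in> unit_coord ` {..<N}"
    then obtain t where t: "t < N" "u = unit_coord t" by blast
    have "(\<lambda>i. \<Sum>e\<in>E. e i) = \<one>\<^bsub>C_pow N\<^esub>"
      using finsum_C_pow[OF E(1), of "\<lambda>e. e" N] minimal_projectionD(3)[OF E(2)] E(3) by simp
    then have "(\<Sum>e\<in>E. e t) = 1" using t by (simp add: fun_eq_iff)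
    then obtain e where e: "e \<in> E" "e t \<noteq> 0" by (metis sum.neutral zero_neq_one)
    obtain s where "e = unit_coord s" using C_pow_minimal_projection[OF E(2)[OF e(1)]] by blast
    then have "e = u" using e(2) t by (auto simp: unit_coord_def split: if_splits)
    then show "u \<in> E" using e by simp
  qed
  then show ?thesis unfolding S shannon_def using m
    by (simp add: sum.reindex[OF inj_unit_coord])
qed

section \<open>Unital completely positive maps\<close>

lemma (in cstar_algebra) matrix_pos_one: "matrix_pos A 1 (\<lambda>_ _. x) \<longleftrightarrow> positive x"
proof
  assume "matrix_pos A 1 (\<lambda>_ _. x)"
  then obtain Y where Y: "Y 0 0 \<in> carrier A" "x = (\<Oplus>k\<in>{..<1::nat}. adj A (Y k 0) \<otimes> Y k 0)"
    unfolding matrix_pos_def by auto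
  have "x = adj A (Y 0 0) \<otimes> Y 0 0" unfolding Y(2) using Y(1) by (simp add: lessThan_Suc adj_closed)
  then show "positive x" using Y(1) unfolding positive_def by blast
next
  assume "positive x"
  then obtain y where y: "y \<in> carrier A" "x = adj A y \<otimes> y" unfolding positive_def by blast
  then show "matrix_pos A 1 (\<lambda>_ _. x)" unfolding matrix_pos_def
    by (intro exI[of _ "\<lambda>_ _. y"]) (simp add: lessThan_Suc adj_closed)
qed

lemma ucpD:
  assumes "ucp A B f"
  shows "\<And>x. x \<in> carrier A \<Longrightarrow> f x \<in> carrier B" "f \<one>\<^bsub>A\<^esub> = \<one>\<^bsub>B\<^esub>"
    "\<And>x y. x \<in> carrier A \<Longrightarrow> y \<in> carrier A \<Longrightarrow> f (x \<oplus>\<^bsub>A\<^esub> y) = f x \<oplus>\<^bsub>B\<^esub> f y"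
    "\<And>c x. x \<in> carrier A \<Longrightarrow> f (c \<odot>\<^bsub>A\<^esub> x) = c \<odot>\<^bsub>B\<^esub> f x"
    "\<And>n X. (\<And>i j. i < n \<Longrightarrow> j < n \<Longrightarrow> X i j \<in> carrier A) \<Longrightarrow> matrix_pos A n X \<Longrightarrow> matrix_pos B n (\<lambda>i j. f (X i j))"
  using assms by (auto simp: ucp_def cp_on_def linear_map_on_def)

lemma ucp_comp:
  assumes f: "ucp A B f" and g: "ucp B C g" shows "ucp A C (g \<circ> f)"
  unfolding ucp_def cp_on_def linear_map_on_def
  using ucpD[OF f] ucpD[OF g] by (auto simp: image_subset_iff)

lemma ucp_positive:
  assumes A: "cstar_algebra A" and B: "cstar_algebra B" and f: "ucp A B f" and x: "cstar_algebra.positive A x"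
  shows "cstar_algebra.positive B (f x)"
proof -
  have "x \<in> carrier A" by (rule cstar_algebra.positive_carrier[OF A x])
  then have "matrix_pos B 1 (\<lambda>i j. f x)"
    using cstar_algebra.matrix_pos_one[OF A, of x] x by (intro ucpD(5)[OF f]) auto
  then show ?thesis using cstar_algebra.matrix_pos_one[OF B] by blast
qed

lemma positive_functional_comp_ucp:
  assumes A: "cstar_algebra A" and B: "cstar_algebra B" and f: "ucp A B f"
    and \<omega>: "cstar_algebra.positive_functional B \<omega>"
  shows "cstar_algebra.positive_functional A (\<omega> \<circ> f)"
proof -
  interpret A: cstar_algebra A by (rule A)
  interpret B: cstar_algebra B by (rule B)
  show ?thesis unfolding A.positive_functional_def linear_functional_def
  proof (intro conjI ballI allI)
    fix x assume "x \<in> carrier A"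
    then have "B.positive (f (adj A x \<otimes>\<^bsub>A\<^esub> x))" by (intro ucp_positive[OF A B f] A.positive_adj_mult)
    then show "(\<omega> \<circ> f) (adj A x \<otimes>\<^bsub>A\<^esub> x) \<in> \<real>\<^sub>\<ge>\<^sub>0" using B.positive_functionalD[OF \<omega>] by simp
  qed (use ucpD[OF f] B.lfD[OF B.positive_functional_linear[OF \<omega>]] in auto)
qed

lemma state_comp_ucp:
  assumes A: "cstar_algebra A" and B: "cstar_algebra B" and f: "ucp A B f" and \<omega>: "state B \<omega>"
  shows "state A (\<omega> \<circ> f)"
proof -
  have "cstar_algebra.positive_functional B \<omega>" using \<omega> by (auto simp: state_def cstar_algebra.positive_functional_def[OF B])
  from positive_functional_comp_ucp[OF A B f this] show ?thesis
    using \<omega> ucpD(2)[OF f] by (auto simp: state_def cstar_algebra.positive_functional_def[OF A])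
qed

lemma C_alg_matrix_pos:
  assumes f: "continuous_on UNIV f" "\<And>x. 0 \<le> f x"
  shows "matrix_pos C_alg 1 (\<lambda>_ _. \<lambda>x. complex_of_real (f x))"
proof -
  let ?f = "\<lambda>x. complex_of_real (f x)" and ?y = "\<lambda>x. complex_of_real (sqrt (f x))"
  have y: "continuous_on UNIV ?y" using f by (intro continuous_intros) auto
  have "(\<lambda>x. cnj (?y x) * ?y x) = ?f" using f(2) by (simp add: fun_eq_iff flip: of_real_mult)
  then show ?thesis unfolding matrix_pos_def
    using y by (intro exI[of _ "\<lambda>_ _. ?y"]) (auto simp: finsum_C_alg f(1))
qed

lemma ucp_C_alg_sum:
  fixes h :: "'k \<Rightarrow> 'x::topological_space \<Rightarrow> complex"
  assumes B: "cstar_algebra B" and \<phi>: "ucp C_alg B \<phi>" and S: "finite S" "\<And>k. k \<in> S \<Longrightarrow> continuous_on UNIV (h k)"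
  shows "\<phi> (\<lambda>x. \<Sum>k\<in>S. h k x) = (\<Oplus>\<^bsub>B\<^esub>k\<in>S. \<phi> (h k))"
proof -
  interpret cstar_algebra B by (rule B)
  note U = ucpD[OF \<phi>]
  show ?thesis using S
  proof (induction S rule: finite_induct)
    case empty
    have "\<phi> (0 \<odot>\<^bsub>C_alg\<^esub> (\<lambda>x. 1)) = 0 \<odot>\<^bsub>B\<^esub> \<phi> (\<lambda>x. 1)" by (rule U(4)) simp
    moreover have "\<phi> (\<lambda>x. 1) \<in> carrier B" by (rule U(1)) simp
    ultimately show ?case by (simp add: scale_zero_left)
  next
    case (insert k S)
    have c: "continuous_on UNIV (\<lambda>x. \<Sum>k\<in>S. h k x)" using insert by (intro continuous_intros) auto
    have "\<phi> (\<lambda>x. \<Sum>k\<in>insert k S. h k x) = \<phi> (h k \<oplus>\<^bsub>C_alg\<^esub> (\<lambda>x. \<Sum>k\<in>S. h k x))" using insert.hyps by simp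
    also have "\<dots> = \<phi> (h k) \<oplus>\<^bsub>B\<^esub> \<phi> (\<lambda>x. \<Sum>k\<in>S. h k x)" using insert.prems c by (intro U(3)) auto
    also have "\<dots> = (\<Oplus>\<^bsub>B\<^esub>k\<in>insert k S. \<phi> (h k))"
      using insert U(1) by (subst finsum_insert) auto
    finally show ?case .
  qed
qed

lemma evaluation_ucp:
  fixes pt :: "nat \<Rightarrow> 'x::topological_space"
  shows "ucp C_alg (C_pow N) (\<lambda>f t. if t < N then f (pt t) else 0)" (is "ucp _ _ ?\<phi>")
  unfolding ucp_def cp_on_def linear_map_on_def
proof (intro conjI allI impI ballI)
  fix n :: nat and X :: "nat \<Rightarrow> nat \<Rightarrow> 'x \<Rightarrow> complex"
  assume "matrix_pos C_alg n X"
  then obtain Y where Yc: "\<And>i j. i < n \<Longrightarrow> j < n \<Longrightarrow> Y i j \<in> carrier C_alg"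
    and Y2: "\<And>i j. i < n \<Longrightarrow> j < n \<Longrightarrow> X i j = (\<Oplus>\<^bsub>C_alg\<^esub>k\<in>{..<n}. adj C_alg (Y k i) \<otimes>\<^bsub>C_alg\<^esub> Y k j)"
    unfolding matrix_pos_def by blast
  have Y1: "\<And>i j. i < n \<Longrightarrow> j < n \<Longrightarrow> continuous_on UNIV (Y i j)" using Yc by simp
  note Y = Y1 Y2
  have "?\<phi> (X i j) = (\<Oplus>\<^bsub>C_pow N\<^esub>k\<in>{..<n}. adj (C_pow N) (?\<phi> (Y k i)) \<otimes>\<^bsub>C_pow N\<^esub> ?\<phi> (Y k j))"
    if ij: "i < n" "j < n" for i j
  proof -
    have "X i j = (\<lambda>x. \<Sum>k<n. cnj (Y k i x) * Y k j x)"
      unfolding Y(2)[OF ij] using Y(1) ij by (subst finsum_C_alg) (auto intro!: continuous_intros)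
    then show ?thesis by (subst finsum_C_pow) (auto simp: fun_eq_iff)
  qed
  then show "matrix_pos (C_pow N) n (\<lambda>i j. ?\<phi> (X i j))" unfolding matrix_pos_def
    by (intro exI[of _ "\<lambda>i j. ?\<phi> (Y i j)"]) auto
qed (auto simp: fun_eq_iff)

text \<open>A positive matrix over C^N is a family of positive matrices Y_t* Y_t, and the map sends it to their average with
weights G t, which is positive over C(X) by continuous_matrix_factorization.\<close>

lemma partition_of_unity_ucp:
  fixes G :: "nat \<Rightarrow> 'x::topological_space \<Rightarrow> real"
  assumes X: "compact (UNIV :: 'x set)" and G: "\<And>t. t < N \<Longrightarrow> continuous_on UNIV (G t)"
    "\<And>t x. t < N \<Longrightarrow> 0 \<le> G t x" "\<And>x. (\<Sum>t<N. G t x) = 1"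
  shows "ucp (C_pow N) C_alg (\<lambda>c x. \<Sum>t<N. c t * complex_of_real (G t x))" (is "ucp _ _ ?\<psi>")
  unfolding ucp_def cp_on_def linear_map_on_def
proof (intro conjI allI impI ballI)
  show "?\<psi> ` carrier (C_pow N) \<subseteq> carrier C_alg" using G(1) by (auto intro!: continuous_intros)
  have "(\<Sum>t<N. complex_of_real (G t x)) = 1" for x using G(3)[of x] by (metis of_real_1 of_real_sum)
  then show "?\<psi> \<one>\<^bsub>C_pow N\<^esub> = \<one>\<^bsub>C_alg\<^esub>" by (simp add: fun_eq_iff)
  fix n and Z :: "nat \<Rightarrow> nat \<Rightarrow> coords" assume "matrix_pos (C_pow N) n Z"
  then obtain Y where Y: "\<And>i j. i < n \<Longrightarrow> j < n \<Longrightarrow> Y i j \<in> carrier (C_pow N)"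
    "\<And>i j. i < n \<Longrightarrow> j < n \<Longrightarrow> Z i j = (\<Oplus>\<^bsub>C_pow N\<^esub>k\<in>{..<n}. adj (C_pow N) (Y k i) \<otimes>\<^bsub>C_pow N\<^esub> Y k j)"
    unfolding matrix_pos_def by blast
  have Z: "Z i j = (\<lambda>t. \<Sum>k<n. cnj (Y k i t) * Y k j t)" if ij: "i < n" "j < n" for i j
    unfolding Y(2)[OF ij] using Y(1) ij by (subst finsum_C_pow) auto
  obtain R :: "nat \<Rightarrow> nat \<Rightarrow> 'x \<Rightarrow> complex" where R: "\<And>i j. continuous_on UNIV (R i j)"
    "\<And>i j x. i < n \<Longrightarrow> j < n \<Longrightarrow>
       (\<Sum>t<N. complex_of_real (G t x) * (\<Sum>k<n. cnj (Y k i t) * Y k j t)) = (\<Sum>k<n. cnj (R k i x) * R k j x)"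
    using continuous_matrix_factorization[OF X, of "{..<N}" G n "\<lambda>t k i. Y k i t"] G(1,2) by auto
  have "?\<psi> (Z i j) = (\<Oplus>\<^bsub>C_alg\<^esub>k\<in>{..<n}. adj C_alg (R k i) \<otimes>\<^bsub>C_alg\<^esub> R k j)" if ij: "i < n" "j < n" for i j
    using R(2)[OF ij, symmetric] R(1)
    by (subst finsum_C_alg) (auto intro!: continuous_intros simp: Z[OF ij] fun_eq_iff mult.commute)
  then show "matrix_pos C_alg n (\<lambda>i j. ?\<psi> (Z i j))" unfolding matrix_pos_def
    using R(1) by (intro exI[of _ R]) auto
qed (auto simp: fun_eq_iff sum.distrib distrib_left distrib_right sum_distrib_left mult_ac)

section \<open>Embeddings of C(X)\<close>

locale function_embedding = cstar_algebra A for A :: "'d cstar" (structure) +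
  fixes \<iota> :: "('x::topological_space \<Rightarrow> complex) \<Rightarrow> 'd"
  assumes compact_X: "compact (UNIV :: 'x set)"
    and embedding: "unital_complete_order_embedding C_alg A \<iota>"
begin

lemma \<iota>_ucp: "ucp C_alg A \<iota>" using embedding by (simp add: unital_complete_order_embedding_def)

lemma \<iota>_linear:
  "continuous_on UNIV f \<Longrightarrow> \<iota> f \<in> carrier A" "\<iota> (\<lambda>x. 1) = \<one>"
  "continuous_on UNIV f \<Longrightarrow> continuous_on UNIV g \<Longrightarrow> \<iota> (\<lambda>x. f x + g x) = \<iota> f \<oplus> \<iota> g"
  "continuous_on UNIV f \<Longrightarrow> \<iota> (\<lambda>x. c * f x) = c \<odot> \<iota> f"
  using ucpD[OF \<iota>_ucp] by auto

lemma \<iota>_minus: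
  assumes "continuous_on UNIV f" "continuous_on UNIV g" shows "\<iota> (\<lambda>x. f x - g x) = \<iota> f \<ominus> \<iota> g"
  using \<iota>_linear(3)[OF assms(1), of "\<lambda>x. (-1) * g x"] \<iota>_linear(4)[OF assms(2), of "-1"] assms \<iota>_linear(1)
  by (simp add: minus_scale continuous_intros)

text \<open>The restriction of \<iota> to real functions, where order and norm can be compared directly.\<close>

definition J :: "('x \<Rightarrow> real) \<Rightarrow> 'd" where "J f = \<iota> (\<lambda>x. complex_of_real (f x))"

lemma J_cont: "continuous_on UNIV f \<Longrightarrow> continuous_on UNIV (\<lambda>x. complex_of_real (f x))"
  by (intro continuous_intros)

lemma J_linear:
  "continuous_on UNIV f \<Longrightarrow> J f \<in> carrier A" "J (\<lambda>x. 1) = \<one>"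
  "continuous_on UNIV f \<Longrightarrow> continuous_on UNIV g \<Longrightarrow> J (\<lambda>x. f x + g x) = J f \<oplus> J g"
  "continuous_on UNIV f \<Longrightarrow> J (\<lambda>x. r * f x) = complex_of_real r \<odot> J f"
  "continuous_on UNIV f \<Longrightarrow> continuous_on UNIV g \<Longrightarrow> J (\<lambda>x. f x - g x) = J f \<ominus> J g"
  unfolding J_def using \<iota>_linear J_cont \<iota>_minus by simp_all

lemma J_positive:
  assumes f: "continuous_on UNIV f" "\<And>x. 0 \<le> f x" shows "positive (J f)"
proof -
  have "matrix_pos A 1 (\<lambda>_ _. \<iota> (\<lambda>x. complex_of_real (f x)))"
    using C_alg_matrix_pos[OF f] J_cont[OF f(1)] by (intro ucpD(5)[OF \<iota>_ucp]) auto
  then show ?thesis using matrix_pos_one by (simp add: J_def)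
qed

text \<open>This is where \<iota> being an order embedding, rather than merely positive, enters.\<close>

lemma J_positiveD:
  assumes f: "continuous_on UNIV f" and pos: "positive (J f)" shows "0 \<le> f x"
proof -
  let ?f = "\<lambda>x. complex_of_real (f x)"
  have "matrix_pos A 1 (\<lambda>_ _. \<iota> ?f)" using pos matrix_pos_one by (simp add: J_def)
  then have "matrix_pos C_alg 1 (\<lambda>_ _. ?f)"
    using embedding J_cont[OF f] unfolding unital_complete_order_embedding_def by auto
  then obtain Y where Y: "continuous_on UNIV (Y 0 0)" "?f = (\<Oplus>\<^bsub>C_alg\<^esub>k\<in>{..<1::nat}. adj C_alg (Y k 0) \<otimes>\<^bsub>C_alg\<^esub> Y k 0)"
    unfolding matrix_pos_def by auto
  have "?f = (\<lambda>x. \<Sum>k<1. cnj (Y k 0 x) * Y k 0 x)"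
    unfolding Y(2) using Y(1) by (subst finsum_C_alg) (auto intro!: continuous_intros)
  then have "complex_of_real (f x) = cnj (Y 0 0 x) * Y 0 0 x" by (simp add: fun_eq_iff)
  then have "complex_of_real (f x) = complex_of_real ((cmod (Y 0 0 x))\<^sup>2)" by (metis complex_norm_square mult.commute)
  then show ?thesis by (metis of_real_eq_iff zero_le_power2)
qed

lemma J_split:
  assumes "continuous_on UNIV f" shows "J f = J (\<lambda>x. max (f x) 0) \<ominus> J (\<lambda>x. max (- f x) 0)"
proof -
  have "f = (\<lambda>x. max (f x) 0 - max (- f x) 0)" by (auto simp: fun_eq_iff)
  then have "J f = J (\<lambda>x. max (f x) 0 - max (- f x) 0)" by simp
  also have "\<dots> = J (\<lambda>x. max (f x) 0) \<ominus> J (\<lambda>x. max (- f x) 0)" using assms by (intro J_linear(5) continuous_intros)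
  finally show ?thesis .
qed

lemma J_selfadj:
  assumes f: "continuous_on UNIV f" shows "selfadj (J f)"
proof -
  have "positive (J (\<lambda>x. max (f x) 0))" "positive (J (\<lambda>x. max (- f x) 0))"
    using f by (auto intro!: J_positive continuous_intros)
  then show ?thesis unfolding J_split[OF f] by (intro selfadj_minus positive_selfadj)
qed

lemma J_nrm_positive:
  assumes f: "continuous_on UNIV f" and b: "\<And>x. 0 \<le> f x" "\<And>x. f x \<le> c" and c: "c > 0"
  shows "nrm A (J f) \<le> c"
proof -
  let ?g = "\<lambda>x. (1/c) * f x"
  have g: "continuous_on UNIV ?g" using f by (intro continuous_intros)
  have "positive (J ?g)" by (rule J_positive[OF g]) (use b c in simp)
  moreover have "positive (J (\<lambda>x. 1 - ?g x))"
    by (rule J_positive[OF continuous_on_diff[OF continuous_on_const g]]) (use b c in simp)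
  then have "positive (\<one> \<ominus> J ?g)" using J_linear(5)[OF continuous_on_const g, of 1] J_linear(2) by simp
  ultimately have "nrm A (J ?g) \<le> 1" by (rule positive_nrm_le_one)
  moreover have "J ?g = complex_of_real (1/c) \<odot> J f" using f by (rule J_linear(4))
  ultimately show ?thesis using c J_linear(1)[OF f] by (simp add: nrm_scale norm_divide field_simps)
qed

lemma J_nrm:
  assumes f: "continuous_on UNIV f" and b: "\<And>x. \<bar>f x\<bar> \<le> c" and c: "c > 0"
  shows "nrm A (J f) \<le> 2 * c"
proof -
  have m: "max (f x) 0 \<le> c" "max (- f x) 0 \<le> c" for x using b[of x] c by auto
  have cm: "continuous_on UNIV (\<lambda>x. max (f x) 0)" "continuous_on UNIV (\<lambda>x. max (- f x) 0)"
    by (intro continuous_on_max f continuous_on_const, intro continuous_on_max continuous_on_minus f continuous_on_const)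
  have "nrm A (J (\<lambda>x. max (f x) 0)) \<le> c" "nrm A (J (\<lambda>x. max (- f x) 0)) \<le> c"
    using J_nrm_positive[OF cm(1) _ m(1) c] J_nrm_positive[OF cm(2) _ m(2) c] by simp_all
  moreover have "J (\<lambda>x. max (f x) 0) \<in> carrier A" "J (\<lambda>x. max (- f x) 0) \<in> carrier A"
    using f by (auto intro!: J_linear(1) continuous_intros)
  ultimately show ?thesis unfolding J_split[OF f] using nrm_triangle_minus by (smt (verit))
qed

lemma \<iota>_real_imag:
  assumes h: "continuous_on UNIV h"
  shows "\<iota> h = J (\<lambda>x. Re (h x)) \<oplus> \<i> \<odot> J (\<lambda>x. Im (h x))"
proof -
  have cr: "continuous_on UNIV (\<lambda>x. Re (h x))" "continuous_on UNIV (\<lambda>x. Im (h x))"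
    by (rule continuous_on_Re[OF h], rule continuous_on_Im[OF h])
  have "h = (\<lambda>x. complex_of_real (Re (h x)) + \<i> * complex_of_real (Im (h x)))" by (simp add: fun_eq_iff complex_eq[symmetric])
  then show ?thesis
    unfolding J_def using \<iota>_linear(3)[OF J_cont[OF cr(1)], of "\<lambda>x. \<i> * complex_of_real (Im (h x))"] \<iota>_linear(4)[OF J_cont[OF cr(2)], of "\<i>"]
      continuous_on_mult_left[OF J_cont[OF cr(2)], of "\<i>"] by simp
qed

text \<open>Splitting into real and imaginary, positive and negative parts costs the factor 4, which is harmless below.\<close>

lemma \<iota>_nrm:
  assumes h: "continuous_on UNIV h" and b: "\<And>x. cmod (h x) \<le> c" and c: "c > 0"
  shows "nrm A (\<iota> h) \<le> 4 * c"
proof -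
  have cr: "continuous_on UNIV (\<lambda>x. Re (h x))" "continuous_on UNIV (\<lambda>x. Im (h x))"
    by (rule continuous_on_Re[OF h], rule continuous_on_Im[OF h])
  note \<iota>_real_imag[OF h]
  moreover have "nrm A (J (\<lambda>x. Re (h x))) \<le> 2 * c" "nrm A (J (\<lambda>x. Im (h x))) \<le> 2 * c"
    using J_nrm cr c order_trans[OF abs_Re_le_cmod b] order_trans[OF abs_Im_le_cmod b] by blast+
  moreover have "nrm A (J (\<lambda>x. Re (h x)) \<oplus> \<i> \<odot> J (\<lambda>x. Im (h x))) \<le> nrm A (J (\<lambda>x. Re (h x))) + nrm A (J (\<lambda>x. Im (h x)))"
    using nrm_triangle[of "J (\<lambda>x. Re (h x))" "\<i> \<odot> J (\<lambda>x. Im (h x))"] J_linear(1)[OF cr(1)] J_linear(1)[OF cr(2)]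
    by (simp add: scale_closed nrm_scale)
  ultimately show ?thesis by simp
qed

text \<open>The members of this family are the unnormalised conditional states, and the member for the whole space extends the state given by the
measure.\<close>

lemma measured_family:
  assumes M: "prob_space M" "sets M = sets borel"
  obtains W :: "'x set \<Rightarrow> 'd \<Rightarrow> complex" where "\<And>S. positive_functional (W S)"
    "\<And>S f. S \<in> sets M \<Longrightarrow> continuous_on UNIV f \<Longrightarrow> W S (J f) = complex_of_real (\<integral>x. indicator S x * f x \<partial>M)"
    "\<And>(K :: 'k set) S d. finite K \<Longrightarrow> disjoint_family_on S K \<Longrightarrow> d \<in> carrier A \<Longrightarrow> W (\<Union>a\<in>K. S a) d = (\<Sum>a\<in>K. W (S a) d)"
    "W UNIV \<in> state_extensions C_alg A \<iota> (measure_state M)"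
proof -
  interpret prob_space M by (rule M)
  have space: "space M = UNIV" using sets_eq_imp_space_eq[OF M(2)] by simp
  have "\<exists>W. (\<forall>B. positive_functional (W B)) \<and>
     (\<forall>B\<in>sets M. \<forall>f. continuous_on UNIV f \<longrightarrow> W B (J f) = complex_of_real (\<integral>x. indicator B x * f x \<partial>M)) \<and>
     (\<forall>(K :: 'k set) B d. finite K \<longrightarrow> disjoint_family_on B K \<longrightarrow> d \<in> carrier A \<longrightarrow>
         W (\<Union>a\<in>K. B a) d = (\<Sum>a\<in>K. W (B a) d))"
    by (rule measured_extension[OF M compact_X J_selfadj J_linear(3) J_linear(4) J_linear(2)]) (use J_positiveD in auto)
  then obtain W :: "'x set \<Rightarrow> 'd \<Rightarrow> complex" where W: "\<And>S. positive_functional (W S)"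
    "\<And>S f. S \<in> sets M \<Longrightarrow> continuous_on UNIV f \<Longrightarrow> W S (J f) = complex_of_real (\<integral>x. indicator S x * f x \<partial>M)"
    "\<And>(K :: 'k set) S d. finite K \<Longrightarrow> disjoint_family_on S K \<Longrightarrow> d \<in> carrier A \<Longrightarrow> W (\<Union>a\<in>K. S a) d = (\<Sum>a\<in>K. W (S a) d)"
    by blast
  have U: "UNIV \<in> sets M" using sets.top[of M] space by simp
  have WJ: "W UNIV (J f) = complex_of_real (\<integral>x. f x \<partial>M)" if "continuous_on UNIV f" for f
    using W(2)[OF U that] by simp
  have "W UNIV \<one> = 1" using WJ[of "\<lambda>x. 1"] J_linear(2) prob_space space by simp
  then have st: "state A (W UNIV)" using W(1)[of UNIV] by (simp add: state_def positive_functional_def)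
  note l = lfD[OF positive_functional_linear[OF W(1)[of UNIV]]]
  have "W UNIV (\<iota> f) = measure_state M f" if f: "continuous_on UNIV f" for f
  proof -
    have "bounded (range f)" using f compact_X by (intro compact_imp_bounded compact_continuous_image)
    then obtain c where c: "\<And>x. cmod (f x) \<le> c" by (auto simp: bounded_iff)
    have fm: "f \<in> borel_measurable M"
      using borel_measurable_continuous_onI[OF f] M(2) by (simp cong: measurable_cong_sets)
    have int: "integrable M f" using fm c by (intro integrable_const_bound[of _ c]) auto
    have cr: "continuous_on UNIV (\<lambda>x. Re (f x))" "continuous_on UNIV (\<lambda>x. Im (f x))"
      by (rule continuous_on_Re[OF f], rule continuous_on_Im[OF f])
    have "W UNIV (\<iota> f) = complex_of_real (\<integral>x. Re (f x) \<partial>M) + \<i> * complex_of_real (\<integral>x. Im (f x) \<partial>M)"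
      unfolding \<iota>_real_imag[OF f] using l(1,3) J_linear(1)[OF cr(1)] J_linear(1)[OF cr(2)] WJ[OF cr(1)] WJ[OF cr(2)] by (simp add: scale_closed)
    also have "\<dots> = (\<integral>x. f x \<partial>M)" using int by (simp add: complex_eq_iff)
    finally show ?thesis by (simp add: measure_state_def)
  qed
  then have "W UNIV \<in> state_extensions C_alg A \<iota> (measure_state M)" using st by (simp add: state_extensions_def)
  then show ?thesis using that[of W] W by blast
qed

text \<open>The approximation evaluates at the points pt t and recombines with the weights G t. Its range lies in the image of
\<iota>, so the pulled back state is determined by the measure, whichever extension \<omega> is used.\<close>

theorem cpe_le_shannon:
  fixes G :: "nat \<Rightarrow> 'x \<Rightarrow> real"
  assumes \<omega>: "\<omega> \<in> state_extensions C_alg A \<iota> (measure_state M)"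
    and G: "\<And>t. t < N \<Longrightarrow> continuous_on UNIV (G t)" "\<And>t x. t < N \<Longrightarrow> 0 \<le> G t x" "\<And>x. (\<Sum>t<N. G t x) = 1"
    and \<Omega>: "\<Omega> \<subseteq> carrier C_alg"
    and approx: "\<And>f x. f \<in> \<Omega> \<Longrightarrow> cmod ((\<Sum>t<N. f (pt t) * complex_of_real (G t x)) - f x) \<le> c"
    and c: "c > 0" "4 * c < \<delta>"
  shows "cpe C_alg A \<iota> \<omega> \<Omega> \<delta> \<le> ereal (shannon {..<N} (\<lambda>t. \<integral>x. G t x \<partial>M))"
proof -
  define \<phi> where "\<phi> f t = (if t < N then f (pt t) else 0)" for f :: "'x \<Rightarrow> complex" and t
  define \<psi>0 where "\<psi>0 c x = (\<Sum>t<N. c t * complex_of_real (G t x))" for c :: coords and x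
  have u\<phi>: "ucp C_alg (C_pow N) \<phi>" using evaluation_ucp[of N pt] by (simp add: \<phi>_def[abs_def])
  have u\<psi>0: "ucp (C_pow N) C_alg \<psi>0" using partition_of_unity_ucp[OF compact_X G] by (simp add: \<psi>0_def[abs_def])
  have u\<psi>: "ucp (C_pow N) A (\<iota> \<circ> \<psi>0)" by (rule ucp_comp[OF u\<psi>0 \<iota>_ucp])
  have "nrm A ((\<iota> \<circ> \<psi>0) (\<phi> f) \<ominus> \<iota> f) < \<delta>" if f: "f \<in> \<Omega>" for f
  proof -
    have fc: "continuous_on UNIV f" using f \<Omega> by auto
    have pc: "continuous_on UNIV (\<psi>0 (\<phi> f))" using ucpD(1)[OF u\<psi>0 ucpD(1)[OF u\<phi>]] fc by simp
    have "\<psi>0 (\<phi> f) x = (\<Sum>t<N. f (pt t) * complex_of_real (G t x))" for x by (simp add: \<psi>0_def \<phi>_def)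
    then have "nrm A (\<iota> (\<lambda>x. \<psi>0 (\<phi> f) x - f x)) \<le> 4 * c"
      using approx[OF f] c(1) pc fc by (intro \<iota>_nrm continuous_intros) auto
    then show ?thesis using c(2) \<iota>_minus[OF pc fc] by simp
  qed
  then have mem: "(\<phi>, \<iota> \<circ> \<psi>0, C_pow N) \<in> CPA C_alg A \<iota> \<Omega> \<delta>"
    using C_pow_cstar C_pow_finite_dimensional u\<phi> u\<psi> by (simp add: CPA_def)
  have st: "state A \<omega>" and ext: "\<And>f. continuous_on UNIV f \<Longrightarrow> \<omega> (\<iota> f) = measure_state M f"
    using \<omega> by (auto simp: state_extensions_def)
  have \<rho>: "state (C_pow N) (\<omega> \<circ> (\<iota> \<circ> \<psi>0))" by (rule state_comp_ucp[OF C_pow_cstar _ u\<psi> st]) unfold_locales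
  have val: "Re ((\<omega> \<circ> (\<iota> \<circ> \<psi>0)) (unit_coord t)) = (\<integral>x. G t x \<partial>M)" if t: "t < N" for t
  proof -
    have "\<psi>0 (unit_coord t) = (\<lambda>x. complex_of_real (G t x))"
    proof
      fix x
      have "\<psi>0 (unit_coord t) x = (\<Sum>s<N. if s = t then complex_of_real (G s x) else 0)"
        unfolding \<psi>0_def by (intro sum.cong) (auto simp: unit_coord_def)
      then show "\<psi>0 (unit_coord t) x = complex_of_real (G t x)" using t by simp
    qed
    then show ?thesis using ext[OF J_cont[OF G(1)[OF t]]] by (simp add: measure_state_def)
  qed
  have "cpe C_alg A \<iota> \<omega> \<Omega> \<delta> \<le> ereal (von_neumann_entropy (C_pow N) (\<omega> \<circ> (\<iota> \<circ> \<psi>0)))"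
    unfolding cpe_def by (rule INF_lower2[OF mem]) simp
  also have "von_neumann_entropy (C_pow N) (\<omega> \<circ> (\<iota> \<circ> \<psi>0)) = shannon {..<N} (\<lambda>t. \<integral>x. G t x \<partial>M)"
    unfolding C_pow_entropy[OF \<rho>] shannon_def using val by simp
  finally show ?thesis .
qed

end

section \<open>Soft partitions and their products\<close>

lemma induced_aut_pow: "(induced_aut T ^^ j) f = f \<circ> T ^^ j"
  by (induction j arbitrary: f) (simp_all add: induced_aut_def fun_eq_iff funpow_swap1)

text \<open>The integral bounds say that g and the indicator functions of the partition almost agree.\<close>

locale soft_partition = finite_borel_partition M T P for M :: "'x::metric_space measure" and T P +
  fixes g :: "'x set \<Rightarrow> 'x \<Rightarrow> real" and \<eta> :: real
  assumes g_cont: "A \<in> P \<Longrightarrow> continuous_on UNIV (g A)" and g_nonneg: "A \<in> P \<Longrightarrow> 0 \<le> g A x"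
    and g_sum: "(\<Sum>A\<in>P. g A x) = 1"
    and g_off: "A \<in> P \<Longrightarrow> B \<in> P \<Longrightarrow> A \<noteq> B \<Longrightarrow> (\<integral>x. indicator A x * g B x \<partial>M) \<le> \<eta>"
begin

definition product_unity :: "nat \<Rightarrow> (nat \<Rightarrow> 'x set) \<Rightarrow> 'x \<Rightarrow> real" where
  "product_unity n I x = (\<Prod>j<n. g (I j) ((T ^^ j) x))"

lemma T_pow_cont: "continuous_on UNIV (T ^^ j)"
proof (induction j)
  case (Suc j)
  show ?case unfolding funpow.simps(2)
    by (rule continuous_on_compose[OF Suc.IH continuous_on_subset[OF T_cont subset_UNIV]])
qed (simp add: id_def)

lemma g_T_cont: "A \<in> P \<Longrightarrow> continuous_on UNIV (\<lambda>x. g A ((T ^^ j) x))"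
  using continuous_on_compose2[OF g_cont T_pow_cont] by auto

lemma product_unity_cont: "I \<in> words n P \<Longrightarrow> continuous_on UNIV (product_unity n I)"
  unfolding product_unity_def[abs_def] by (intro continuous_on_prod g_T_cont) (auto simp: PiE_mem)

lemma product_unity_nonneg: "I \<in> words n P \<Longrightarrow> 0 \<le> product_unity n I x"
  unfolding product_unity_def using g_nonneg by (intro prod_nonneg) (auto simp: PiE_mem)

lemma product_unity_sum: "(\<Sum>I\<in>words n P. product_unity n I x) = 1"
proof -
  have "(\<Sum>I\<in>words n P. product_unity n I x) = (\<Prod>j<n. \<Sum>A\<in>P. g A ((T ^^ j) x))"
    unfolding product_unity_def using P(1) by (subst prod_sum_PiE) auto
  then show ?thesis by (simp add: g_sum)
qed

text \<open>Summing out the letters other than the one at position j leaves one factor.\<close>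

lemma product_unity_marginal:
  assumes j: "j < n" and A: "A \<in> P"
  shows "(\<Sum>I\<in>{I\<in>words n P. I j = A}. product_unity n I x) = g A ((T ^^ j) x)"
proof -
  define f where "f k B = (if k = j \<and> B \<noteq> A then 0 else g B ((T ^^ k) x))" for k B
  have "(\<Prod>k<n. f k (I k)) = (if I j = A then product_unity n I x else 0)" for I
  proof (cases "I j = A")
    case True
    then show ?thesis unfolding product_unity_def by (auto simp: f_def intro!: prod.cong)
  next
    case False
    then have "f j (I j) = 0" by (simp add: f_def)
    then show ?thesis using False j by (auto intro!: prod_zero)
  qed
  then have "(\<Sum>I\<in>{I\<in>words n P. I j = A}. product_unity n I x) = (\<Sum>I\<in>words n P. \<Prod>k<n. f k (I k))"
    using fin_words[of n] by (simp add: sum.inter_filter)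
  also have "\<dots> = (\<Prod>k<n. \<Sum>B\<in>P. f k B)" using P(1) by (subst prod_sum_PiE) auto
  also have "\<dots> = (\<Prod>k<n. if k = j then g A ((T ^^ j) x) else 1)"
  proof (intro prod.cong refl)
    fix k assume "k \<in> {..<n}"
    show "(\<Sum>B\<in>P. f k B) = (if k = j then g A ((T ^^ j) x) else 1)"
    proof (cases "k = j")
      case True
      have "(\<Sum>B\<in>P. f k B) = (\<Sum>B\<in>P. if B = A then g A ((T ^^ j) x) else 0)"
        using True by (intro sum.cong) (auto simp: f_def)
      then show ?thesis using True A P(1) by simp
    next
      case False
      then show ?thesis by (simp add: f_def g_sum)
    qed
  qed
  also have "\<dots> = g A ((T ^^ j) x)" using j by simp
  finally show ?thesis .
qed

lemma g_measurable: "A \<in> P \<Longrightarrow> g A \<in> borel_measurable M"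
  using borel_measurable_continuous_onI[OF g_cont] sets_M by (simp cong: measurable_cong_sets)

lemma letter_integral:
  assumes "A \<in> P" "B \<in> P"
  shows "(\<integral>x. indicator ((T ^^ j) -` A) x * g B ((T ^^ j) x) \<partial>M) = (\<integral>x. indicator A x * g B x \<partial>M)"
proof -
  have "(\<lambda>x. indicator A x * g B x) \<in> borel_measurable M"
    using assms g_measurable P(2) by (intro borel_measurable_times borel_measurable_indicator) auto
  from integral_comp_pow[OF this, of j] show ?thesis by (simp add: indicator_def)
qed

text \<open>If distinct letters are coupled with mass at most e at every position, the words determine each other up to a small
entropy per letter.\<close>

lemma cond_shannon_words_bound:
  fixes q :: "(nat \<Rightarrow> 'x set) \<Rightarrow> (nat \<Rightarrow> 'x set) \<Rightarrow> real"
  assumes q: "\<And>a i. a \<in> words n P \<Longrightarrow> i \<in> words n P \<Longrightarrow> q a i \<ge> 0"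
    and total: "(\<Sum>(a,i)\<in>words n P \<times> words n P. q a i) = 1"
    and off: "\<And>j A B. j < n \<Longrightarrow> A \<in> P \<Longrightarrow> B \<in> P \<Longrightarrow> A \<noteq> B \<Longrightarrow> letter_marginal n P q j A B \<le> e" and e: "e \<ge> 0"
  shows "cond_shannon (words n P) (words n P) q \<le> real n * ((real (card P))\<^sup>2 * (e + 2 * sqrt e))"
proof -
  have lm0: "letter_marginal n P q j A B \<ge> 0" for j A B
    unfolding letter_marginal_def using q by (intro sum_nonneg) auto
  have "cond_shannon (words n P) (words n P) q \<le> (\<Sum>j<n. cond_shannon P P (letter_marginal n P q j))"
    by (rule cond_shannon_words_le[OF P(1) q])
  also have "\<dots> \<le> (\<Sum>j<n. (real (card P))\<^sup>2 * (e + 2 * sqrt e))"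
  proof (intro sum_mono cond_shannon_le P(1) lm0 e)
    fix j A assume j: "j \<in> {..<n}" and A: "A \<in> P"
    have "(\<Sum>B\<in>P. letter_marginal n P q j A B) \<le> (\<Sum>A\<in>P. \<Sum>B\<in>P. letter_marginal n P q j A B)"
      using lm0 P(1) A by (intro member_le_sum[of A P "\<lambda>A. \<Sum>B\<in>P. letter_marginal n P q j A B"] sum_nonneg) auto
    also have "\<dots> = (\<Sum>(A,B)\<in>P\<times>P. letter_marginal n P q j A B)" by (simp add: sum.cartesian_product)
    also have "\<dots> = 1" using sum_letter_marginal[OF P(1), of j n q "\<lambda>_ _. 1"] j total by simp
    finally show "(\<Sum>B\<in>P. letter_marginal n P q j A B) \<le> 1" .
  qed (use off in auto)
  finally show ?thesis by simp
qed

lemma letter_cells: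
  assumes "j < n" "A \<in> P"
  shows "(\<Union>a\<in>{a\<in>words n P. a j = A}. cell T n a) = (T ^^ j) -` A"
proof (intro equalityI subsetI)
  fix x assume "x \<in> (\<Union>a\<in>{a\<in>words n P. a j = A}. cell T n a)"
  then show "x \<in> (T ^^ j) -` A" using assms(1) by (auto simp: cell_def)
next
  fix x assume x: "x \<in> (T ^^ j) -` A"
  obtain a where a: "a \<in> words n P" "x \<in> cell T n a" using cell_cover[of n] by blast
  then have "(T ^^ j) x \<in> a j" "a j \<in> P" using assms(1) by (auto simp: cell_def PiE_mem)
  then have "a j = A" using partition_disjoint[of "a j" A] assms(2) x by auto
  then show "x \<in> (\<Union>a\<in>{a\<in>words n P. a j = A}. cell T n a)" using a by blast
qed

text \<open>Couple the cells with the products by p a i, the integral of product i over cell a. The entropy of the second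
coordinate is at most H n plus its conditional entropy, and by invariance of the measure distinct letters at
position j are coupled with mass at most \<eta>.\<close>

theorem shannon_product_unity_le:
  assumes \<eta>: "\<eta> \<ge> 0"
  shows "shannon (words n P) (\<lambda>I. \<integral>x. product_unity n I x \<partial>M) \<le> H n + real n * ((real (card P))\<^sup>2 * (\<eta> + 2 * sqrt \<eta>))"
proof -
  let ?W = "words n P"
  define p where "p a i = (\<integral>x. indicator (cell T n a) x * product_unity n i x \<partial>M)" for a i
  have le1: "product_unity n i x \<le> 1" if "i \<in> ?W" for i x
    using product_unity_sum[of n x] member_le_sum[OF that, of "\<lambda>I. product_unity n I x"] product_unity_nonneg fin_words by auto
  have pm: "product_unity n i \<in> borel_measurable M" if "i \<in> ?W" for i
    using borel_measurable_continuous_onI[OF product_unity_cont[OF that]] sets_M by (simp cong: measurable_cong_sets)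
  have int: "integrable M (\<lambda>x. indicator S x * product_unity n i x)" if "i \<in> ?W" "S \<in> sets M" for i S
    using pm[OF that(1)] that(2) product_unity_nonneg[OF that(1)] le1[OF that(1)]
    by (intro integrable_const_bound[of _ 1]) (auto simp: indicator_def)
  have p0: "p a i \<ge> 0" if "i \<in> ?W" for a i
    unfolding p_def using product_unity_nonneg[OF that] by (intro integral_nonneg_AE) (auto simp: indicator_def)
  have S: "(\<Sum>a\<in>K. \<Sum>i\<in>L. p a i) = (\<integral>x. (\<Sum>a\<in>K. indicator (cell T n a) x) * (\<Sum>i\<in>L. product_unity n i x) \<partial>M)"
    if "K \<subseteq> ?W" "L \<subseteq> ?W" for K L
  proof -
    have i: "integrable M (\<lambda>x. indicator (cell T n a) x * product_unity n i x)" if "a \<in> K" "i \<in> L" for a i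
      using int[of i "cell T n a"] cell_measurable[of a n] that \<open>K \<subseteq> ?W\<close> \<open>L \<subseteq> ?W\<close> by blast
    have "(\<Sum>a\<in>K. \<Sum>i\<in>L. p a i) = (\<Sum>a\<in>K. \<integral>x. (\<Sum>i\<in>L. indicator (cell T n a) x * product_unity n i x) \<partial>M)"
      unfolding p_def using i by (intro sum.cong refl Bochner_Integration.integral_sum[symmetric])
    also have "\<dots> = (\<integral>x. (\<Sum>a\<in>K. \<Sum>i\<in>L. indicator (cell T n a) x * product_unity n i x) \<partial>M)"
      using i by (intro Bochner_Integration.integral_sum[symmetric] Bochner_Integration.integrable_sum)
    finally have "(\<Sum>a\<in>K. \<Sum>i\<in>L. p a i) = (\<integral>x. (\<Sum>a\<in>K. \<Sum>i\<in>L. indicator (cell T n a) x * product_unity n i x) \<partial>M)" .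
    then show ?thesis by (simp add: sum_product)
  qed
  have ind: "(\<Sum>a\<in>K. indicator (cell T n a) x) = (indicator (\<Union>a\<in>K. cell T n a) x :: real)" if "K \<subseteq> ?W" for K x
  proof -
    have "disjoint_family_on (cell T n) K" using cell_disjoint[of n] that by (rule disjoint_family_on_mono[rotated])
    then show ?thesis using finite_subset[OF that fin_words] by (intro indicator_UN_disjoint[symmetric])
  qed
  have rows: "(\<Sum>i\<in>?W. p a i) = measure M (cell T n a)" if a: "a \<in> ?W" for a
    using S[of "{a}" ?W] a cell_measurable[OF a] by (simp add: product_unity_sum)
  have cols: "(\<Sum>a\<in>?W. p a i) = (\<integral>x. product_unity n i x \<partial>M)" if i: "i \<in> ?W" for i
    using S[of ?W "{i}"] i ind[of ?W] by (simp add: cell_cover)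
  have tot: "(\<Sum>(a,i)\<in>?W\<times>?W. p a i) = 1"
    using S[of ?W ?W] ind[of ?W] by (simp add: sum.cartesian_product product_unity_sum cell_cover prob_space space_UNIV[symmetric])
  have off: "letter_marginal n P p j A B \<le> \<eta>" if "j < n" "A \<in> P" "B \<in> P" "A \<noteq> B" for j A B
  proof -
    let ?K = "{a\<in>?W. a j = A}" and ?L = "{i\<in>?W. i j = B}"
    have "{(a,i)\<in>?W\<times>?W. a j = A \<and> i j = B} = ?K \<times> ?L" by auto
    then have "letter_marginal n P p j A B = (\<Sum>a\<in>?K. \<Sum>i\<in>?L. p a i)"
      by (simp add: letter_marginal_def sum.cartesian_product)
    also have "\<dots> = (\<integral>x. indicator (\<Union>a\<in>?K. cell T n a) x * g B ((T ^^ j) x) \<partial>M)"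
      using S[of ?K ?L] ind[of ?K] product_unity_marginal[OF that(1,3)] by simp
    also have "(\<Union>a\<in>?K. cell T n a) = (T ^^ j) -` A" by (rule letter_cells[OF that(1,2)])
    also have "(\<integral>x. indicator ((T ^^ j) -` A) x * g B ((T ^^ j) x) \<partial>M) \<le> \<eta>"
      unfolding letter_integral[OF that(2,3)] by (rule g_off[OF that(2,3,4)])
    finally show ?thesis .
  qed
  have "shannon ?W (\<lambda>I. \<integral>x. product_unity n I x \<partial>M) = shannon ?W (\<lambda>i. \<Sum>a\<in>?W. p a i)"
    unfolding shannon_def using cols by simp
  also have "\<dots> \<le> shannon ?W (\<lambda>a. \<Sum>i\<in>?W. p a i) + cond_shannon ?W ?W p"
    using p0 fin_words by (intro shannon_output_le) auto
  also have "shannon ?W (\<lambda>a. \<Sum>i\<in>?W. p a i) = H n" unfolding shannon_def H_def using rows by simp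
  also have "cond_shannon ?W ?W p \<le> real n * ((real (card P))\<^sup>2 * (\<eta> + 2 * sqrt \<eta>))"
    using p0 tot off \<eta> by (intro cond_shannon_words_bound) auto
  finally show ?thesis by simp
qed

end

section \<open>Comparison of the entropies\<close>

locale dynamical_embedding = function_embedding A \<iota> + soft_partition M T P g \<eta>
  for A :: "'d cstar" (structure) and \<iota> :: "('x::metric_space \<Rightarrow> complex) \<Rightarrow> 'd"
    and M :: "'x measure" and T P g \<eta>
begin

text \<open>The cells are the preparations, with functionals W S o \<psi>, and the images E I of the products under \<phi> are the
measurement. Distinct letters at position j are coupled with mass at most \<eta> + \<delta>: replacing \<psi> o \<phi>
by \<iota> costs \<delta>, and the resulting integral of g X o T^j over a preimage of Y is at most \<eta>.\<close>

theorem entropy_of_approximation_ge: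
  fixes W :: "'x set \<Rightarrow> 'd \<Rightarrow> complex"
  assumes W: "\<And>S. positive_functional (W S)"
    "\<And>S f. S \<in> sets M \<Longrightarrow> continuous_on UNIV f \<Longrightarrow> W S (J f) = complex_of_real (\<integral>x. indicator S x * f x \<partial>M)"
    "\<And>(K :: (nat \<Rightarrow> 'x set) set) S d. finite K \<Longrightarrow> disjoint_family_on S K \<Longrightarrow> d \<in> carrier A \<Longrightarrow> W (\<Union>a\<in>K. S a) d = (\<Sum>a\<in>K. W (S a) d)"
    "W UNIV \<in> state_extensions C_alg A \<iota> (measure_state M)"
    and mem: "(\<phi>, \<psi>, B) \<in> CPA C_alg A \<iota> (orbit_set (induced_aut T) ((\<lambda>B x. complex_of_real (g B x)) ` P) n) \<delta>"
    and \<delta>: "\<delta> > 0" and \<eta>: "\<eta> \<ge> 0"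
  shows "H n - real n * ((real (card P))\<^sup>2 * ((\<eta> + \<delta>) + 2 * sqrt (\<eta> + \<delta>))) \<le> von_neumann_entropy B (W UNIV \<circ> \<psi>)"
proof -
  let ?W = "words n P"
  have Bc: "cstar_algebra B" and Bf: "finite_dimensional B" and u\<phi>: "ucp C_alg B \<phi>" and u\<psi>: "ucp B A \<psi>"
    and approx: "\<And>f. f \<in> orbit_set (induced_aut T) ((\<lambda>B x. complex_of_real (g B x)) ` P) n \<Longrightarrow> nrm A (\<psi> (\<phi> f) \<ominus> \<iota> f) < \<delta>"
    using mem by (auto simp: CPA_def)
  interpret B: fd_cstar B by (intro fd_cstar.intro Bc fd_cstar_axioms.intro Bf)
  have Ac: "cstar_algebra A" by unfold_locales
  define h where "h I x = complex_of_real (product_unity n I x)" for I x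
  have hc: "continuous_on UNIV (h I)" if "I \<in> ?W" for I
    unfolding h_def[abs_def] using product_unity_cont[OF that] by (intro continuous_intros)
  define E where "E I = \<phi> (h I)" for I
  have positive_image: "B.positive (\<phi> (\<lambda>x. complex_of_real (f x)))"
    if f: "continuous_on UNIV f" "\<And>x. 0 \<le> f x" for f
  proof -
    have "matrix_pos B 1 (\<lambda>i j. \<phi> (\<lambda>x. complex_of_real (f x)))"
      using C_alg_matrix_pos[OF f] J_cont[OF f(1)] by (intro ucpD(5)[OF u\<phi>]) auto
    then show ?thesis using B.matrix_pos_one by blast
  qed
  have Epos: "B.positive (E I)" if "I \<in> ?W" for I
    unfolding E_def h_def[abs_def] using product_unity_cont[OF that] product_unity_nonneg[OF that] by (rule positive_image)
  have Ec: "E I \<in> carrier B" if "I \<in> ?W" for I using B.positive_carrier[OF Epos[OF that]] .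
  have Esum: "\<phi> (\<lambda>x. \<Sum>I\<in>L. h I x) = (\<Oplus>\<^bsub>B\<^esub>I\<in>L. E I)" if "L \<subseteq> ?W" for L
    unfolding E_def using that hc finite_subset[OF that fin_words] by (intro ucp_C_alg_sum[OF Bc u\<phi>]) auto
  have E1: "(\<Oplus>\<^bsub>B\<^esub>I\<in>?W. E I) = \<one>\<^bsub>B\<^esub>"
  proof -
    have "(\<lambda>x. \<Sum>I\<in>?W. h I x) = (\<lambda>x. 1)"
      using product_unity_sum[of n] by (simp add: h_def fun_eq_iff flip: of_real_sum)
    then show ?thesis using Esum[of ?W] ucpD(2)[OF u\<phi>] by simp
  qed
  define F where "F a = W (cell T n a) \<circ> \<psi>" for a
  have Fpos: "B.positive_functional (F a)" for a
    unfolding F_def by (rule positive_functional_comp_ucp[OF Bc Ac u\<psi> W(1)])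
  note Flin = B.linear_functional_finsum[OF B.positive_functional_linear[OF Fpos]]
  define p where "p a i = Re (F a (E i))" for a i
  have p0: "p a i \<ge> 0" if "i \<in> ?W" for a i
    using B.positive_functionalD[OF Fpos[of a] Epos[OF that]] by (simp add: p_def complex_nonneg_Reals_iff)
  have Wone: "Re (W S \<one>) = measure M S" if "S \<in> sets M" for S
    using W(2)[OF that continuous_on_const[of UNIV 1]] J_linear(2) that by simp
  have rows: "(\<Sum>i\<in>?W. p a i) = measure M (cell T n a)" if a: "a \<in> ?W" for a
  proof -
    have "(\<Sum>i\<in>?W. p a i) = Re (F a (\<Oplus>\<^bsub>B\<^esub>I\<in>?W. E I))" unfolding p_def using Ec fin_words by (subst Flin) auto
    also have "\<dots> = measure M (cell T n a)"
      unfolding E1 F_def using ucpD(2)[OF u\<psi>] Wone[OF cell_measurable[OF a]] by simp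
    finally show ?thesis .
  qed
  have info: "(\<Sum>(a,i)\<in>?W\<times>?W. p a i * ln (p a i / ((\<Sum>j\<in>?W. p a j) * (\<Sum>b\<in>?W. p b i)))) \<le> von_neumann_entropy B (W UNIV \<circ> \<psi>)"
    unfolding p_def
  proof (rule B.accessible_information_le_entropy)
    have "state A (W UNIV)" using W(4) by (simp add: state_extensions_def)
    then show "state B (W UNIV \<circ> \<psi>)" by (rule state_comp_ucp[OF Bc Ac u\<psi>])
    show "(W UNIV \<circ> \<psi>) x = (\<Sum>a\<in>?W. F a x)" if "x \<in> carrier B" for x
      using W(3)[OF fin_words cell_disjoint ucpD(1)[OF u\<psi> that], of n] by (simp add: F_def cell_cover)
  qed (use fin_words Fpos Epos E1 in auto)
  have off: "letter_marginal n P (\<lambda>i a. p a i) j X Y \<le> \<eta> + \<delta>" if j: "j < n" and XY: "X \<in> P" "Y \<in> P" "X \<noteq> Y" for j X Y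
  proof -
    let ?L = "{i\<in>?W. i j = X}" and ?K = "{a\<in>?W. a j = Y}"
    let ?S = "(T ^^ j) -` Y" and ?gj = "\<lambda>x. g X ((T ^^ j) x)"
    let ?f = "\<lambda>x. complex_of_real (?gj x)"
    have S: "?S \<in> sets M"
      using measurable_sets[OF T_pow_measurable[of j], of Y] XY P(2) space_UNIV by auto
    have gc: "continuous_on UNIV ?gj" by (rule g_T_cont[OF XY(1)])
    have gn: "0 \<le> ?gj x" for x by (rule g_nonneg[OF XY(1)])
    have hL: "(\<lambda>x. \<Sum>I\<in>?L. h I x) = ?f"
      using product_unity_marginal[OF j XY(1)] by (simp add: h_def fun_eq_iff flip: of_real_sum)
    have Lsum: "\<phi> ?f = (\<Oplus>\<^bsub>B\<^esub>I\<in>?L. E I)" using Esum[of ?L] unfolding hL by auto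
    have \<phi>pos: "B.positive (\<phi> ?f)" by (rule positive_image[OF gc gn])
    have \<psi>c: "\<psi> (\<phi> ?f) \<in> carrier A" by (rule ucpD(1)[OF u\<psi> B.positive_carrier[OF \<phi>pos]])
    have disj: "disjoint_family_on (cell T n) ?K" using cell_disjoint[of n] by (rule disjoint_family_on_mono[rotated]) auto
    have "{(i,a)\<in>?W\<times>?W. i j = X \<and> a j = Y} = ?L \<times> ?K" by auto
    then have "letter_marginal n P (\<lambda>i a. p a i) j X Y = (\<Sum>i\<in>?L. \<Sum>a\<in>?K. p a i)"
      by (simp add: letter_marginal_def sum.cartesian_product)
    also have "\<dots> = (\<Sum>a\<in>?K. \<Sum>i\<in>?L. p a i)" by (rule sum.swap)
    also have "\<dots> = (\<Sum>a\<in>?K. Re (F a (\<phi> ?f)))"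
      unfolding p_def Lsum using Ec fin_words by (subst Flin) auto
    also have "\<dots> = Re (W (\<Union>a\<in>?K. cell T n a) (\<psi> (\<phi> ?f)))"
      using W(3)[OF _ disj \<psi>c] fin_words by (simp add: F_def)
    also have "(\<Union>a\<in>?K. cell T n a) = ?S" by (rule letter_cells[OF j XY(2)])
    also have "Re (W ?S (\<psi> (\<phi> ?f))) \<le> \<eta> + \<delta>"
    proof -
      have \<iota>f: "\<iota> ?f = J ?gj" by (simp add: J_def)
      have "?f \<in> orbit_set (induced_aut T) ((\<lambda>B x. complex_of_real (g B x)) ` P) n"
        unfolding orbit_set_def induced_aut_pow using j XY(1) by (auto simp: comp_def intro!: bexI[of _ j] image_eqI[of _ _ "\<lambda>x. complex_of_real (g X x)"])
      then have nd: "nrm A (\<psi> (\<phi> ?f) \<ominus> J ?gj) < \<delta>" using approx \<iota>f by metis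
      have sa: "selfadj (\<psi> (\<phi> ?f) \<ominus> J ?gj)"
        by (rule selfadj_minus[OF positive_selfadj[OF ucp_positive[OF Bc Ac u\<psi> \<phi>pos]] J_selfadj[OF gc]])
      \<comment> \<open>W S has total mass at most 1, so replacing the approximation by the function itself costs at most \<delta>.\<close>
      have "Re (W ?S (\<psi> (\<phi> ?f) \<ominus> J ?gj)) \<le> nrm A (\<psi> (\<phi> ?f) \<ominus> J ?gj) * Re (W ?S \<one>)"
        using positive_functional_bounded[OF W(1)[of ?S] sa] by simp
      also have "\<dots> \<le> \<delta> * 1"
        using nd Wone[OF S] \<delta> by (intro mult_mono) auto
      finally have "Re (W ?S (\<psi> (\<phi> ?f))) - Re (W ?S (J ?gj)) \<le> \<delta>"
        using lfD(2)[OF positive_functional_linear[OF W(1)[of ?S]] \<psi>c J_linear(1)[OF gc]] by simp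
      moreover have "Re (W ?S (J ?gj)) \<le> \<eta>"
        using W(2)[OF S gc] letter_integral[OF XY(2,1), of j] g_off[OF XY(2,1)] XY(3) by simp
      ultimately show ?thesis by linarith
    qed
    finally show ?thesis .
  qed
  have tot: "(\<Sum>(i,a)\<in>?W\<times>?W. p a i) = 1"
  proof -
    have "(\<Sum>(i,a)\<in>?W\<times>?W. p a i) = (\<Sum>i\<in>?W. \<Sum>a\<in>?W. p a i)" by (simp add: sum.cartesian_product)
    also have "\<dots> = (\<Sum>a\<in>?W. measure M (cell T n a))" using rows by (subst sum.swap) simp
    also have "\<dots> = 1" using measure_split_words[of UNIV n] sets.top[of M] prob_space space_UNIV by simp
    finally show ?thesis .
  qed
  have "H n = shannon ?W (\<lambda>a. \<Sum>i\<in>?W. p a i)" unfolding H_def shannon_def using rows by simp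
  also have "\<dots> \<le> (\<Sum>(a,i)\<in>?W\<times>?W. p a i * ln (p a i / ((\<Sum>j\<in>?W. p a j) * (\<Sum>b\<in>?W. p b i))))
      + cond_shannon ?W ?W (\<lambda>i a. p a i)"
    using p0 fin_words by (intro shannon_source_le) auto
  also have "cond_shannon ?W ?W (\<lambda>i a. p a i) \<le> real n * ((real (card P))\<^sup>2 * ((\<eta> + \<delta>) + 2 * sqrt (\<eta> + \<delta>)))"
    using p0 tot off \<eta> \<delta> by (intro cond_shannon_words_bound) auto
  finally show ?thesis using info by linarith
qed

text \<open>The products of length n are a partition of unity that serves the functions f o T^j, j < n, simultaneously, since on
the support of a product the j-th iterate stays in the support of a single g B.\<close>

theorem cpe_orbit_le:
  assumes \<omega>: "\<omega> \<in> state_extensions C_alg A \<iota> (measure_state M)" and \<Omega>: "\<Omega> \<subseteq> carrier C_alg"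
    and c: "c > 0" "4 * c < \<delta>" and \<eta>: "\<eta> \<ge> 0"
    and osc: "\<And>f B x y. f \<in> \<Omega> \<Longrightarrow> B \<in> P \<Longrightarrow> g B x \<noteq> 0 \<Longrightarrow> g B y \<noteq> 0 \<Longrightarrow> cmod (f x - f y) \<le> c"
  shows "cpe C_alg A \<iota> \<omega> (orbit_set (induced_aut T) \<Omega> n) \<delta> \<le> ereal (H n + real n * ((real (card P))\<^sup>2 * (\<eta> + 2 * sqrt \<eta>)))"
proof -
  let ?W = "words n P"
  define N where "N = card ?W"
  obtain w where w: "bij_betw w {..<N} ?W"
    using ex_bij_betw_nat_finite[OF fin_words[of n]] unfolding N_def atLeast0LessThan by blast
  have wW: "w t \<in> ?W" if "t < N" for t using bij_betwE[OF w] that by blast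
  define G where "G t = product_unity n (w t)" for t
  \<comment> \<open>If the product vanishes identically, the point is arbitrary and has weight 0.\<close>
  define pt where "pt t = (SOME y. G t y \<noteq> 0)" for t
  have pt: "G t (pt t) \<noteq> 0" if "G t x \<noteq> 0" for t x unfolding pt_def using that by (rule someI)
  have Gn: "0 \<le> G t x" if "t < N" for t x unfolding G_def by (rule product_unity_nonneg[OF wW[OF that]])
  have G1: "(\<Sum>t<N. G t x) = 1" for x
    unfolding G_def using sum.reindex_bij_betw[OF w, of "\<lambda>I. product_unity n I x"] product_unity_sum by simp
  have "cpe C_alg A \<iota> \<omega> (orbit_set (induced_aut T) \<Omega> n) \<delta> \<le> ereal (shannon {..<N} (\<lambda>t. \<integral>x. G t x \<partial>M))"
  proof (rule cpe_le_shannon[OF \<omega> _ Gn G1 _ _ c])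
    show "continuous_on UNIV (G t)" if "t < N" for t unfolding G_def by (rule product_unity_cont[OF wW[OF that]])
    show "orbit_set (induced_aut T) \<Omega> n \<subseteq> carrier C_alg"
    proof
      fix f assume "f \<in> orbit_set (induced_aut T) \<Omega> n"
      then obtain j f0 where f: "f0 \<in> \<Omega>" "f = f0 \<circ> T ^^ j" by (auto simp: orbit_set_def induced_aut_pow)
      have "continuous_on UNIV f0" using f(1) \<Omega> by auto
      then have "continuous_on (range (T ^^ j)) f0" by (rule continuous_on_subset) simp
      then show "f \<in> carrier C_alg" using continuous_on_compose[OF T_pow_cont] f(2) by simp
    qed
    fix f x assume "f \<in> orbit_set (induced_aut T) \<Omega> n"
    then obtain j f0 where f: "j < n" "f0 \<in> \<Omega>" "f = f0 \<circ> T ^^ j" by (auto simp: orbit_set_def induced_aut_pow)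
    have "(\<Sum>t<N. complex_of_real (G t x)) = 1" using G1[of x] by (metis of_real_1 of_real_sum)
    then have "(\<Sum>t<N. f (pt t) * complex_of_real (G t x)) - f x = (\<Sum>t<N. (f (pt t) - f x) * complex_of_real (G t x))"
      by (simp add: left_diff_distrib sum_subtractf flip: sum_distrib_left)
    also have "cmod \<dots> \<le> (\<Sum>t<N. c * G t x)"
    proof (rule order_trans[OF norm_sum], rule sum_mono)
      fix t assume t: "t \<in> {..<N}"
      show "cmod ((f (pt t) - f x) * complex_of_real (G t x)) \<le> c * G t x"
      proof (cases "G t x = 0")
        case False
        have nz: "g (w t j) ((T ^^ j) y) \<noteq> 0" if "G t y \<noteq> 0" for y
          using that f(1) unfolding G_def product_unity_def by auto
        have "w t j \<in> P" using wW[of t] t f(1) by (auto simp: PiE_mem)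
        then have "cmod (f (pt t) - f x) \<le> c"
          using osc[OF f(2) _ nz[OF pt[OF False]] nz[OF False]] f(3) by simp
        then show ?thesis using Gn[of t x] t by (simp add: norm_mult mult_right_mono)
      qed simp
    qed
    also have "\<dots> = c" using G1[of x] by (simp flip: sum_distrib_left)
    finally show "cmod ((\<Sum>t<N. f (pt t) * complex_of_real (G t x)) - f x) \<le> c" .
  qed
  also have "shannon {..<N} (\<lambda>t. \<integral>x. G t x \<partial>M) = shannon ?W (\<lambda>I. \<integral>x. product_unity n I x \<partial>M)"
    unfolding shannon_def G_def
    using sum.reindex_bij_betw[OF w, of "\<lambda>I. (\<integral>x. product_unity n I x \<partial>M) * ln (\<integral>x. product_unity n I x \<partial>M)"] by simp
  finally show ?thesis using shannon_product_unity_le[OF \<eta>, of n] by (meson ereal_less_eq(3) order_trans)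
qed

end

lemma small_entropy_error:
  fixes k :: nat and \<epsilon> :: real
  assumes "\<epsilon> > 0" shows "\<exists>e>0. (real k)\<^sup>2 * (e + 2 * sqrt e) \<le> \<epsilon>"
proof -
  define s where "s = min 1 (\<epsilon> / (3 * ((real k)\<^sup>2 + 1)))"
  have w: "(real k)\<^sup>2 + 1 > 0" by (simp add: add_nonneg_pos)
  have s: "s > 0" "s \<le> 1" using assms w by (auto simp: s_def)
  have "s * s \<le> s" using s by (simp add: mult_left_le)
  then have "(real k)\<^sup>2 * (s * s + 2 * s) \<le> ((real k)\<^sup>2 + 1) * (3 * s)" using s by (intro mult_mono) auto
  also have "\<dots> \<le> ((real k)\<^sup>2 + 1) * (3 * (\<epsilon> / (3 * ((real k)\<^sup>2 + 1))))"
    unfolding s_def using w by (intro mult_left_mono) auto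
  also have "\<dots> = \<epsilon>" using w by (simp add: field_simps)
  finally show ?thesis using s by (intro exI[of _ "s * s"]) simp
qed

theorem proposition4p12:
  fixes T :: "'x::metric_space \<Rightarrow> 'x"
    and M :: "'x measure"
    and D :: "'d cstar"
    and \<iota> :: "('x \<Rightarrow> complex) \<Rightarrow> 'd"
  assumes "compact (UNIV :: 'x set)"
    and "\<exists>S. homeomorphism UNIV UNIV T S"
    and "prob_space M" and "sets M = sets borel"
    and "distr M M T = M"
    and "injective_cstar D"
    and "unital_complete_order_embedding C_alg D \<iota>"
  shows "KS_entropy M T = hm C_alg D \<iota> (measure_state M) (induced_aut T)"
proof -
  have Tc: "continuous_on UNIV T" using assms(2) by (auto simp: homeomorphism_def)
  have cD: "cstar_algebra D" using assms(6) by (simp add: injective_cstar_def)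
  interpret M: prob_space M by (rule assms(3))
  have space: "space M = UNIV" using sets_eq_imp_space_eq[OF assms(4)] by simp
  interpret fe: function_embedding D \<iota>
    by (intro function_embedding.intro cD function_embedding_axioms.intro assms(1,7))
  let ?hm = "hm C_alg D \<iota> (measure_state M) (induced_aut T)"
  have fbp: "finite_borel_partition M T P" if "finite P" "P \<subseteq> sets M" "partition_on UNIV P" for P
    by (intro finite_borel_partition.intro assms(3) finite_borel_partition_axioms.intro assms(4,5) Tc that)
  have dyn: "dynamical_embedding D \<iota> M T P g \<eta>"
    if P: "finite P" "P \<subseteq> sets M" "partition_on UNIV P"
      and g: "\<And>A. A \<in> P \<Longrightarrow> continuous_on UNIV (g A)" "\<And>A x. A \<in> P \<Longrightarrow> 0 \<le> g A x"
        "\<And>x. (\<Sum>A\<in>P. g A x) = 1"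
        "\<And>A B. A \<in> P \<Longrightarrow> B \<in> P \<Longrightarrow> A \<noteq> B \<Longrightarrow> (\<integral>x. indicator A x * g B x \<partial>M) \<le> \<eta>" for P g \<eta>
    by (intro dynamical_embedding.intro fe.function_embedding_axioms soft_partition.intro fbp[OF P] soft_partition_axioms.intro g)
  show ?thesis
  proof (rule antisym)
    show "KS_entropy M T \<le> ?hm" unfolding KS_entropy_def space
    proof (rule SUP_least)
      fix P assume "P \<in> {P. finite P \<and> P \<subseteq> sets M \<and> partition_on UNIV P}"
      then have P: "finite P" "P \<subseteq> sets M" "partition_on UNIV P" by auto
      interpret fp: finite_borel_partition M T P by (rule fbp[OF P])
      have low_eps: "ereal (KS_entropy_partition M T P - \<epsilon>) \<le> ?hm" if eps: "\<epsilon> > 0" for \<epsilon>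
      proof -
        obtain e where e: "e > 0" "(real (card P))\<^sup>2 * (e + 2 * sqrt e) \<le> \<epsilon>" using small_entropy_error[OF eps] by blast
        obtain g :: "'x set \<Rightarrow> 'x \<Rightarrow> real" where
          g: "\<And>A. A \<in> P \<Longrightarrow> continuous_on UNIV (g A)" "\<And>A x. A \<in> P \<Longrightarrow> 0 \<le> g A x"
            "\<And>x. (\<Sum>A\<in>P. g A x) = 1" "\<And>A x. A \<in> P \<Longrightarrow> x \<notin> UNIV \<Longrightarrow> g A x = 0"
            "\<And>A B. A \<in> P \<Longrightarrow> B \<in> P \<Longrightarrow> A \<noteq> B \<Longrightarrow> (\<integral>x. indicator A x * g B x \<partial>M) \<le> e / 2"
          by (rule partition_of_unity_near_partition[OF assms(3,4) P, of "\<lambda>_. UNIV" "e / 2"]) (use e(1) in auto)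
        interpret de: dynamical_embedding D \<iota> M T P g "e / 2" by (rule dyn[OF P g(1,2,3,5)])
        \<comment> \<open>This extension of the state is chosen before the approximation and the word length.\<close>
        obtain W where W: "\<And>S. fe.positive_functional (W S)"
          "\<And>S f. S \<in> sets M \<Longrightarrow> continuous_on UNIV f \<Longrightarrow> W S (fe.J f) = complex_of_real (\<integral>x. indicator S x * f x \<partial>M)"
          "\<And>(K :: (nat \<Rightarrow> 'x set) set) S d. finite K \<Longrightarrow> disjoint_family_on S K \<Longrightarrow> d \<in> carrier D \<Longrightarrow> W (\<Union>a\<in>K. S a) d = (\<Sum>a\<in>K. W (S a) d)"
          "W UNIV \<in> state_extensions C_alg D \<iota> (measure_state M)"
          by (rule fe.measured_family[OF assms(3,4)]) blast
        have half_pos: "e / 2 > 0" and half_nonneg: "e / 2 \<ge> 0" using e(1) by auto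
        let ?\<Omega> = "(\<lambda>B x. complex_of_real (g B x)) ` P"
        let ?c = "\<lambda>n. cpe C_alg D \<iota> (W UNIV) (orbit_set (induced_aut T) ?\<Omega> n) (e / 2)"
        have low: "ereal (fp.H n - real n * \<epsilon>) \<le> ?c n" for n
          unfolding cpe_def
        proof (rule INF_greatest, clarify)
          fix \<phi> \<psi> B assume "(\<phi>, \<psi>, B) \<in> CPA C_alg D \<iota> (orbit_set (induced_aut T) ?\<Omega> n) (e / 2)"
          note de.entropy_of_approximation_ge[OF W this half_pos half_nonneg]
          then have "fp.H n - real n * ((real (card P))\<^sup>2 * (e + 2 * sqrt e)) \<le> von_neumann_entropy B (W UNIV \<circ> \<psi>)"
            unfolding field_sum_of_halves .
          moreover have "real n * ((real (card P))\<^sup>2 * (e + 2 * sqrt e)) \<le> real n * \<epsilon>" using e(2) by (intro mult_left_mono) auto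
          ultimately show "ereal (fp.H n - real n * \<epsilon>) \<le> ereal (von_neumann_entropy B (W UNIV \<circ> \<psi>))" by simp
        qed
        have "(\<lambda>n. ereal (fp.H n / real n - \<epsilon>)) \<longlonglongrightarrow> ereal (KS_entropy_partition M T P - \<epsilon>)"
          by (intro tendsto_ereal tendsto_diff fp.KS_limit tendsto_const)
        then have "ereal (KS_entropy_partition M T P - \<epsilon>) = limsup (\<lambda>n. ereal (fp.H n / real n - \<epsilon>))"
          by (rule lim_imp_Limsup[OF sequentially_bot, symmetric])
        also have "\<dots> \<le> limsup (\<lambda>n. ereal (1 / real n) * ?c n)"
        proof (rule Limsup_mono, rule eventually_sequentiallyI[of 1])
          fix n :: nat assume n: "1 \<le> n"
          have "ereal (fp.H n / real n - \<epsilon>) = ereal (1 / real n) * ereal (fp.H n - real n * \<epsilon>)"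
            using n by (simp add: field_simps)
          also have "\<dots> \<le> ereal (1 / real n) * ?c n" by (intro ereal_mult_left_mono low) simp
          finally show "ereal (fp.H n / real n - \<epsilon>) \<le> ereal (1 / real n) * ?c n" .
        qed
        also have "\<dots> \<le> ?hm" unfolding hm_def
        proof (rule SUP_upper2[OF W(4)], rule SUP_upper2[of ?\<Omega>])
          show "?\<Omega> \<in> {\<Omega>. finite \<Omega> \<and> \<Omega> \<subseteq> carrier C_alg}" using P(1) g(1) by (auto intro!: continuous_intros)
          show "limsup (\<lambda>n. ereal (1 / real n) * ?c n) \<le> (SUP \<delta>\<in>{0<..}. limsup (\<lambda>n. ereal (1 / real n) * cpe C_alg D \<iota> (W UNIV) (orbit_set (induced_aut T) ?\<Omega> n) \<delta>))"
            by (rule SUP_upper2[of "e / 2"]) (use e(1) in auto)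
        qed
        finally show ?thesis .
      qed
      have low_hm: "ereal (KS_entropy_partition M T P) \<le> ?hm + ereal \<epsilon>" if "\<epsilon> > 0" for \<epsilon>
      proof -
        have "ereal (KS_entropy_partition M T P) = ereal (KS_entropy_partition M T P - \<epsilon>) + ereal \<epsilon>" by simp
        also have "\<dots> \<le> ?hm + ereal \<epsilon>" by (rule add_right_mono) (rule low_eps[OF that])
        finally show ?thesis .
      qed
      show "ereal (KS_entropy_partition M T P) \<le> ?hm"
        by (rule ereal_le_epsilon2) (intro allI impI low_hm)
    qed
    show "?hm \<le> KS_entropy M T" unfolding hm_def
    proof (intro SUP_least)
      fix \<omega> \<Omega> and \<delta> :: real
      assume \<omega>: "\<omega> \<in> state_extensions C_alg D \<iota> (measure_state M)"
        and "\<Omega> \<in> {\<Omega>. finite \<Omega> \<and> \<Omega> \<subseteq> carrier (C_alg :: ('x \<Rightarrow> complex) cstar)}" and "\<delta> \<in> {0<..}"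
      then have \<Omega>: "finite \<Omega>" "\<Omega> \<subseteq> carrier C_alg" and \<delta>: "\<delta> > 0" by auto
      let ?c = "\<lambda>n. cpe C_alg D \<iota> \<omega> (orbit_set (induced_aut T) \<Omega> n) \<delta>"
      \<comment> \<open>The oscillation bound \<delta> / 8 leaves room for the factor 4 lost in the norm of \<iota>.\<close>
      have "\<exists>r>0. \<forall>f\<in>\<Omega>. \<forall>x y. dist x y < 2 * r \<longrightarrow> cmod (f x - f y) \<le> \<delta> / 8"
        using \<Omega>
      proof (induction \<Omega> rule: finite_induct)
        case empty show ?case by (intro exI[of _ 1]) auto
      next
        case (insert f \<Omega>)
        then obtain r where r: "r > 0" "\<And>f x y. f \<in> \<Omega> \<Longrightarrow> dist x y < 2 * r \<Longrightarrow> cmod (f x - f y) \<le> \<delta> / 8" by auto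
        have "uniformly_continuous_on UNIV f" using insert.prems assms(1) by (intro compact_uniformly_continuous) auto
        then obtain d where d: "d > 0" "\<And>x y. dist x y < d \<Longrightarrow> dist (f x) (f y) < \<delta> / 8"
          unfolding uniformly_continuous_on_def using \<delta> by (metis UNIV_I dist_commute divide_pos_pos zero_less_numeral)
        show ?case
        proof (intro exI[of _ "min r (d / 2)"] conjI ballI allI impI)
          show "0 < min r (d / 2)" using r d by simp
          fix f' and x y :: 'x assume f': "f' \<in> insert f \<Omega>" and xy: "dist x y < 2 * min r (d / 2)"
          show "cmod (f' x - f' y) \<le> \<delta> / 8"
          proof (cases "f' = f")
            case True
            have "dist x y < d" using xy by simp
            then show ?thesis using d(2)[of x y] True by (simp add: dist_norm)
          next
            case False
            then show ?thesis using r(2)[of f' x y] f' xy by simp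
          qed
        qed
      qed
      then obtain r where r: "r > 0" "\<And>f x y. f \<in> \<Omega> \<Longrightarrow> dist x y < 2 * r \<Longrightarrow> cmod (f x - f y) \<le> \<delta> / 8" by blast
      obtain P :: "'x set set" where P: "finite P" "P \<subseteq> sets borel" "partition_on UNIV P" "\<And>A. A \<in> P \<Longrightarrow> \<exists>c. A \<subseteq> ball c r"
        using small_partition[OF assms(1) r(1)] by blast
      have PM: "P \<subseteq> sets M" using P(2) assms(4) by simp
      obtain z where z: "\<And>A. A \<in> P \<Longrightarrow> A \<subseteq> ball (z A) r" using P(4) by metis
      interpret fp: finite_borel_partition M T P by (rule fbp[OF P(1) PM P(3)])
      have bound: "limsup (\<lambda>n. ereal (1 / real n) * ?c n) \<le> ereal (KS_entropy_partition M T P) + ereal \<epsilon>" if eps: "\<epsilon> > 0" for \<epsilon>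
      proof -
        obtain e where e: "e > 0" "(real (card P))\<^sup>2 * (e + 2 * sqrt e) \<le> \<epsilon>" using small_entropy_error[OF eps] by blast
        obtain g :: "'x set \<Rightarrow> 'x \<Rightarrow> real" where
          g: "\<And>A. A \<in> P \<Longrightarrow> continuous_on UNIV (g A)" "\<And>A x. A \<in> P \<Longrightarrow> 0 \<le> g A x"
            "\<And>x. (\<Sum>A\<in>P. g A x) = 1" "\<And>A x. A \<in> P \<Longrightarrow> x \<notin> ball (z A) r \<Longrightarrow> g A x = 0"
            "\<And>A B. A \<in> P \<Longrightarrow> B \<in> P \<Longrightarrow> A \<noteq> B \<Longrightarrow> (\<integral>x. indicator A x * g B x \<partial>M) \<le> e"
          by (rule partition_of_unity_near_partition[OF assms(3,4) P(1) PM P(3) _ z e(1)]) auto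
        interpret de: dynamical_embedding D \<iota> M T P g e by (rule dyn[OF P(1) PM P(3) g(1,2,3,5)])
        have up: "?c n \<le> ereal (fp.H n + real n * \<epsilon>)" for n
        proof -
          have "?c n \<le> ereal (fp.H n + real n * ((real (card P))\<^sup>2 * (e + 2 * sqrt e)))"
          proof (rule de.cpe_orbit_le[OF \<omega> \<Omega>(2), of "\<delta> / 8"])
            fix f B x y assume f: "f \<in> \<Omega>" and B: "B \<in> P" and nz: "g B x \<noteq> 0" "g B y \<noteq> 0"
            have "x \<in> ball (z B) r" "y \<in> ball (z B) r" using g(4)[OF B] nz by blast+
            then have "dist x y < 2 * r" using dist_triangle2[of x y "z B"] by (simp add: dist_commute)
            then show "cmod (f x - f y) \<le> \<delta> / 8" by (rule r(2)[OF f])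
          qed (use \<delta> e(1) in auto)
          also have "\<dots> \<le> ereal (fp.H n + real n * \<epsilon>)" using mult_left_mono[OF e(2), of "real n"] by simp
          finally show ?thesis .
        qed
        have "limsup (\<lambda>n. ereal (1 / real n) * ?c n) \<le> limsup (\<lambda>n. ereal (fp.H n / real n + \<epsilon>))"
        proof (rule Limsup_mono, rule eventually_sequentiallyI[of 1])
          fix n :: nat assume n: "1 \<le> n"
          have "ereal (1 / real n) * ?c n \<le> ereal (1 / real n) * ereal (fp.H n + real n * \<epsilon>)"
            by (intro ereal_mult_left_mono up) simp
          also have "\<dots> = ereal (fp.H n / real n + \<epsilon>)" using n by (simp add: field_simps)
          finally show "ereal (1 / real n) * ?c n \<le> ereal (fp.H n / real n + \<epsilon>)" .
        qed
        also have "limsup (\<lambda>n. ereal (fp.H n / real n + \<epsilon>)) = ereal (KS_entropy_partition M T P + \<epsilon>)"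
        proof (rule lim_imp_Limsup[OF sequentially_bot])
          show "(\<lambda>n. ereal (fp.H n / real n + \<epsilon>)) \<longlonglongrightarrow> ereal (KS_entropy_partition M T P + \<epsilon>)"
            by (intro tendsto_ereal tendsto_add fp.KS_limit tendsto_const)
        qed
        finally show ?thesis by simp
      qed
      have "limsup (\<lambda>n. ereal (1 / real n) * ?c n) \<le> ereal (KS_entropy_partition M T P)"
        by (rule ereal_le_epsilon2) (use bound in auto)
      also have "\<dots> \<le> KS_entropy M T" unfolding KS_entropy_def space
        by (rule SUP_upper) (use P(1,3) PM in auto)
      finally show "limsup (\<lambda>n. ereal (1 / real n) * ?c n) \<le> KS_entropy M T" .
    qed
  qed
qed

end
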